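(* Let $n\ge 1$ be an integer, let $A$ and $B$ be rings, $U$ a $(B,A)$-bimodule, and $\Lambda=\begin{pmatrix} A & 0\\ U & B\end{pmatrix}$ the formal triangular matrix ring. Let $\mathcal{C},\mathcal{D}$ be classes in $A\text{-Mod}$ and $\mathcal{E},\mathcal{F}$ classes in $B\text{-Mod}$. (1) Assume $(\mathfrak{P}^{\mathcal{C}}_{\mathcal{E}},\mathfrak{A}^{\mathcal{D}}_{\mathcal{F}})$ is a right $n$-cotorsion pair in $\Lambda\text{-Mod}$. (a) If $\operatorname{Tor}^A_j(U,C)=0$ for all $C\in\mathcal{C}$ and $1\le j\le n+1$, then $(\mathcal{C},\mathcal{D})$ is a right $n$-cotorsion pair in $A\text{-Mod}$. (b) If $\operatorname{Tor}^A_j(U,C)=0$ for all $C\in\mathcal{C}$ and $1\le j\le n+1$, $\mathcal{E}^\vee_{n-1}$ is closed under extensions, and $U\otimes_A D\in\mathcal{E}^\vee_{n-1}$ for all $D\in\mathcal{D}$, then $(\mathcal{E},\mathcal{F})$ is a right $n$-cotorsion pair in $B\text{-Mod}$. (2) Assume $(\mathfrak{A}^{\mathcal{C}}_{\mathcal{E}},\mathfrak{I}^{\mathcal{D}}_{\mathcal{F}})$ is a left $n$-cotorsion pair in $\Lambda\text{-Mod}$. (a) If $\operatorname{Ext}_B^j(U,F)=0$ for all $F\in\mathcal{F}$ and $1\le j\le n+1$, then $(\mathcal{E},\mathcal{F})$ is a left $n$-cotorsion pair in $B\text{-Mod}$. (b) If $\operatorname{Ext}_B^j(U,F)=0$ for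 all $F\in\mathcal{F}$ and $1\le j\le n+1$, $\mathcal{D}^\wedge_{n-1}$ is closed under extensions, and $\operatorname{Hom}_B(U,E)\in\mathcal{D}^\wedge_{n-1}$ for all $E\in\mathcal{E}$, then $(\mathcal{C},\mathcal{D})$ is a left $n$-cotorsion pair in $A\text{-Mod}$.
   Context: Rings are nonzero, associative, with identity. $R\text{-Mod}$ is the category of left $R$-modules. Classes of modules are understood to be closed under isomorphisms. Formal triangular matrix rings. $\Lambda=\begin{pmatrix} A & 0\\ U & B\end{pmatrix}$ has the usual matrix addition and multiplication. $\Lambda\text{-Mod}$ is identified with the (equivalent) category whose objects are triples $M=\begin{pmatrix} M_1\\ M_2\end{pmatrix}_{\varphi}$ with $M_1\in A\text{-Mod}$, $M_2\in B\text{-Mod}$ and $\varphi:U\otimes_A M_1\to M_2$ a left $B$-homomorphism; a morphism from $\begin{pmatrix} M_1\\ M_2\end{pmatrix}_{\varphi}$ to $\begin{pmatrix} N_1\\ N_2\end{pmatrix}_{\psi}$ is a pair $(f_1,f_2)$ with $f_1\in\operatorname{Hom}_A(M_1,N_1)$, $f_2\in\operatorname{Hom}_B(M_2,N_2)$ and $f_2\varphi=\psi(1\otimes f_1)$. Let $\widetilde{\varphi}:M_1\to\operatorname{Hom}_B(U,M_2)$ denote the map adjoint to $\varphi$. Classes. For a class $\mathcal{X}$ in $A\text{-Mod}$ and a class $\mathcal{Y}$ in $B\text{-Mod}$: - $\mathfrak{A}^{\mathcal{X}}_{\mathcal{Y}}$ is the class of $\begin{pmatrix} M_1\\ M_2\end{pmatrix}_{\varphi}$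 with $M_1\in\mathcal{X}$ and $M_2\in\mathcal{Y}$; - $\mathfrak{P}^{\mathcal{X}}_{\mathcal{Y}}$ is the class of $\begin{pmatrix} M_1\\ M_2\end{pmatrix}_{\varphi}$ with $M_1\in\mathcal{X}$, $\operatorname{Coker}\varphi\in\mathcal{Y}$ and $\varphi$ a monomorphism; - $\mathfrak{I}^{\mathcal{X}}_{\mathcal{Y}}$ is the class of $\begin{pmatrix} M_1\\ M_2\end{pmatrix}_{\varphi}$ with $\operatorname{Ker}\widetilde{\varphi}\in\mathcal{X}$, $M_2\in\mathcal{Y}$ and $\widetilde{\varphi}$ an epimorphism. Dimensions. For a class $\mathcal{X}$ in $R\text{-Mod}$ and $m\ge 0$, $\mathcal{X}^\wedge_m$ is the class of modules $M$ admitting an exact sequence $0\to X_k\to\cdots\to X_0\to M\to 0$ with $k\le m$ and all $X_i\in\mathcal{X}$; $\mathcal{X}^\vee_m$ is the class of modules $M$ admitting an exact sequence $0\to M\to X_0\to\cdots\to X_k\to 0$ with $k\le m$ and all $X_i\in\mathcal{X}$. $n$-cotorsion pairs. Let $\mathcal{X},\mathcal{Y}$ be classes in $R\text{-Mod}$. $(\mathcal{X},\mathcal{Y})$ is a left $n$-cotorsion pair if (a) $\mathcal{X}$ is closed under direct summands; (b) $\operatorname{Ext}^i_R(X,Y)=0$ for all $X\in\mathcal{X}$, $Y\in\mathcal{Y}$, $1\le i\le n$; (c) for every $M\in R\text{-Mod}$ there is a short exact sequence $0\to Y\to X\to M\to 0$ with $X\in\mathcal{X}$ and $Y\in\mathcal{Y}^\wedge_{n-1}$.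 $(\mathcal{X},\mathcal{Y})$ is a right $n$-cotorsion pair if (a) $\mathcal{Y}$ is closed under direct summands; (b) $\operatorname{Ext}^i_R(X,Y)=0$ for all $X\in\mathcal{X}$, $Y\in\mathcal{Y}$, $1\le i\le n$; (c) for every $M\in R\text{-Mod}$ there is a short exact sequence $0\to M\to Y\to X\to 0$ with $Y\in\mathcal{Y}$ and $X\in\mathcal{X}^\vee_{n-1}$. *)

theory Defs
  imports
    "HOL-Algebra.Module"
    "HOL-Algebra.AbelCoset"
    "HOL-Algebra.Generated_Groups"
    "HOL-Algebra.Elementary_Groups"
    "HOL-Algebra.Free_Abelian_Groups"
    "HOL-Library.Equipollence"
begin

section \<open>Modules over noncommutative rings\<close>

text \<open>
  The record type of HOL-Algebra modules is reused, but the locale \<open>module\<close> of HOL-Algebra demands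
  a commutative ring. The fields \<open>mult\<close> and \<open>one\<close> of the underlying ring record carry no information
  for a module; they are set to \<open>undefined\<close> in constructions and ignored by isomorphisms.
\<close>

locale lmodule = R?: ring R + M?: abelian_group M for R (structure) and M (structure) +
  assumes smult_closed:
      "\<lbrakk>a \<in> carrier R; x \<in> carrier M\<rbrakk> \<Longrightarrow> a \<odot>\<^bsub>M\<^esub> x \<in> carrier M"
    and smult_l_distr:
      "\<lbrakk>a \<in> carrier R; b \<in> carrier R; x \<in> carrier M\<rbrakk> \<Longrightarrow>
        (a \<oplus>\<^bsub>R\<^esub> b) \<odot>\<^bsub>M\<^esub> x = a \<odot>\<^bsub>M\<^esub> x \<oplus>\<^bsub>M\<^esub> b \<odot>\<^bsub>M\<^esub> x"
    and smult_r_distr: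
      "\<lbrakk>a \<in> carrier R; x \<in> carrier M; y \<in> carrier M\<rbrakk> \<Longrightarrow>
        a \<odot>\<^bsub>M\<^esub> (x \<oplus>\<^bsub>M\<^esub> y) = a \<odot>\<^bsub>M\<^esub> x \<oplus>\<^bsub>M\<^esub> a \<odot>\<^bsub>M\<^esub> y"
    and smult_assoc1:
      "\<lbrakk>a \<in> carrier R; b \<in> carrier R; x \<in> carrier M\<rbrakk> \<Longrightarrow>
        (a \<otimes>\<^bsub>R\<^esub> b) \<odot>\<^bsub>M\<^esub> x = a \<odot>\<^bsub>M\<^esub> (b \<odot>\<^bsub>M\<^esub> x)"
    and smult_one:
      "x \<in> carrier M \<Longrightarrow> \<one>\<^bsub>R\<^esub> \<odot>\<^bsub>M\<^esub> x = x"

definition Hom ::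
  "('r, 'x) ring_scheme \<Rightarrow> ('r, 'm, 'y) module_scheme \<Rightarrow> ('r, 'n, 'z) module_scheme \<Rightarrow> ('m \<Rightarrow> 'n) set"
  where "Hom R M N =
    {f \<in> carrier M \<rightarrow>\<^sub>E carrier N.
      (\<forall>x\<in>carrier M. \<forall>y\<in>carrier M. f (x \<oplus>\<^bsub>M\<^esub> y) = f x \<oplus>\<^bsub>N\<^esub> f y) \<and>
      (\<forall>r\<in>carrier R. \<forall>x\<in>carrier M. f (r \<odot>\<^bsub>M\<^esub> x) = r \<odot>\<^bsub>N\<^esub> f x)}"

definition mod_iso ::
  "('r, 'x) ring_scheme \<Rightarrow> ('r, 'm, 'y) module_scheme \<Rightarrow> ('r, 'n, 'z) module_scheme \<Rightarrow> bool"
  where "mod_iso R M N \<longleftrightarrow> (\<exists>f\<in>Hom R M N. bij_betw f (carrier M) (carrier N))"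

definition dirsum ::
  "('r, 'm, 'y) module_scheme \<Rightarrow> ('r, 'n, 'z) module_scheme \<Rightarrow> ('r, 'm \<times> 'n) module"
  where "dirsum M N = \<lparr>carrier = carrier M \<times> carrier N, mult = undefined, one = undefined,
    ring.zero = (\<zero>\<^bsub>M\<^esub>, \<zero>\<^bsub>N\<^esub>),
    add = (\<lambda>(x, y) (x', y'). (x \<oplus>\<^bsub>M\<^esub> x', y \<oplus>\<^bsub>N\<^esub> y')),
    smult = (\<lambda>r (x, y). (r \<odot>\<^bsub>M\<^esub> x, r \<odot>\<^bsub>N\<^esub> y))\<rparr>"

definition quot_module :: "('r, 'm, 'y) module_scheme \<Rightarrow> 'm set \<Rightarrow> ('r, 'm set) module"
  where "quot_module M K = \<lparr>carrier = a_rcosets\<^bsub>M\<^esub> K, mult = undefined, one = undefined,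
    ring.zero = K,
    add = (\<lambda>X Y. X <+>\<^bsub>M\<^esub> Y),
    smult = (\<lambda>r X. K <+>\<^bsub>M\<^esub> ((\<lambda>x. r \<odot>\<^bsub>M\<^esub> x) ` X))\<rparr>"

section \<open>The category of modules and classes of modules\<close>

text \<open>
  HOL has no type of all sets, so the category of all left \<open>R\<close>-modules is taken relative to a universe:
  a family \<open>\<U>\<close> of subsets of some type \<open>'m\<close>, the sets counted as small. An \<open>R\<close>-module is an object of
  \<open>RMod R \<U>\<close> if its carrier is small. Small sets are closed under passing to sets of at most the
  same cardinality, and, for the index sets \<open>I\<close> that matter (the natural numbers and the carriers of
  the rings and of the bimodule), \<open>X\<^sup>I\<close> is small up to bijection whenever \<open>X\<close> is. Together with the
  existence of a small set with two elements this makes \<open>RMod R \<U>\<close> closed under sub- and quotient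
  modules, countable products, tensor products with and homomorphisms out of the bimodule, and gives
  it enough projectives and injectives. The family of all sets inside a type that models set theory
  satisfies the conditions, and then \<open>RMod R \<U>\<close> is the category of all modules. Within plain HOL,
  \<open>\<U> = UNIV\<close> satisfies them for \<open>'m = 'i \<Rightarrow> bool\<close>, where \<open>'i\<close> is infinite and at least as large as
  the rings and the bimodule.
\<close>

definition universe :: "'m set set \<Rightarrow> bool"
  where "universe \<U> \<longleftrightarrow>
    (\<forall>X\<in>\<U>. \<forall>Y. Y \<lesssim> X \<longrightarrow> Y \<in> \<U>) \<and> (\<exists>X\<in>\<U>. \<exists>x\<in>X. \<exists>y\<in>X. x \<noteq> y)"

definition closed_under_powers :: "'m set set \<Rightarrow> 'i set \<Rightarrow> bool"
  where "closed_under_powers \<U> I \<longleftrightarrow> (\<forall>X\<in>\<U>. \<exists>Y\<in>\<U>. (I \<rightarrow>\<^sub>E X) \<lesssim> Y)"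

definition RMod :: "('r, 'x) ring_scheme \<Rightarrow> 'm set set \<Rightarrow> ('r, 'm) module set"
  where "RMod R \<U> = {M. lmodule R M \<and> carrier M \<in> \<U>}"

definition module_class ::
  "('r, 'x) ring_scheme \<Rightarrow> 'm set set \<Rightarrow> ('r, 'm) module set \<Rightarrow> bool"
  where "module_class R \<U> \<X> \<longleftrightarrow>
    \<X> \<subseteq> RMod R \<U> \<and> (\<forall>M\<in>\<X>. \<forall>N\<in>RMod R \<U>. mod_iso R M N \<longrightarrow> N \<in> \<X>)"

text \<open>Membership in a class for modules whose carrier need not be a subset of \<open>'m\<close>.\<close>

definition in_class ::
  "('r, 'x) ring_scheme \<Rightarrow> ('r, 'm) module set \<Rightarrow> ('r, 'n, 'y) module_scheme \<Rightarrow> bool"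
  where "in_class R \<X> M \<longleftrightarrow> (\<exists>N\<in>\<X>. mod_iso R N M)"

definition closed_under_summands ::
  "('r, 'x) ring_scheme \<Rightarrow> 'm set set \<Rightarrow> ('r, 'm) module set \<Rightarrow> bool"
  where "closed_under_summands R \<U> \<X> \<longleftrightarrow>
    (\<forall>X\<in>\<X>. \<forall>N\<in>RMod R \<U>. \<forall>N'\<in>RMod R \<U>. mod_iso R X (dirsum N N') \<longrightarrow> N \<in> \<X>)"

text \<open>Short exact sequences \<open>0 \<rightarrow> L \<rightarrow> M \<rightarrow> N \<rightarrow> 0\<close>.\<close>

definition short_exact ::
  "('r, 'x) ring_scheme \<Rightarrow> ('r, 'l, 'y1) module_scheme \<Rightarrow> ('l \<Rightarrow> 'm) \<Rightarrow> ('r, 'm, 'y2) module_scheme \<Rightarrow>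
    ('m \<Rightarrow> 'n) \<Rightarrow> ('r, 'n, 'y3) module_scheme \<Rightarrow> bool"
  where "short_exact R L f M g N \<longleftrightarrow>
    f \<in> Hom R L M \<and> g \<in> Hom R M N \<and> inj_on f (carrier L) \<and> f ` carrier L = a_kernel M N g \<and>
    g ` carrier M = carrier N"

definition closed_under_extensions ::
  "('r, 'x) ring_scheme \<Rightarrow> 'm set set \<Rightarrow> ('r, 'm) module set \<Rightarrow> bool"
  where "closed_under_extensions R \<U> \<X> \<longleftrightarrow>
    (\<forall>L\<in>\<X>. \<forall>N\<in>\<X>. \<forall>M\<in>RMod R \<U>. \<forall>f g. short_exact R L f M g N \<longrightarrow> M \<in> \<X>)"

section \<open>Resolutions and relative dimensions\<close>

text \<open>Exactness of \<open>\<dots> \<rightarrow> X\<^sub>2 \<rightarrow> X\<^sub>1 \<rightarrow> X\<^sub>0 \<rightarrow> M \<rightarrow> 0\<close> with \<open>d i : X\<^sub>i\<^sub>+\<^sub>1 \<rightarrow> X\<^sub>i\<close> and \<open>e : X\<^sub>0 \<rightarrow> M\<close>.\<close>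

definition resolution ::
  "('r, 'x) ring_scheme \<Rightarrow> (nat \<Rightarrow> ('r, 'm) module) \<Rightarrow> (nat \<Rightarrow> 'm \<Rightarrow> 'm) \<Rightarrow> ('m \<Rightarrow> 'n) \<Rightarrow>
    ('r, 'n, 'y) module_scheme \<Rightarrow> bool"
  where "resolution R X d e M \<longleftrightarrow>
    e \<in> Hom R (X 0) M \<and> (\<forall>i. d i \<in> Hom R (X (Suc i)) (X i)) \<and>
    e ` carrier (X 0) = carrier M \<and>
    d 0 ` carrier (X (Suc 0)) = a_kernel (X 0) M e \<and>
    (\<forall>i. d (Suc i) ` carrier (X (Suc (Suc i))) = a_kernel (X (Suc i)) (X i) (d i))"

text \<open>Exactness of \<open>0 \<rightarrow> M \<rightarrow> X\<^sub>0 \<rightarrow> X\<^sub>1 \<rightarrow> X\<^sub>2 \<rightarrow> \<dots>\<close> with \<open>e : M \<rightarrow> X\<^sub>0\<close> and \<open>d i : X\<^sub>i \<rightarrow> X\<^sub>i\<^sub>+\<^sub>1\<close>.\<close>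

definition coresolution ::
  "('r, 'x) ring_scheme \<Rightarrow> ('r, 'n, 'y) module_scheme \<Rightarrow> ('n \<Rightarrow> 'm) \<Rightarrow> (nat \<Rightarrow> ('r, 'm) module) \<Rightarrow>
    (nat \<Rightarrow> 'm \<Rightarrow> 'm) \<Rightarrow> bool"
  where "coresolution R M e X d \<longleftrightarrow>
    e \<in> Hom R M (X 0) \<and> (\<forall>i. d i \<in> Hom R (X i) (X (Suc i))) \<and>
    inj_on e (carrier M) \<and>
    e ` carrier M = a_kernel (X 0) (X (Suc 0)) (d 0) \<and>
    (\<forall>i. d i ` carrier (X i) = a_kernel (X (Suc i)) (X (Suc (Suc i))) (d (Suc i)))"

text \<open>
  \<open>res_class\<close> is \<open>\<X>\<^sup>\<and>\<^sub>m\<close> and \<open>cores_class\<close> is \<open>\<X>\<^sup>\<or>\<^sub>m\<close>. The finite exact sequences in their definition are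
  continued by zero modules, and these need not belong to \<open>\<X>\<close>.
\<close>

definition res_class ::
  "('r, 'x) ring_scheme \<Rightarrow> 'm set set \<Rightarrow> nat \<Rightarrow> ('r, 'm) module set \<Rightarrow> ('r, 'm) module set"
  where "res_class R \<U> m \<X> =
    {M \<in> RMod R \<U>. \<exists>k\<le>m. \<exists>X d e. resolution R X d e M \<and> (\<forall>i\<le>k. X i \<in> \<X>) \<and>
      (\<forall>i>k. X i \<in> RMod R \<U> \<and> carrier (X i) = {\<zero>\<^bsub>X i\<^esub>})}"

definition cores_class ::
  "('r, 'x) ring_scheme \<Rightarrow> 'm set set \<Rightarrow> nat \<Rightarrow> ('r, 'm) module set \<Rightarrow> ('r, 'm) module set"
  where "cores_class R \<U> m \<X> =
    {M \<in> RMod R \<U>. \<exists>k\<le>m. \<exists>X d e. coresolution R M e X d \<and> (\<forall>i\<le>k. X i \<in> \<X>) \<and>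
      (\<forall>i>k. X i \<in> RMod R \<U> \<and> carrier (X i) = {\<zero>\<^bsub>X i\<^esub>})}"

definition projective :: "('r, 'x) ring_scheme \<Rightarrow> 'm set set \<Rightarrow> ('r, 'm) module \<Rightarrow> bool"
  where "projective R \<U> P \<longleftrightarrow> P \<in> RMod R \<U> \<and>
    (\<forall>M\<in>RMod R \<U>. \<forall>N\<in>RMod R \<U>. \<forall>g\<in>Hom R M N. \<forall>f\<in>Hom R P N. g ` carrier M = carrier N \<longrightarrow>
      (\<exists>h\<in>Hom R P M. compose (carrier P) g h = f))"

definition proj_resolution ::
  "('r, 'x) ring_scheme \<Rightarrow> 'm set set \<Rightarrow> (nat \<Rightarrow> ('r, 'm) module) \<Rightarrow> (nat \<Rightarrow> 'm \<Rightarrow> 'm) \<Rightarrow> ('m \<Rightarrow> 'n) \<Rightarrow>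
    ('r, 'n, 'y) module_scheme \<Rightarrow> bool"
  where "proj_resolution R \<U> P d e M \<longleftrightarrow> resolution R P d e M \<and> (\<forall>i. projective R \<U> (P i))"

section \<open>Ext\<close>

definition hom_group ::
  "('r, 'x) ring_scheme \<Rightarrow> ('r, 'm, 'y) module_scheme \<Rightarrow> ('r, 'n, 'z) module_scheme \<Rightarrow>
    ('m \<Rightarrow> 'n) monoid"
  where "hom_group R M N = \<lparr>carrier = Hom R M N,
    mult = (\<lambda>f g. \<lambda>x\<in>carrier M. f x \<oplus>\<^bsub>N\<^esub> g x), one = (\<lambda>x\<in>carrier M. \<zero>\<^bsub>N\<^esub>)\<rparr>"

text \<open>\<open>Ext\<^sup>i(X, Y)\<close> is the \<open>i\<close>-th cohomology group of \<open>Hom(P\<^sub>0, Y) \<rightarrow> Hom(P\<^sub>1, Y) \<rightarrow> \<dots>\<close> for a chosen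
  projective resolution \<open>P\<close> of \<open>X\<close>.\<close>

definition Ext ::
  "('r, 'x) ring_scheme \<Rightarrow> 'm set set \<Rightarrow> nat \<Rightarrow> ('r, 'n, 'y) module_scheme \<Rightarrow>
    ('r, 'm) module \<Rightarrow> ('m \<Rightarrow> 'm) set monoid"
  where "Ext R \<U> i X Y =
    (let (P, d, e) = (SOME (P, d, e). proj_resolution R \<U> P d e X);
         G = (\<lambda>j. hom_group R (P j) Y);
         \<delta> = (\<lambda>j f. compose (carrier (P (Suc j))) f (d j));
         Z = kernel (G i) (G (Suc i)) (\<delta> i);
         B = (case i of 0 \<Rightarrow> {\<one>\<^bsub>G 0\<^esub>} | Suc j \<Rightarrow> \<delta> j ` carrier (G j))
     in (G i)\<lparr>carrier := Z\<rparr> Mod B)"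

section \<open>Bimodules, tensor products and Tor\<close>

text \<open>A \<open>(B, A)\<close>-bimodule is a left \<open>B\<close>-module record together with a right scalar multiplication.\<close>

record ('b, 'u, 'a) bimodule = "('b, 'u) module" +
  rsmult :: "'u \<Rightarrow> 'a \<Rightarrow> 'u"

locale bimodule = lmodule B U + A?: ring A
  for B (structure) and A (structure) and U (structure) +
  assumes rsmult_closed:
      "\<lbrakk>u \<in> carrier U; a \<in> carrier A\<rbrakk> \<Longrightarrow> rsmult U u a \<in> carrier U"
    and rsmult_l_distr:
      "\<lbrakk>u \<in> carrier U; v \<in> carrier U; a \<in> carrier A\<rbrakk> \<Longrightarrow>
        rsmult U (u \<oplus>\<^bsub>U\<^esub> v) a = rsmult U u a \<oplus>\<^bsub>U\<^esub> rsmult U v a"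
    and rsmult_r_distr:
      "\<lbrakk>u \<in> carrier U; a \<in> carrier A; a' \<in> carrier A\<rbrakk> \<Longrightarrow>
        rsmult U u (a \<oplus>\<^bsub>A\<^esub> a') = rsmult U u a \<oplus>\<^bsub>U\<^esub> rsmult U u a'"
    and rsmult_assoc:
      "\<lbrakk>u \<in> carrier U; a \<in> carrier A; a' \<in> carrier A\<rbrakk> \<Longrightarrow>
        rsmult U u (a \<otimes>\<^bsub>A\<^esub> a') = rsmult U (rsmult U u a) a'"
    and rsmult_one:
      "u \<in> carrier U \<Longrightarrow> rsmult U u \<one>\<^bsub>A\<^esub> = u"
    and smult_rsmult:
      "\<lbrakk>b \<in> carrier B; u \<in> carrier U; a \<in> carrier A\<rbrakk> \<Longrightarrow>
        b \<odot>\<^bsub>U\<^esub> rsmult U u a = rsmult U (b \<odot>\<^bsub>U\<^esub> u) a"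

text \<open>
  \<open>U \<otimes>\<^sub>A M\<close> is the free abelian group on \<open>U \<times> M\<close> modulo the subgroup generated by the bilinearity and
  balancing relations. Its elements are cosets; a map \<open>h\<close> between index sets acts on formal sums
  via \<open>tensor_push\<close>, and on cosets by taking the image and adding the target subgroup.
\<close>

definition tensor_rels ::
  "('a, 'x) ring_scheme \<Rightarrow> ('b, 'u, 'a, 'y) bimodule_scheme \<Rightarrow> ('a, 'm, 'z) module_scheme \<Rightarrow>
    ('u \<times> 'm \<Rightarrow>\<^sub>0 int) set"
  where "tensor_rels A U M = generate (free_Abelian_group (carrier U \<times> carrier M))
    ({frag_of (u \<oplus>\<^bsub>U\<^esub> v, x) - frag_of (u, x) - frag_of (v, x) | u v x.
        u \<in> carrier U \<and> v \<in> carrier U \<and> x \<in> carrier M} \<union>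
     {frag_of (u, x \<oplus>\<^bsub>M\<^esub> y) - frag_of (u, x) - frag_of (u, y) | u x y.
        u \<in> carrier U \<and> x \<in> carrier M \<and> y \<in> carrier M} \<union>
     {frag_of (rsmult U u a, x) - frag_of (u, a \<odot>\<^bsub>M\<^esub> x) | u a x.
        u \<in> carrier U \<and> a \<in> carrier A \<and> x \<in> carrier M})"

definition tensor_group ::
  "('a, 'x) ring_scheme \<Rightarrow> ('b, 'u, 'a, 'y) bimodule_scheme \<Rightarrow> ('a, 'm, 'z) module_scheme \<Rightarrow>
    ('u \<times> 'm \<Rightarrow>\<^sub>0 int) set monoid"
  where "tensor_group A U M =
    free_Abelian_group (carrier U \<times> carrier M) Mod tensor_rels A U M"

definition pure_tensor ::
  "('a, 'x) ring_scheme \<Rightarrow> ('b, 'u, 'a, 'y) bimodule_scheme \<Rightarrow> ('a, 'm, 'z) module_scheme \<Rightarrow>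
    'u \<Rightarrow> 'm \<Rightarrow> ('u \<times> 'm \<Rightarrow>\<^sub>0 int) set"
  where "pure_tensor A U M u x =
    tensor_rels A U M #>\<^bsub>free_Abelian_group (carrier U \<times> carrier M)\<^esub> frag_of (u, x)"

definition tensor_push :: "('i \<Rightarrow> 'j) \<Rightarrow> ('i \<Rightarrow>\<^sub>0 int) \<Rightarrow> ('j \<Rightarrow>\<^sub>0 int)"
  where "tensor_push h = frag_extend (\<lambda>i. frag_of (h i))"

definition tensor_module ::
  "('a, 'x) ring_scheme \<Rightarrow> ('b, 'u, 'a, 'y) bimodule_scheme \<Rightarrow> ('a, 'm, 'z) module_scheme \<Rightarrow>
    ('b, ('u \<times> 'm \<Rightarrow>\<^sub>0 int) set) module"
  where "tensor_module A U M =
    \<lparr>carrier = carrier (tensor_group A U M), mult = undefined, one = undefined,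
     ring.zero = \<one>\<^bsub>tensor_group A U M\<^esub>, add = (\<lambda>X Y. X \<otimes>\<^bsub>tensor_group A U M\<^esub> Y),
     smult = (\<lambda>b X. tensor_rels A U M <#>\<^bsub>free_Abelian_group (carrier U \<times> carrier M)\<^esub>
       (tensor_push (\<lambda>(u, x). (b \<odot>\<^bsub>U\<^esub> u, x)) ` X))\<rparr>"

text \<open>The map \<open>1 \<otimes> f : U \<otimes>\<^sub>A M \<rightarrow> U \<otimes>\<^sub>A N\<close>.\<close>

definition tensor_map ::
  "('a, 'x) ring_scheme \<Rightarrow> ('b, 'u, 'a, 'y) bimodule_scheme \<Rightarrow> ('a, 'n, 'z) module_scheme \<Rightarrow>
    ('m \<Rightarrow> 'n) \<Rightarrow> ('u \<times> 'm \<Rightarrow>\<^sub>0 int) set \<Rightarrow> ('u \<times> 'n \<Rightarrow>\<^sub>0 int) set"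
  where "tensor_map A U N f X =
    tensor_rels A U N <#>\<^bsub>free_Abelian_group (carrier U \<times> carrier N)\<^esub>
      (tensor_push (\<lambda>(u, x). (u, f x)) ` X)"

text \<open>\<open>Tor\<^sub>j(U, C)\<close> is the \<open>j\<close>-th homology group of \<open>\<dots> \<rightarrow> U \<otimes> P\<^sub>1 \<rightarrow> U \<otimes> P\<^sub>0\<close> for a chosen projective
  resolution \<open>P\<close> of \<open>C\<close>.\<close>

definition Tor ::
  "('a, 'x) ring_scheme \<Rightarrow> 'm set set \<Rightarrow> nat \<Rightarrow> ('b, 'u, 'a, 'y) bimodule_scheme \<Rightarrow>
    ('a, 'n, 'z) module_scheme \<Rightarrow> ('u \<times> 'm \<Rightarrow>\<^sub>0 int) set set monoid"
  where "Tor A \<U> j U C =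
    (let (P, d, e) = (SOME (P, d, e). proj_resolution A \<U> P d e C);
         G = (\<lambda>i. tensor_group A U (P i));
         \<delta> = (\<lambda>i. tensor_map A U (P i) (d i));
         Z = (case j of 0 \<Rightarrow> carrier (G 0) | Suc i \<Rightarrow> kernel (G (Suc i)) (G i) (\<delta> i))
     in (G j)\<lparr>carrier := Z\<rparr> Mod (\<delta> j ` carrier (G (Suc j))))"

text \<open>\<open>Hom\<^sub>B(U, N)\<close> as a left \<open>A\<close>-module.\<close>

definition hom_module ::
  "('b, 'x) ring_scheme \<Rightarrow> ('b, 'u, 'a, 'y) bimodule_scheme \<Rightarrow> ('b, 'n, 'z) module_scheme \<Rightarrow>
    ('a, 'u \<Rightarrow> 'n) module"
  where "hom_module B U N =
    \<lparr>carrier = Hom B U N, mult = undefined, one = undefined,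
     ring.zero = \<one>\<^bsub>hom_group B U N\<^esub>, add = (\<lambda>f g. f \<otimes>\<^bsub>hom_group B U N\<^esub> g),
     smult = (\<lambda>a f. \<lambda>u\<in>carrier U. f (rsmult U u a))\<rparr>"

section \<open>Cotorsion pairs\<close>

definition left_cotorsion_pair ::
  "('r, 'x) ring_scheme \<Rightarrow> 'm set set \<Rightarrow> nat \<Rightarrow> ('r, 'm) module set \<Rightarrow> ('r, 'm) module set \<Rightarrow> bool"
  where "left_cotorsion_pair R \<U> n \<X> \<Y> \<longleftrightarrow>
    closed_under_summands R \<U> \<X> \<and>
    (\<forall>X\<in>\<X>. \<forall>Y\<in>\<Y>. \<forall>i. 1 \<le> i \<and> i \<le> n \<longrightarrow> trivial_group (Ext R \<U> i X Y)) \<and>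
    (\<forall>M\<in>RMod R \<U>. \<exists>X\<in>\<X>. \<exists>Y\<in>res_class R \<U> (n - 1) \<Y>. \<exists>f g. short_exact R Y f X g M)"

definition right_cotorsion_pair ::
  "('r, 'x) ring_scheme \<Rightarrow> 'm set set \<Rightarrow> nat \<Rightarrow> ('r, 'm) module set \<Rightarrow> ('r, 'm) module set \<Rightarrow> bool"
  where "right_cotorsion_pair R \<U> n \<X> \<Y> \<longleftrightarrow>
    closed_under_summands R \<U> \<Y> \<and>
    (\<forall>X\<in>\<X>. \<forall>Y\<in>\<Y>. \<forall>i. 1 \<le> i \<and> i \<le> n \<longrightarrow> trivial_group (Ext R \<U> i X Y)) \<and>
    (\<forall>M\<in>RMod R \<U>. \<exists>Y\<in>\<Y>. \<exists>X\<in>cores_class R \<U> (n - 1) \<X>. \<exists>f g. short_exact R M f Y g X)"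

section \<open>Formal triangular matrix rings\<close>

text \<open>The triple \<open>(a, u, b)\<close> stands for the matrix with rows \<open>(a, 0)\<close> and \<open>(u, b)\<close>.\<close>

definition tri_ring ::
  "('a, 'x) ring_scheme \<Rightarrow> ('b, 'u, 'a, 'y) bimodule_scheme \<Rightarrow> ('b, 'z) ring_scheme \<Rightarrow>
    ('a \<times> 'u \<times> 'b) ring"
  where "tri_ring A U B =
    \<lparr>carrier = carrier A \<times> carrier U \<times> carrier B,
     mult = (\<lambda>(a, u, b) (a', u', b').
       (a \<otimes>\<^bsub>A\<^esub> a', rsmult U u a' \<oplus>\<^bsub>U\<^esub> b \<odot>\<^bsub>U\<^esub> u', b \<otimes>\<^bsub>B\<^esub> b')),
     one = (\<one>\<^bsub>A\<^esub>, \<zero>\<^bsub>U\<^esub>, \<one>\<^bsub>B\<^esub>),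
     ring.zero = (\<zero>\<^bsub>A\<^esub>, \<zero>\<^bsub>U\<^esub>, \<zero>\<^bsub>B\<^esub>),
     add = (\<lambda>(a, u, b) (a', u', b'). (a \<oplus>\<^bsub>A\<^esub> a', u \<oplus>\<^bsub>U\<^esub> u', b \<oplus>\<^bsub>B\<^esub> b'))\<rparr>"

text \<open>
  The module over the triangular matrix ring that is identified with the triple of \<open>M\<^sub>1\<close>, \<open>M\<^sub>2\<close> and
  \<open>\<phi> : U \<otimes>\<^sub>A M\<^sub>1 \<rightarrow> M\<^sub>2\<close>. The classes below are closed under isomorphism, so they consist of the modules
  isomorphic to such a module.
\<close>

definition tri_module ::
  "('a, 'x) ring_scheme \<Rightarrow> ('b, 'u, 'a, 'y) bimodule_scheme \<Rightarrow> ('a, 'm) module \<Rightarrow> ('b, 'n) module \<Rightarrow>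
    (('u \<times> 'm \<Rightarrow>\<^sub>0 int) set \<Rightarrow> 'n) \<Rightarrow> ('a \<times> 'u \<times> 'b, 'm \<times> 'n) module"
  where "tri_module A U M\<^sub>1 M\<^sub>2 \<phi> =
    \<lparr>carrier = carrier M\<^sub>1 \<times> carrier M\<^sub>2, mult = undefined, one = undefined,
     ring.zero = (\<zero>\<^bsub>M\<^sub>1\<^esub>, \<zero>\<^bsub>M\<^sub>2\<^esub>),
     add = (\<lambda>(x, y) (x', y'). (x \<oplus>\<^bsub>M\<^sub>1\<^esub> x', y \<oplus>\<^bsub>M\<^sub>2\<^esub> y')),
     smult = (\<lambda>(a, u, b) (x, y).
       (a \<odot>\<^bsub>M\<^sub>1\<^esub> x, \<phi> (pure_tensor A U M\<^sub>1 u x) \<oplus>\<^bsub>M\<^sub>2\<^esub> b \<odot>\<^bsub>M\<^sub>2\<^esub> y))\<rparr>"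

definition tri_adjoint ::
  "('a, 'x) ring_scheme \<Rightarrow> ('b, 'u, 'a, 'y) bimodule_scheme \<Rightarrow> ('a, 'm) module \<Rightarrow>
    (('u \<times> 'm \<Rightarrow>\<^sub>0 int) set \<Rightarrow> 'n) \<Rightarrow> 'm \<Rightarrow> 'u \<Rightarrow> 'n"
  where "tri_adjoint A U M\<^sub>1 \<phi> =
    (\<lambda>x\<in>carrier M\<^sub>1. \<lambda>u\<in>carrier U. \<phi> (pure_tensor A U M\<^sub>1 u x))"

definition class_A ::
  "('a, 'x) ring_scheme \<Rightarrow> ('b, 'u, 'a, 'y) bimodule_scheme \<Rightarrow> ('b, 'z) ring_scheme \<Rightarrow> 'm set set \<Rightarrow>
    ('a, 'm) module set \<Rightarrow> ('b, 'm) module set \<Rightarrow> ('a \<times> 'u \<times> 'b, 'm) module set"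
  where "class_A A U B \<U> \<X> \<Y> =
    {L \<in> RMod (tri_ring A U B) \<U>.
      \<exists>M\<^sub>1\<in>RMod A \<U>. \<exists>M\<^sub>2\<in>RMod B \<U>. \<exists>\<phi>\<in>Hom B (tensor_module A U M\<^sub>1) M\<^sub>2.
        mod_iso (tri_ring A U B) L (tri_module A U M\<^sub>1 M\<^sub>2 \<phi>) \<and> M\<^sub>1 \<in> \<X> \<and> M\<^sub>2 \<in> \<Y>}"

definition class_P ::
  "('a, 'x) ring_scheme \<Rightarrow> ('b, 'u, 'a, 'y) bimodule_scheme \<Rightarrow> ('b, 'z) ring_scheme \<Rightarrow> 'm set set \<Rightarrow>
    ('a, 'm) module set \<Rightarrow> ('b, 'm) module set \<Rightarrow> ('a \<times> 'u \<times> 'b, 'm) module set"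
  where "class_P A U B \<U> \<X> \<Y> =
    {L \<in> RMod (tri_ring A U B) \<U>.
      \<exists>M\<^sub>1\<in>RMod A \<U>. \<exists>M\<^sub>2\<in>RMod B \<U>. \<exists>\<phi>\<in>Hom B (tensor_module A U M\<^sub>1) M\<^sub>2.
        mod_iso (tri_ring A U B) L (tri_module A U M\<^sub>1 M\<^sub>2 \<phi>) \<and> M\<^sub>1 \<in> \<X> \<and>
        in_class B \<Y> (quot_module M\<^sub>2 (\<phi> ` carrier (tensor_module A U M\<^sub>1))) \<and>
        inj_on \<phi> (carrier (tensor_module A U M\<^sub>1))}"

definition class_I ::
  "('a, 'x) ring_scheme \<Rightarrow> ('b, 'u, 'a, 'y) bimodule_scheme \<Rightarrow> ('b, 'z) ring_scheme \<Rightarrow> 'm set set \<Rightarrow>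
    ('a, 'm) module set \<Rightarrow> ('b, 'm) module set \<Rightarrow> ('a \<times> 'u \<times> 'b, 'm) module set"
  where "class_I A U B \<U> \<X> \<Y> =
    {L \<in> RMod (tri_ring A U B) \<U>.
      \<exists>M\<^sub>1\<in>RMod A \<U>. \<exists>M\<^sub>2\<in>RMod B \<U>. \<exists>\<phi>\<in>Hom B (tensor_module A U M\<^sub>1) M\<^sub>2.
        mod_iso (tri_ring A U B) L (tri_module A U M\<^sub>1 M\<^sub>2 \<phi>) \<and>
        M\<^sub>1\<lparr>carrier := a_kernel M\<^sub>1 (hom_module B U M\<^sub>2) (tri_adjoint A U M\<^sub>1 \<phi>)\<rparr> \<in> \<X> \<and> M\<^sub>2 \<in> \<Y> \<and>
        tri_adjoint A U M\<^sub>1 \<phi> ` carrier M\<^sub>1 = carrier (hom_module B U M\<^sub>2)}"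

end

theory Submission
  imports Defs
begin

text \<open>
  A module \<open>L\<close> over \<open>\<Lambda>\<close> amounts to its components \<open>L\<^sub>1\<close>, \<open>L\<^sub>2\<close> and the multiplication \<open>U \<otimes> L\<^sub>1 \<rightarrow> L\<^sub>2\<close>. The functors
  \<open>L \<mapsto> L\<^sub>1\<close>, \<open>L \<mapsto> L\<^sub>2\<close>, \<open>M \<mapsto> (M, 0)\<close> and \<open>N \<mapsto> (0, N)\<close> are exact. Since \<open>L \<mapsto> L\<^sub>1\<close> is left adjoint to \<open>M \<mapsto> (M, 0)\<close>
  and \<open>N \<mapsto> (0, N)\<close> is left adjoint to \<open>L \<mapsto> L\<^sub>2\<close>, these two left adjoints preserve projectives, so that
  \<open>Ext(X\<^sub>1, D) = Ext(X, (D, 0))\<close> and \<open>Ext(E, Y\<^sub>2) = Ext((0, E), Y)\<close>. This gives the orthogonality relations.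
  The approximation sequences are the components of those of \<open>(M, 0)\<close> and \<open>(0, N)\<close>. In (1)(b), the sequence
  \<open>0 \<rightarrow> (0, N) \<rightarrow> Y \<rightarrow> X \<rightarrow> 0\<close> yields \<open>Y\<^sub>1 \<cong> X\<^sub>1\<close>. The first components of the coresolution of \<open>X\<close> are
  Tor-acyclic, so it stays exact under \<open>U \<otimes> -\<close>, the cokernels of \<open>U \<otimes> L\<^sub>1 \<rightarrow> L\<^sub>2\<close> form a coresolution, and \<open>X\<^sub>2\<close> is
  an extension of a module in \<open>\<E>\<^sup>\<or>\<close> by \<open>U \<otimes> Y\<^sub>1\<close>. Part (2)(b) is dual: the kernels of
  \<open>L\<^sub>1 \<rightarrow> Hom(U, L\<^sub>2)\<close> form a resolution, because \<open>Hom(U, -)\<close> is exact on the second components.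
\<close>

section \<open>Modules and homomorphisms\<close>

text \<open>The classes are closed under isomorphism and nothing more: they may omit zero and, a
  priori, be empty. Orthogonality is therefore tested on larger triples from which the wanted
  modules split off, and nonemptiness is read off the approximation of one module over \<Lambda>.
  \<open>Ext\<close> and \<open>Tor\<close> use a resolution picked by \<open>SOME\<close>. For Ext
  the comparison of resolutions is proved once, in a form that also yields inheritance by retracts.
  For Tor it is avoided: triviality of the groups is turned into \<open>tor_vanish\<close>, a
  condition on all short exact sequences, and every later dimension shift happens there. The
  vanishing range is spent by walking along a finite resolution or coresolution away from its zero
  tail; its length is at most n - 1, and each short exact sequence on the way costs one degree.
  Modules live on subsets of one type, which pairs, cosets and function spaces leave; such a
  construction is made on its natural type, shown to be small and copied back along an
  injection.\<close>

lemma lmodule_imp_abelian_group: "lmodule R M \<Longrightarrow> abelian_group M"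
  by (simp add: lmodule_def)

lemma lmoduleI:
  fixes R (structure) and M (structure)
  assumes "ring R"
    and "\<And>x y. \<lbrakk>x \<in> carrier M; y \<in> carrier M\<rbrakk> \<Longrightarrow> x \<oplus>\<^bsub>M\<^esub> y \<in> carrier M"
    and "\<zero>\<^bsub>M\<^esub> \<in> carrier M"
    and "\<And>x y z. \<lbrakk>x \<in> carrier M; y \<in> carrier M; z \<in> carrier M\<rbrakk> \<Longrightarrow>
      (x \<oplus>\<^bsub>M\<^esub> y) \<oplus>\<^bsub>M\<^esub> z = x \<oplus>\<^bsub>M\<^esub> (y \<oplus>\<^bsub>M\<^esub> z)"
    and "\<And>x y. \<lbrakk>x \<in> carrier M; y \<in> carrier M\<rbrakk> \<Longrightarrow> x \<oplus>\<^bsub>M\<^esub> y = y \<oplus>\<^bsub>M\<^esub> x"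
    and "\<And>x. x \<in> carrier M \<Longrightarrow> \<zero>\<^bsub>M\<^esub> \<oplus>\<^bsub>M\<^esub> x = x"
    and "\<And>x. x \<in> carrier M \<Longrightarrow> \<exists>y\<in>carrier M. y \<oplus>\<^bsub>M\<^esub> x = \<zero>\<^bsub>M\<^esub>"
    and "\<And>a x. \<lbrakk>a \<in> carrier R; x \<in> carrier M\<rbrakk> \<Longrightarrow> a \<odot>\<^bsub>M\<^esub> x \<in> carrier M"
    and "\<And>a b x. \<lbrakk>a \<in> carrier R; b \<in> carrier R; x \<in> carrier M\<rbrakk> \<Longrightarrow>
      (a \<oplus>\<^bsub>R\<^esub> b) \<odot>\<^bsub>M\<^esub> x = a \<odot>\<^bsub>M\<^esub> x \<oplus>\<^bsub>M\<^esub> b \<odot>\<^bsub>M\<^esub> x"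
    and "\<And>a x y. \<lbrakk>a \<in> carrier R; x \<in> carrier M; y \<in> carrier M\<rbrakk> \<Longrightarrow>
      a \<odot>\<^bsub>M\<^esub> (x \<oplus>\<^bsub>M\<^esub> y) = a \<odot>\<^bsub>M\<^esub> x \<oplus>\<^bsub>M\<^esub> a \<odot>\<^bsub>M\<^esub> y"
    and "\<And>a b x. \<lbrakk>a \<in> carrier R; b \<in> carrier R; x \<in> carrier M\<rbrakk> \<Longrightarrow>
      (a \<otimes>\<^bsub>R\<^esub> b) \<odot>\<^bsub>M\<^esub> x = a \<odot>\<^bsub>M\<^esub> (b \<odot>\<^bsub>M\<^esub> x)"
    and "\<And>x. x \<in> carrier M \<Longrightarrow> \<one>\<^bsub>R\<^esub> \<odot>\<^bsub>M\<^esub> x = x"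
  shows "lmodule R M"
  by (intro lmodule.intro lmodule_axioms.intro abelian_groupI; (rule assms; assumption))

lemma (in abelian_group) add_eq_zeroD:
  assumes "x \<in> carrier G" "y \<in> carrier G" "x \<oplus> y = \<zero>"
  shows "x = \<ominus> y"
  using assms by (simp add: minus_equality)

lemma (in abelian_group) minus_add_cancel:
  assumes "x \<in> carrier G" "y \<in> carrier G"
  shows "(x \<ominus> y) \<oplus> y = x" and "y \<oplus> (x \<ominus> y) = x"
  using assms by (simp_all add: a_minus_def a_assoc a_lcomm[of y x] l_neg r_neg)

lemma (in abelian_group) minus_eq_zero_iff:
  assumes "x \<in> carrier G" "y \<in> carrier G"
  shows "x \<ominus> y = \<zero> \<longleftrightarrow> x = y"
  using minus_add_cancel(1)[OF assms] assms by (auto simp: a_minus_def r_neg)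

lemma (in abelian_group) minus_self: "x \<in> carrier G \<Longrightarrow> x \<ominus> x = \<zero>"
  by (simp add: a_minus_def r_neg)

lemma (in abelian_group) zero_minus: "x \<in> carrier G \<Longrightarrow> x \<ominus> \<zero> = x"
  by (simp add: a_minus_def)

context lmodule
begin

lemma smult_zero_right: "r \<in> carrier R \<Longrightarrow> r \<odot>\<^bsub>M\<^esub> \<zero>\<^bsub>M\<^esub> = \<zero>\<^bsub>M\<^esub>"
  by (metis M.add.r_cancel_one' M.zero_closed M.r_zero smult_closed smult_r_distr)

lemma smult_zero_left: "x \<in> carrier M \<Longrightarrow> \<zero>\<^bsub>R\<^esub> \<odot>\<^bsub>M\<^esub> x = \<zero>\<^bsub>M\<^esub>"
  by (metis M.add.r_cancel_one' R.zero_closed R.r_zero smult_closed smult_l_distr)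

lemma smult_minus_right:
  assumes "r \<in> carrier R" "x \<in> carrier M"
  shows "r \<odot>\<^bsub>M\<^esub> (\<ominus>\<^bsub>M\<^esub> x) = \<ominus>\<^bsub>M\<^esub> (r \<odot>\<^bsub>M\<^esub> x)"
  using assms by (metis M.a_inv_closed M.l_neg M.minus_equality smult_closed smult_r_distr smult_zero_right)

end

lemma HomI:
  assumes "lmodule R M" "\<And>x. x \<in> carrier M \<Longrightarrow> f x \<in> carrier N"
    and "\<And>x y. \<lbrakk>x \<in> carrier M; y \<in> carrier M\<rbrakk> \<Longrightarrow> f (x \<oplus>\<^bsub>M\<^esub> y) = f x \<oplus>\<^bsub>N\<^esub> f y"
    and "\<And>r x. \<lbrakk>r \<in> carrier R; x \<in> carrier M\<rbrakk> \<Longrightarrow> f (r \<odot>\<^bsub>M\<^esub> x) = r \<odot>\<^bsub>N\<^esub> f x"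
  shows "restrict f (carrier M) \<in> Hom R M N"
proof -
  interpret lmodule R M by fact
  show ?thesis
    using assms(2-4) by (auto simp: Hom_def smult_closed)
qed

lemma HomE:
  assumes "f \<in> Hom R M N"
  shows "f \<in> carrier M \<rightarrow>\<^sub>E carrier N"
    and "x \<in> carrier M \<Longrightarrow> f x \<in> carrier N"
    and "\<lbrakk>x \<in> carrier M; y \<in> carrier M\<rbrakk> \<Longrightarrow> f (x \<oplus>\<^bsub>M\<^esub> y) = f x \<oplus>\<^bsub>N\<^esub> f y"
    and "\<lbrakk>r \<in> carrier R; x \<in> carrier M\<rbrakk> \<Longrightarrow> f (r \<odot>\<^bsub>M\<^esub> x) = r \<odot>\<^bsub>N\<^esub> f x"
  using assms by (auto simp: Hom_def)

lemma Hom_eqI: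
  assumes "f \<in> Hom R M N" "g \<in> Hom R M' N'" "carrier M' = carrier M"
    and "\<And>x. x \<in> carrier M \<Longrightarrow> f x = g x"
  shows "f = g"
  using assms by (intro extensionalityI[of f "carrier M"]) (auto simp: Hom_def PiE_iff)

lemma Hom_zero:
  assumes "lmodule R M" "lmodule R N" "f \<in> Hom R M N"
  shows "f \<zero>\<^bsub>M\<^esub> = \<zero>\<^bsub>N\<^esub>"
proof -
  interpret M: lmodule R M by fact
  interpret N: lmodule R N by fact
  show ?thesis
    using HomE(2,3)[OF assms(3), of "\<zero>\<^bsub>M\<^esub>"] HomE(3)[OF assms(3), of "\<zero>\<^bsub>M\<^esub>" "\<zero>\<^bsub>M\<^esub>"]
    by (metis M.M.r_zero M.M.zero_closed N.M.add.r_cancel_one')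
qed

lemma Hom_uminus:
  assumes "lmodule R M" "lmodule R N" "f \<in> Hom R M N" "x \<in> carrier M"
  shows "f (\<ominus>\<^bsub>M\<^esub> x) = \<ominus>\<^bsub>N\<^esub> f x"
proof -
  interpret M: lmodule R M by fact
  interpret N: lmodule R N by fact
  have "f (\<ominus>\<^bsub>M\<^esub> x) \<oplus>\<^bsub>N\<^esub> f x = \<zero>\<^bsub>N\<^esub>"
    using assms by (metis HomE(3) Hom_zero M.M.a_inv_closed M.M.l_neg)
  then show ?thesis
    using assms by (metis HomE(2) M.M.a_inv_closed N.M.minus_equality)
qed

lemma Hom_minus:
  assumes "lmodule R M" "lmodule R N" "f \<in> Hom R M N" "x \<in> carrier M" "y \<in> carrier M"
  shows "f (x \<ominus>\<^bsub>M\<^esub> y) = f x \<ominus>\<^bsub>N\<^esub> f y"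
proof -
  interpret M: lmodule R M by fact
  show ?thesis
    using assms by (simp add: a_minus_def HomE(3) Hom_uminus)
qed

lemma Hom_compose:
  assumes "lmodule R L" "f \<in> Hom R L M" "g \<in> Hom R M N"
  shows "compose (carrier L) g f \<in> Hom R L N"
  unfolding compose_def using assms by (intro HomI) (auto simp: HomE)

lemma Hom_id:
  assumes "lmodule R M"
  shows "(\<lambda>x\<in>carrier M. x) \<in> Hom R M M"
  using HomI[of R M "\<lambda>x. x" M] assms by auto

lemma Hom_const_zero:
  assumes "lmodule R M" "lmodule R N"
  shows "(\<lambda>x\<in>carrier M. \<zero>\<^bsub>N\<^esub>) \<in> Hom R M N"
proof -
  interpret N: lmodule R N by fact
  show ?thesis using assms by (intro HomI) (auto simp: N.smult_zero_right)
qed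

lemma Hom_add:
  assumes "lmodule R M" "lmodule R N" "f \<in> Hom R M N" "g \<in> Hom R M N"
  shows "(\<lambda>x\<in>carrier M. f x \<oplus>\<^bsub>N\<^esub> g x) \<in> Hom R M N"
proof -
  interpret N: lmodule R N by fact
  show ?thesis
    using assms by (intro HomI) (auto simp: HomE N.smult_r_distr N.M.a_ac)
qed

lemma Hom_neg:
  assumes "lmodule R M" "lmodule R N" "f \<in> Hom R M N"
  shows "(\<lambda>x\<in>carrier M. \<ominus>\<^bsub>N\<^esub> f x) \<in> Hom R M N"
proof -
  interpret N: lmodule R N by fact
  show ?thesis
    using assms by (intro HomI) (auto simp: HomE N.smult_minus_right N.M.minus_add)
qed

lemma Hom_diff:
  assumes "lmodule R M" "lmodule R N" "f \<in> Hom R M N" "g \<in> Hom R M N"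
  shows "(\<lambda>x\<in>carrier M. f x \<ominus>\<^bsub>N\<^esub> g x) \<in> Hom R M N"
  using Hom_add[OF assms(1,2,3) Hom_neg[OF assms(1,2,4)]]
  by (simp add: a_minus_def cong: restrict_cong)

lemma a_kernel_iff: "x \<in> a_kernel M N f \<longleftrightarrow> x \<in> carrier M \<and> f x = \<zero>\<^bsub>N\<^esub>"
  by (simp add: a_kernel_def')

lemma Hom_inj_onI:
  assumes "lmodule R M" "lmodule R N" "f \<in> Hom R M N"
    and "\<And>x. x \<in> carrier M \<Longrightarrow> f x = \<zero>\<^bsub>N\<^esub> \<Longrightarrow> x = \<zero>\<^bsub>M\<^esub>"
  shows "inj_on f (carrier M)"
proof (rule inj_onI)
  interpret M: lmodule R M by fact
  interpret N: lmodule R N by fact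
  fix x y assume xy: "x \<in> carrier M" "y \<in> carrier M" "f x = f y"
  then have "f (x \<ominus>\<^bsub>M\<^esub> y) = \<zero>\<^bsub>N\<^esub>"
    using assms by (simp add: Hom_minus HomE(2) N.M.minus_self)
  then show "x = y"
    using xy assms(4)[of "x \<ominus>\<^bsub>M\<^esub> y"] by (simp add: M.M.minus_eq_zero_iff)
qed

lemma Hom_inj_onD:
  assumes "lmodule R M" "lmodule R N" "f \<in> Hom R M N" "inj_on f (carrier M)"
    "x \<in> carrier M" "f x = \<zero>\<^bsub>N\<^esub>"
  shows "x = \<zero>\<^bsub>M\<^esub>"
proof -
  interpret M: lmodule R M by fact
  show ?thesis using assms by (metis Hom_zero M.M.zero_closed inj_onD)
qed

subsection \<open>Submodules\<close>

text \<open>Kept as a subset, so that the submodule is M with its carrier replaced: same element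
  type, same operations. Kernels and images thus stay in the universe without being copied.\<close>

definition submod :: "('r, 'x) ring_scheme \<Rightarrow> ('r, 'm, 'y) module_scheme \<Rightarrow> 'm set \<Rightarrow> bool"
  where "submod R M S \<longleftrightarrow> S \<subseteq> carrier M \<and> \<zero>\<^bsub>M\<^esub> \<in> S \<and> (\<forall>x\<in>S. \<forall>y\<in>S. x \<oplus>\<^bsub>M\<^esub> y \<in> S) \<and>
    (\<forall>x\<in>S. \<ominus>\<^bsub>M\<^esub> x \<in> S) \<and> (\<forall>r\<in>carrier R. \<forall>x\<in>S. r \<odot>\<^bsub>M\<^esub> x \<in> S)"

lemma lmodule_submod:
  assumes "lmodule R M" "submod R M S"
  shows "lmodule R (M\<lparr>carrier := S\<rparr>)"
proof -
  interpret M: lmodule R M by fact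
  have S: "\<And>x. x \<in> S \<Longrightarrow> x \<in> carrier M"
    using assms(2) by (auto simp: submod_def)
  have "\<exists>y\<in>S. y \<oplus>\<^bsub>M\<^esub> x = \<zero>\<^bsub>M\<^esub>" if "x \<in> S" for x
    using that assms(2) S by (intro bexI[of _ "\<ominus>\<^bsub>M\<^esub> x"]) (auto simp: submod_def M.M.l_neg)
  then show ?thesis
    using assms(2) S by (intro lmoduleI M.R.ring_axioms)
      (auto simp: submod_def M.M.a_assoc intro: M.M.a_comm simp: M.smult_assoc1 M.smult_one
        M.smult_r_distr M.smult_l_distr)
qed

lemma submod_kernel:
  assumes "lmodule R M" "lmodule R N" "f \<in> Hom R M N"
  shows "submod R M (a_kernel M N f)"
proof -
  interpret M: lmodule R M by fact
  interpret N: lmodule R N by fact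
  show ?thesis
    using assms by (auto simp: submod_def a_kernel_iff HomE Hom_zero Hom_uminus N.smult_zero_right
      M.smult_closed)
qed

lemma submod_image:
  assumes "lmodule R M" "lmodule R N" "f \<in> Hom R M N"
  shows "submod R N (f ` carrier M)"
proof -
  interpret M: lmodule R M by fact
  interpret N: lmodule R N by fact
  show ?thesis unfolding submod_def
  proof (intro conjI ballI)
    show "\<zero>\<^bsub>N\<^esub> \<in> f ` carrier M"
      using Hom_zero[OF assms] by (metis M.M.zero_closed image_eqI)
  next
    fix x y assume "x \<in> f ` carrier M" "y \<in> f ` carrier M"
    then show "x \<oplus>\<^bsub>N\<^esub> y \<in> f ` carrier M"
      using assms(3) by (auto simp: HomE(3)[symmetric])
  next
    fix x assume "x \<in> f ` carrier M"
    then show "\<ominus>\<^bsub>N\<^esub> x \<in> f ` carrier M"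
      using assms by (auto simp: Hom_uminus[OF assms, symmetric])
  next
    fix r x assume "r \<in> carrier R" "x \<in> f ` carrier M"
    then show "r \<odot>\<^bsub>N\<^esub> x \<in> f ` carrier M"
      using assms(3) by (auto simp: HomE(4)[symmetric] M.smult_closed)
  qed (use assms(3) in \<open>auto simp: HomE\<close>)
qed

lemma Hom_submod_codomain:
  assumes "f \<in> Hom R M N" "f ` carrier M \<subseteq> S"
  shows "f \<in> Hom R M (N\<lparr>carrier := S\<rparr>)"
  using assms by (auto simp: Hom_def PiE_iff)

lemma Hom_submod_inclusion:
  assumes "lmodule R M" "submod R M S"
  shows "(\<lambda>x\<in>S. x) \<in> Hom R (M\<lparr>carrier := S\<rparr>) M"
  using HomI[OF lmodule_submod[OF assms], of "\<lambda>x. x" M] assms by (auto simp: submod_def)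

lemma Hom_submod_restrict:
  assumes "lmodule R M" "submod R M S" "f \<in> Hom R M N"
  shows "restrict f S \<in> Hom R (M\<lparr>carrier := S\<rparr>) N"
  using HomI[OF lmodule_submod[OF assms(1,2)], of f N] assms by (auto simp: submod_def HomE subset_eq)

lemma Hom_submod_target:
  assumes "f \<in> Hom R M (N\<lparr>carrier := S\<rparr>)" "S \<subseteq> carrier N"
  shows "f \<in> Hom R M N"
  using assms by (auto simp: Hom_def PiE_iff)

subsection \<open>Isomorphisms\<close>

text \<open>\<open>mod_iso\<close> only asserts a bijective homomorphism. Here an inverse is carried
  along, because maps get composed with it in both directions; its equations are asked on the
  carriers alone.\<close>

definition isos :: "('r, 'x) ring_scheme \<Rightarrow> ('r, 'm, 'y) module_scheme \<Rightarrow> ('r, 'n, 'z) module_scheme \<Rightarrow>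
    ('m \<Rightarrow> 'n) \<Rightarrow> ('n \<Rightarrow> 'm) \<Rightarrow> bool"
  where "isos R M N f g \<longleftrightarrow> f \<in> Hom R M N \<and> g \<in> Hom R N M \<and>
    (\<forall>x\<in>carrier M. g (f x) = x) \<and> (\<forall>y\<in>carrier N. f (g y) = y)"

lemma isosD:
  assumes "isos R M N f g"
  shows "f \<in> Hom R M N" "g \<in> Hom R N M" "x \<in> carrier M \<Longrightarrow> g (f x) = x" "y \<in> carrier N \<Longrightarrow> f (g y) = y"
  using assms by (auto simp: isos_def)

lemma isos_sym: "isos R M N f g \<Longrightarrow> isos R N M g f"
  by (auto simp: isos_def)

lemma isos_imp_bij: "isos R M N f g \<Longrightarrow> bij_betw f (carrier M) (carrier N)"
  by (rule bij_betw_byWitness[where f' = g]) (auto simp: isos_def HomE)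

lemma isos_imp_mod_iso: "isos R M N f g \<Longrightarrow> mod_iso R M N"
  using isos_imp_bij isosD(1) unfolding mod_iso_def by blast

lemma bij_Hom_isos:
  assumes "lmodule R M" "lmodule R N" "f \<in> Hom R M N" "bij_betw f (carrier M) (carrier N)"
  shows "isos R M N f (restrict (inv_into (carrier M) f) (carrier N))"
proof -
  interpret M: lmodule R M by fact
  interpret N: lmodule R N by fact
  let ?g = "inv_into (carrier M) f"
  have inj: "inj_on f (carrier M)"
    using assms(4) by (simp add: bij_betw_def)
  have gf: "?g (f x) = x" if "x \<in> carrier M" for x
    using inj that by simp
  have fg: "f (?g y) = y" "?g y \<in> carrier M" if "y \<in> carrier N" for y
    using assms(4) that by (auto simp: bij_betw_def f_inv_into_f inv_into_into)
  have "restrict ?g (carrier N) \<in> Hom R N M"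
  proof (rule HomI[OF assms(2)])
    fix x y assume "x \<in> carrier N" "y \<in> carrier N"
    then show "?g (x \<oplus>\<^bsub>N\<^esub> y) = ?g x \<oplus>\<^bsub>M\<^esub> ?g y"
      using gf[of "?g x \<oplus>\<^bsub>M\<^esub> ?g y"] fg assms(3) by (simp add: HomE)
  next
    fix r x assume "r \<in> carrier R" "x \<in> carrier N"
    then show "?g (r \<odot>\<^bsub>N\<^esub> x) = r \<odot>\<^bsub>M\<^esub> ?g x"
      using gf[of "r \<odot>\<^bsub>M\<^esub> ?g x"] fg assms(3) by (simp add: HomE M.smult_closed)
  qed (use fg in auto)
  then show ?thesis
    using assms(3) gf fg by (auto simp: isos_def HomE)
qed

lemma mod_iso_imp_isos:
  assumes "lmodule R M" "lmodule R N" "mod_iso R M N"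
  obtains f g where "isos R M N f g"
  using assms bij_Hom_isos unfolding mod_iso_def by blast

lemma isos_trans:
  assumes "lmodule R L" "lmodule R N" "isos R L M f g" "isos R M N f' g'"
  shows "isos R L N (compose (carrier L) f' f) (compose (carrier N) g g')"
  using assms Hom_compose[of R L f M f' N] Hom_compose[of R N g' M g L]
  by (auto simp: isos_def compose_eq HomE)

lemma isos_refl: "lmodule R M \<Longrightarrow> isos R M M (\<lambda>x\<in>carrier M. x) (\<lambda>x\<in>carrier M. x)"
  by (simp add: isos_def Hom_id)

lemma isos_zero: "lmodule R M \<Longrightarrow> lmodule R N \<Longrightarrow> isos R M N f g \<Longrightarrow> f \<zero>\<^bsub>M\<^esub> = \<zero>\<^bsub>N\<^esub>"
  using Hom_zero isosD(1) by blast

lemma isos_eq_zero_iff: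
  assumes "lmodule R M" "lmodule R N" "isos R M N f g" "x \<in> carrier M"
  shows "f x = \<zero>\<^bsub>N\<^esub> \<longleftrightarrow> x = \<zero>\<^bsub>M\<^esub>"
  by (metis assms isosD(3) isos_sym isos_zero)

text \<open>Copies a module along an injection t of its carrier into another type. Direct sums, free
  modules and triples enter the universe in this way.\<close>

definition transport :: "('n \<Rightarrow> 'm) \<Rightarrow> ('r, 'n, 'y) module_scheme \<Rightarrow> ('r, 'm) module"
  where "transport t N = (let s = inv_into (carrier N) t in
    \<lparr>carrier = t ` carrier N, mult = undefined, one = undefined, ring.zero = t \<zero>\<^bsub>N\<^esub>,
     add = (\<lambda>x y. t (s x \<oplus>\<^bsub>N\<^esub> s y)), smult = (\<lambda>r x. t (r \<odot>\<^bsub>N\<^esub> s x))\<rparr>)"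

lemma transport_isos:
  assumes "lmodule R N" "inj_on t (carrier N)"
  shows "lmodule R (transport t N)" and "\<exists>f g. isos R (transport t N) N f g"
proof -
  interpret N: lmodule R N by fact
  have ex: "\<exists>y\<in>t ` carrier N. t (inv_into (carrier N) t y \<oplus>\<^bsub>N\<^esub> x) = t \<zero>\<^bsub>N\<^esub>" if "x \<in> carrier N" for x
    using that assms(2) by (intro bexI[of _ "t (\<ominus>\<^bsub>N\<^esub> x)"]) (auto simp: N.M.l_neg)
  show *: "lmodule R (transport t N)"
    using assms(2) ex by (intro lmoduleI N.R.ring_axioms)
      (auto simp: transport_def Let_def N.M.a_ac N.smult_assoc1 N.smult_one
        N.smult_closed N.smult_r_distr N.smult_l_distr)
  have "restrict t (carrier N) \<in> Hom R N (transport t N)"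
    using assms by (intro HomI) (auto simp: transport_def Let_def)
  moreover have "bij_betw (restrict t (carrier N)) (carrier N) (carrier (transport t N))"
    using assms(2) by (auto simp: transport_def Let_def bij_betw_def inj_on_def)
  ultimately show "\<exists>f g. isos R (transport t N) N f g"
    using bij_Hom_isos[OF assms(1) *] isos_sym by blast
qed

text \<open>Retracts replace summands wherever only the vanishing of Ext is at stake: no complement
  has to be exhibited, and isomorphisms are a special case.\<close>

definition retract :: "('r, 'x) ring_scheme \<Rightarrow> ('r, 'm, 'y) module_scheme \<Rightarrow> ('r, 'n, 'z) module_scheme \<Rightarrow> bool"
  where "retract R M N \<longleftrightarrow> (\<exists>i\<in>Hom R M N. \<exists>r\<in>Hom R N M. \<forall>x\<in>carrier M. r (i x) = x)"

lemma isos_retract: "isos R M N f g \<Longrightarrow> retract R M N"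
  by (auto simp: isos_def retract_def)

lemma retract_trans:
  assumes "lmodule R L" "lmodule R N" "retract R L M" "retract R M N"
  shows "retract R L N"
proof -
  obtain i r i' r' where "i \<in> Hom R L M" "r \<in> Hom R M L" "\<forall>x\<in>carrier L. r (i x) = x"
    "i' \<in> Hom R M N" "r' \<in> Hom R N M" "\<forall>x\<in>carrier M. r' (i' x) = x"
    using assms(3,4) by (auto simp: retract_def)
  then show ?thesis
    unfolding retract_def using assms(1,2)
    by (intro bexI[of _ "compose (carrier L) i' i"] bexI[of _ "compose (carrier N) r r'"])
      (auto simp: compose_eq HomE intro: Hom_compose)
qed

subsection \<open>Direct sums\<close>

lemma dirsum_simps [simp]:
  "carrier (dirsum M N) = carrier M \<times> carrier N"
  "\<zero>\<^bsub>dirsum M N\<^esub> = (\<zero>\<^bsub>M\<^esub>, \<zero>\<^bsub>N\<^esub>)"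
  "(x, y) \<oplus>\<^bsub>dirsum M N\<^esub> (x', y') = (x \<oplus>\<^bsub>M\<^esub> x', y \<oplus>\<^bsub>N\<^esub> y')"
  "r \<odot>\<^bsub>dirsum M N\<^esub> (x, y) = (r \<odot>\<^bsub>M\<^esub> x, r \<odot>\<^bsub>N\<^esub> y)"
  by (simp_all add: dirsum_def)

lemma lmodule_dirsum:
  assumes "lmodule R M" "lmodule R N"
  shows "lmodule R (dirsum M N)"
proof -
  interpret M: lmodule R M by fact
  interpret N: lmodule R N by fact
  have "\<exists>x'\<in>carrier M. \<exists>y'\<in>carrier N. x' \<oplus>\<^bsub>M\<^esub> x = \<zero>\<^bsub>M\<^esub> \<and> y' \<oplus>\<^bsub>N\<^esub> y = \<zero>\<^bsub>N\<^esub>"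
    if "x \<in> carrier M" "y \<in> carrier N" for x y
    using that M.M.l_neg N.M.l_neg by blast
  then show ?thesis
    by (intro lmoduleI M.R.ring_axioms)
      (auto simp: M.M.a_ac M.smult_assoc1 M.smult_one M.smult_closed M.smult_r_distr
        M.smult_l_distr N.M.a_ac N.smult_assoc1 N.smult_one N.smult_closed
        N.smult_r_distr N.smult_l_distr)
qed

lemma dirsum_Hom:
  assumes "lmodule R M" "lmodule R N"
  shows "(\<lambda>p\<in>carrier (dirsum M N). fst p) \<in> Hom R (dirsum M N) M"
    and "(\<lambda>p\<in>carrier (dirsum M N). snd p) \<in> Hom R (dirsum M N) N"
    and "(\<lambda>x\<in>carrier M. (x, \<zero>\<^bsub>N\<^esub>)) \<in> Hom R M (dirsum M N)"
    and "(\<lambda>y\<in>carrier N. (\<zero>\<^bsub>M\<^esub>, y)) \<in> Hom R N (dirsum M N)"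
proof -
  interpret M: lmodule R M by fact
  interpret N: lmodule R N by fact
  show "(\<lambda>p\<in>carrier (dirsum M N). fst p) \<in> Hom R (dirsum M N) M"
    "(\<lambda>p\<in>carrier (dirsum M N). snd p) \<in> Hom R (dirsum M N) N"
    by (rule HomI[OF lmodule_dirsum[OF assms]]; auto)+
  show "(\<lambda>x\<in>carrier M. (x, \<zero>\<^bsub>N\<^esub>)) \<in> Hom R M (dirsum M N)"
    "(\<lambda>y\<in>carrier N. (\<zero>\<^bsub>M\<^esub>, y)) \<in> Hom R N (dirsum M N)"
    using assms by (intro HomI; auto simp: M.smult_zero_right N.smult_zero_right)+
qed

lemma Hom_pair:
  assumes "lmodule R L" "f \<in> Hom R L M" "g \<in> Hom R L N"
  shows "(\<lambda>x\<in>carrier L. (f x, g x)) \<in> Hom R L (dirsum M N)"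
  using assms by (intro HomI) (auto simp: HomE)

lemma Hom_copair:
  assumes "lmodule R M" "lmodule R N" "lmodule R L" "f \<in> Hom R M L" "g \<in> Hom R N L"
  shows "(\<lambda>p\<in>carrier (dirsum M N). f (fst p) \<oplus>\<^bsub>L\<^esub> g (snd p)) \<in> Hom R (dirsum M N) L"
proof -
  interpret L: lmodule R L by fact
  show ?thesis
    using assms by (intro HomI lmodule_dirsum) (auto simp: HomE L.smult_r_distr L.M.a_ac)
qed

subsection \<open>Short exact sequences\<close>

lemma short_exactD:
  assumes "short_exact R L f M g N"
  shows "f \<in> Hom R L M" "g \<in> Hom R M N" "inj_on f (carrier L)"
    "x \<in> carrier L \<Longrightarrow> g (f x) = \<zero>\<^bsub>N\<^esub>"
    "\<lbrakk>y \<in> carrier M; g y = \<zero>\<^bsub>N\<^esub>\<rbrakk> \<Longrightarrow> \<exists>x\<in>carrier L. y = f x"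
    "z \<in> carrier N \<Longrightarrow> \<exists>y\<in>carrier M. z = g y"
proof -
  note * = assms[unfolded short_exact_def]
  show "f \<in> Hom R L M" "g \<in> Hom R M N" "inj_on f (carrier L)" using * by auto
  show "g (f x) = \<zero>\<^bsub>N\<^esub>" if "x \<in> carrier L" using * that a_kernel_iff by (metis image_eqI)
  show "\<exists>x\<in>carrier L. y = f x" if "y \<in> carrier M" "g y = \<zero>\<^bsub>N\<^esub>"
    using * that a_kernel_iff[of y M N g] by (metis (no_types, lifting) imageE)
  show "\<exists>y\<in>carrier M. z = g y" if "z \<in> carrier N" using * that by (metis imageE)
qed

lemma image_eq_kernelI:
  assumes "f \<in> Hom R L M" "\<And>x. x \<in> carrier L \<Longrightarrow> g (f x) = \<zero>\<^bsub>N\<^esub>"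
    "\<And>y. \<lbrakk>y \<in> carrier M; g y = \<zero>\<^bsub>N\<^esub>\<rbrakk> \<Longrightarrow> \<exists>x\<in>carrier L. y = f x"
  shows "f ` carrier L = a_kernel M N g"
proof (intro equalityI subsetI)
  fix y assume "y \<in> a_kernel M N g"
  then have "y \<in> carrier M" "g y = \<zero>\<^bsub>N\<^esub>" by (simp_all add: a_kernel_iff)
  then show "y \<in> f ` carrier L" using assms(3) by blast
qed (use assms(2) HomE(2)[OF assms(1)] in \<open>auto simp: a_kernel_iff\<close>)

lemma short_exactI:
  assumes "f \<in> Hom R L M" "g \<in> Hom R M N" "inj_on f (carrier L)"
    "\<And>x. x \<in> carrier L \<Longrightarrow> g (f x) = \<zero>\<^bsub>N\<^esub>"
    "\<And>y. \<lbrakk>y \<in> carrier M; g y = \<zero>\<^bsub>N\<^esub>\<rbrakk> \<Longrightarrow> \<exists>x\<in>carrier L. y = f x"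
    "\<And>z. z \<in> carrier N \<Longrightarrow> \<exists>y\<in>carrier M. z = g y"
  shows "short_exact R L f M g N"
proof -
  have "f ` carrier L = a_kernel M N g"
    by (rule image_eq_kernelI) (rule assms; assumption)+
  moreover have "g ` carrier M = carrier N"
    using assms(2,6) by (auto simp: HomE) 
  ultimately show ?thesis
    using assms(1-3) by (simp add: short_exact_def)
qed

lemma short_exact_isos_left:
  assumes "lmodule R L'" "short_exact R L f M g N" "isos R L' L h k"
  shows "short_exact R L' (compose (carrier L') f h) M g N"
proof (rule short_exactI)
  note e = short_exactD[OF assms(2)] and i = isosD[OF assms(3)]
  show "compose (carrier L') f h \<in> Hom R L' M" using Hom_compose assms(1) e i by blast
  show "g \<in> Hom R M N" by fact
  show "inj_on (compose (carrier L') f h) (carrier L')"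
  proof (rule inj_onI)
    fix x y assume xy: "x \<in> carrier L'" "y \<in> carrier L'"
      "compose (carrier L') f h x = compose (carrier L') f h y"
    then have "h x = h y"
      using e(3) i(1) by (auto simp: compose_eq HomE dest: inj_onD)
    then show "x = y"
      using xy i(3) by metis
  qed
  show "\<And>x. x \<in> carrier L' \<Longrightarrow> g (compose (carrier L') f h x) = \<zero>\<^bsub>N\<^esub>"
    using e(4) i(1) by (simp add: compose_eq HomE)
  show "\<And>y. \<lbrakk>y \<in> carrier M; g y = \<zero>\<^bsub>N\<^esub>\<rbrakk> \<Longrightarrow> \<exists>x\<in>carrier L'. y = compose (carrier L') f h x"
    using e(5) i by (metis HomE(2) compose_eq)
  show "\<And>z. z \<in> carrier N \<Longrightarrow> \<exists>y\<in>carrier M. z = g y" by fact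
qed

lemma short_exact_isos_right:
  assumes "lmodule R M" "lmodule R N" "lmodule R N'" "short_exact R L f M g N" "isos R N N' h k"
  shows "short_exact R L f M (compose (carrier M) h g) N'"
proof (rule short_exactI)
  note e = short_exactD[OF assms(4)] and i = isosD[OF assms(5)]
  show "compose (carrier M) h g \<in> Hom R M N'" using Hom_compose assms(1) e i by blast
  show "f \<in> Hom R L M" "inj_on f (carrier L)" by fact+
  show "\<And>x. x \<in> carrier L \<Longrightarrow> compose (carrier M) h g (f x) = \<zero>\<^bsub>N'\<^esub>"
    using e(1,4) isos_zero[OF assms(2,3,5)] by (simp add: compose_eq HomE)
  show "\<And>y. \<lbrakk>y \<in> carrier M; compose (carrier M) h g y = \<zero>\<^bsub>N'\<^esub>\<rbrakk> \<Longrightarrow> \<exists>x\<in>carrier L. y = f x"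
    using e(2,5) isos_eq_zero_iff[OF assms(2,3,5)] by (metis HomE(2) compose_eq)
  show "\<And>z. z \<in> carrier N' \<Longrightarrow> \<exists>y\<in>carrier M. z = compose (carrier M) h g y"
    using e(6) i by (metis HomE(2) compose_eq)
qed

lemma short_exact_isos_middle:
  assumes "lmodule R L" "lmodule R M'" "short_exact R L f M g N" "isos R M' M h k"
  shows "short_exact R L (compose (carrier L) k f) M' (compose (carrier M') g h) N"
proof (rule short_exactI)
  note e = short_exactD[OF assms(3)] and i = isosD[OF assms(4)]
  show "compose (carrier L) k f \<in> Hom R L M'" "compose (carrier M') g h \<in> Hom R M' N"
    using Hom_compose assms(1,2) e i by blast+
  show "inj_on (compose (carrier L) k f) (carrier L)"
    using isos_imp_bij[OF isos_sym[OF assms(4)]] e(1,3) by (auto simp: bij_betw_def inj_on_def compose_eq HomE)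
  show "\<And>x. x \<in> carrier L \<Longrightarrow> compose (carrier M') g h (compose (carrier L) k f x) = \<zero>\<^bsub>N\<^esub>"
    using e(1,4) i by (simp add: compose_eq HomE)
  show "\<And>y. \<lbrakk>y \<in> carrier M'; compose (carrier M') g h y = \<zero>\<^bsub>N\<^esub>\<rbrakk>
      \<Longrightarrow> \<exists>x\<in>carrier L. y = compose (carrier L) k f x"
    using e(5) i by (metis HomE(2) compose_eq)
  show "\<And>z. z \<in> carrier N \<Longrightarrow> \<exists>y\<in>carrier M'. z = compose (carrier M') g h y"
    using e(6) i by (metis HomE(2) compose_eq)
qed

lemma short_exact_kernel:
  assumes "lmodule R M" "lmodule R N" "g \<in> Hom R M N" "g ` carrier M = carrier N"
  shows "short_exact R (M\<lparr>carrier := a_kernel M N g\<rparr>) (\<lambda>x\<in>a_kernel M N g. x) M g N"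
  using Hom_submod_inclusion[OF assms(1) submod_kernel[OF assms(1-3)]] assms(3,4)
  by (auto simp: short_exact_def inj_on_def)

text \<open>Injectivity of f makes preimages unique, and uniqueness makes their pointwise choice
  linear.\<close>

lemma factor_through_kernel:
  assumes "lmodule R X" "lmodule R L" "lmodule R M" "f \<in> Hom R L M" "inj_on f (carrier L)" "h \<in> Hom R X M"
    "h ` carrier X \<subseteq> f ` carrier L"
  obtains h' where "h' \<in> Hom R X L" "\<And>x. x \<in> carrier X \<Longrightarrow> f (h' x) = h x"
proof -
  interpret L: lmodule R L by fact
  interpret X: lmodule R X by fact
  let ?h = "\<lambda>x. inv_into (carrier L) f (h x)"
  have c: "?h x \<in> carrier L" "f (?h x) = h x" if "x \<in> carrier X" for x
    using assms(7) that by (auto simp: f_inv_into_f inv_into_into image_subset_iff)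
  have u: "y = ?h x" if "x \<in> carrier X" "y \<in> carrier L" "f y = h x" for x y
    using that c assms(5) by (metis inj_onD)
  have "restrict ?h (carrier X) \<in> Hom R X L"
  proof (rule HomI[OF assms(1)])
    fix x y assume "x \<in> carrier X" "y \<in> carrier X"
    then show "?h (x \<oplus>\<^bsub>X\<^esub> y) = ?h x \<oplus>\<^bsub>L\<^esub> ?h y"
      using c assms(4,6) by (intro u[symmetric]) (auto simp: HomE)
  next
    fix r x assume "r \<in> carrier R" "x \<in> carrier X"
    then show "?h (r \<odot>\<^bsub>X\<^esub> x) = r \<odot>\<^bsub>L\<^esub> ?h x"
      using c assms(4,6) by (intro u[symmetric]) (auto simp: HomE X.smult_closed L.smult_closed)
  qed (use c in auto)
  then show thesis
    using that c by (metis (no_types, lifting) restrict_apply)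
qed

text \<open>As h vanishes on the kernel of g, the value h x depends only on g x; so any choice of
  preimages gives the same, linear map.\<close>

lemma factor_through_cokernel:
  assumes "lmodule R M" "lmodule R N" "lmodule R X" "g \<in> Hom R M N" "g ` carrier M = carrier N" "h \<in> Hom R M X"
    "\<And>x. x \<in> carrier M \<Longrightarrow> g x = \<zero>\<^bsub>N\<^esub> \<Longrightarrow> h x = \<zero>\<^bsub>X\<^esub>"
  obtains h' where "h' \<in> Hom R N X" "\<And>x. x \<in> carrier M \<Longrightarrow> h' (g x) = h x"
proof -
  interpret M: lmodule R M by fact
  interpret N: lmodule R N by fact
  interpret X: lmodule R X by fact
  let ?h = "\<lambda>y. h (inv_into (carrier M) g y)"
  have e: "h x = h y" if "x \<in> carrier M" "y \<in> carrier M" "g x = g y" for x y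
  proof -
    have "g (x \<ominus>\<^bsub>M\<^esub> y) = \<zero>\<^bsub>N\<^esub>"
      using that assms by (simp add: Hom_minus HomE(2) N.M.minus_self)
    then have "h (x \<ominus>\<^bsub>M\<^esub> y) = \<zero>\<^bsub>X\<^esub>"
      using that assms(7) by simp
    then show ?thesis
      using that assms(1,3,6) by (simp add: Hom_minus HomE(2) X.M.minus_eq_zero_iff)
  qed
  have u: "?h (g x) = h x" if "x \<in> carrier M" for x
    using that e by (metis f_inv_into_f image_eqI inv_into_into)
  have "restrict ?h (carrier N) \<in> Hom R N X"
  proof (rule HomI[OF assms(2)])
    fix x assume "x \<in> carrier N"
    then show "?h x \<in> carrier X" using assms(5,6) by (metis HomE(2) inv_into_into)
  next
    fix x y assume "x \<in> carrier N" "y \<in> carrier N"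
    then obtain x' y' where "x = g x'" "y = g y'" "x' \<in> carrier M" "y' \<in> carrier M"
      using assms(5) by blast
    then show "?h (x \<oplus>\<^bsub>N\<^esub> y) = ?h x \<oplus>\<^bsub>X\<^esub> ?h y"
      using u[of "x' \<oplus>\<^bsub>M\<^esub> y'"] u assms(4,6) by (simp add: HomE)
  next
    fix r x assume r: "r \<in> carrier R" "x \<in> carrier N"
    then obtain x' where "x = g x'" "x' \<in> carrier M"
      using assms(5) by blast
    then show "?h (r \<odot>\<^bsub>N\<^esub> x) = r \<odot>\<^bsub>X\<^esub> ?h x"
      using r u[of "r \<odot>\<^bsub>M\<^esub> x'"] u assms(4,6) by (simp add: HomE M.smult_closed)
  qed
  moreover have "restrict ?h (carrier N) (g x) = h x" if "x \<in> carrier M" for x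
    using that u assms(4) by (simp add: HomE)
  ultimately show thesis
    using that by blast
qed

section \<open>Small sets\<close>

text \<open>Comparability of cardinals lets a single member of the universe dominate two small sets,
  see \<open>small_pair\<close>.\<close>

lemma lepoll_linear: "A \<lesssim> B \<or> B \<lesssim> A"
  unfolding lepoll_def by (simp add: card_of_ordLeq ordLeq_total[OF card_of_Well_order card_of_Well_order])

text \<open>Smallness for sets of any type: the universe contains subsets of one type only, and
  carriers of tensor products or Hom modules are measured against these by injections.\<close>

definition small :: "'m set set \<Rightarrow> 'a set \<Rightarrow> bool"
  where "small \<U> S \<longleftrightarrow> (\<exists>Y\<in>\<U>. S \<lesssim> Y)"

lemma small_lepoll: "small \<U> S \<Longrightarrow> T \<lesssim> S \<Longrightarrow> small \<U> T"
  unfolding small_def by (meson lepoll_trans)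

lemma small_subset: "small \<U> S \<Longrightarrow> T \<subseteq> S \<Longrightarrow> small \<U> T"
  using small_lepoll subset_imp_lepoll by blast

lemma small_image: "small \<U> S \<Longrightarrow> small \<U> (f ` S)"
  using small_lepoll image_lepoll by blast

locale small_universe =
  fixes \<U> :: "'m set set"
  assumes universe: "universe \<U>"
    and powers_nat: "closed_under_powers \<U> (UNIV :: nat set)"
begin

lemma small_imp_mem: "small \<U> S \<Longrightarrow> S \<in> \<U>"
  using universe unfolding small_def universe_def by blast

lemma mem_imp_small: "S \<in> \<U> \<Longrightarrow> small \<U> S"
  unfolding small_def by blast

lemma small_exponent:
  assumes "closed_under_powers \<U> I" "small \<U> S"
  shows "small \<U> (I \<rightarrow>\<^sub>E S)"
proof -
  obtain Y j where Y: "Y \<in> \<U>" "inj_on j S" "j ` S \<subseteq> Y"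
    using assms(2) by (auto simp: small_def lepoll_def)
  have "inj_on (\<lambda>f. \<lambda>i\<in>I. j (f i)) (I \<rightarrow>\<^sub>E S)"
  proof (rule inj_onI)
    fix f g assume fg: "f \<in> I \<rightarrow>\<^sub>E S" "g \<in> I \<rightarrow>\<^sub>E S" "(\<lambda>i\<in>I. j (f i)) = (\<lambda>i\<in>I. j (g i))"
    have "f i = g i" if "i \<in> I" for i
      using fun_cong[OF fg(3), of i] that fg(1,2) Y(2) by (auto simp: PiE_iff dest: inj_onD)
    then show "f = g" using fg(1,2) by (blast intro: PiE_ext)
  qed
  then have "(I \<rightarrow>\<^sub>E S) \<lesssim> (I \<rightarrow>\<^sub>E Y)"
    unfolding lepoll_def using Y by (intro exI[of _ "\<lambda>f. \<lambda>i\<in>I. j (f i)"]) (auto simp: PiE_iff)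
  moreover have "small \<U> (I \<rightarrow>\<^sub>E Y)"
    using assms(1) Y(1) unfolding closed_under_powers_def small_def by blast
  ultimately show ?thesis using small_lepoll by blast
qed

text \<open>I embeds into its own power of X by indicator functions, with two distinct elements of X
  as values.\<close>

lemma small_index:
  assumes "closed_under_powers \<U> I"
  shows "small \<U> I"
proof -
  obtain X x y where X: "X \<in> \<U>" "x \<in> X" "y \<in> X" "x \<noteq> y"
    using universe unfolding universe_def by blast
  have "inj_on (\<lambda>i. \<lambda>k\<in>I. if k = i then x else y) I"
  proof (rule inj_onI)
    fix i i' assume i: "i \<in> I" "(\<lambda>k\<in>I. if k = i then x else y) = (\<lambda>k\<in>I. if k = i' then x else y)"
    show "i = i'"
      using fun_cong[OF i(2), of i] i(1) X(4) by (simp split: if_splits)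
  qed
  then have "I \<lesssim> (I \<rightarrow>\<^sub>E X)"
    unfolding lepoll_def using X by (intro exI[of _ "\<lambda>i. \<lambda>k\<in>I. if k = i then x else y"]) auto
  then show ?thesis
    using small_exponent[OF assms mem_imp_small[OF X(1)]] small_lepoll by blast
qed

lemma small_pair:
  assumes "small \<U> S" "small \<U> T"
  obtains Y where "Y \<in> \<U>" "S \<lesssim> Y" "T \<lesssim> Y"
  using assms lepoll_linear lepoll_trans unfolding small_def by metis

lemma small_Times:
  assumes "small \<U> S" "small \<U> T"
  shows "small \<U> (S \<times> T)"
proof -
  obtain Y where Y: "Y \<in> \<U>" "S \<lesssim> Y" "T \<lesssim> Y"
    using small_pair assms by metis
  \<comment> \<open>A pair becomes the sequence a, b, b, ..., from whose first two entries it is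
    recovered.\<close>
  have "inj_on (\<lambda>(a, b) (n::nat). if n = 0 then a else b) (Y \<times> Y)"
    by (rule inj_onI) (auto simp: fun_eq_iff split: if_splits)
  then have "(Y \<times> Y) \<lesssim> ((UNIV::nat set) \<rightarrow>\<^sub>E Y)"
    unfolding lepoll_def by (intro exI[of _ "\<lambda>(a, b) (n::nat). if n = 0 then a else b"]) auto
  then have "small \<U> (Y \<times> Y)"
    using small_exponent[OF powers_nat mem_imp_small[OF Y(1)]] small_lepoll by blast
  then show ?thesis
    using Y(2,3) times_lepoll_mono small_lepoll by blast
qed

lemma small_lists:
  assumes "small \<U> S"
  shows "small \<U> (lists S)"
proof -
  obtain X x where X: "X \<in> \<U>" "x \<in> X"
    using universe unfolding universe_def by blast
  obtain Y j k where Y: "Y \<in> \<U>" "inj_on j S" "j ` S \<subseteq> Y" "k ` X \<subseteq> Y"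
    using small_pair[OF assms mem_imp_small[OF X(1)]] unfolding lepoll_def by metis
  \<comment> \<open>A list is encoded as a sequence padded to infinite length, together with its
    length. The padding value k x comes from a nonempty member of the universe, since S may be
    empty.\<close>
  let ?f = "\<lambda>xs. (\<lambda>i::nat. if i < length xs then j (xs ! i) else k x, length xs)"
  have "inj_on ?f (lists S)"
  proof (rule inj_onI)
    fix xs ys assume *: "xs \<in> lists S" "ys \<in> lists S" "?f xs = ?f ys"
    then have l: "length xs = length ys"
      and e: "(\<lambda>i::nat. if i < length xs then j (xs ! i) else k x)
        = (\<lambda>i::nat. if i < length ys then j (ys ! i) else k x)"
      by (metis (no_types, lifting) Pair_inject)+
    have "xs ! i = ys ! i" if "i < length xs" for i
    proof -
      have "xs ! i \<in> S" "ys ! i \<in> S" using * that l by (auto simp: in_lists_conv_set)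
      moreover have "j (xs ! i) = j (ys ! i)" using fun_cong[OF e, of i] that l by simp
      ultimately show ?thesis using Y(2) by (simp add: inj_on_eq_iff)
    qed
    then show "xs = ys" using l by (simp add: nth_equalityI)
  qed
  moreover have "?f ` lists S \<subseteq> ((UNIV::nat set) \<rightarrow>\<^sub>E Y) \<times> UNIV"
    using Y X(2) by (auto simp: in_lists_conv_set image_subset_iff)
  ultimately have "lists S \<lesssim> ((UNIV::nat set) \<rightarrow>\<^sub>E Y) \<times> (UNIV::nat set)"
    unfolding lepoll_def by blast
  moreover have "small \<U> (((UNIV::nat set) \<rightarrow>\<^sub>E Y) \<times> (UNIV::nat set))"
    by (intro small_Times small_exponent small_index powers_nat mem_imp_small Y)
  ultimately show ?thesis using small_lepoll by blast
qed

lemma RMod_small: "M \<in> RMod R \<U> \<longleftrightarrow> lmodule R M \<and> small \<U> (carrier M)"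
  using small_imp_mem mem_imp_small unfolding RMod_def by blast

text \<open>The gate into \<open>RMod\<close> for constructions on other types: smallness of the
  carrier provides the injection for \<open>transport\<close>.\<close>

lemma RMod_transport:
  fixes N :: "('r, 'n, 'y) module_scheme"
  assumes "lmodule R N" "small \<U> (carrier N)"
  obtains M f g where "M \<in> RMod R \<U>" "isos R M N f g"
proof -
  obtain t where t: "inj_on t (carrier N)" "t ` carrier N \<in> \<U>"
    using assms(2) small_imp_mem[OF small_image[OF assms(2)]] by (auto simp: small_def lepoll_def)
  have "carrier (transport t N) = t ` carrier N" by (simp add: transport_def Let_def)
  then have "transport t N \<in> RMod R \<U>" using t transport_isos(1)[OF assms(1) t(1)] by (simp add: RMod_def)
  then show thesis using that transport_isos(2)[OF assms(1) t(1)] by blast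
qed

lemma RMod_submod:
  assumes "M \<in> RMod R \<U>" "submod R M S"
  shows "M\<lparr>carrier := S\<rparr> \<in> RMod R \<U>"
  using assms lmodule_submod[of R M S] small_subset[of \<U> "carrier M" S]
  by (auto simp: RMod_small submod_def)

lemma RMod_dirsum:
  assumes "M \<in> RMod R \<U>" "N \<in> RMod R \<U>"
  obtains W f g where "W \<in> RMod R \<U>" "isos R W (dirsum M N) f g"
proof -
  have "lmodule R (dirsum M N)" "small \<U> (carrier (dirsum M N))"
    using assms by (auto simp: RMod_small lmodule_dirsum small_Times)
  then show thesis using RMod_transport that by metis
qed

end

section \<open>Free modules and projective resolutions\<close>

definition free_module :: "('r, 'x) ring_scheme \<Rightarrow> 'i set \<Rightarrow> ('r, 'i \<Rightarrow> 'r) module"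
  where "free_module R X =
    \<lparr>carrier = {f \<in> X \<rightarrow>\<^sub>E carrier R. finite {x \<in> X. f x \<noteq> \<zero>\<^bsub>R\<^esub>}}, mult = undefined, one = undefined,
     ring.zero = (\<lambda>x\<in>X. \<zero>\<^bsub>R\<^esub>), add = (\<lambda>f g. \<lambda>x\<in>X. f x \<oplus>\<^bsub>R\<^esub> g x),
     smult = (\<lambda>r f. \<lambda>x\<in>X. r \<otimes>\<^bsub>R\<^esub> f x)\<rparr>"

definition free_basis :: "('r, 'x) ring_scheme \<Rightarrow> 'i set \<Rightarrow> 'i \<Rightarrow> 'i \<Rightarrow> 'r"
  where "free_basis R X x = (\<lambda>y\<in>X. if y = x then \<one>\<^bsub>R\<^esub> else \<zero>\<^bsub>R\<^esub>)"

definition free_lift :: "('r, 'x) ring_scheme \<Rightarrow> 'i set \<Rightarrow> ('r, 'm, 'y) module_scheme \<Rightarrow> ('i \<Rightarrow> 'm) \<Rightarrow> ('i \<Rightarrow> 'r) \<Rightarrow> 'm"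
  where "free_lift R X M \<phi> =
    (\<lambda>f\<in>carrier (free_module R X). finsum M (\<lambda>x. f x \<odot>\<^bsub>M\<^esub> \<phi> x) {x \<in> X. f x \<noteq> \<zero>\<^bsub>R\<^esub>})"

context ring
begin

lemma lmodule_free: "lmodule R (free_module R X)"
proof (rule lmoduleI)
  let ?F = "free_module R X"
  show "ring R" by (rule ring_axioms)
  fix f assume f: "f \<in> carrier ?F"
  show "\<exists>g\<in>carrier ?F. g \<oplus>\<^bsub>?F\<^esub> f = \<zero>\<^bsub>?F\<^esub>"
    using f by (intro bexI[of _ "\<lambda>x\<in>X. \<ominus> f x"])
      (auto simp: free_module_def PiE_iff l_neg extensional_def fun_eq_iff elim!: finite_subset[rotated])
  show "\<zero>\<^bsub>?F\<^esub> \<oplus>\<^bsub>?F\<^esub> f = f"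
    "\<one> \<odot>\<^bsub>?F\<^esub> f = f"
    using f by (auto simp: free_module_def PiE_iff extensional_def fun_eq_iff)
next
  let ?F = "free_module R X"
  fix f g assume "f \<in> carrier ?F" "g \<in> carrier ?F"
  then show "f \<oplus>\<^bsub>?F\<^esub> g \<in> carrier ?F" "f \<oplus>\<^bsub>?F\<^esub> g = g \<oplus>\<^bsub>?F\<^esub> f"
    by (auto simp: free_module_def PiE_iff a_comm extensional_def fun_eq_iff
      intro: finite_subset[of _ "{x \<in> X. f x \<noteq> \<zero>} \<union> {x \<in> X. g x \<noteq> \<zero>}"])
next
  let ?F = "free_module R X"
  fix f r assume "f \<in> carrier ?F" "r \<in> carrier R"
  then show "r \<odot>\<^bsub>?F\<^esub> f \<in> carrier ?F"
    by (auto simp: free_module_def PiE_iff extensional_def fun_eq_iff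
      intro: finite_subset[of _ "{x \<in> X. f x \<noteq> \<zero>}"])
qed (auto simp: free_module_def PiE_iff extensional_def fun_eq_iff a_assoc m_assoc l_distr r_distr)

lemma free_basis_closed: "x \<in> X \<Longrightarrow> free_basis R X x \<in> carrier (free_module R X)"
  by (auto simp: free_module_def free_basis_def intro: finite_subset[of _ "{x}"])

text \<open>Induction on the size of the support: setting one coordinate to zero splits off a
  multiple of a basis vector.\<close>

lemma free_module_induct:
  assumes f: "f \<in> carrier (free_module R X)" and "P \<zero>\<^bsub>free_module R X\<^esub>"
    and "\<And>g h. \<lbrakk>g \<in> carrier (free_module R X); h \<in> carrier (free_module R X); P g; P h\<rbrakk> \<Longrightarrow>
      P (g \<oplus>\<^bsub>free_module R X\<^esub> h)"
    and "\<And>r x. \<lbrakk>r \<in> carrier R; x \<in> X\<rbrakk> \<Longrightarrow> P (r \<odot>\<^bsub>free_module R X\<^esub> free_basis R X x)"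
  shows "P f"
proof -
  let ?F = "free_module R X"
  interpret F: lmodule R ?F by (rule lmodule_free)
  have "\<forall>f\<in>carrier ?F. card {x \<in> X. f x \<noteq> \<zero>} = n \<longrightarrow> P f" for n
  proof (induction n)
    case 0
    have "f = \<zero>\<^bsub>?F\<^esub>" if "f \<in> carrier ?F" "card {x \<in> X. f x \<noteq> \<zero>} = 0" for f
      using that by (auto simp: free_module_def PiE_iff extensional_def fun_eq_iff)
    then show ?case using assms(2) by blast
  next
    case (Suc n)
    show ?case
    proof (intro ballI impI)
      fix f assume f: "f \<in> carrier ?F" "card {x \<in> X. f x \<noteq> \<zero>} = Suc n"
      then have "{x \<in> X. f x \<noteq> \<zero>} \<noteq> {}" by (metis card.empty nat.distinct(1))
      then obtain x where x: "x \<in> X" "f x \<noteq> \<zero>" by blast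
      let ?g = "\<lambda>y\<in>X. if y = x then \<zero> else f y"
      have s: "{y \<in> X. ?g y \<noteq> \<zero>} = {y \<in> X. f y \<noteq> \<zero>} - {x}" by auto
      have g: "?g \<in> carrier ?F"
        using f(1) unfolding free_module_def partial_object.simps mem_Collect_eq s by auto
      have "card {y \<in> X. ?g y \<noteq> \<zero>} = n"
        unfolding s using f x by (simp add: free_module_def)
      then have Pg: "P ?g" using Suc g by blast
      have fx: "f x \<in> carrier R" using f(1) x(1) by (auto simp: free_module_def)
      have eq: "f = ?g \<oplus>\<^bsub>?F\<^esub> f x \<odot>\<^bsub>?F\<^esub> free_basis R X x"
        using f(1) x(1) by (auto simp: free_module_def free_basis_def PiE_iff extensional_def fun_eq_iff)
      show "P f"
        by (subst eq, rule assms(3)[OF g F.smult_closed[OF fx free_basis_closed[OF x(1)]] Pg assms(4)[OF fx x(1)]])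
    qed
  qed
  then show ?thesis using f by blast
qed

lemma free_lift_Hom:
  assumes "lmodule R M" "\<And>x. x \<in> X \<Longrightarrow> \<phi> x \<in> carrier M"
  shows "free_lift R X M \<phi> \<in> Hom R (free_module R X) M"
    and "x \<in> X \<Longrightarrow> free_lift R X M \<phi> (free_basis R X x) = \<phi> x"
proof -
  interpret M: lmodule R M by fact
  let ?F = "free_module R X"
  interpret F: lmodule R ?F by (rule lmodule_free)
  have val: "f x \<in> carrier R" if "f \<in> carrier ?F" "x \<in> X" for f x
    using that by (auto simp: free_module_def)
  have fin: "finite {x \<in> X. f x \<noteq> \<zero>}" if "f \<in> carrier ?F" for f
    using that by (auto simp: free_module_def)
  \<comment> \<open>The sum may run over any finite set that contains the support, so f, g and their
    sum can be compared over one index set.\<close>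
  have on: "free_lift R X M \<phi> f = finsum M (\<lambda>x. f x \<odot>\<^bsub>M\<^esub> \<phi> x) B"
    if "f \<in> carrier ?F" "finite B" "{x \<in> X. f x \<noteq> \<zero>} \<subseteq> B" "B \<subseteq> X" for f B
  proof -
    have "finsum M (\<lambda>x. f x \<odot>\<^bsub>M\<^esub> \<phi> x) {x \<in> X. f x \<noteq> \<zero>} = finsum M (\<lambda>x. f x \<odot>\<^bsub>M\<^esub> \<phi> x) B"
      using that assms(2) val by (intro M.M.add.finprod_mono_neutral_cong_left)
        (auto simp: M.smult_zero_left M.smult_closed subset_eq)
    then show ?thesis using that(1) by (simp add: free_lift_def)
  qed
  have "restrict (free_lift R X M \<phi>) (carrier ?F) \<in> Hom R ?F M"
  proof (rule HomI[OF lmodule_free])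
    fix f assume f: "f \<in> carrier ?F"
    then show "free_lift R X M \<phi> f \<in> carrier M"
      using val assms(2) by (auto simp: free_lift_def M.smult_closed intro!: M.M.finsum_closed)
    fix r assume r: "r \<in> carrier R"
    let ?B = "{x \<in> X. f x \<noteq> \<zero>}"
    have *: "finsum M (\<lambda>x. (r \<otimes> f x) \<odot>\<^bsub>M\<^esub> \<phi> x) B = r \<odot>\<^bsub>M\<^esub> finsum M (\<lambda>x. f x \<odot>\<^bsub>M\<^esub> \<phi> x) B"
      if "finite B" "B \<subseteq> X" for B
      using that
    proof (induction B rule: finite_induct)
      case empty then show ?case using r by (simp add: M.smult_zero_right)
    next
      case (insert x B)
      then show ?case using r f val assms(2)
        by (subst M.M.finsum_insert; (subst M.M.finsum_insert)?)
          (auto simp: M.smult_closed M.smult_assoc1 M.smult_r_distr subset_eq M.M.finsum_closed)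
    qed
    have "free_lift R X M \<phi> (r \<odot>\<^bsub>?F\<^esub> f) = finsum M (\<lambda>x. (r \<odot>\<^bsub>?F\<^esub> f) x \<odot>\<^bsub>M\<^esub> \<phi> x) ?B"
      using f r by (intro on F.smult_closed fin) (auto simp: free_module_def)
    also have "\<dots> = finsum M (\<lambda>x. (r \<otimes> f x) \<odot>\<^bsub>M\<^esub> \<phi> x) ?B"
      using f r val assms(2) by (intro M.M.finsum_cong') (auto simp: free_module_def M.smult_closed)
    also have "\<dots> = r \<odot>\<^bsub>M\<^esub> free_lift R X M \<phi> f"
      using *[OF fin[OF f]] f by (simp add: free_lift_def)
    finally show "free_lift R X M \<phi> (r \<odot>\<^bsub>?F\<^esub> f) = r \<odot>\<^bsub>M\<^esub> free_lift R X M \<phi> f" .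
  next
    fix f g assume fg: "f \<in> carrier ?F" "g \<in> carrier ?F"
    let ?B = "{x \<in> X. f x \<noteq> \<zero>} \<union> {x \<in> X. g x \<noteq> \<zero>}"
    have B: "finite ?B" "?B \<subseteq> X" using fg fin by auto
    have "free_lift R X M \<phi> (f \<oplus>\<^bsub>?F\<^esub> g) = finsum M (\<lambda>x. (f \<oplus>\<^bsub>?F\<^esub> g) x \<odot>\<^bsub>M\<^esub> \<phi> x) ?B"
      using fg by (intro on F.M.a_closed B) (auto simp: free_module_def)
    also have "\<dots> = finsum M (\<lambda>x. f x \<odot>\<^bsub>M\<^esub> \<phi> x \<oplus>\<^bsub>M\<^esub> g x \<odot>\<^bsub>M\<^esub> \<phi> x) ?B"
      using fg val assms(2)
      by (intro M.M.finsum_cong') (auto simp: free_module_def M.smult_closed M.smult_l_distr)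
    also have "\<dots> = finsum M (\<lambda>x. f x \<odot>\<^bsub>M\<^esub> \<phi> x) ?B \<oplus>\<^bsub>M\<^esub> finsum M (\<lambda>x. g x \<odot>\<^bsub>M\<^esub> \<phi> x) ?B"
      using fg val assms(2) by (intro M.M.finsum_addf) (auto simp: M.smult_closed)
    also have "\<dots> = free_lift R X M \<phi> f \<oplus>\<^bsub>M\<^esub> free_lift R X M \<phi> g"
      using on[OF fg(1) B(1) _ B(2)] on[OF fg(2) B(1) _ B(2)] by simp
    finally show "free_lift R X M \<phi> (f \<oplus>\<^bsub>?F\<^esub> g) = free_lift R X M \<phi> f \<oplus>\<^bsub>M\<^esub> free_lift R X M \<phi> g" .
  qed
  then show "free_lift R X M \<phi> \<in> Hom R ?F M" by (simp add: free_lift_def)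
  assume x: "x \<in> X"
  have "free_lift R X M \<phi> (free_basis R X x) = finsum M (\<lambda>y. free_basis R X x y \<odot>\<^bsub>M\<^esub> \<phi> y) {x}"
    using x by (intro on free_basis_closed) (auto simp: free_basis_def)
  also have "\<dots> = \<phi> x"
    using x assms(2) by (simp add: M.M.finsum_insert free_basis_def M.smult_one)
  finally show "free_lift R X M \<phi> (free_basis R X x) = \<phi> x" .
qed

lemma free_module_Hom_eq:
  assumes "lmodule R M" "f \<in> Hom R (free_module R X) M" "g \<in> Hom R (free_module R X) M"
    and "\<And>x. x \<in> X \<Longrightarrow> f (free_basis R X x) = g (free_basis R X x)" "y \<in> carrier (free_module R X)"
  shows "f y = g y"
  using assms(5)
proof (rule free_module_induct[where P = "\<lambda>y. f y = g y"])
  show "f \<zero>\<^bsub>free_module R X\<^esub> = g \<zero>\<^bsub>free_module R X\<^esub>"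
    using assms(1-3) Hom_zero[OF lmodule_free] by metis
qed (use assms(2-4) in \<open>simp_all add: HomE free_basis_closed\<close>)

end

context small_universe
begin

lemma small_free_module:
  assumes "small \<U> X" "small \<U> (carrier R)"
  shows "small \<U> (carrier (free_module R X))"
proof -
  \<comment> \<open>A list of pairs decodes to a function that is zero at the points it does not
    mention. A list of the graph of f over its finite support decodes to f, so lists reach every
    element of the free module.\<close>
  let ?f = "\<lambda>xs. \<lambda>x\<in>X. if \<exists>r. (x, r) \<in> set xs then (SOME r. (x, r) \<in> set xs) else \<zero>\<^bsub>R\<^esub>"
  have "f \<in> ?f ` lists (X \<times> carrier R)" if f: "f \<in> carrier (free_module R X)" for f
  proof -
    have fin: "finite {x \<in> X. f x \<noteq> \<zero>\<^bsub>R\<^esub>}" using f by (simp add: free_module_def)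
    obtain xs where xs: "set xs = (\<lambda>x. (x, f x)) ` {x \<in> X. f x \<noteq> \<zero>\<^bsub>R\<^esub>}"
      using finite_list[OF finite_imageI[OF fin]] by metis
    have "f x = ?f xs x" for x
      using f unfolding xs by (auto simp: free_module_def PiE_iff extensional_def image_iff)
    moreover have "xs \<in> lists (X \<times> carrier R)"
      using f by (auto simp: in_lists_conv_set xs free_module_def)
    ultimately show ?thesis by (metis (no_types, lifting) image_eqI ext)
  qed
  then show ?thesis
    by (intro small_subset[OF small_image[OF small_lists[OF small_Times[OF assms]], of ?f]] subsetI)
qed

text \<open>The free module on the elements of M, copied into the universe. M itself may live on
  another type; this matters for U, which gets a projective resolution later.\<close>

lemma enough_projectives:
  assumes M: "lmodule R M" and "small \<U> (carrier M)" "small \<U> (carrier R)"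
  obtains P p where "projective R \<U> P" "p \<in> Hom R P M" "p ` carrier P = carrier M"
proof -
  interpret M: lmodule R M by fact
  let ?X = "carrier M" let ?F = "free_module R ?X"
  have F: "lmodule R ?F" by (rule M.lmodule_free)
  obtain P f g where P: "P \<in> RMod R \<U>" "isos R P ?F f g"
    using RMod_transport[OF F small_free_module[OF assms(2,3)]] by metis
  note i = isosD[OF P(2)]
  have P': "lmodule R P" using P(1) by (simp add: RMod_def)
  have "projective R \<U> P"
    unfolding projective_def
  proof (intro conjI ballI impI P(1))
    fix K N q h
    assume K: "K \<in> RMod R \<U>" and N: "N \<in> RMod R \<U>" and q: "q \<in> Hom R K N" and h: "h \<in> Hom R P N"
      and sur: "q ` carrier K = carrier N"
    then have K': "lmodule R K" and N': "lmodule R N" by (auto simp: RMod_def)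
    \<comment> \<open>Freeness gives projectivity: choose preimages for the images of the basis
      vectors and extend linearly.\<close>
    have "\<forall>x\<in>?X. \<exists>y\<in>carrier K. q y = h (g (free_basis R ?X x))"
    proof
      fix x assume "x \<in> ?X"
      then have "h (g (free_basis R ?X x)) \<in> carrier N"
        using HomE(2)[OF h HomE(2)[OF i(2) M.free_basis_closed]] by blast
      then show "\<exists>y\<in>carrier K. q y = h (g (free_basis R ?X x))" using sur by (metis imageE)
    qed
    then obtain \<phi> where \<phi>: "\<And>x. x \<in> ?X \<Longrightarrow> \<phi> x \<in> carrier K"
      "\<And>x. x \<in> ?X \<Longrightarrow> q (\<phi> x) = h (g (free_basis R ?X x))" by metis
    let ?l = "free_lift R ?X K \<phi>"
    have l: "?l \<in> Hom R ?F K" "\<And>x. x \<in> ?X \<Longrightarrow> ?l (free_basis R ?X x) = \<phi> x"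
      using M.free_lift_Hom[OF K', of ?X \<phi>] \<phi>(1) by blast+
    have "compose (carrier ?F) q ?l y = compose (carrier ?F) h g y" if "y \<in> carrier ?F" for y
      using Hom_compose[OF F l(1) q] Hom_compose[OF F i(2) h] _ that
      by (rule M.free_module_Hom_eq[OF N']) (simp add: compose_eq l(2) \<phi>(2) M.free_basis_closed)
    then have e: "q (?l y) = h (g y)" if "y \<in> carrier ?F" for y
      using that by (simp add: compose_eq)
    show "\<exists>k\<in>Hom R P K. compose (carrier P) q k = h"
    proof (intro bexI)
      show "compose (carrier P) ?l f \<in> Hom R P K" using Hom_compose[OF P' i(1) l(1)] .
      show "compose (carrier P) q (compose (carrier P) ?l f) = h"
        using e i h by (intro Hom_eqI[OF Hom_compose[OF P' Hom_compose[OF P' i(1) l(1)] q] h])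
          (auto simp: compose_eq HomE)
    qed
  qed
  moreover
  let ?l = "free_lift R ?X M (\<lambda>x. x)"
  note l = M.free_lift_Hom[OF M, of ?X "\<lambda>x. x", simplified]
  have "compose (carrier P) ?l f \<in> Hom R P M" using Hom_compose[OF P' i(1) l(1)] .
  moreover have "compose (carrier P) ?l f ` carrier P = carrier M"
  proof
    show "compose (carrier P) ?l f ` carrier P \<subseteq> carrier M"
      using HomE(2)[OF calculation(2)] by blast
    show "carrier M \<subseteq> compose (carrier P) ?l f ` carrier P"
    proof
      fix x assume x: "x \<in> carrier M"
      let ?y = "g (free_basis R ?X x)"
      have "?y \<in> carrier P" using HomE(2)[OF i(2) M.free_basis_closed[OF x]] .
      moreover have "x = compose (carrier P) ?l f ?y"
        using l(2)[OF x] i(4)[OF M.free_basis_closed[OF x]] \<open>?y \<in> carrier P\<close> by (simp add: compose_eq)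
      ultimately show "x \<in> compose (carrier P) ?l f ` carrier P" by blast
    qed
  qed
  ultimately show thesis using that by blast
qed

lemma projective_resolution_exists:
  assumes M: "lmodule R M" and "small \<U> (carrier M)" and R: "small \<U> (carrier R)"
  obtains P d e where "proj_resolution R \<U> P d e M"
proof -
  obtain P0 e where P0: "projective R \<U> P0" "e \<in> Hom R P0 M" "e ` carrier P0 = carrier M"
    using enough_projectives[OF assms] by metis
  have step: "\<exists>Q q. projective R \<U> Q \<and> q \<in> Hom R Q P \<and> q ` carrier Q = S"
    if P: "projective R \<U> P" and S: "submod R P S" for P S
  proof -
    have PM: "P \<in> RMod R \<U>" using P by (simp add: projective_def)
    then have K: "P\<lparr>carrier := S\<rparr> \<in> RMod R \<U>" by (rule RMod_submod[OF _ S])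
    then obtain Q q where "projective R \<U> Q" "q \<in> Hom R Q (P\<lparr>carrier := S\<rparr>)" "q ` carrier Q = S"
      using enough_projectives[of R "P\<lparr>carrier := S\<rparr>"] R by (auto simp: RMod_small)
    then show ?thesis using Hom_submod_target S unfolding submod_def by blast
  qed
  \<comment> \<open>Dependent choice runs over triples of two consecutive modules and the map
    between them; J, exactness, links successive triples. The augmentation may have a target of
    another type and does not fit into a triple, so the condition for n = 0 anchors the first one at
    it.\<close>
  define I where "I = (\<lambda>(n::nat) (P, P', d). projective R \<U> P \<and> projective R \<U> P' \<and> d \<in> Hom R P' P \<and>
    (n = 0 \<longrightarrow> P = P0 \<and> d ` carrier P' = a_kernel P0 M e))"
  define J where "J = (\<lambda>(n::nat) (P :: ('a, 'm) module, P' :: ('a, 'm) module, d :: 'm \<Rightarrow> 'm)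
    (Q :: ('a, 'm) module, Q' :: ('a, 'm) module, d' :: 'm \<Rightarrow> 'm). Q = P' \<and> d' ` carrier Q' = a_kernel P' P d)"
  have "\<exists>s. I 0 s"
    using step[OF P0(1) submod_kernel[of R P0 M e]] P0 M
    by (auto simp: I_def projective_def RMod_def)
  moreover have "\<exists>t. I (Suc n) t \<and> J n s t" if "I n s" for n s
  proof -
    obtain P P' d where s: "s = (P, P', d)" by (cases s)
    then have *: "projective R \<U> P" "projective R \<U> P'" "d \<in> Hom R P' P" using that by (auto simp: I_def)
    then obtain Q q where "projective R \<U> Q" "q \<in> Hom R Q P'" "q ` carrier Q = a_kernel P' P d"
      using step[OF *(2) submod_kernel[of R P' P d]] by (auto simp: projective_def RMod_def)
    then show ?thesis using * s by (intro exI[of _ "(P', Q, q)"]) (auto simp: I_def J_def)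
  qed
  ultimately obtain s where s: "\<And>n. I n (s n) \<and> J n (s n) (s (Suc n))"
    using dependent_nat_choice[of I J] by blast
  define P where "P n = fst (s n)" for n
  define d where "d n = snd (snd (s n))" for n
  have P': "fst (snd (s n)) = P (Suc n)" for n
    using s[of n] by (auto simp: J_def P_def split: prod.splits)
  have a: "projective R \<U> (P n)" "d n \<in> Hom R (P (Suc n)) (P n)" for n
    using s[of n] P'[of n] by (auto simp: I_def P_def d_def split: prod.splits)
  have b: "d (Suc n) ` carrier (P (Suc (Suc n))) = a_kernel (P (Suc n)) (P n) (d n)" for n
  proof -
    obtain Q Q' q T T' t where e: "s n = (Q, Q', q)" "s (Suc n) = (T, T', t)" by (metis prod_cases3)
    have "T = Q'" "t ` carrier T' = a_kernel Q' Q q" using s[of n] unfolding e J_def by auto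
    moreover have "P n = Q" "P (Suc n) = T" "P (Suc (Suc n)) = T'" "d n = q" "d (Suc n) = t"
      using e P'[of "Suc n"] by (simp_all add: P_def d_def)
    ultimately show ?thesis by simp
  qed
  have c: "P 0 = P0" "d 0 ` carrier (P (Suc 0)) = a_kernel P0 M e"
    using s[of 0] P'[of 0] by (auto simp: I_def P_def d_def split: prod.splits)
  have "proj_resolution R \<U> P d e M"
    using a b c P0 by (simp add: proj_resolution_def resolution_def)
  then show thesis by (rule that)
qed

end

section \<open>Vanishing of Ext\<close>

lemma projectiveD:
  assumes "projective R \<U> P"
  shows "P \<in> RMod R \<U>" and "lmodule R P"
  using assms by (auto simp: projective_def RMod_def)

lemma resolutionD:
  assumes "resolution R X d e M"
  shows "e \<in> Hom R (X 0) M" "d i \<in> Hom R (X (Suc i)) (X i)"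
    "y \<in> carrier M \<Longrightarrow> \<exists>x\<in>carrier (X 0). y = e x"
    "x \<in> carrier (X (Suc 0)) \<Longrightarrow> e (d 0 x) = \<zero>\<^bsub>M\<^esub>"
    "\<lbrakk>x \<in> carrier (X 0); e x = \<zero>\<^bsub>M\<^esub>\<rbrakk> \<Longrightarrow> \<exists>w\<in>carrier (X (Suc 0)). x = d 0 w"
    "x \<in> carrier (X (Suc (Suc i))) \<Longrightarrow> d i (d (Suc i) x) = \<zero>\<^bsub>X i\<^esub>"
    "\<lbrakk>z \<in> carrier (X (Suc i)); d i z = \<zero>\<^bsub>X i\<^esub>\<rbrakk> \<Longrightarrow> \<exists>w\<in>carrier (X (Suc (Suc i))). z = d (Suc i) w"
proof -
  note * = assms[unfolded resolution_def]
  show "e \<in> Hom R (X 0) M" "d i \<in> Hom R (X (Suc i)) (X i)" using * by auto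
  show "\<exists>x\<in>carrier (X 0). y = e x" if "y \<in> carrier M" using * that by blast
  show "e (d 0 x) = \<zero>\<^bsub>M\<^esub>" if "x \<in> carrier (X (Suc 0))"
    using * that a_kernel_iff by (metis image_eqI)
  show "\<exists>w\<in>carrier (X (Suc 0)). x = d 0 w" if "x \<in> carrier (X 0)" "e x = \<zero>\<^bsub>M\<^esub>"
    using * that a_kernel_iff[of x "X 0" M e] by (metis (no_types, lifting) imageE)
  show "d i (d (Suc i) x) = \<zero>\<^bsub>X i\<^esub>" if "x \<in> carrier (X (Suc (Suc i)))"
    using * that a_kernel_iff by (metis image_eqI)
  show "\<exists>w\<in>carrier (X (Suc (Suc i))). z = d (Suc i) w"
    if "z \<in> carrier (X (Suc i))" "d i z = \<zero>\<^bsub>X i\<^esub>"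
    using * that a_kernel_iff[of z "X (Suc i)" "X i" "d i"] by (metis (no_types, lifting) imageE)
qed

text \<open>For a projective resolution \<open>P\<close> of \<open>X\<close>, this says that \<open>Ext\<close> of \<open>X\<close> and \<open>Y\<close> vanishes in degree \<open>j + 1\<close>.\<close>

definition ext_vanish ::
  "('r, 'x) ring_scheme \<Rightarrow> (nat \<Rightarrow> ('r, 'm) module) \<Rightarrow> (nat \<Rightarrow> 'm \<Rightarrow> 'm) \<Rightarrow> ('r, 'n, 'y) module_scheme \<Rightarrow> nat \<Rightarrow> bool"
  where "ext_vanish R P d Y j \<longleftrightarrow>
    (\<forall>f\<in>Hom R (P (Suc j)) Y. (\<forall>x\<in>carrier (P (Suc (Suc j))). f (d (Suc j) x) = \<zero>\<^bsub>Y\<^esub>) \<longrightarrow>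
      (\<exists>g\<in>Hom R (P j) Y. \<forall>x\<in>carrier (P (Suc j)). f x = g (d j x)))"

lemma ext_vanishD:
  assumes "ext_vanish R P d Y j" "f \<in> Hom R (P (Suc j)) Y"
    "\<And>x. x \<in> carrier (P (Suc (Suc j))) \<Longrightarrow> f (d (Suc j) x) = \<zero>\<^bsub>Y\<^esub>"
  obtains g where "g \<in> Hom R (P j) Y" "\<And>x. x \<in> carrier (P (Suc j)) \<Longrightarrow> f x = g (d j x)"
  using assms unfolding ext_vanish_def by blast

section \<open>Lifting along projectives and comparison of resolutions\<close>

context small_universe
begin

text \<open>Projectivity is applied to the surjection from N onto its image, a submodule of M. So it
  is enough that h lands in the image of g, the form in which exactness of a complex presents
  itself.\<close>

lemma projective_lift:
  assumes P: "projective R \<U> P" and M: "M \<in> RMod R \<U>" and N: "N \<in> RMod R \<U>"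
    and h: "h \<in> Hom R P M" and g: "g \<in> Hom R N M"
    and im: "\<And>x. x \<in> carrier P \<Longrightarrow> \<exists>y\<in>carrier N. h x = g y"
  obtains k where "k \<in> Hom R P N" "\<And>x. x \<in> carrier P \<Longrightarrow> g (k x) = h x"
proof -
  have M': "lmodule R M" and N': "lmodule R N" using M N by (auto simp: RMod_def)
  let ?S = "M\<lparr>carrier := g ` carrier N\<rparr>"
  have "?S \<in> RMod R \<U>" by (rule RMod_submod[OF M submod_image[OF N' M' g]])
  moreover have "h \<in> Hom R P ?S" using im by (intro Hom_submod_codomain[OF h]) auto
  moreover have "g \<in> Hom R N ?S" by (intro Hom_submod_codomain[OF g]) auto
  ultimately obtain k where k: "k \<in> Hom R P N" "compose (carrier P) g k = h"
    using P N unfolding projective_def by force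
  then show thesis using that by (metis compose_eq)
qed

lemma projective_trivial:
  assumes "P \<in> RMod R \<U>" "carrier P = {\<zero>\<^bsub>P\<^esub>}"
  shows "projective R \<U> P"
  unfolding projective_def
proof (intro conjI ballI impI assms(1))
  fix M N q h
  assume *: "M \<in> RMod R \<U>" "N \<in> RMod R \<U>" "q \<in> Hom R M N" "h \<in> Hom R P N"
  then have l: "lmodule R P" "lmodule R M" "lmodule R N" using assms by (auto simp: RMod_def)
  note z = Hom_const_zero[OF l(1,2)]
  show "\<exists>k\<in>Hom R P M. compose (carrier P) q k = h"
    using Hom_zero[OF l(2,3) *(3)] Hom_zero[OF l(1,3) *(4)] assms(2)
    by (intro bexI[OF _ z] Hom_eqI[OF Hom_compose[OF l(1) z *(3)] *(4)]) (auto simp: compose_eq)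
qed

lemma chain_map_lift:
  assumes P: "proj_resolution R \<U> P d e X" and Q: "resolution R Q d' e' X'" and QM: "\<And>i. Q i \<in> RMod R \<U>"
    and X: "X \<in> RMod R \<U>" "X' \<in> RMod R \<U>" and f: "f \<in> Hom R X X'"
  obtains a where "\<And>i. a i \<in> Hom R (P i) (Q i)" "\<And>x. x \<in> carrier (P 0) \<Longrightarrow> e' (a 0 x) = f (e x)"
    "\<And>i x. x \<in> carrier (P (Suc i)) \<Longrightarrow> d' i (a (Suc i) x) = a i (d i x)"
proof -
  have pr: "projective R \<U> (P i)" for i using P by (simp add: proj_resolution_def)
  note p = resolutionD[OF P[unfolded proj_resolution_def, THEN conjunct1]] and q = resolutionD[OF Q]
  have l: "lmodule R (P i)" "lmodule R (Q i)" "lmodule R X" "lmodule R X'" "P i \<in> RMod R \<U>" for i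
    using projectiveD[OF pr] QM X by (auto simp: RMod_def)
  \<comment> \<open>The invariant records that a after d lands in the image of d', which is what the
    next use of projectivity asks for. It hides whether this came from the augmentation or from the
    previous degree.\<close>
  define I where "I n a \<longleftrightarrow> a \<in> Hom R (P n) (Q n) \<and> (\<forall>x\<in>carrier (P (Suc n)). \<exists>y\<in>carrier (Q (Suc n)). a (d n x) = d' n y) \<and>
    (n = 0 \<longrightarrow> (\<forall>x\<in>carrier (P 0). e' (a x) = f (e x)))" for n a
  define J where "J n a b \<longleftrightarrow> (\<forall>x\<in>carrier (P (Suc n)). d' n (b x) = a (d n x))" for n and a b :: "'m \<Rightarrow> 'm"
  have "\<exists>a. I 0 a"
  proof -
    obtain a where a: "a \<in> Hom R (P 0) (Q 0)" "\<And>x. x \<in> carrier (P 0) \<Longrightarrow> e' (a x) = compose (carrier (P 0)) f e x"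
    proof (rule projective_lift[OF pr X(2) QM Hom_compose[OF l(1) p(1) f] q(1)])
      fix x assume "x \<in> carrier (P 0)"
      then show "\<exists>y\<in>carrier (Q 0). compose (carrier (P 0)) f e x = e' y"
        using q(3) HomE(2)[OF Hom_compose[OF l(1) p(1) f]] by blast
    qed blast
    have "\<exists>y\<in>carrier (Q (Suc 0)). a (d 0 x) = d' 0 y" if x: "x \<in> carrier (P (Suc 0))" for x
    proof (rule q(5))
      have dx: "d 0 x \<in> carrier (P 0)" using HomE(2)[OF p(2) x] .
      show "a (d 0 x) \<in> carrier (Q 0)" using a(1) dx by (simp add: HomE)
      show "e' (a (d 0 x)) = \<zero>\<^bsub>X'\<^esub>" using a(2)[OF dx] dx p(4)[OF x] Hom_zero[OF l(3,4) f] by (simp add: compose_eq)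
    qed
    then show ?thesis using a by (auto simp: I_def compose_eq)
  qed
  moreover have "\<exists>b. I (Suc n) b \<and> J n a b" if "I n a" for n a
  proof -
    have a: "a \<in> Hom R (P n) (Q n)" "\<And>x. x \<in> carrier (P (Suc n)) \<Longrightarrow> \<exists>y\<in>carrier (Q (Suc n)). a (d n x) = d' n y"
      using that by (auto simp: I_def)
    obtain b where b: "b \<in> Hom R (P (Suc n)) (Q (Suc n))"
      "\<And>x. x \<in> carrier (P (Suc n)) \<Longrightarrow> d' n (b x) = compose (carrier (P (Suc n))) a (d n) x"
      by (rule projective_lift[OF pr QM QM Hom_compose[OF l(1) p(2) a(1)] q(2)]) (auto simp: compose_eq a(2))
    have "\<exists>y\<in>carrier (Q (Suc (Suc n))). b (d (Suc n) x) = d' (Suc n) y" if x: "x \<in> carrier (P (Suc (Suc n)))" for x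
    proof (rule q(7))
      have dx: "d (Suc n) x \<in> carrier (P (Suc n))" using HomE(2)[OF p(2) x] .
      show "b (d (Suc n) x) \<in> carrier (Q (Suc n))" using b(1) dx by (simp add: HomE)
      show "d' n (b (d (Suc n) x)) = \<zero>\<^bsub>Q n\<^esub>" using b(2)[OF dx] dx p(6)[OF x] Hom_zero[OF l(1,2) a(1)] by (simp add: compose_eq)
    qed
    then show ?thesis using b by (auto simp: I_def J_def compose_eq)
  qed
  ultimately obtain a where "\<And>n. I n (a n) \<and> J n (a n) (a (Suc n))"
    using dependent_nat_choice[of I J] by blast
  then show thesis using that[of a] by (auto simp: I_def J_def)
qed

text \<open>As c lifts the identity of X, the difference 1 - c can be lifted step by step: each new
  s is a lift of 1 - c - s d. The equation is stated in positive degrees, the ones seen by Ext in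
  positive degree.\<close>

lemma chain_homotopy:
  assumes P: "proj_resolution R \<U> P d e X" and X: "X \<in> RMod R \<U>"
    and c: "\<And>i. c i \<in> Hom R (P i) (P i)" "\<And>x. x \<in> carrier (P 0) \<Longrightarrow> e (c 0 x) = e x"
    "\<And>i x. x \<in> carrier (P (Suc i)) \<Longrightarrow> d i (c (Suc i) x) = c i (d i x)"
  obtains s where "\<And>i. s i \<in> Hom R (P i) (P (Suc i))"
    "\<And>i x. x \<in> carrier (P (Suc i)) \<Longrightarrow> d (Suc i) (s (Suc i) x) = (x \<ominus>\<^bsub>P (Suc i)\<^esub> c (Suc i) x) \<ominus>\<^bsub>P (Suc i)\<^esub> s i (d i x)"
proof -
  have pr: "projective R \<U> (P i)" for i using P by (simp add: proj_resolution_def)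
  note p = resolutionD[OF P[unfolded proj_resolution_def, THEN conjunct1]]
  have l: "lmodule R (P i)" "lmodule R X" "P i \<in> RMod R \<U>" for i
    using projectiveD[OF pr] X by (auto simp: RMod_def)
  have ab: "abelian_group (P i)" "abelian_group X" for i
    using l lmodule_imp_abelian_group by blast+
  have k1: "(\<lambda>x\<in>carrier (P i). x \<ominus>\<^bsub>P i\<^esub> c i x) \<in> Hom R (P i) (P i)" for i
    using Hom_diff[OF l(1) l(1) Hom_id[OF l(1)] c(1)[of i]] by (simp cong: restrict_cong)
  define I where "I n s \<longleftrightarrow> s \<in> Hom R (P n) (P (Suc n)) \<and> (\<forall>x\<in>carrier (P (Suc n)).
     \<exists>y\<in>carrier (P (Suc (Suc n))). (x \<ominus>\<^bsub>P (Suc n)\<^esub> c (Suc n) x) \<ominus>\<^bsub>P (Suc n)\<^esub> s (d n x) = d (Suc n) y)" for n s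
  define J where "J n s t \<longleftrightarrow> (\<forall>x\<in>carrier (P (Suc n)). d (Suc n) (t x) =
      (x \<ominus>\<^bsub>P (Suc n)\<^esub> c (Suc n) x) \<ominus>\<^bsub>P (Suc n)\<^esub> s (d n x))" for n and s t :: "'m \<Rightarrow> 'm"
  have "\<exists>s. I 0 s"
  proof -
    obtain s where s: "s \<in> Hom R (P 0) (P (Suc 0))" "\<And>x. x \<in> carrier (P 0) \<Longrightarrow> d 0 (s x) = x \<ominus>\<^bsub>P 0\<^esub> c 0 x"
    proof (rule projective_lift[OF pr l(3) l(3) k1 p(2)])
      fix x assume x: "x \<in> carrier (P 0)"
      have cx: "c 0 x \<in> carrier (P 0)" using HomE(2)[OF c(1) x] .
      have "\<exists>y\<in>carrier (P (Suc 0)). x \<ominus>\<^bsub>P 0\<^esub> c 0 x = d 0 y"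
        using x cx c(2)[OF x] abelian_group.minus_closed[OF ab(1)] HomE(2)[OF p(1)]
        by (intro p(5)) (simp_all add: Hom_minus[OF l(1,2) p(1)] abelian_group.minus_self[OF ab(2)])
      then show "\<exists>y\<in>carrier (P (Suc 0)). (\<lambda>x\<in>carrier (P 0). x \<ominus>\<^bsub>P 0\<^esub> c 0 x) x = d 0 y" using x by simp
    qed simp
    have "\<exists>y\<in>carrier (P (Suc (Suc 0))). (x \<ominus>\<^bsub>P (Suc 0)\<^esub> c (Suc 0) x) \<ominus>\<^bsub>P (Suc 0)\<^esub> s (d 0 x) = d (Suc 0) y"
      if x: "x \<in> carrier (P (Suc 0))" for x
    proof (rule p(7))
      have dx: "d 0 x \<in> carrier (P 0)" "c (Suc 0) x \<in> carrier (P (Suc 0))" using HomE(2)[OF p(2) x] HomE(2)[OF c(1) x] .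
      have sx: "s (d 0 x) \<in> carrier (P (Suc 0))" using HomE(2)[OF s(1) dx(1)] .
      have xc: "x \<ominus>\<^bsub>P (Suc 0)\<^esub> c (Suc 0) x \<in> carrier (P (Suc 0))" using x dx abelian_group.minus_closed[OF ab(1)] by blast
      show "(x \<ominus>\<^bsub>P (Suc 0)\<^esub> c (Suc 0) x) \<ominus>\<^bsub>P (Suc 0)\<^esub> s (d 0 x) \<in> carrier (P (Suc 0))"
        using xc sx abelian_group.minus_closed[OF ab(1)] by blast
      have "d 0 ((x \<ominus>\<^bsub>P (Suc 0)\<^esub> c (Suc 0) x) \<ominus>\<^bsub>P (Suc 0)\<^esub> s (d 0 x)) =
          (d 0 x \<ominus>\<^bsub>P 0\<^esub> c 0 (d 0 x)) \<ominus>\<^bsub>P 0\<^esub> (d 0 x \<ominus>\<^bsub>P 0\<^esub> c 0 (d 0 x))"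
        using x dx sx xc by (simp add: Hom_minus[OF l(1) l(1) p(2)] c(3) s(2))
      then show "d 0 ((x \<ominus>\<^bsub>P (Suc 0)\<^esub> c (Suc 0) x) \<ominus>\<^bsub>P (Suc 0)\<^esub> s (d 0 x)) = \<zero>\<^bsub>P 0\<^esub>"
        using dx HomE(2)[OF c(1) dx(1)] abelian_group.minus_closed[OF ab(1)] by (simp add: abelian_group.minus_self[OF ab(1)])
    qed
    then show ?thesis using s by (auto simp: I_def)
  qed
  moreover have "\<exists>t. I (Suc n) t \<and> J n s t" if "I n s" for n s
  proof -
    have s: "s \<in> Hom R (P n) (P (Suc n))" "\<And>x. x \<in> carrier (P (Suc n)) \<Longrightarrow>
       \<exists>y\<in>carrier (P (Suc (Suc n))). (x \<ominus>\<^bsub>P (Suc n)\<^esub> c (Suc n) x) \<ominus>\<^bsub>P (Suc n)\<^esub> s (d n x) = d (Suc n) y"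
      using that by (auto simp: I_def)
    let ?h = "\<lambda>x\<in>carrier (P (Suc n)). (x \<ominus>\<^bsub>P (Suc n)\<^esub> c (Suc n) x) \<ominus>\<^bsub>P (Suc n)\<^esub> s (d n x)"
    have h: "?h \<in> Hom R (P (Suc n)) (P (Suc n))"
      using Hom_diff[OF l(1) l(1) k1 Hom_compose[OF l(1) p(2) s(1)]] by (simp add: compose_eq cong: restrict_cong)
    obtain t where t: "t \<in> Hom R (P (Suc n)) (P (Suc (Suc n)))"
      "\<And>x. x \<in> carrier (P (Suc n)) \<Longrightarrow> d (Suc n) (t x) = ?h x"
      by (rule projective_lift[OF pr l(3) l(3) h p(2)]) (auto simp: s(2))
    let ?m = "Suc n"
    have "\<exists>y\<in>carrier (P (Suc (Suc ?m))). (x \<ominus>\<^bsub>P (Suc ?m)\<^esub> c (Suc ?m) x) \<ominus>\<^bsub>P (Suc ?m)\<^esub> t (d ?m x) = d (Suc ?m) y"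
      if x: "x \<in> carrier (P (Suc ?m))" for x
    proof (rule p(7))
      have dx: "d ?m x \<in> carrier (P ?m)" "c (Suc ?m) x \<in> carrier (P (Suc ?m))" using HomE(2)[OF p(2) x] HomE(2)[OF c(1) x] .
      have sx: "t (d ?m x) \<in> carrier (P (Suc ?m))" using HomE(2)[OF t(1) dx(1)] .
      have xc: "x \<ominus>\<^bsub>P (Suc ?m)\<^esub> c (Suc ?m) x \<in> carrier (P (Suc ?m))" using x dx abelian_group.minus_closed[OF ab(1)] by blast
      show "(x \<ominus>\<^bsub>P (Suc ?m)\<^esub> c (Suc ?m) x) \<ominus>\<^bsub>P (Suc ?m)\<^esub> t (d ?m x) \<in> carrier (P (Suc ?m))"
        using xc sx abelian_group.minus_closed[OF ab(1)] by blast
      have cd: "c ?m (d ?m x) \<in> carrier (P ?m)" using HomE(2)[OF c(1) dx(1)] .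
      have dd: "s (d n (d ?m x)) = \<zero>\<^bsub>P ?m\<^esub>" using p(6)[OF x] Hom_zero[OF l(1) l(1) s(1)] by simp
      \<comment> \<open>With d t = 1 - c - s d from the previous step and d d = 0 the terms cancel,
        so the expression is a cycle and exactness makes it a boundary.\<close>
      have "d ?m ((x \<ominus>\<^bsub>P (Suc ?m)\<^esub> c (Suc ?m) x) \<ominus>\<^bsub>P (Suc ?m)\<^esub> t (d ?m x)) =
          (d ?m x \<ominus>\<^bsub>P ?m\<^esub> c ?m (d ?m x)) \<ominus>\<^bsub>P ?m\<^esub> ((d ?m x \<ominus>\<^bsub>P ?m\<^esub> c ?m (d ?m x)) \<ominus>\<^bsub>P ?m\<^esub> s (d n (d ?m x)))"
        using x dx sx xc by (simp add: Hom_minus[OF l(1) l(1) p(2)] c(3) t(2))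
      also have "\<dots> = \<zero>\<^bsub>P ?m\<^esub>"
        using dx cd abelian_group.minus_closed[OF ab(1)] unfolding dd
        by (simp add: abelian_group.minus_self[OF ab(1)] abelian_group.zero_minus[OF ab(1)])
      finally show "d ?m ((x \<ominus>\<^bsub>P (Suc ?m)\<^esub> c (Suc ?m) x) \<ominus>\<^bsub>P (Suc ?m)\<^esub> t (d ?m x)) = \<zero>\<^bsub>P ?m\<^esub>" .
    qed
    then show ?thesis using t by (auto simp: I_def J_def)
  qed
  ultimately obtain s where "\<And>n. I n (s n) \<and> J n (s n) (s (Suc n))"
    using dependent_nat_choice[of I J] by blast
  then show thesis using that[of s] by (auto simp: I_def J_def)
qed

text \<open>Lifts a of the inclusion and b of the retraction compose to an endomorphism of P over
  the identity of X, which is homotopic to the identity. A cocycle on P can therefore be pulled back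
  along b, solved on Q and brought back along a. With X = X' this is independence of the resolution;
  in general it is inheritance by retracts.\<close>

lemma ext_vanish_retract:
  assumes Q: "proj_resolution R \<U> Q d' e' X'" and P: "proj_resolution R \<U> P d e X"
    and X: "X \<in> RMod R \<U>" "X' \<in> RMod R \<U>" "retract R X X'" and Y: "lmodule R Y"
    and van: "ext_vanish R Q d' Y j"
  shows "ext_vanish R P d Y j"
proof -
  have pr: "projective R \<U> (P i)" "projective R \<U> (Q i)" for i using P Q by (simp_all add: proj_resolution_def)
  have rp: "resolution R P d e X" "resolution R Q d' e' X'" using P Q by (simp_all add: proj_resolution_def)
  note p = resolutionD[OF rp(1)] and q = resolutionD[OF rp(2)]
  have l: "lmodule R (P i)" "lmodule R (Q i)" "P i \<in> RMod R \<U>" "Q i \<in> RMod R \<U>" for i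
    using projectiveD pr by blast+
  obtain i r where ir: "i \<in> Hom R X X'" "r \<in> Hom R X' X" "\<And>x. x \<in> carrier X \<Longrightarrow> r (i x) = x"
    using X(3) by (auto simp: retract_def)
  obtain a where a: "\<And>i. a i \<in> Hom R (P i) (Q i)" "\<And>x. x \<in> carrier (P 0) \<Longrightarrow> e' (a 0 x) = i (e x)"
    "\<And>i x. x \<in> carrier (P (Suc i)) \<Longrightarrow> d' i (a (Suc i) x) = a i (d i x)"
    using chain_map_lift[OF P rp(2) l(4) X(1,2) ir(1)] by blast
  obtain b where b: "\<And>i. b i \<in> Hom R (Q i) (P i)" "\<And>x. x \<in> carrier (Q 0) \<Longrightarrow> e (b 0 x) = r (e' x)"
    "\<And>i x. x \<in> carrier (Q (Suc i)) \<Longrightarrow> d i (b (Suc i) x) = b i (d' i x)"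
    using chain_map_lift[OF Q rp(1) l(3) X(2,1) ir(2)] by blast
  define c where "c i = compose (carrier (P i)) (b i) (a i)" for i
  have ac: "a i x \<in> carrier (Q i)" if "x \<in> carrier (P i)" for i x using HomE(2)[OF a(1) that] .
  have c: "\<And>i. c i \<in> Hom R (P i) (P i)"
    unfolding c_def by (rule Hom_compose[OF l(1) a(1) b(1)])
  have c1: "e (c 0 x) = e x" if "x \<in> carrier (P 0)" for x
    using that a(2) b(2) ir(3) ac HomE(2)[OF p(1)] by (simp add: c_def compose_eq)
  have c2: "d i (c (Suc i) x) = c i (d i x)" if "x \<in> carrier (P (Suc i))" for i x
    using that b(3) a(3) ac HomE(2)[OF p(2) that] by (simp add: c_def compose_eq)
  obtain s where s: "\<And>i. s i \<in> Hom R (P i) (P (Suc i))"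
    "\<And>i x. x \<in> carrier (P (Suc i)) \<Longrightarrow> d (Suc i) (s (Suc i) x) = (x \<ominus>\<^bsub>P (Suc i)\<^esub> c (Suc i) x) \<ominus>\<^bsub>P (Suc i)\<^esub> s i (d i x)"
    using chain_homotopy[OF P X(1) c c1 c2] by blast
  show ?thesis
    unfolding ext_vanish_def
  proof (intro ballI impI)
    fix f assume f: "f \<in> Hom R (P (Suc j)) Y" and z: "\<forall>x\<in>carrier (P (Suc (Suc j))). f (d (Suc j) x) = \<zero>\<^bsub>Y\<^esub>"
    \<comment> \<open>From f b = g d' follows f c = g a d, and f - f c = f s d because f is a
      cocycle. So g a + f s solves f.\<close>
    let ?f = "compose (carrier (Q (Suc j))) f (b (Suc j))"
    have "?f (d' (Suc j) x) = \<zero>\<^bsub>Y\<^esub>" if "x \<in> carrier (Q (Suc (Suc j)))" for x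
      using z b(3)[OF that] HomE(2)[OF q(2) that] HomE(2)[OF b(1) that] by (metis compose_eq)
    then obtain g where g: "g \<in> Hom R (Q j) Y" "\<And>x. x \<in> carrier (Q (Suc j)) \<Longrightarrow> ?f x = g (d' j x)"
      using ext_vanishD[OF van Hom_compose[OF l(2) b(1) f]] by metis
    let ?u = "compose (carrier (P j)) g (a j)" and ?v = "compose (carrier (P j)) f (s j)"
    let ?g = "\<lambda>x\<in>carrier (P j). ?u x \<oplus>\<^bsub>Y\<^esub> ?v x"
    have "?g \<in> Hom R (P j) Y"
      by (rule Hom_add[OF l(1) Y Hom_compose[OF l(1) a(1) g(1)] Hom_compose[OF l(1) s(1) f]])
    moreover have "f x = ?g (d j x)" if x: "x \<in> carrier (P (Suc j))" for x
    proof -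
      interpret Y: lmodule R Y by fact
      interpret P: lmodule R "P (Suc j)" by (rule l)
      have dx: "d j x \<in> carrier (P j)" using HomE(2)[OF p(2) x] .
      have cx: "c (Suc j) x \<in> carrier (P (Suc j))" and sx: "s j (d j x) \<in> carrier (P (Suc j))"
        using HomE(2)[OF c x] HomE(2)[OF s(1) dx] .
      have "f ((x \<ominus>\<^bsub>P (Suc j)\<^esub> c (Suc j) x) \<ominus>\<^bsub>P (Suc j)\<^esub> s j (d j x)) = \<zero>\<^bsub>Y\<^esub>"
        using z s(2)[OF x] HomE(2)[OF s(1) x] by metis
      then have "(f x \<ominus>\<^bsub>Y\<^esub> f (c (Suc j) x)) \<ominus>\<^bsub>Y\<^esub> f (s j (d j x)) = \<zero>\<^bsub>Y\<^esub>"
        using x cx sx by (simp add: Hom_minus[OF l(1) Y f])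
      moreover have "f x \<in> carrier Y" "f (c (Suc j) x) \<in> carrier Y" "f (s j (d j x)) \<in> carrier Y"
        using HomE(2)[OF f] x cx sx by blast+
      ultimately have "f x = f (c (Suc j) x) \<oplus>\<^bsub>Y\<^esub> f (s j (d j x))"
        by (metis Y.M.minus_add_cancel(2) Y.M.minus_closed Y.M.minus_eq_zero_iff)
      moreover have "f (c (Suc j) x) = g (a j (d j x))"
        using g(2)[OF ac[OF x]] x ac[OF x] a(3)[OF x] by (simp add: c_def compose_eq)
      ultimately show ?thesis using dx by (simp add: compose_eq)
    qed
    ultimately show "\<exists>g\<in>Hom R (P j) Y. \<forall>x\<in>carrier (P (Suc j)). f x = g (d j x)" by blast
  qed
qed

end

section \<open>From the quotient groups Ext to solvability of cocycles\<close>

lemma comm_group_hom_group: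
  assumes "lmodule R M" "lmodule R N"
  shows "comm_group (hom_group R M N)"
proof -
  interpret M: lmodule R M by fact
  interpret N: lmodule R N by fact
  let ?G = "hom_group R M N"
  show ?thesis
  proof (rule comm_groupI)
    fix f assume f: "f \<in> carrier ?G"
    show "\<one>\<^bsub>?G\<^esub> \<otimes>\<^bsub>?G\<^esub> f = f"
      using f by (auto simp: hom_group_def Hom_def PiE_iff extensional_def fun_eq_iff)
    show "\<exists>g\<in>carrier ?G. g \<otimes>\<^bsub>?G\<^esub> f = \<one>\<^bsub>?G\<^esub>"
      using f Hom_neg[OF assms] by (intro bexI[of _ "\<lambda>x\<in>carrier M. \<ominus>\<^bsub>N\<^esub> f x"])
        (auto simp: hom_group_def HomE N.M.l_neg cong: restrict_cong)
    fix g assume g: "g \<in> carrier ?G"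
    show "f \<otimes>\<^bsub>?G\<^esub> g \<in> carrier ?G" using f g Hom_add[OF assms] by (simp add: hom_group_def)
    show "f \<otimes>\<^bsub>?G\<^esub> g = g \<otimes>\<^bsub>?G\<^esub> f"
      using f g by (auto simp: hom_group_def HomE N.M.a_comm[of "f _" "g _"] intro!: restrict_ext)
    fix h assume "h \<in> carrier ?G"
    then show "f \<otimes>\<^bsub>?G\<^esub> g \<otimes>\<^bsub>?G\<^esub> h = f \<otimes>\<^bsub>?G\<^esub> (g \<otimes>\<^bsub>?G\<^esub> h)"
      using f g by (auto simp: hom_group_def HomE N.M.a_assoc intro: restrict_ext)
  qed (simp add: hom_group_def Hom_const_zero[OF assms])
qed

text \<open>In a one-element quotient the coset of z is B itself, and it contains 1 z.\<close>

lemma (in group) trivial_group_ModD: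
  assumes t: "trivial_group ((G\<lparr>carrier := Z\<rparr>) Mod B)" and "Z \<subseteq> carrier G" "\<one> \<in> B"
  shows "Z \<subseteq> B"
proof
  fix z assume z: "z \<in> Z"
  have "B #>\<^bsub>G\<lparr>carrier := Z\<rparr>\<^esub> z \<in> carrier ((G\<lparr>carrier := Z\<rparr>) Mod B)"
    using z by (auto simp: carrier_FactGroup)
  then have "B #>\<^bsub>G\<lparr>carrier := Z\<rparr>\<^esub> z = B" using t by (simp add: trivial_group_def)
  moreover have "\<one> \<otimes> z \<in> B #>\<^bsub>G\<lparr>carrier := Z\<rparr>\<^esub> z" using assms(3) by (auto simp: r_coset_def)
  moreover have "z \<in> carrier G" using z assms(2) by blast
  ultimately show "z \<in> B" by simp
qed

lemma (in group) trivial_group_Mod_self: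
  assumes "subgroup Z G"
  shows "trivial_group ((G\<lparr>carrier := Z\<rparr>) Mod Z)"
proof -
  interpret H: group "G\<lparr>carrier := Z\<rparr>" using assms(1) by (rule subgroup.subgroup_is_group[OF _ is_group])
  have n: "normal Z (G\<lparr>carrier := Z\<rparr>)"
    using H.subgroup_self H.m_closed H.inv_closed by (simp add: H.normal_inv_iff)
  have "carrier ((G\<lparr>carrier := Z\<rparr>) Mod Z) = {Z}"
    using H.coset_join2[OF _ H.subgroup_self] H.one_closed by (auto simp: carrier_FactGroup)
  then show ?thesis
    using normal.factorgroup_is_group[OF n] by (simp add: trivial_group_def)
qed

text \<open>The resolution hidden in \<open>Ext\<close> depends on X alone, so one P serves every Y
  and every degree. X may live outside the universe type, as U does; the comparison of resolutions
  is stated for members of \<open>RMod\<close> and does not cover it, so this P has to be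
  kept.\<close>

lemma Ext_trivial_iff_SOME:
  fixes X :: "('r, 'n, 'y) module_scheme" and \<U> :: "'m set set"
  assumes ex: "\<exists>P d e. proj_resolution R \<U> P d e X"
  obtains P d e where "proj_resolution R \<U> P d e X"
    "\<And>(Y :: ('r, 'm) module) j. lmodule R Y \<Longrightarrow> trivial_group (Ext R \<U> (Suc j) X Y) \<longleftrightarrow> ext_vanish R P d Y j"
proof -
  define T where "T = (SOME (P, d, e). proj_resolution R \<U> P d e X)"
  obtain P d e where T: "T = (P, d, e)" by (cases T)
  have "case T of (P, d, e) \<Rightarrow> proj_resolution R \<U> P d e X"
    unfolding T_def by (rule someI_ex) (use ex in auto)
  then have P: "proj_resolution R \<U> P d e X" by (simp add: T)
  have pr: "projective R \<U> (P i)" for i using P by (simp add: proj_resolution_def)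
  note p = resolutionD[OF P[unfolded proj_resolution_def, THEN conjunct1]]
  have l: "lmodule R (P i)" for i using projectiveD pr by blast
  have "trivial_group (Ext R \<U> (Suc j) X Y) \<longleftrightarrow> ext_vanish R P d Y j" if Y: "lmodule R Y" for Y :: "('r, 'm) module" and j
  proof -
    interpret Y: lmodule R Y by fact
    define G where "G = (\<lambda>j. hom_group R (P j) Y)"
    define \<delta> where "\<delta> = (\<lambda>j (f :: 'm \<Rightarrow> 'm). compose (carrier (P (Suc j))) f (d j))"
    let ?Z = "kernel (G (Suc j)) (G (Suc (Suc j))) (\<delta> (Suc j))" and ?B = "\<delta> j ` carrier (G j)"
    have ext: "Ext R \<U> (Suc j) X Y = (G (Suc j))\<lparr>carrier := ?Z\<rparr> Mod ?B"
      unfolding Ext_def T_def[symmetric] T by (simp add: Let_def G_def \<delta>_def)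
    interpret comm_group "G k" for k unfolding G_def by (rule comm_group_hom_group[OF l Y])
    have dom: "d i x \<in> carrier (P i)" if "x \<in> carrier (P (Suc i))" for i x using HomE(2)[OF p(2) that] .
    have \<delta>: "\<delta> i \<in> hom (G i) (G (Suc i))" for i
      using Hom_compose[OF l p(2)] dom by (intro homI)
        (auto simp: G_def \<delta>_def hom_group_def compose_def intro: restrict_ext)
    have mZ: "f \<in> ?Z \<longleftrightarrow> f \<in> Hom R (P (Suc j)) Y \<and> (\<forall>x\<in>carrier (P (Suc (Suc j))). f (d (Suc j) x) = \<zero>\<^bsub>Y\<^esub>)" for f
      by (auto simp: kernel_def G_def \<delta>_def hom_group_def compose_def fun_eq_iff)
    have BZ: "?B \<subseteq> ?Z"
    proof
      fix f assume "f \<in> ?B"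
      then obtain g where g: "g \<in> Hom R (P j) Y" "f = compose (carrier (P (Suc j))) g (d j)"
        by (auto simp: G_def \<delta>_def hom_group_def)
      then show "f \<in> ?Z"
        unfolding mZ using Hom_compose[OF l p(2) g(1)] dom p(6) Hom_zero[OF l Y g(1)] by (auto simp: compose_eq)
    qed
    have one: "\<one>\<^bsub>G (Suc j)\<^esub> \<in> ?B"
      using hom_one[OF \<delta>[of j] is_group is_group] one_closed by (metis image_eqI)
    have Z: "subgroup ?Z (G (Suc j))"
      by (rule group_hom.subgroup_kernel) (unfold_locales, rule \<delta>)
    have "trivial_group (Ext R \<U> (Suc j) X Y) \<longleftrightarrow> ?B = ?Z"
      unfolding ext using trivial_group_ModD[OF _ subgroup.subset[OF Z] one] trivial_group_Mod_self[OF Z] BZ by auto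
    also have "\<dots> \<longleftrightarrow> ?Z \<subseteq> ?B" using BZ by blast
    also have "\<dots> \<longleftrightarrow> ext_vanish R P d Y j"
    proof
      assume *: "?Z \<subseteq> ?B"
      show "ext_vanish R P d Y j"
        unfolding ext_vanish_def
      proof (intro ballI impI)
        fix f assume "f \<in> Hom R (P (Suc j)) Y" "\<forall>x\<in>carrier (P (Suc (Suc j))). f (d (Suc j) x) = \<zero>\<^bsub>Y\<^esub>"
        then have "f \<in> ?B" using * mZ by blast
        then show "\<exists>g\<in>Hom R (P j) Y. \<forall>x\<in>carrier (P (Suc j)). f x = g (d j x)"
          by (auto simp: G_def \<delta>_def hom_group_def compose_eq)
      qed
    next
      assume *: "ext_vanish R P d Y j"
      show "?Z \<subseteq> ?B"
      proof
        fix f assume "f \<in> ?Z"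
        then have f: "f \<in> Hom R (P (Suc j)) Y" "\<And>x. x\<in>carrier (P (Suc (Suc j))) \<Longrightarrow> f (d (Suc j) x) = \<zero>\<^bsub>Y\<^esub>"
          unfolding mZ by auto
        obtain g where g: "g \<in> Hom R (P j) Y" "\<And>x. x \<in> carrier (P (Suc j)) \<Longrightarrow> f x = g (d j x)"
          using ext_vanishD[OF * f] by metis
        then have "f = \<delta> j g"
          unfolding \<delta>_def by (intro Hom_eqI[OF f(1) Hom_compose[OF l p(2) g(1)]]) (auto simp: compose_eq)
        then show "f \<in> ?B" using g(1) by (auto simp: G_def hom_group_def)
      qed
    qed
    finally show ?thesis .
  qed
  then show thesis using that P by blast
qed

context small_universe
begin

text \<open>For X in the universe the resolution chosen inside \<open>Ext\<close> may be exchanged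
  for any other, by viewing X as a retract of itself.\<close>

lemma Ext_trivial_iff:
  assumes P: "proj_resolution R \<U> P d e X" and X: "X \<in> RMod R \<U>" and Y: "lmodule R Y"
  shows "trivial_group (Ext R \<U> (Suc j) X Y) \<longleftrightarrow> ext_vanish R P d Y j"
proof -
  have l: "lmodule R X" using X by (simp add: RMod_def)
  obtain Q d' e' where "proj_resolution R \<U> Q d' e' X"
    "trivial_group (Ext R \<U> (Suc j) X Y) \<longleftrightarrow> ext_vanish R Q d' Y j"
    using Ext_trivial_iff_SOME[of R \<U> X] P Y by metis
  then show ?thesis
    using ext_vanish_retract[OF _ _ X X isos_retract[OF isos_refl[OF l]] Y] P by metis
qed

end

section \<open>Change of rings along non-unital homomorphisms\<close>

definition nuhom :: "('r, 'x) ring_scheme \<Rightarrow> ('s, 'y) ring_scheme \<Rightarrow> ('r \<Rightarrow> 's) \<Rightarrow> bool"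
  where "nuhom R S \<iota> \<longleftrightarrow> ring R \<and> ring S \<and> \<iota> \<in> carrier R \<rightarrow> carrier S \<and>
    (\<forall>a\<in>carrier R. \<forall>b\<in>carrier R. \<iota> (a \<oplus>\<^bsub>R\<^esub> b) = \<iota> a \<oplus>\<^bsub>S\<^esub> \<iota> b \<and> \<iota> (a \<otimes>\<^bsub>R\<^esub> b) = \<iota> a \<otimes>\<^bsub>S\<^esub> \<iota> b)"

text \<open>
  For unital \<open>\<iota>\<close> this is restriction of scalars; in general the idempotent \<open>\<iota> 1\<close> cuts out the part of
  \<open>M\<close> on which \<open>R\<close> acts unitally. For the triangular matrix ring the same functor thus describes both
  components of a module (along the inclusions of \<open>A\<close> and \<open>B\<close>) and the modules concentrated in one
  component (along the projections).
\<close>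

definition cor :: "('r, 'x) ring_scheme \<Rightarrow> ('r \<Rightarrow> 's) \<Rightarrow> ('s, 'm, 'y) module_scheme \<Rightarrow> ('r, 'm) module"
  where "cor R \<iota> M = \<lparr>carrier = {x \<in> carrier M. \<iota> \<one>\<^bsub>R\<^esub> \<odot>\<^bsub>M\<^esub> x = x}, mult = undefined, one = undefined,
    ring.zero = \<zero>\<^bsub>M\<^esub>, add = add M, smult = (\<lambda>r x. \<iota> r \<odot>\<^bsub>M\<^esub> x)\<rparr>"

lemma cor_simps [simp]:
  "x \<in> carrier (cor R \<iota> M) \<longleftrightarrow> x \<in> carrier M \<and> \<iota> \<one>\<^bsub>R\<^esub> \<odot>\<^bsub>M\<^esub> x = x"
  "\<zero>\<^bsub>cor R \<iota> M\<^esub> = \<zero>\<^bsub>M\<^esub>" "x \<oplus>\<^bsub>cor R \<iota> M\<^esub> y = x \<oplus>\<^bsub>M\<^esub> y" "r \<odot>\<^bsub>cor R \<iota> M\<^esub> x = \<iota> r \<odot>\<^bsub>M\<^esub> x"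
  by (auto simp: cor_def)

lemma nuhomD:
  assumes "nuhom R S \<iota>"
  shows "ring R" "ring S" "a \<in> carrier R \<Longrightarrow> \<iota> a \<in> carrier S"
    "\<lbrakk>a \<in> carrier R; b \<in> carrier R\<rbrakk> \<Longrightarrow> \<iota> (a \<oplus>\<^bsub>R\<^esub> b) = \<iota> a \<oplus>\<^bsub>S\<^esub> \<iota> b"
    "\<lbrakk>a \<in> carrier R; b \<in> carrier R\<rbrakk> \<Longrightarrow> \<iota> (a \<otimes>\<^bsub>R\<^esub> b) = \<iota> a \<otimes>\<^bsub>S\<^esub> \<iota> b"
    "\<iota> \<one>\<^bsub>R\<^esub> \<in> carrier S"
proof -
  show "\<iota> \<one>\<^bsub>R\<^esub> \<in> carrier S" using assms ring.ring_simprules(6) unfolding nuhom_def by blast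
qed (use assms in \<open>auto simp: nuhom_def\<close>)

text \<open>\<iota> r equals \<iota> 1 times \<iota> r, so whatever \<iota> r produces is fixed by
  the idempotent \<iota> 1.\<close>

lemma cor_smult_mem:
  assumes "nuhom R S \<iota>" "lmodule S M" "x \<in> carrier M" "r \<in> carrier R"
  shows "\<iota> r \<odot>\<^bsub>M\<^esub> x \<in> carrier (cor R \<iota> M)"
proof -
  interpret R: ring R using assms(1) by (rule nuhomD)
  interpret M: lmodule S M by fact
  show ?thesis
    using assms nuhomD[OF assms(1)] by (simp add: M.smult_closed M.smult_assoc1[symmetric] flip: nuhomD(5)[OF assms(1)])
qed

lemma cor_unit_mem:
  assumes "nuhom R S \<iota>" "lmodule S M" "x \<in> carrier M"
  shows "\<iota> \<one>\<^bsub>R\<^esub> \<odot>\<^bsub>M\<^esub> x \<in> carrier (cor R \<iota> M)"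
  by (rule cor_smult_mem[OF assms]) (use nuhomD(1)[OF assms(1)] in \<open>rule ring.ring_simprules(6)\<close>)

lemma lmodule_cor:
  assumes "nuhom R S \<iota>" "lmodule S M"
  shows "lmodule R (cor R \<iota> M)"
proof -
  interpret M: lmodule S M by fact
  note h = nuhomD[OF assms(1)]
  interpret R: ring R by (rule h)
  have inv: "\<exists>y\<in>carrier (cor R \<iota> M). y \<oplus>\<^bsub>M\<^esub> x = \<zero>\<^bsub>M\<^esub>" if "x \<in> carrier (cor R \<iota> M)" for x
    using that h by (intro bexI[of _ "\<ominus>\<^bsub>M\<^esub> x"]) (auto simp: M.M.l_neg M.smult_minus_right)
  show ?thesis
    by (intro lmoduleI h(1))
      (use h inv cor_smult_mem[OF assms] in \<open>auto simp: M.M.a_ac M.smult_zero_right M.smult_r_distr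
        M.smult_l_distr M.smult_closed M.smult_assoc1\<close>)
qed

lemma cor_Hom:
  assumes "nuhom R S \<iota>" "lmodule S M" "f \<in> Hom S M N"
  shows "restrict f (carrier (cor R \<iota> M)) \<in> Hom R (cor R \<iota> M) (cor R \<iota> N)"
proof (rule HomI[OF lmodule_cor[OF assms(1,2)]])
  note h = nuhomD[OF assms(1)] and f = HomE[OF assms(3)]
  fix x assume x: "x \<in> carrier (cor R \<iota> M)"
  then show "f x \<in> carrier (cor R \<iota> N)"
    using f(2)[of x] f(4)[OF h(6), of x] by simp
  show "f (r \<odot>\<^bsub>cor R \<iota> M\<^esub> x) = r \<odot>\<^bsub>cor R \<iota> N\<^esub> f x" if "r \<in> carrier R" for r
    using x f(4)[OF h(3)[OF that], of x] by simp
  fix y assume "y \<in> carrier (cor R \<iota> M)"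
  then show "f (x \<oplus>\<^bsub>cor R \<iota> M\<^esub> y) = f x \<oplus>\<^bsub>cor R \<iota> N\<^esub> f y"
    using x f(3)[of x y] by simp
qed

text \<open>This is exactness of \<open>cor\<close>: multiplying a preimage by the idempotent
  \<iota> 1 moves it into the part that is cut out, and does not change its image y, which that
  idempotent fixes.\<close>

lemma cor_image:
  assumes "nuhom R S \<iota>" "lmodule S L" "f \<in> Hom S L M" "y \<in> carrier (cor R \<iota> M)" "\<exists>x\<in>carrier L. y = f x"
  shows "\<exists>x\<in>carrier (cor R \<iota> L). y = restrict f (carrier (cor R \<iota> L)) x"
proof -
  obtain x where x: "x \<in> carrier L" "y = f x" using assms(5) by blast
  let ?x = "\<iota> \<one>\<^bsub>R\<^esub> \<odot>\<^bsub>L\<^esub> x"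
  have "?x \<in> carrier (cor R \<iota> L)" by (rule cor_unit_mem[OF assms(1,2) x(1)])
  moreover have "f ?x = y" using assms(4) x nuhomD(6)[OF assms(1)] HomE(4)[OF assms(3)] by simp
  ultimately show ?thesis by (intro bexI[of _ ?x]) simp_all
qed

lemma cor_short_exact:
  assumes "nuhom R S \<iota>" "lmodule S L" "lmodule S M" "short_exact S L f M g N"
  shows "short_exact R (cor R \<iota> L) (restrict f (carrier (cor R \<iota> L))) (cor R \<iota> M)
    (restrict g (carrier (cor R \<iota> M))) (cor R \<iota> N)"
proof (rule short_exactI)
  note e = short_exactD[OF assms(4)]
  show f: "restrict f (carrier (cor R \<iota> L)) \<in> Hom R (cor R \<iota> L) (cor R \<iota> M)" by (rule cor_Hom[OF assms(1,2) e(1)])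
  show "restrict g (carrier (cor R \<iota> M)) \<in> Hom R (cor R \<iota> M) (cor R \<iota> N)" by (rule cor_Hom[OF assms(1,3) e(2)])
  show "inj_on (restrict f (carrier (cor R \<iota> L))) (carrier (cor R \<iota> L))"
    using e(3) by (auto simp: inj_on_def)
  show "restrict g (carrier (cor R \<iota> M)) (restrict f (carrier (cor R \<iota> L)) x) = \<zero>\<^bsub>cor R \<iota> N\<^esub>"
    if x: "x \<in> carrier (cor R \<iota> L)" for x using HomE(2)[OF f x] x e(4) by simp
  show "\<exists>x\<in>carrier (cor R \<iota> L). y = restrict f (carrier (cor R \<iota> L)) x"
    if "y \<in> carrier (cor R \<iota> M)" "restrict g (carrier (cor R \<iota> M)) y = \<zero>\<^bsub>cor R \<iota> N\<^esub>" for y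
    using that e(5) by (intro cor_image[OF assms(1,2) e(1)]) auto
  show "\<exists>y\<in>carrier (cor R \<iota> M). z = restrict g (carrier (cor R \<iota> M)) y" if "z \<in> carrier (cor R \<iota> N)" for z
    using that e(6) by (intro cor_image[OF assms(1,3) e(2)]) auto
qed

section \<open>Resolutions and coresolutions under change of rings\<close>

lemma resolutionI:
  assumes "e \<in> Hom R (X 0) M" "\<And>i. d i \<in> Hom R (X (Suc i)) (X i)"
    "\<And>y. y \<in> carrier M \<Longrightarrow> \<exists>x\<in>carrier (X 0). y = e x"
    "\<And>x. x \<in> carrier (X (Suc 0)) \<Longrightarrow> e (d 0 x) = \<zero>\<^bsub>M\<^esub>"
    "\<And>x. \<lbrakk>x \<in> carrier (X 0); e x = \<zero>\<^bsub>M\<^esub>\<rbrakk> \<Longrightarrow> \<exists>w\<in>carrier (X (Suc 0)). x = d 0 w"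
    "\<And>i x. x \<in> carrier (X (Suc (Suc i))) \<Longrightarrow> d i (d (Suc i) x) = \<zero>\<^bsub>X i\<^esub>"
    "\<And>i z. \<lbrakk>z \<in> carrier (X (Suc i)); d i z = \<zero>\<^bsub>X i\<^esub>\<rbrakk> \<Longrightarrow> \<exists>w\<in>carrier (X (Suc (Suc i))). z = d (Suc i) w"
  shows "resolution R X d e M"
  unfolding resolution_def
proof (intro conjI allI assms(1,2))
  show "e ` carrier (X 0) = carrier M" using assms(3) HomE(2)[OF assms(1)] by blast
  show "d 0 ` carrier (X (Suc 0)) = a_kernel (X 0) M e"
    by (rule image_eq_kernelI) (rule assms; assumption)+
  show "d (Suc i) ` carrier (X (Suc (Suc i))) = a_kernel (X (Suc i)) (X i) (d i)" for i
    by (rule image_eq_kernelI) (rule assms; assumption)+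
qed

lemma coresolutionD:
  assumes "coresolution R M e X d"
  shows "e \<in> Hom R M (X 0)" "d i \<in> Hom R (X i) (X (Suc i))" "inj_on e (carrier M)"
    "x \<in> carrier M \<Longrightarrow> d 0 (e x) = \<zero>\<^bsub>X (Suc 0)\<^esub>"
    "\<lbrakk>y \<in> carrier (X 0); d 0 y = \<zero>\<^bsub>X (Suc 0)\<^esub>\<rbrakk> \<Longrightarrow> \<exists>x\<in>carrier M. y = e x"
    "z \<in> carrier (X i) \<Longrightarrow> d (Suc i) (d i z) = \<zero>\<^bsub>X (Suc (Suc i))\<^esub>"
    "\<lbrakk>w \<in> carrier (X (Suc i)); d (Suc i) w = \<zero>\<^bsub>X (Suc (Suc i))\<^esub>\<rbrakk> \<Longrightarrow> \<exists>z\<in>carrier (X i). w = d i z"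
proof -
  note * = assms[unfolded coresolution_def]
  show "e \<in> Hom R M (X 0)" "d i \<in> Hom R (X i) (X (Suc i))" "inj_on e (carrier M)" using * by auto
  show "d 0 (e x) = \<zero>\<^bsub>X (Suc 0)\<^esub>" if "x \<in> carrier M"
    using * that a_kernel_iff by (metis image_eqI)
  show "\<exists>x\<in>carrier M. y = e x" if "y \<in> carrier (X 0)" "d 0 y = \<zero>\<^bsub>X (Suc 0)\<^esub>"
    using * that a_kernel_iff[of y "X 0" "X (Suc 0)" "d 0"] by (metis (no_types, lifting) imageE)
  show "d (Suc i) (d i z) = \<zero>\<^bsub>X (Suc (Suc i))\<^esub>" if "z \<in> carrier (X i)"
    using * that a_kernel_iff by (metis image_eqI)
  show "\<exists>z\<in>carrier (X i). w = d i z" if "w \<in> carrier (X (Suc i))" "d (Suc i) w = \<zero>\<^bsub>X (Suc (Suc i))\<^esub>"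
    using * that a_kernel_iff[of w "X (Suc i)" "X (Suc (Suc i))" "d (Suc i)"] by (metis (no_types, lifting) imageE)
qed

lemma coresolutionI:
  assumes "e \<in> Hom R M (X 0)" "\<And>i. d i \<in> Hom R (X i) (X (Suc i))" "inj_on e (carrier M)"
    "\<And>x. x \<in> carrier M \<Longrightarrow> d 0 (e x) = \<zero>\<^bsub>X (Suc 0)\<^esub>"
    "\<And>y. \<lbrakk>y \<in> carrier (X 0); d 0 y = \<zero>\<^bsub>X (Suc 0)\<^esub>\<rbrakk> \<Longrightarrow> \<exists>x\<in>carrier M. y = e x"
    "\<And>i z. z \<in> carrier (X i) \<Longrightarrow> d (Suc i) (d i z) = \<zero>\<^bsub>X (Suc (Suc i))\<^esub>"
    "\<And>i w. \<lbrakk>w \<in> carrier (X (Suc i)); d (Suc i) w = \<zero>\<^bsub>X (Suc (Suc i))\<^esub>\<rbrakk> \<Longrightarrow> \<exists>z\<in>carrier (X i). w = d i z"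
  shows "coresolution R M e X d"
  unfolding coresolution_def
proof (intro conjI allI assms(1,2,3))
  show "e ` carrier M = a_kernel (X 0) (X (Suc 0)) (d 0)"
    by (rule image_eq_kernelI) (rule assms; assumption)+
  show "d i ` carrier (X i) = a_kernel (X (Suc i)) (X (Suc (Suc i))) (d (Suc i))" for i
    by (rule image_eq_kernelI) (rule assms; assumption)+
qed

lemma cor_resolution:
  assumes "nuhom R S \<iota>" "\<And>i. lmodule S (X i)" "resolution S X d e M"
  shows "resolution R (\<lambda>i. cor R \<iota> (X i)) (\<lambda>i. restrict (d i) (carrier (cor R \<iota> (X (Suc i)))))
    (restrict e (carrier (cor R \<iota> (X 0)))) (cor R \<iota> M)"
proof (rule resolutionI)
  note r = resolutionD[OF assms(3)]
  show e: "restrict e (carrier (cor R \<iota> (X 0))) \<in> Hom R (cor R \<iota> (X 0)) (cor R \<iota> M)"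
    by (rule cor_Hom[OF assms(1,2) r(1)])
  show d: "restrict (d i) (carrier (cor R \<iota> (X (Suc i)))) \<in> Hom R (cor R \<iota> (X (Suc i))) (cor R \<iota> (X i))" for i
    by (rule cor_Hom[OF assms(1,2) r(2)])
  show "\<exists>x\<in>carrier (cor R \<iota> (X 0)). y = restrict e (carrier (cor R \<iota> (X 0))) x" if "y \<in> carrier (cor R \<iota> M)" for y
    using that r(3) by (intro cor_image[OF assms(1,2) r(1)]) auto
  show "restrict e (carrier (cor R \<iota> (X 0))) (restrict (d 0) (carrier (cor R \<iota> (X (Suc 0)))) x) = \<zero>\<^bsub>cor R \<iota> M\<^esub>"
    if x: "x \<in> carrier (cor R \<iota> (X (Suc 0)))" for x using HomE(2)[OF d x] x r(4) by simp
  show "\<exists>w\<in>carrier (cor R \<iota> (X (Suc 0))). x = restrict (d 0) (carrier (cor R \<iota> (X (Suc 0)))) w"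
    if "x \<in> carrier (cor R \<iota> (X 0))" "restrict e (carrier (cor R \<iota> (X 0))) x = \<zero>\<^bsub>cor R \<iota> M\<^esub>" for x
    using that r(5) by (intro cor_image[OF assms(1,2) r(2)]) auto
  show "restrict (d i) (carrier (cor R \<iota> (X (Suc i)))) (restrict (d (Suc i)) (carrier (cor R \<iota> (X (Suc (Suc i))))) x)
      = \<zero>\<^bsub>cor R \<iota> (X i)\<^esub>" if x: "x \<in> carrier (cor R \<iota> (X (Suc (Suc i))))" for i x
    using HomE(2)[OF d x] x r(6) by simp
  show "\<exists>w\<in>carrier (cor R \<iota> (X (Suc (Suc i)))). z = restrict (d (Suc i)) (carrier (cor R \<iota> (X (Suc (Suc i))))) w"
    if "z \<in> carrier (cor R \<iota> (X (Suc i)))" "restrict (d i) (carrier (cor R \<iota> (X (Suc i)))) z = \<zero>\<^bsub>cor R \<iota> (X i)\<^esub>" for i z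
    using that r(7) by (intro cor_image[OF assms(1,2) r(2)]) auto
qed

lemma cor_coresolution:
  assumes "nuhom R S \<iota>" "\<And>i. lmodule S (X i)" "lmodule S M" "coresolution S M e X d"
  shows "coresolution R (cor R \<iota> M) (restrict e (carrier (cor R \<iota> M))) (\<lambda>i. cor R \<iota> (X i))
    (\<lambda>i. restrict (d i) (carrier (cor R \<iota> (X i))))"
proof (rule coresolutionI)
  note r = coresolutionD[OF assms(4)]
  show e: "restrict e (carrier (cor R \<iota> M)) \<in> Hom R (cor R \<iota> M) (cor R \<iota> (X 0))"
    by (rule cor_Hom[OF assms(1,3) r(1)])
  show d: "restrict (d i) (carrier (cor R \<iota> (X i))) \<in> Hom R (cor R \<iota> (X i)) (cor R \<iota> (X (Suc i)))" for i
    by (rule cor_Hom[OF assms(1,2) r(2)])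
  show "inj_on (restrict e (carrier (cor R \<iota> M))) (carrier (cor R \<iota> M))" using r(3) by (auto simp: inj_on_def)
  show "restrict (d 0) (carrier (cor R \<iota> (X 0))) (restrict e (carrier (cor R \<iota> M)) x) = \<zero>\<^bsub>cor R \<iota> (X (Suc 0))\<^esub>"
    if x: "x \<in> carrier (cor R \<iota> M)" for x using HomE(2)[OF e x] x r(4) by simp
  show "\<exists>x\<in>carrier (cor R \<iota> M). y = restrict e (carrier (cor R \<iota> M)) x"
    if "y \<in> carrier (cor R \<iota> (X 0))" "restrict (d 0) (carrier (cor R \<iota> (X 0))) y = \<zero>\<^bsub>cor R \<iota> (X (Suc 0))\<^esub>" for y
    using that r(5) by (intro cor_image[OF assms(1,3) r(1)]) auto
  show "restrict (d (Suc i)) (carrier (cor R \<iota> (X (Suc i)))) (restrict (d i) (carrier (cor R \<iota> (X i))) x)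
      = \<zero>\<^bsub>cor R \<iota> (X (Suc (Suc i)))\<^esub>" if x: "x \<in> carrier (cor R \<iota> (X i))" for i x
    using HomE(2)[OF d x] x r(6) by simp
  show "\<exists>z\<in>carrier (cor R \<iota> (X i)). w = restrict (d i) (carrier (cor R \<iota> (X i))) z"
    if "w \<in> carrier (cor R \<iota> (X (Suc i)))"
      "restrict (d (Suc i)) (carrier (cor R \<iota> (X (Suc i)))) w = \<zero>\<^bsub>cor R \<iota> (X (Suc (Suc i)))\<^esub>" for i w
    using that r(7) by (intro cor_image[OF assms(1,2) r(2)]) auto
qed

lemma cor_isos:
  assumes "nuhom R S \<iota>" "lmodule S M" "lmodule S N" "isos S M N f g"
  shows "isos R (cor R \<iota> M) (cor R \<iota> N) (restrict f (carrier (cor R \<iota> M))) (restrict g (carrier (cor R \<iota> N)))"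
  using cor_Hom[OF assms(1,2) isosD(1)[OF assms(4)]] cor_Hom[OF assms(1,3) isosD(2)[OF assms(4)]]
    isosD(3,4)[OF assms(4)] HomE(2)[OF cor_Hom[OF assms(1,2) isosD(1)[OF assms(4)]]]
    HomE(2)[OF cor_Hom[OF assms(1,3) isosD(2)[OF assms(4)]]] by (auto simp: isos_def)

lemma cor_mod_iso:
  assumes "nuhom R S \<iota>" "lmodule S M" "lmodule S N" "mod_iso S M N"
  shows "mod_iso R (cor R \<iota> M) (cor R \<iota> N)"
  using mod_iso_imp_isos[OF assms(2-4)] isos_imp_mod_iso cor_isos[OF assms(1-3)] by metis

lemma cor_dirsum: "cor R \<iota> (dirsum M N) = dirsum (cor R \<iota> M) (cor R \<iota> N)"
  by (auto simp: cor_def dirsum_def fun_eq_iff)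

text \<open>\<iota> (\<kappa> 1) is \<iota> 1 times \<iota> (\<kappa> 1), so an element fixed by the
  smaller idempotent is fixed by the larger one too.\<close>

lemma cor_cor:
  assumes "nuhom R S \<iota>" "nuhom Q R \<kappa>" "lmodule S M"
  shows "cor Q \<kappa> (cor R \<iota> M) = cor Q (\<lambda>q. \<iota> (\<kappa> q)) M"
proof -
  interpret M: lmodule S M by fact
  interpret R: ring R by (rule nuhomD(1)[OF assms(1)])
  note h = nuhomD[OF assms(1)] nuhomD[OF assms(2)]
  have "\<iota> \<one>\<^bsub>R\<^esub> \<odot>\<^bsub>M\<^esub> x = x" if "x \<in> carrier M" "\<iota> (\<kappa> \<one>\<^bsub>Q\<^esub>) \<odot>\<^bsub>M\<^esub> x = x" for x
    using that M.smult_assoc1[of "\<iota> \<one>\<^bsub>R\<^esub>" "\<iota> (\<kappa> \<one>\<^bsub>Q\<^esub>)" x] h(5)[of "\<one>\<^bsub>R\<^esub>" "\<kappa> \<one>\<^bsub>Q\<^esub>"] h by simp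
  then show ?thesis by (auto simp: cor_def)
qed

lemma cor_id_isos:
  assumes "lmodule R M"
  shows "isos R (cor R (\<lambda>r. r) M) M (\<lambda>x\<in>carrier M. x) (\<lambda>x\<in>carrier M. x)"
proof -
  interpret M: lmodule R M by fact
  have n: "nuhom R R (\<lambda>r. r)" using M.R.ring_axioms by (simp add: nuhom_def)
  have c: "carrier (cor R (\<lambda>r. r) M) = carrier M" by (auto simp: M.smult_one)
  have "(\<lambda>x\<in>carrier M. x) \<in> Hom R (cor R (\<lambda>r. r) M) M"
    using HomI[OF lmodule_cor[OF n assms], of "\<lambda>x. x" M] unfolding c by simp
  moreover have "(\<lambda>x\<in>carrier M. x) \<in> Hom R M (cor R (\<lambda>r. r) M)"
    by (rule HomI[OF assms]) (auto simp: M.smult_one)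
  ultimately show ?thesis by (simp add: isos_def c)
qed

lemma module_classD:
  assumes "module_class R \<U> \<X>"
  shows "M \<in> \<X> \<Longrightarrow> M \<in> RMod R \<U>" "M \<in> \<X> \<Longrightarrow> lmodule R M"
    "\<lbrakk>M \<in> \<X>; N \<in> RMod R \<U>; mod_iso R M N\<rbrakk> \<Longrightarrow> N \<in> \<X>"
  using assms by (auto simp: module_class_def RMod_def)

context small_universe
begin

lemma RMod_cor:
  assumes "nuhom R S \<iota>" "M \<in> RMod S \<U>"
  shows "cor R \<iota> M \<in> RMod R \<U>"
proof -
  have "carrier (cor R \<iota> M) \<subseteq> carrier M" by auto
  then show ?thesis
    using assms lmodule_cor[OF assms(1), of M] small_subset by (auto simp only: RMod_small)
qed

lemma cor_zero:
  assumes "nuhom R S \<iota>" "lmodule S M" "carrier M = {\<zero>\<^bsub>M\<^esub>}"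
  shows "carrier (cor R \<iota> M) = {\<zero>\<^bsub>cor R \<iota> M\<^esub>}"
proof -
  have "x \<in> carrier (cor R \<iota> M) \<longleftrightarrow> x = \<zero>\<^bsub>M\<^esub>" for x
    unfolding cor_simps(1) assms(3) using lmodule.smult_zero_right[OF assms(2) nuhomD(6)[OF assms(1)]] by auto
  then show ?thesis unfolding cor_simps(2) set_eq_iff singleton_iff by blast
qed

text \<open>An exact functor carries the finite sequence along, and the zero modules beyond its
  length k stay zero.\<close>

lemma cor_res_class:
  assumes h: "nuhom R S \<iota>" and \<X>: "\<And>X. X \<in> \<X> \<Longrightarrow> X \<in> RMod S \<U> \<and> cor R \<iota> X \<in> \<Y>"
    and M: "M \<in> res_class S \<U> m \<X>"
  shows "cor R \<iota> M \<in> res_class R \<U> m \<Y>"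
proof -
  obtain k X d e where X: "M \<in> RMod S \<U>" "k \<le> m" "resolution S X d e M" "\<And>i. i \<le> k \<Longrightarrow> X i \<in> \<X>"
    "\<And>i. i > k \<Longrightarrow> X i \<in> RMod S \<U> \<and> carrier (X i) = {\<zero>\<^bsub>X i\<^esub>}"
    using M unfolding res_class_def by blast
  have XS: "X i \<in> RMod S \<U>" for i using X(4,5) \<X> by (cases "i \<le> k") auto
  then have l: "lmodule S (X i)" for i by (simp add: RMod_def)
  show ?thesis
    unfolding res_class_def mem_Collect_eq
    by (intro conjI exI[of _ k] exI allI impI, rule RMod_cor[OF h X(1)], rule X(2), rule cor_resolution[OF h l X(3)])
      (use \<X> X(4,5) RMod_cor[OF h XS] cor_zero[OF h l] in auto)
qed

lemma cor_cores_class: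
  assumes h: "nuhom R S \<iota>" and \<X>: "\<And>X. X \<in> \<X> \<Longrightarrow> X \<in> RMod S \<U> \<and> cor R \<iota> X \<in> \<Y>"
    and M: "M \<in> cores_class S \<U> m \<X>"
  shows "cor R \<iota> M \<in> cores_class R \<U> m \<Y>"
proof -
  obtain k X d e where X: "M \<in> RMod S \<U>" "k \<le> m" "coresolution S M e X d" "\<And>i. i \<le> k \<Longrightarrow> X i \<in> \<X>"
    "\<And>i. i > k \<Longrightarrow> X i \<in> RMod S \<U> \<and> carrier (X i) = {\<zero>\<^bsub>X i\<^esub>}"
    using M unfolding cores_class_def by blast
  have XS: "X i \<in> RMod S \<U>" for i using X(4,5) \<X> by (cases "i \<le> k") auto
  then have l: "lmodule S (X i)" "lmodule S M" for i using X(1) by (simp_all add: RMod_def)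
  show ?thesis
    unfolding cores_class_def mem_Collect_eq
    by (intro conjI exI[of _ k] exI allI impI, rule RMod_cor[OF h X(1)], rule X(2), rule cor_coresolution[OF h l X(3)])
      (use \<X> X(4,5) RMod_cor[OF h XS] cor_zero[OF h l(1)] in auto)
qed

text \<open>In the first argument by comparison of resolutions; in the second by composing cocycles
  with the inclusion of Y and their solutions with the retraction.\<close>

lemma Ext_trivial_retract:
  assumes X: "X \<in> RMod R \<U>" "X' \<in> RMod R \<U>" "retract R X X'" and R: "small \<U> (carrier R)"
    and Y: "lmodule R Y" "lmodule R Y'" "retract R Y Y'"
    and t: "trivial_group (Ext R \<U> (Suc j) X' Y')"
  shows "trivial_group (Ext R \<U> (Suc j) X Y)"
proof -
  have ls: "lmodule R X" "lmodule R X'" "small \<U> (carrier X)" "small \<U> (carrier X')" using X by (auto simp: RMod_small)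
  obtain P d e where P: "proj_resolution R \<U> P d e X" using projective_resolution_exists[OF ls(1,3) R] by metis
  obtain Q d' e' where Q: "proj_resolution R \<U> Q d' e' X'" using projective_resolution_exists[OF ls(2,4) R] by metis
  have "ext_vanish R Q d' Y' j" using Ext_trivial_iff[OF Q X(2) Y(2)] t by blast
  then have v: "ext_vanish R P d Y' j" by (rule ext_vanish_retract[OF Q P X Y(2)])
  obtain i r where ir: "i \<in> Hom R Y Y'" "r \<in> Hom R Y' Y" "\<And>x. x \<in> carrier Y \<Longrightarrow> r (i x) = x"
    using Y(3) by (auto simp: retract_def)
  have l: "lmodule R (P i)" for i using P projectiveD(2)[of R \<U> "P i"] by (simp add: proj_resolution_def)
  note p = resolutionD[OF P[unfolded proj_resolution_def, THEN conjunct1]]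
  have "ext_vanish R P d Y j"
    unfolding ext_vanish_def
  proof (intro ballI impI)
    fix f assume f: "f \<in> Hom R (P (Suc j)) Y" and z: "\<forall>x\<in>carrier (P (Suc (Suc j))). f (d (Suc j) x) = \<zero>\<^bsub>Y\<^esub>"
    have "compose (carrier (P (Suc j))) i f (d (Suc j) x) = \<zero>\<^bsub>Y'\<^esub>" if x: "x \<in> carrier (P (Suc (Suc j)))" for x
      using z x HomE(2)[OF p(2) x] Hom_zero[OF Y(1,2) ir(1)] by (simp add: compose_eq)
    then obtain g where g: "g \<in> Hom R (P j) Y'"
      "\<And>x. x \<in> carrier (P (Suc j)) \<Longrightarrow> compose (carrier (P (Suc j))) i f x = g (d j x)"
      using ext_vanishD[OF v Hom_compose[OF l f ir(1)]] by metis
    have "f x = compose (carrier (P j)) r g (d j x)" if x: "x \<in> carrier (P (Suc j))" for x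
      using g(2)[OF x] x ir(3) HomE(2)[OF f x] HomE(2)[OF p(2) x] by (metis compose_eq)
    then show "\<exists>g\<in>Hom R (P j) Y. \<forall>x\<in>carrier (P (Suc j)). f x = g (d j x)"
      using Hom_compose[OF l g(1) ir(2)] by blast
  qed
  then show ?thesis using Ext_trivial_iff[OF P X(1) Y(1)] by blast
qed

end

section \<open>The components of a module over a triangular matrix ring\<close>

text \<open>The corner embeddings send 1 to a diagonal idempotent and in general not to 1, hence the
  treatment of non-unital maps.\<close>

definition inc_A where "inc_A U B a = (a, \<zero>\<^bsub>U\<^esub>, \<zero>\<^bsub>B\<^esub>)"
definition inc_B where "inc_B A U b = (\<zero>\<^bsub>A\<^esub>, \<zero>\<^bsub>U\<^esub>, b)"

lemma tri_ring_simps [simp]: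
  "carrier (tri_ring A U B) = carrier A \<times> carrier U \<times> carrier B"
  "\<one>\<^bsub>tri_ring A U B\<^esub> = (\<one>\<^bsub>A\<^esub>, \<zero>\<^bsub>U\<^esub>, \<one>\<^bsub>B\<^esub>)"
  "(a, u, b) \<oplus>\<^bsub>tri_ring A U B\<^esub> (a', u', b') = (a \<oplus>\<^bsub>A\<^esub> a', u \<oplus>\<^bsub>U\<^esub> u', b \<oplus>\<^bsub>B\<^esub> b')"
  "(a, u, b) \<otimes>\<^bsub>tri_ring A U B\<^esub> (a', u', b') = (a \<otimes>\<^bsub>A\<^esub> a', rsmult U u a' \<oplus>\<^bsub>U\<^esub> b \<odot>\<^bsub>U\<^esub> u', b \<otimes>\<^bsub>B\<^esub> b')"
  by (simp_all add: tri_ring_def)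

context bimodule
begin

lemma rsmult_zero_left: "a \<in> carrier A \<Longrightarrow> rsmult U \<zero>\<^bsub>U\<^esub> a = \<zero>\<^bsub>U\<^esub>"
  by (metis M.add.r_cancel_one' M.zero_closed M.r_zero rsmult_closed rsmult_l_distr)

lemma rsmult_zero_right: "u \<in> carrier U \<Longrightarrow> rsmult U u \<zero>\<^bsub>A\<^esub> = \<zero>\<^bsub>U\<^esub>"
  by (metis M.add.r_cancel_one' A.zero_closed A.r_zero rsmult_closed rsmult_r_distr)

lemma ring_tri_ring: "ring (tri_ring A U B)"
proof (rule ringI)
  show "abelian_group (tri_ring A U B)"
  proof (rule abelian_groupI)
    fix x assume "x \<in> carrier (tri_ring A U B)"
    then obtain a u b where x: "x = (a, u, b)" "a \<in> carrier A" "u \<in> carrier U" "b \<in> carrier B" by auto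
    then show "\<exists>y\<in>carrier (tri_ring A U B). y \<oplus>\<^bsub>tri_ring A U B\<^esub> x = \<zero>\<^bsub>tri_ring A U B\<^esub>"
      by (intro bexI[of _ "(\<ominus>\<^bsub>A\<^esub> a, \<ominus>\<^bsub>U\<^esub> u, \<ominus>\<^bsub>B\<^esub> b)"])
        (auto simp: A.l_neg R.l_neg M.l_neg tri_ring_def)
  qed (auto simp: A.a_ac R.a_ac M.a_ac tri_ring_def)
  show "monoid (tri_ring A U B)"
    by (rule monoidI) (auto simp: rsmult_closed smult_closed A.m_assoc R.m_assoc rsmult_l_distr smult_r_distr
      rsmult_assoc smult_assoc1 smult_rsmult M.a_assoc rsmult_zero_left smult_one rsmult_one smult_zero_right)
qed (auto simp: A.l_distr R.l_distr A.r_distr R.r_distr rsmult_closed smult_closed rsmult_r_distr rsmult_l_distr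
  smult_l_distr smult_r_distr M.a_ac)

lemma nuhom_tri:
  "nuhom A (tri_ring A U B) (inc_A U B)" "nuhom B (tri_ring A U B) (inc_B A U)"
  "nuhom (tri_ring A U B) A fst" "nuhom (tri_ring A U B) B (\<lambda>l. snd (snd l))"
  using ring_tri_ring A.ring_axioms R.ring_axioms
  by (auto simp: nuhom_def inc_A_def inc_B_def rsmult_zero_left rsmult_zero_right smult_zero_right)

text \<open>Because the upper right entry is zero, the diagonal idempotents e and f satisfy e
  \<Lambda> = e \<Lambda> e and \<Lambda> f = f \<Lambda> f. The first makes multiplication by e a
  linear map onto the first component, the second makes the second component a submodule. Both
  adjunctions rest on this.\<close>

lemma inc_mult:
  assumes "l \<in> carrier (tri_ring A U B)"
  shows "inc_A U B \<one>\<^bsub>A\<^esub> \<otimes>\<^bsub>tri_ring A U B\<^esub> l = inc_A U B (fst l) \<otimes>\<^bsub>tri_ring A U B\<^esub> inc_A U B \<one>\<^bsub>A\<^esub>"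
    and "l \<otimes>\<^bsub>tri_ring A U B\<^esub> inc_B A U \<one>\<^bsub>B\<^esub> = inc_B A U (snd (snd l))"
  using assms by (auto simp: inc_A_def inc_B_def rsmult_zero_left rsmult_zero_right smult_zero_right smult_zero_left)

text \<open>The first adjunction: a map from the first component extends to all of P by multiplying
  with the idempotent beforehand, and entries outside the A-corner then act as zero.\<close>

lemma Hom_tri_fst:
  assumes P: "lmodule (tri_ring A U B) P" and N: "lmodule A N"
    and f: "f \<in> Hom A (cor A (inc_A U B) P) N"
  shows "(\<lambda>x\<in>carrier P. f (inc_A U B \<one>\<^bsub>A\<^esub> \<odot>\<^bsub>P\<^esub> x)) \<in> Hom (tri_ring A U B) P (cor (tri_ring A U B) fst N)"
proof (rule HomI[OF P])
  interpret P: lmodule "tri_ring A U B" P by fact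
  interpret N: lmodule A N by fact
  let ?e = "inc_A U B \<one>\<^bsub>A\<^esub>"
  have e: "?e \<in> carrier (tri_ring A U B)" by (auto simp: inc_A_def)
  have ex: "?e \<odot>\<^bsub>P\<^esub> x \<in> carrier (cor A (inc_A U B) P)" if "x \<in> carrier P" for x
    by (rule cor_unit_mem[OF nuhom_tri(1) P that])
  fix x assume x: "x \<in> carrier P"
  show "f (?e \<odot>\<^bsub>P\<^esub> x) \<in> carrier (cor (tri_ring A U B) fst N)"
    using HomE(2)[OF f ex[OF x]] by (simp add: N.smult_one)
  show "f (?e \<odot>\<^bsub>P\<^esub> (l \<odot>\<^bsub>P\<^esub> x)) = l \<odot>\<^bsub>cor (tri_ring A U B) fst N\<^esub> f (?e \<odot>\<^bsub>P\<^esub> x)"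
    if l: "l \<in> carrier (tri_ring A U B)" for l
  proof -
    have l': "fst l \<in> carrier A" "inc_A U B (fst l) \<in> carrier (tri_ring A U B)" using l by (auto simp: inc_A_def)
    have "?e \<odot>\<^bsub>P\<^esub> (l \<odot>\<^bsub>P\<^esub> x) = inc_A U B (fst l) \<odot>\<^bsub>P\<^esub> (?e \<odot>\<^bsub>P\<^esub> x)"
      by (simp only: P.smult_assoc1[OF e l x, symmetric] inc_mult(1)[OF l] P.smult_assoc1[OF l'(2) e x])
    then show ?thesis using HomE(4)[OF f l'(1) ex[OF x]] by simp
  qed
  fix y assume y: "y \<in> carrier P"
  show "f (?e \<odot>\<^bsub>P\<^esub> (x \<oplus>\<^bsub>P\<^esub> y)) = f (?e \<odot>\<^bsub>P\<^esub> x) \<oplus>\<^bsub>cor (tri_ring A U B) fst N\<^esub> f (?e \<odot>\<^bsub>P\<^esub> y)"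
    using HomE(3)[OF f ex[OF x] ex[OF y]] by (simp only: P.smult_r_distr[OF e x y] cor_simps)
qed

lemma Hom_tri_fst_restrict:
  assumes P: "lmodule (tri_ring A U B) P" and f: "f \<in> Hom (tri_ring A U B) P (cor (tri_ring A U B) fst N)"
  shows "restrict f (carrier (cor A (inc_A U B) P)) \<in> Hom A (cor A (inc_A U B) P) N"
proof (rule HomI[OF lmodule_cor[OF nuhom_tri(1) P]])
  fix r x assume "r \<in> carrier A" "x \<in> carrier (cor A (inc_A U B) P)"
  then show "f (r \<odot>\<^bsub>cor A (inc_A U B) P\<^esub> x) = r \<odot>\<^bsub>N\<^esub> f x"
    using HomE(4)[OF f, of "inc_A U B r" x] by (simp add: inc_A_def)
qed (use HomE(2,3)[OF f] in simp_all)

text \<open>The second adjunction: on the second component of N only the B-entry of a matrix acts,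
  so a B-linear map into it is already linear over \<Lambda> as a map into N.\<close>

lemma Hom_tri_snd:
  assumes Q: "lmodule B Q" and N: "lmodule (tri_ring A U B) N"
    and f: "f \<in> Hom B Q (cor B (inc_B A U) N)"
  shows "f \<in> Hom (tri_ring A U B) (cor (tri_ring A U B) (\<lambda>l. snd (snd l)) Q) N"
proof -
  interpret Q: lmodule B Q by fact
  interpret N: lmodule "tri_ring A U B" N by fact
  let ?Q = "cor (tri_ring A U B) (\<lambda>l. snd (snd l)) Q"
  have c: "carrier ?Q = carrier Q" by (auto simp: Q.smult_one)
  have e: "inc_B A U \<one>\<^bsub>B\<^esub> \<in> carrier (tri_ring A U B)" by (auto simp: inc_B_def)
  have "restrict f (carrier ?Q) \<in> Hom (tri_ring A U B) ?Q N"
  proof (rule HomI[OF lmodule_cor[OF nuhom_tri(4) Q]])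
    fix l x assume l: "l \<in> carrier (tri_ring A U B)" and x: "x \<in> carrier ?Q"
    then have fx: "f x \<in> carrier N" "inc_B A U \<one>\<^bsub>B\<^esub> \<odot>\<^bsub>N\<^esub> f x = f x" using HomE(2)[OF f, of x] c by auto
    have "f (snd (snd l) \<odot>\<^bsub>Q\<^esub> x) = inc_B A U (snd (snd l)) \<odot>\<^bsub>N\<^esub> f x"
      using HomE(4)[OF f, of "snd (snd l)" x] l x c by auto
    also have "\<dots> = l \<odot>\<^bsub>N\<^esub> f x"
      using N.smult_assoc1[OF l e fx(1)] fx(2) inc_mult(2)[OF l] by simp
    finally show "f (l \<odot>\<^bsub>?Q\<^esub> x) = l \<odot>\<^bsub>N\<^esub> f x" by simp
  qed (use HomE(2,3)[OF f] c in auto)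
  moreover have "restrict f (carrier ?Q) = f"
    unfolding c using HomE(1)[OF f] by (simp add: PiE_def extensional_restrict)
  ultimately show ?thesis by simp
qed

lemma Hom_tri_snd':
  assumes Q: "lmodule B Q" and f: "f \<in> Hom (tri_ring A U B) (cor (tri_ring A U B) (\<lambda>l. snd (snd l)) Q) N"
  shows "f \<in> Hom B Q (cor B (inc_B A U) N)"
proof -
  interpret Q: lmodule B Q by fact
  let ?Q = "cor (tri_ring A U B) (\<lambda>l. snd (snd l)) Q"
  have c: "carrier ?Q = carrier Q" by (auto simp: Q.smult_one)
  have s: "f (b \<odot>\<^bsub>Q\<^esub> x) = inc_B A U b \<odot>\<^bsub>N\<^esub> f x" if "b \<in> carrier B" "x \<in> carrier Q" for b x
    using HomE(4)[OF f, of "inc_B A U b" x] that c by (simp add: inc_B_def)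
  have "restrict f (carrier Q) \<in> Hom B Q (cor B (inc_B A U) N)"
    using HomE(2,3)[OF f] s c by (intro HomI[OF Q]) (auto simp: s[symmetric] Q.smult_one)
  moreover have "restrict f (carrier Q) = f"
    unfolding c[symmetric] using HomE(1)[OF f] by (simp add: PiE_def extensional_restrict)
  ultimately show ?thesis by simp
qed

end

section \<open>Projectives and Ext under the component functors\<close>

locale triangular = bimodule B A U + small_universe \<U>
  for A :: "'a ring" (structure) and B :: "'b ring" (structure) and U :: "('b, 'u, 'a) bimodule" (structure)
    and \<U> :: "'m set set" +
  assumes powers_A: "closed_under_powers \<U> (carrier A)"
    and powers_B: "closed_under_powers \<U> (carrier B)"
    and powers_U: "closed_under_powers \<U> (carrier U)"
begin

abbreviation \<Lambda> where "\<Lambda> \<equiv> tri_ring A U B"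
abbreviation comp\<^sub>1 where "comp\<^sub>1 L \<equiv> cor A (inc_A U B) L"
abbreviation comp\<^sub>2 where "comp\<^sub>2 L \<equiv> cor B (inc_B A U) L"
abbreviation emb\<^sub>1 where "emb\<^sub>1 M \<equiv> cor \<Lambda> fst M"
abbreviation emb\<^sub>2 where "emb\<^sub>2 N \<equiv> cor \<Lambda> (\<lambda>l. snd (snd l)) N"

lemma small_rings: "small \<U> (carrier A)" "small \<U> (carrier B)" "small \<U> (carrier \<Lambda>)"
  by (simp_all add: small_index powers_A powers_B powers_U small_Times)

lemma projective_comp\<^sub>1:
  assumes P: "projective \<Lambda> \<U> P"
  shows "projective A \<U> (comp\<^sub>1 P)"
  unfolding projective_def
proof (intro conjI ballI impI)
  show "comp\<^sub>1 P \<in> RMod A \<U>" using RMod_cor[OF nuhom_tri(1)] projectiveD(1)[OF P] .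
  fix M N q h
  assume *: "M \<in> RMod A \<U>" "N \<in> RMod A \<U>" "q \<in> Hom A M N" "h \<in> Hom A (comp\<^sub>1 P) N" "q ` carrier M = carrier N"
  have l: "lmodule A M" "lmodule A N" "lmodule \<Lambda> P" using * projectiveD(2)[OF P] by (auto simp: RMod_def)
  interpret M: lmodule A M by (rule l)
  interpret N: lmodule A N by (rule l)
  have c: "carrier (emb\<^sub>1 M) = carrier M" "carrier (emb\<^sub>1 N) = carrier N" by (auto simp: M.smult_one N.smult_one)
  let ?h = "\<lambda>x\<in>carrier P. h (inc_A U B \<one>\<^bsub>A\<^esub> \<odot>\<^bsub>P\<^esub> x)"
  have h: "?h \<in> Hom \<Lambda> P (emb\<^sub>1 N)" by (rule Hom_tri_fst[OF l(3,2) *(4)])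
  note q = cor_Hom[OF nuhom_tri(3) l(1) *(3)]
  obtain k where k: "k \<in> Hom \<Lambda> P (emb\<^sub>1 M)" "\<And>x. x \<in> carrier P \<Longrightarrow> restrict q (carrier (emb\<^sub>1 M)) (k x) = ?h x"
  proof (rule projective_lift[OF P RMod_cor[OF nuhom_tri(3) *(2)] RMod_cor[OF nuhom_tri(3) *(1)] h q])
    fix x assume "x \<in> carrier P"
    then have "?h x \<in> carrier N" using HomE(2)[OF h] c by blast
    then show "\<exists>y\<in>carrier (emb\<^sub>1 M). ?h x = restrict q (carrier (emb\<^sub>1 M)) y" unfolding c using *(5) by auto
  qed blast
  note k' = Hom_tri_fst_restrict[OF l(3) k(1)]
  show "\<exists>k\<in>Hom A (comp\<^sub>1 P) M. compose (carrier (comp\<^sub>1 P)) q k = h"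
  proof (intro bexI[OF _ k'] Hom_eqI[OF Hom_compose[OF lmodule_cor[OF nuhom_tri(1) l(3)] k' *(3)] *(4)] refl)
    fix x assume x: "x \<in> carrier (comp\<^sub>1 P)"
    then have xP: "x \<in> carrier P" "inc_A U B \<one>\<^bsub>A\<^esub> \<odot>\<^bsub>P\<^esub> x = x" by auto
    have "k x \<in> carrier M" using HomE(2)[OF k(1) xP(1)] c by blast
    then show "compose (carrier (comp\<^sub>1 P)) q (restrict k (carrier (comp\<^sub>1 P))) x = h x"
      using k(2)[OF xP(1)] x xP unfolding c by (simp add: compose_def)
  qed
qed

lemma projective_emb\<^sub>2:
  assumes Q: "projective B \<U> Q"
  shows "projective \<Lambda> \<U> (emb\<^sub>2 Q)"
  unfolding projective_def
proof (intro conjI ballI impI)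
  show "emb\<^sub>2 Q \<in> RMod \<Lambda> \<U>" using RMod_cor[OF nuhom_tri(4)] projectiveD(1)[OF Q] .
  fix M N q h
  assume *: "M \<in> RMod \<Lambda> \<U>" "N \<in> RMod \<Lambda> \<U>" "q \<in> Hom \<Lambda> M N" "h \<in> Hom \<Lambda> (emb\<^sub>2 Q) N" "q ` carrier M = carrier N"
  have l: "lmodule \<Lambda> M" "lmodule \<Lambda> N" "lmodule B Q" using * projectiveD(2)[OF Q] by (auto simp: RMod_def)
  interpret Q: lmodule B Q by (rule l)
  have c: "carrier (emb\<^sub>2 Q) = carrier Q" by (auto simp: Q.smult_one)
  have h: "h \<in> Hom B Q (comp\<^sub>2 N)" by (rule Hom_tri_snd'[OF l(3) *(4)])
  note q = cor_Hom[OF nuhom_tri(2) l(1) *(3)]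
  obtain k where k: "k \<in> Hom B Q (comp\<^sub>2 M)" "\<And>x. x \<in> carrier Q \<Longrightarrow> restrict q (carrier (comp\<^sub>2 M)) (k x) = h x"
  proof (rule projective_lift[OF Q RMod_cor[OF nuhom_tri(2) *(2)] RMod_cor[OF nuhom_tri(2) *(1)] h q])
    fix x assume "x \<in> carrier Q"
    then have "h x \<in> carrier (comp\<^sub>2 N)" using HomE(2)[OF h] by blast
    then show "\<exists>y\<in>carrier (comp\<^sub>2 M). h x = restrict q (carrier (comp\<^sub>2 M)) y"
      using *(5) by (intro cor_image[OF nuhom_tri(2) l(1) *(3)]) auto
  qed blast
  note k' = Hom_tri_snd[OF l(3,1) k(1)]
  show "\<exists>k\<in>Hom \<Lambda> (emb\<^sub>2 Q) M. compose (carrier (emb\<^sub>2 Q)) q k = h"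
  proof (intro bexI[OF _ k'] Hom_eqI[OF Hom_compose[OF lmodule_cor[OF nuhom_tri(4) l(3)] k' *(3)] *(4)] refl)
    fix x assume x: "x \<in> carrier (emb\<^sub>2 Q)"
    then show "compose (carrier (emb\<^sub>2 Q)) q k x = h x"
      using k(2)[of x] HomE(2)[OF k(1), of x] unfolding c by (simp add: compose_def)
  qed
qed

lemma Ext_trivial_comp\<^sub>1:
  assumes X: "X \<in> RMod \<Lambda> \<U>" and D: "D \<in> RMod A \<U>" and t: "trivial_group (Ext \<Lambda> \<U> (Suc j) X (emb\<^sub>1 D))"
  shows "trivial_group (Ext A \<U> (Suc j) (comp\<^sub>1 X) D)"
proof -
  have l: "lmodule \<Lambda> X" "lmodule A D" using X D by (auto simp: RMod_def)
  obtain P d e where P: "proj_resolution \<Lambda> \<U> P d e X"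
    using projective_resolution_exists[OF l(1) _ small_rings(3)] X by (metis RMod_small)
  have pr: "projective \<Lambda> \<U> (P i)" for i using P by (simp add: proj_resolution_def)
  have lP: "lmodule \<Lambda> (P i)" for i using projectiveD(2)[OF pr] .
  note p = resolutionD[OF P[unfolded proj_resolution_def, THEN conjunct1]]
  have v: "ext_vanish \<Lambda> P d (emb\<^sub>1 D) j"
    using Ext_trivial_iff[OF P X lmodule_cor[OF nuhom_tri(3) l(2)]] t by blast
  define d' where "d' i = restrict (d i) (carrier (comp\<^sub>1 (P (Suc i))))" for i
  define e' where "e' = restrict e (carrier (comp\<^sub>1 (P 0)))"
  have P': "proj_resolution A \<U> (\<lambda>i. comp\<^sub>1 (P i)) d' e' (comp\<^sub>1 X)"
    using cor_resolution[OF nuhom_tri(1) lP P[unfolded proj_resolution_def, THEN conjunct1]] projective_comp\<^sub>1[OF pr]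
    unfolding proj_resolution_def d'_def e'_def by blast
  have "ext_vanish A (\<lambda>i. comp\<^sub>1 (P i)) d' D j"
    unfolding ext_vanish_def
  proof (intro ballI impI)
    fix f assume f: "f \<in> Hom A (comp\<^sub>1 (P (Suc j))) D"
      and z: "\<forall>x\<in>carrier (comp\<^sub>1 (P (Suc (Suc j)))). f (d' (Suc j) x) = \<zero>\<^bsub>D\<^esub>"
    let ?e = "inc_A U B \<one>\<^bsub>A\<^esub>"
    \<comment> \<open>The cocycle f on the first components is carried to P by the adjunction and
      solved there; the solution is restricted back.\<close>
    let ?f = "\<lambda>x\<in>carrier (P (Suc j)). f (?e \<odot>\<^bsub>P (Suc j)\<^esub> x)"
    have f': "?f \<in> Hom \<Lambda> (P (Suc j)) (emb\<^sub>1 D)" by (rule Hom_tri_fst[OF lP l(2) f])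
    have "?f (d (Suc j) x) = \<zero>\<^bsub>emb\<^sub>1 D\<^esub>" if x: "x \<in> carrier (P (Suc (Suc j)))" for x
    proof -
      have ex: "?e \<odot>\<^bsub>P (Suc (Suc j))\<^esub> x \<in> carrier (comp\<^sub>1 (P (Suc (Suc j))))" by (rule cor_unit_mem[OF nuhom_tri(1) lP x])
      have "?e \<odot>\<^bsub>P (Suc j)\<^esub> d (Suc j) x = d' (Suc j) (?e \<odot>\<^bsub>P (Suc (Suc j))\<^esub> x)"
        using ex HomE(4)[OF p(2) nuhomD(6)[OF nuhom_tri(1)] x] by (simp add: d'_def)
      then show ?thesis using z ex HomE(2)[OF p(2) x] by simp
    qed
    then obtain g where g: "g \<in> Hom \<Lambda> (P j) (emb\<^sub>1 D)" "\<And>x. x \<in> carrier (P (Suc j)) \<Longrightarrow> ?f x = g (d j x)"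
      using ext_vanishD[OF v f'] by metis
    have "f x = restrict g (carrier (comp\<^sub>1 (P j))) (d' j x)" if x: "x \<in> carrier (comp\<^sub>1 (P (Suc j)))" for x
      using g(2)[of x] x HomE(2)[OF cor_Hom[OF nuhom_tri(1) lP p(2)] x] by (simp add: d'_def)
    then show "\<exists>g\<in>Hom A (comp\<^sub>1 (P j)) D. \<forall>x\<in>carrier (comp\<^sub>1 (P (Suc j))). f x = g (d' j x)"
      using Hom_tri_fst_restrict[OF lP g(1)] by blast
  qed
  then show ?thesis using Ext_trivial_iff[OF P' RMod_cor[OF nuhom_tri(1) X] l(2)] by blast
qed

lemma Ext_trivial_emb\<^sub>2:
  assumes E: "E \<in> RMod B \<U>" and Y: "Y \<in> RMod \<Lambda> \<U>" and t: "trivial_group (Ext \<Lambda> \<U> (Suc j) (emb\<^sub>2 E) Y)"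
  shows "trivial_group (Ext B \<U> (Suc j) E (comp\<^sub>2 Y))"
proof -
  have l: "lmodule B E" "lmodule \<Lambda> Y" using E Y by (auto simp: RMod_def)
  obtain P d e where P: "proj_resolution B \<U> P d e E"
    using projective_resolution_exists[OF l(1) _ small_rings(2)] E by (metis RMod_small)
  have pr: "projective B \<U> (P i)" for i using P by (simp add: proj_resolution_def)
  have lP: "lmodule B (P i)" for i using projectiveD(2)[OF pr] .
  have c: "carrier (emb\<^sub>2 (P i)) = carrier (P i)" for i by (auto simp: lmodule.smult_one[OF lP])
  note p = resolutionD[OF P[unfolded proj_resolution_def, THEN conjunct1]]
  define d' where "d' i = restrict (d i) (carrier (emb\<^sub>2 (P (Suc i))))" for i
  define e' where "e' = restrict e (carrier (emb\<^sub>2 (P 0)))"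
  have P': "proj_resolution \<Lambda> \<U> (\<lambda>i. emb\<^sub>2 (P i)) d' e' (emb\<^sub>2 E)"
    using cor_resolution[OF nuhom_tri(4) lP P[unfolded proj_resolution_def, THEN conjunct1]] projective_emb\<^sub>2[OF pr]
    unfolding proj_resolution_def d'_def e'_def by blast
  have v: "ext_vanish \<Lambda> (\<lambda>i. emb\<^sub>2 (P i)) d' Y j"
    using Ext_trivial_iff[OF P' RMod_cor[OF nuhom_tri(4) E] l(2)] t by blast
  have "ext_vanish B P d (comp\<^sub>2 Y) j"
    unfolding ext_vanish_def
  proof (intro ballI impI)
    fix f assume f: "f \<in> Hom B (P (Suc j)) (comp\<^sub>2 Y)"
      and z: "\<forall>x\<in>carrier (P (Suc (Suc j))). f (d (Suc j) x) = \<zero>\<^bsub>comp\<^sub>2 Y\<^esub>"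
    \<comment> \<open>The carriers on both sides agree, so a cocycle with values in the second
      component of Y is read without change as a cocycle with values in Y.\<close>
    obtain g where g: "g \<in> Hom \<Lambda> (emb\<^sub>2 (P j)) Y" "\<And>x. x \<in> carrier (emb\<^sub>2 (P (Suc j))) \<Longrightarrow> f x = g (d' j x)"
    proof (rule ext_vanishD[OF v Hom_tri_snd[OF lP l(2) f]])
      fix x assume "x \<in> carrier (emb\<^sub>2 (P (Suc (Suc j))))"
      then show "f (d' (Suc j) x) = \<zero>\<^bsub>Y\<^esub>" using z unfolding d'_def c by simp
    qed blast
    have "f x = g (d j x)" if "x \<in> carrier (P (Suc j))" for x
      using g(2)[of x] that unfolding d'_def c by simp
    then show "\<exists>g\<in>Hom B (P j) (comp\<^sub>2 Y). \<forall>x\<in>carrier (P (Suc j)). f x = g (d j x)"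
      using Hom_tri_snd'[OF lP g(1)] by blast
  qed
  then show ?thesis using Ext_trivial_iff[OF P E lmodule_cor[OF nuhom_tri(2) l(2)]] by blast
qed

end

section \<open>Tensor products\<close>

text \<open>The generators of \<open>tensor_rels\<close>, named separately so that invariance under
  a push of formal sums can be checked on them.\<close>

definition tensor_relators ::
  "('a, 'x) ring_scheme \<Rightarrow> ('b, 'u, 'a, 'y) bimodule_scheme \<Rightarrow> ('a, 'm, 'z) module_scheme \<Rightarrow> ('u \<times> 'm \<Rightarrow>\<^sub>0 int) set"
  where "tensor_relators A U M =
    {frag_of (u \<oplus>\<^bsub>U\<^esub> v, x) - frag_of (u, x) - frag_of (v, x) | u v x.
        u \<in> carrier U \<and> v \<in> carrier U \<and> x \<in> carrier M} \<union>
     {frag_of (u, x \<oplus>\<^bsub>M\<^esub> y) - frag_of (u, x) - frag_of (u, y) | u x y.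
        u \<in> carrier U \<and> x \<in> carrier M \<and> y \<in> carrier M} \<union>
     {frag_of (rsmult U u a, x) - frag_of (u, a \<odot>\<^bsub>M\<^esub> x) | u a x.
        u \<in> carrier U \<and> a \<in> carrier A \<and> x \<in> carrier M}"

lemma tensor_rels_eq: "tensor_rels A U M = generate (free_Abelian_group (carrier U \<times> carrier M)) (tensor_relators A U M)"
  by (simp add: tensor_rels_def tensor_relators_def)

text \<open>The target is written multiplicatively, so that quotient groups and
  \<open>add_monoid N\<close> both qualify.\<close>

definition balanced ::
  "('a, 'x) ring_scheme \<Rightarrow> ('b, 'u, 'a, 'y) bimodule_scheme \<Rightarrow> ('a, 'm, 'z) module_scheme \<Rightarrow> ('n, 'w) monoid_scheme \<Rightarrow>
    ('u \<Rightarrow> 'm \<Rightarrow> 'n) \<Rightarrow> bool"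
  where "balanced A U M G \<beta> \<longleftrightarrow>
    (\<forall>u\<in>carrier U. \<forall>x\<in>carrier M. \<beta> u x \<in> carrier G) \<and>
    (\<forall>u\<in>carrier U. \<forall>v\<in>carrier U. \<forall>x\<in>carrier M. \<beta> (u \<oplus>\<^bsub>U\<^esub> v) x = \<beta> u x \<otimes>\<^bsub>G\<^esub> \<beta> v x) \<and>
    (\<forall>u\<in>carrier U. \<forall>x\<in>carrier M. \<forall>y\<in>carrier M. \<beta> u (x \<oplus>\<^bsub>M\<^esub> y) = \<beta> u x \<otimes>\<^bsub>G\<^esub> \<beta> u y) \<and>
    (\<forall>u\<in>carrier U. \<forall>a\<in>carrier A. \<forall>x\<in>carrier M. \<beta> (rsmult U u a) x = \<beta> u (a \<odot>\<^bsub>M\<^esub> x))"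

lemma tensor_push_mem:
  assumes "c \<in> carrier (free_Abelian_group S)" "\<And>q. q \<in> S \<Longrightarrow> h q \<in> S'"
  shows "tensor_push h c \<in> carrier (free_Abelian_group S')"
  using assms keys_frag_extend[of "\<lambda>i. frag_of (h i)" c] by (fastforce simp: tensor_push_def)

section \<open>The tensor product as a quotient group and its universal property\<close>

context bimodule
begin

context
  fixes M :: "('d, 'm, 'z) module_scheme"
  assumes M: "lmodule A M"
begin

interpretation N: lmodule A M by (rule M)

private abbreviation (input) F where "F \<equiv> free_Abelian_group (carrier U \<times> carrier M)"

interpretation F: comm_group F by (rule abelian_free_Abelian_group)

lemma tensor_relators_subset: "tensor_relators A U M \<subseteq> carrier F"
proof
  have "Poly_Mapping.keys (frag_of p - frag_of q - frag_of r) \<subseteq> carrier U \<times> carrier M"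
    if "p \<in> carrier U \<times> carrier M" "q \<in> carrier U \<times> carrier M" "r \<in> carrier U \<times> carrier M" for p q r
    using that keys_diff[of "frag_of p - frag_of q" "frag_of r"] keys_diff[of "frag_of p" "frag_of q"]
    by (auto split: if_splits)
  moreover have "Poly_Mapping.keys (frag_of p - frag_of q) \<subseteq> carrier U \<times> carrier M"
    if "p \<in> carrier U \<times> carrier M" "q \<in> carrier U \<times> carrier M" for p q
    using that keys_diff[of "frag_of p" "frag_of q"] by (auto split: if_splits)
  moreover fix c assume "c \<in> tensor_relators A U M"
  ultimately show "c \<in> carrier F"
    unfolding tensor_relators_def carrier_free_Abelian_group_iff
    by (elim UnE CollectE exE conjE; simp only:) (simp_all add: rsmult_closed N.smult_closed)
qed

lemma subgroup_tensor_rels: "subgroup (tensor_rels A U M) F"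
  unfolding tensor_rels_eq by (rule F.generate_is_subgroup[OF tensor_relators_subset])

lemma normal_tensor_rels: "tensor_rels A U M \<lhd> F"
  using F.normal_iff_subgroup subgroup_tensor_rels by blast

lemma comm_group_tensor: "comm_group (tensor_group A U M)"
  unfolding tensor_group_def by (rule F.abelian_FactGroup[OF subgroup_tensor_rels])

interpretation T: comm_group "tensor_group A U M" by (rule comm_group_tensor)

lemma tensor_module_simps:
  "carrier (tensor_module A U M) = carrier (tensor_group A U M)"
  "\<zero>\<^bsub>tensor_module A U M\<^esub> = \<one>\<^bsub>tensor_group A U M\<^esub>"
  "s \<oplus>\<^bsub>tensor_module A U M\<^esub> t = s \<otimes>\<^bsub>tensor_group A U M\<^esub> t"
  by (simp_all add: tensor_module_def)

lemma abelian_group_tensor: "abelian_group (tensor_module A U M)"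
  by (rule abelian_groupI) (auto simp: tensor_module_simps T.m_ac intro: T.l_inv_ex)

interpretation TM: abelian_group "tensor_module A U M" by (rule abelian_group_tensor)

private abbreviation (input) coset where "coset c \<equiv> tensor_rels A U M #>\<^bsub>F\<^esub> c"

lemma coset_closed: "c \<in> carrier F \<Longrightarrow> coset c \<in> carrier (tensor_module A U M)"
  by (auto simp: tensor_module_simps tensor_group_def carrier_FactGroup simp del: carrier_free_Abelian_group_iff)

lemma coset_add:
  "\<lbrakk>c \<in> carrier F; d \<in> carrier F\<rbrakk> \<Longrightarrow> coset (c + d) = coset c \<oplus>\<^bsub>tensor_module A U M\<^esub> coset d"
  using normal.rcos_sum[OF normal_tensor_rels, of c d]
  by (simp add: tensor_module_simps tensor_group_def)

lemma coset_rels: "c \<in> tensor_rels A U M \<Longrightarrow> coset c = \<zero>\<^bsub>tensor_module A U M\<^esub>"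
  using F.coset_join2[OF _ subgroup_tensor_rels] subgroup.mem_carrier[OF subgroup_tensor_rels]
  by (simp add: tensor_module_simps tensor_group_def del: carrier_free_Abelian_group_iff)

lemma coset_zero: "coset 0 = \<zero>\<^bsub>tensor_module A U M\<^esub>"
  using coset_rels subgroup.one_closed[OF subgroup_tensor_rels] by simp

lemma coset_uminus:
  assumes "c \<in> carrier F"
  shows "coset (- c) = \<ominus>\<^bsub>tensor_module A U M\<^esub> coset c"
proof -
  have m: "- c \<in> carrier F" using assms by simp
  have "coset (- c) \<oplus>\<^bsub>tensor_module A U M\<^esub> coset c = \<zero>\<^bsub>tensor_module A U M\<^esub>"
    using coset_add[OF m assms] coset_zero by simp
  then show ?thesis using coset_closed assms m TM.minus_equality by metis
qed

lemma coset_eq_of_rels: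
  assumes "c \<in> carrier F" "d \<in> carrier F" "c - d \<in> tensor_relators A U M"
  shows "coset c = coset d"
proof -
  have r: "c - d \<in> tensor_rels A U M" unfolding tensor_rels_eq by (rule generate.incl[OF assms(3)])
  then have "c - d \<in> carrier F" using subgroup.mem_carrier[OF subgroup_tensor_rels] by blast
  then have "coset ((c - d) + d) = \<zero>\<^bsub>tensor_module A U M\<^esub> \<oplus>\<^bsub>tensor_module A U M\<^esub> coset d"
    using coset_add assms(2) coset_rels[OF r] by metis
  then show ?thesis using coset_closed[OF assms(2)] by simp
qed

private abbreviation (input) pure where "pure \<equiv> pure_tensor A U M"

lemma frag_of_mem: "u \<in> carrier U \<Longrightarrow> x \<in> carrier M \<Longrightarrow> frag_of (u, x) \<in> carrier F"
  by simp

lemma frag_add_mem: "c \<in> carrier F \<Longrightarrow> d \<in> carrier F \<Longrightarrow> c + d \<in> carrier F"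
  using F.m_closed by simp

lemma pure_closed: "u \<in> carrier U \<Longrightarrow> x \<in> carrier M \<Longrightarrow> pure u x \<in> carrier (tensor_module A U M)"
  unfolding pure_tensor_def by (rule coset_closed) simp

lemma pure_add_left:
  assumes "u \<in> carrier U" "v \<in> carrier U" "x \<in> carrier M"
  shows "pure (u \<oplus>\<^bsub>U\<^esub> v) x = pure u x \<oplus>\<^bsub>tensor_module A U M\<^esub> pure v x"
proof -
  note f = frag_of_mem[OF assms(1,3)] frag_of_mem[OF assms(2,3)]
  have "frag_of (u \<oplus>\<^bsub>U\<^esub> v, x) - (frag_of (u, x) + frag_of (v, x)) \<in> tensor_relators A U M"
    using assms unfolding tensor_relators_def diff_diff_eq[symmetric] by blast
  then have "coset (frag_of (u \<oplus>\<^bsub>U\<^esub> v, x)) = coset (frag_of (u, x) + frag_of (v, x))"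
    using assms f by (intro coset_eq_of_rels frag_add_mem frag_of_mem) auto
  then show ?thesis unfolding pure_tensor_def coset_add[OF f] .
qed

lemma pure_add_right:
  assumes "u \<in> carrier U" "x \<in> carrier M" "y \<in> carrier M"
  shows "pure u (x \<oplus>\<^bsub>M\<^esub> y) = pure u x \<oplus>\<^bsub>tensor_module A U M\<^esub> pure u y"
proof -
  note f = frag_of_mem[OF assms(1,2)] frag_of_mem[OF assms(1,3)]
  have "frag_of (u, x \<oplus>\<^bsub>M\<^esub> y) - (frag_of (u, x) + frag_of (u, y)) \<in> tensor_relators A U M"
    using assms unfolding tensor_relators_def diff_diff_eq[symmetric] by blast
  then have "coset (frag_of (u, x \<oplus>\<^bsub>M\<^esub> y)) = coset (frag_of (u, x) + frag_of (u, y))"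
    using assms f by (intro coset_eq_of_rels frag_add_mem frag_of_mem) auto
  then show ?thesis unfolding pure_tensor_def coset_add[OF f] .
qed

lemma pure_balanced:
  assumes "u \<in> carrier U" "a \<in> carrier A" "x \<in> carrier M"
  shows "pure (rsmult U u a) x = pure u (a \<odot>\<^bsub>M\<^esub> x)"
  unfolding pure_tensor_def
proof (rule coset_eq_of_rels)
  show "frag_of (rsmult U u a, x) - frag_of (u, a \<odot>\<^bsub>M\<^esub> x) \<in> tensor_relators A U M"
    using assms unfolding tensor_relators_def by blast
qed (use assms in \<open>simp_all add: rsmult_closed N.smult_closed\<close>)

text \<open>Minus signs are absorbed by U, so sums of pure tensors are closed under negation; this
  is why the induction principle for tensors gets by without a case for it.\<close>

lemma pure_uminus:
  assumes "u \<in> carrier U" "x \<in> carrier M"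
  shows "\<ominus>\<^bsub>tensor_module A U M\<^esub> pure u x = pure (\<ominus>\<^bsub>U\<^esub> u) x"
proof -
  let ?T = "tensor_module A U M"
  have u: "\<ominus>\<^bsub>U\<^esub> u \<in> carrier U" using assms(1) by simp
  have z: "pure \<zero>\<^bsub>U\<^esub> x = \<zero>\<^bsub>?T\<^esub>"
    using pure_add_left[OF M.zero_closed M.zero_closed assms(2)] pure_closed[OF M.zero_closed assms(2)]
    by (metis M.l_zero M.zero_closed TM.add.r_cancel_one')
  have "pure (\<ominus>\<^bsub>U\<^esub> u) x \<oplus>\<^bsub>?T\<^esub> pure u x = \<zero>\<^bsub>?T\<^esub>"
    unfolding pure_add_left[OF u assms, symmetric] using assms(1) z by (simp add: M.l_neg)
  then show ?thesis using pure_closed u assms TM.minus_equality by metis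
qed

lemma tensor_induct:
  assumes t: "t \<in> carrier (tensor_module A U M)" and z: "P \<zero>\<^bsub>tensor_module A U M\<^esub>"
    and p: "\<And>u x. \<lbrakk>u \<in> carrier U; x \<in> carrier M\<rbrakk> \<Longrightarrow> P (pure u x)"
    and a: "\<And>s t. \<lbrakk>s \<in> carrier (tensor_module A U M); t \<in> carrier (tensor_module A U M); P s; P t\<rbrakk> \<Longrightarrow>
      P (s \<oplus>\<^bsub>tensor_module A U M\<^esub> t)"
  shows "P t"
proof -
  let ?T = "tensor_module A U M"
  obtain c where c: "Poly_Mapping.keys c \<subseteq> carrier U \<times> carrier M" "t = coset c"
    using t by (auto simp: tensor_module_simps tensor_group_def carrier_FactGroup)
  \<comment> \<open>Induction on the free abelian group has a case for differences. Carrying the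
    negative along with each element reduces that case to sums.\<close>
  have "P (coset c) \<and> P (\<ominus>\<^bsub>?T\<^esub> coset c)"
    using c(1)
  proof (rule free_Abelian_group_induct[where P = "\<lambda>c. P (coset c) \<and> P (\<ominus>\<^bsub>?T\<^esub> coset c)"])
    show "P (coset 0) \<and> P (\<ominus>\<^bsub>?T\<^esub> coset 0)" using z TM.minus_equality[OF TM.l_zero[OF TM.zero_closed] TM.zero_closed TM.zero_closed] by (simp only: coset_zero)
  next
    fix x y
    assume 2: "Poly_Mapping.keys x \<subseteq> carrier U \<times> carrier M" "Poly_Mapping.keys y \<subseteq> carrier U \<times> carrier M"
      "P (coset x) \<and> P (\<ominus>\<^bsub>?T\<^esub> coset x)" "P (coset y) \<and> P (\<ominus>\<^bsub>?T\<^esub> coset y)"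
    then have xy: "x \<in> carrier F" "- y \<in> carrier F" "y \<in> carrier F" by simp_all
    note cl = coset_closed[OF xy(1)] coset_closed[OF xy(3)]
    have e: "coset (x - y) = coset x \<oplus>\<^bsub>?T\<^esub> \<ominus>\<^bsub>?T\<^esub> coset y"
      using coset_add[OF xy(1,2)] coset_uminus[OF xy(3)] by simp
    have e': "\<ominus>\<^bsub>?T\<^esub> coset (x - y) = \<ominus>\<^bsub>?T\<^esub> coset x \<oplus>\<^bsub>?T\<^esub> coset y"
      unfolding e using cl by (simp add: TM.minus_add)
    show "P (coset (x - y)) \<and> P (\<ominus>\<^bsub>?T\<^esub> coset (x - y))" unfolding e' unfolding e using a 2 cl by simp
  next
    fix q assume "q \<in> carrier U \<times> carrier M"
    then obtain u x where q: "q = (u, x)" "u \<in> carrier U" "x \<in> carrier M" by auto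
    show "P (coset (frag_of q)) \<and> P (\<ominus>\<^bsub>?T\<^esub> coset (frag_of q))"
      using p[OF q(2,3)] p[of "\<ominus>\<^bsub>U\<^esub> u" x] pure_uminus[OF q(2,3)] q by (simp add: pure_tensor_def)
  qed
  then show ?thesis using c(2) by blast
qed

text \<open>\<beta> extends freely to formal sums; the extension kills the relators, hence the
  subgroup they generate, and descends to the quotient.\<close>

lemma tensor_universal:
  assumes G: "comm_group G" and \<beta>: "balanced A U M G \<beta>"
  obtains h where "\<And>t. t \<in> carrier (tensor_module A U M) \<Longrightarrow> h t \<in> carrier G"
    "\<And>s t. \<lbrakk>s \<in> carrier (tensor_module A U M); t \<in> carrier (tensor_module A U M)\<rbrakk> \<Longrightarrow>
      h (s \<oplus>\<^bsub>tensor_module A U M\<^esub> t) = h s \<otimes>\<^bsub>G\<^esub> h t"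
    "\<And>u x. \<lbrakk>u \<in> carrier U; x \<in> carrier M\<rbrakk> \<Longrightarrow> h (pure u x) = \<beta> u x"
proof -
  interpret G: comm_group G by fact
  note b = \<beta>[unfolded balanced_def]
  have "(\<lambda>(u, x). \<beta> u x) ` (carrier U \<times> carrier M) \<subseteq> carrier G" using b by auto
  then obtain k where k: "k \<in> hom F G" "\<And>q. q \<in> carrier U \<times> carrier M \<Longrightarrow> k (frag_of q) = (case q of (u, x) \<Rightarrow> \<beta> u x)"
    using G.free_Abelian_group_universal by metis
  interpret k: group_hom F G k by unfold_locales (rule k)
  have ka: "k (c + d) = k c \<otimes>\<^bsub>G\<^esub> k d" if "c \<in> carrier F" "d \<in> carrier F" for c d
    using k.hom_mult[OF that] by simp
  have kd: "k c = k d" if "c \<in> carrier F" "d \<in> carrier F" "k (c - d) = \<one>\<^bsub>G\<^esub>" for c d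
  proof -
    have m: "c - d \<in> carrier F" using that(1,2) keys_diff[of c d] by auto
    have "k c = k (c - d) \<otimes>\<^bsub>G\<^esub> k d" using ka[OF m that(2)] by simp
    then show ?thesis using that(3) k.hom_closed[OF that(2)] by simp
  qed
  have kd': "k (c - d) = \<one>\<^bsub>G\<^esub>" if "c \<in> carrier F" "d \<in> carrier F" "k c = k d" for c d
  proof -
    have m: "c - d \<in> carrier F" using that(1,2) keys_diff[of c d] by auto
    have "k c = k (c - d) \<otimes>\<^bsub>G\<^esub> k d" using ka[OF m that(2)] by simp
    then show ?thesis using that(3) k.hom_closed[OF that(2)] k.hom_closed[OF m] by simp
  qed
  have "k r = \<one>\<^bsub>G\<^esub>" if "r \<in> tensor_relators A U M" for r
    using that unfolding tensor_relators_def
  proof (elim UnE CollectE exE conjE)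
    fix u v x assume r: "r = frag_of (u \<oplus>\<^bsub>U\<^esub> v, x) - frag_of (u, x) - frag_of (v, x)"
      and *: "u \<in> carrier U" "v \<in> carrier U" "x \<in> carrier M"
    then show "k r = \<one>\<^bsub>G\<^esub>"
      using b k(2) ka[OF frag_of_mem frag_of_mem, of u x v x] unfolding r diff_diff_eq
      by (intro kd' frag_add_mem frag_of_mem) auto
  next
    fix u x y assume r: "r = frag_of (u, x \<oplus>\<^bsub>M\<^esub> y) - frag_of (u, x) - frag_of (u, y)"
      and *: "u \<in> carrier U" "x \<in> carrier M" "y \<in> carrier M"
    then show "k r = \<one>\<^bsub>G\<^esub>"
      using b k(2) ka[OF frag_of_mem frag_of_mem, of u x u y] unfolding r diff_diff_eq
      by (intro kd' frag_add_mem frag_of_mem) auto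
  next
    fix u a x assume r: "r = frag_of (rsmult U u a, x) - frag_of (u, a \<odot>\<^bsub>M\<^esub> x)"
      and *: "u \<in> carrier U" "a \<in> carrier A" "x \<in> carrier M"
    then show "k r = \<one>\<^bsub>G\<^esub>"
      using b k(2) unfolding r by (intro kd' frag_of_mem) (auto simp: rsmult_closed N.smult_closed)
  qed
  then have "tensor_relators A U M \<subseteq> kernel F G k"
    using tensor_relators_subset by (auto simp: kernel_def simp del: carrier_free_Abelian_group_iff)
  then have "tensor_rels A U M \<subseteq> kernel F G k"
    unfolding tensor_rels_eq by (rule F.generate_subgroup_incl[OF _ k.subgroup_kernel])
  then obtain h where h: "h \<in> hom (F Mod tensor_rels A U M) G" "\<And>c. c \<in> carrier F \<Longrightarrow> h (coset c) = k c"
    using k.FactGroup_universal_kernel[OF normal_tensor_rels] by metis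
  show thesis
  proof (rule that[of h])
    show "h t \<in> carrier G" if "t \<in> carrier (tensor_module A U M)" for t
      using h(1) that by (auto simp: hom_def tensor_module_simps tensor_group_def)
    show "h (s \<oplus>\<^bsub>tensor_module A U M\<^esub> t) = h s \<otimes>\<^bsub>G\<^esub> h t"
      if "s \<in> carrier (tensor_module A U M)" "t \<in> carrier (tensor_module A U M)" for s t
      using hom_mult[OF h(1)] that by (simp add: tensor_module_simps tensor_group_def)
    show "h (pure u x) = \<beta> u x" if "u \<in> carrier U" "x \<in> carrier M" for u x
      using h(2)[OF frag_of_mem[OF that]] k(2) that by (simp add: pure_tensor_def)
  qed
qed

end

text \<open>\<open>tensor_map\<close> and the action of B are both defined on cosets as image plus
  subgroup. If the push maps relators to relators, this is the coset of the pushed representative,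
  and both operations can be computed on formal sums.\<close>

lemma tensor_push_coset:
  assumes M: "lmodule A M" and M': "lmodule A M'"
    and h: "\<And>q. q \<in> carrier U \<times> carrier M \<Longrightarrow> h q \<in> carrier U \<times> carrier M'"
    and r: "\<And>c. c \<in> tensor_relators A U M \<Longrightarrow> tensor_push h c \<in> tensor_relators A U M'"
    and c: "c \<in> carrier (free_Abelian_group (carrier U \<times> carrier M))"
  shows "tensor_rels A U M' <#>\<^bsub>free_Abelian_group (carrier U \<times> carrier M')\<^esub>
      (tensor_push h ` (tensor_rels A U M #>\<^bsub>free_Abelian_group (carrier U \<times> carrier M)\<^esub> c)) =
    tensor_rels A U M' #>\<^bsub>free_Abelian_group (carrier U \<times> carrier M')\<^esub> tensor_push h c"
proof -
  let ?F = "free_Abelian_group (carrier U \<times> carrier M)" and ?F' = "free_Abelian_group (carrier U \<times> carrier M')"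
  interpret F: comm_group ?F by (rule abelian_free_Abelian_group)
  interpret F': comm_group ?F' by (rule abelian_free_Abelian_group)
  have add: "tensor_push h (x + y) = tensor_push h x + tensor_push h y"
    and um: "tensor_push h (- x) = - tensor_push h x" and zero: "tensor_push h 0 = 0" for x y
    by (simp_all add: tensor_push_def frag_extend_add frag_extend_minus)
  have mem: "tensor_push h x \<in> carrier ?F'" if "x \<in> carrier ?F" for x
    by (rule tensor_push_mem[OF that h])
  have rel: "tensor_push h x \<in> tensor_rels A U M'" if "x \<in> tensor_rels A U M" for x
    using that unfolding tensor_rels_eq
  proof (induction rule: generate.induct)
    case one
    show ?case using generate.one[of ?F'] by (simp add: zero)
  next
    case (incl x)
    then show ?case using r by (blast intro: generate.incl)
  next
    case (inv x)
    then have "x \<in> carrier ?F" using tensor_relators_subset[OF M] by blast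
    moreover have "inv\<^bsub>?F'\<^esub> tensor_push h x \<in> generate ?F' (tensor_relators A U M')"
      using inv r by (blast intro: generate.inv)
    ultimately show ?case using mem[of x] by (simp add: um)
  next
    case (eng x y)
    then show ?case using generate.eng[of "tensor_push h x" ?F' _ "tensor_push h y"] by (simp add: add)
  qed
  note K = subgroup_tensor_rels[OF M] and K' = subgroup_tensor_rels[OF M']
  have z: "0 \<in> tensor_rels A U M" using subgroup.one_closed[OF K] by simp
  have sum: "x + y \<in> tensor_rels A U M'" if "x \<in> tensor_rels A U M'" "y \<in> tensor_rels A U M'" for x y
    using subgroup.m_closed[OF K' that] by simp
  show ?thesis
  proof (intro equalityI subsetI)
    fix y assume "y \<in> tensor_rels A U M' <#>\<^bsub>?F'\<^esub> (tensor_push h ` (tensor_rels A U M #>\<^bsub>?F\<^esub> c))"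
    then obtain k' k where "k' \<in> tensor_rels A U M'" "k \<in> tensor_rels A U M" "y = k' + tensor_push h (k + c)"
      by (auto simp: set_mult_def r_coset_def)
    then have "y = (k' + tensor_push h k) + tensor_push h c" "k' + tensor_push h k \<in> tensor_rels A U M'"
      using rel sum by (auto simp: add add.assoc)
    then show "y \<in> tensor_rels A U M' #>\<^bsub>?F'\<^esub> tensor_push h c"
      by (auto simp: r_coset_def)
  next
    fix y assume "y \<in> tensor_rels A U M' #>\<^bsub>?F'\<^esub> tensor_push h c"
    then obtain k' where k': "k' \<in> tensor_rels A U M'" "y = k' + tensor_push h (0 + c)" by (auto simp: r_coset_def)
    have "0 + c \<in> tensor_rels A U M #>\<^bsub>?F\<^esub> c" using z unfolding r_coset_def mult_free_Abelian_group by blast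
    then show "y \<in> tensor_rels A U M' <#>\<^bsub>?F'\<^esub> (tensor_push h ` (tensor_rels A U M #>\<^bsub>?F\<^esub> c))"
      using k' unfolding set_mult_def mult_free_Abelian_group by blast
  qed
qed

section \<open>The action of B, functoriality and right exactness of the tensor product\<close>

lemma tensor_map_coset:
  assumes M: "lmodule A M" and N: "lmodule A N" and f: "f \<in> Hom A M N"
    and c: "c \<in> carrier (free_Abelian_group (carrier U \<times> carrier M))"
  shows "tensor_map A U N f (tensor_rels A U M #>\<^bsub>free_Abelian_group (carrier U \<times> carrier M)\<^esub> c) =
    tensor_rels A U N #>\<^bsub>free_Abelian_group (carrier U \<times> carrier N)\<^esub> tensor_push (\<lambda>(u, x). (u, f x)) c"
  unfolding tensor_map_def
proof (rule tensor_push_coset[OF M N _ _ c])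
  interpret M: lmodule A M by fact
  show "(case q of (u, x) \<Rightarrow> (u, f x)) \<in> carrier U \<times> carrier N" if "q \<in> carrier U \<times> carrier M" for q
    using that HomE(2)[OF f] by auto
  fix r assume "r \<in> tensor_relators A U M"
  then show "tensor_push (\<lambda>(u, x). (u, f x)) r \<in> tensor_relators A U N"
    unfolding tensor_relators_def[of _ _ M]
  proof (elim UnE CollectE exE conjE)
    fix u v x assume "r = frag_of (u \<oplus>\<^bsub>U\<^esub> v, x) - frag_of (u, x) - frag_of (v, x)"
      and *: "u \<in> carrier U" "v \<in> carrier U" "x \<in> carrier M"
    then have "tensor_push (\<lambda>(u, x). (u, f x)) r = frag_of (u \<oplus>\<^bsub>U\<^esub> v, f x) - frag_of (u, f x) - frag_of (v, f x)"
      by (simp add: tensor_push_def frag_extend_diff)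
    then show ?thesis using * HomE(2)[OF f *(3)] unfolding tensor_relators_def by blast
  next
    fix u x y assume "r = frag_of (u, x \<oplus>\<^bsub>M\<^esub> y) - frag_of (u, x) - frag_of (u, y)"
      and *: "u \<in> carrier U" "x \<in> carrier M" "y \<in> carrier M"
    then have "tensor_push (\<lambda>(u, x). (u, f x)) r = frag_of (u, f x \<oplus>\<^bsub>N\<^esub> f y) - frag_of (u, f x) - frag_of (u, f y)"
      using HomE(3)[OF f *(2,3)] by (simp add: tensor_push_def frag_extend_diff)
    then show ?thesis using * HomE(2)[OF f *(2)] HomE(2)[OF f *(3)] unfolding tensor_relators_def by blast
  next
    fix u a x assume "r = frag_of (rsmult U u a, x) - frag_of (u, a \<odot>\<^bsub>M\<^esub> x)"
      and *: "u \<in> carrier U" "a \<in> carrier A" "x \<in> carrier M"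
    then have "tensor_push (\<lambda>(u, x). (u, f x)) r = frag_of (rsmult U u a, f x) - frag_of (u, a \<odot>\<^bsub>N\<^esub> f x)"
      using HomE(4)[OF f *(2,3)] by (simp add: tensor_push_def frag_extend_diff)
    then show ?thesis using * HomE(2)[OF f *(3)] unfolding tensor_relators_def by blast
  qed
qed

lemma tensor_smult_coset:
  assumes M: "lmodule A M" and b: "b \<in> carrier B"
    and c: "c \<in> carrier (free_Abelian_group (carrier U \<times> carrier M))"
  shows "b \<odot>\<^bsub>tensor_module A U M\<^esub> (tensor_rels A U M #>\<^bsub>free_Abelian_group (carrier U \<times> carrier M)\<^esub> c) =
    tensor_rels A U M #>\<^bsub>free_Abelian_group (carrier U \<times> carrier M)\<^esub> tensor_push (\<lambda>(u, x). (b \<odot>\<^bsub>U\<^esub> u, x)) c"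
  unfolding tensor_module_def module.select_convs
proof (rule tensor_push_coset[OF M M _ _ c])
  interpret M: lmodule A M by fact
  show "(case q of (u, x) \<Rightarrow> (b \<odot>\<^bsub>U\<^esub> u, x)) \<in> carrier U \<times> carrier M" if "q \<in> carrier U \<times> carrier M" for q
    using that b smult_closed by auto
  fix r assume "r \<in> tensor_relators A U M"
  from this[unfolded tensor_relators_def]
  show "tensor_push (\<lambda>(u, x). (b \<odot>\<^bsub>U\<^esub> u, x)) r \<in> tensor_relators A U M"
  proof (elim UnE CollectE exE conjE)
    fix u v x assume "r = frag_of (u \<oplus>\<^bsub>U\<^esub> v, x) - frag_of (u, x) - frag_of (v, x)"
      and *: "u \<in> carrier U" "v \<in> carrier U" "x \<in> carrier M"
    then have "tensor_push (\<lambda>(u, x). (b \<odot>\<^bsub>U\<^esub> u, x)) r =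
        frag_of (b \<odot>\<^bsub>U\<^esub> u \<oplus>\<^bsub>U\<^esub> b \<odot>\<^bsub>U\<^esub> v, x) - frag_of (b \<odot>\<^bsub>U\<^esub> u, x) - frag_of (b \<odot>\<^bsub>U\<^esub> v, x)"
      by (simp add: tensor_push_def frag_extend_diff smult_r_distr[OF b])
    moreover have "b \<odot>\<^bsub>U\<^esub> u \<in> carrier U" "b \<odot>\<^bsub>U\<^esub> v \<in> carrier U" using * b smult_closed by auto
    ultimately show "tensor_push (\<lambda>(u, x). (b \<odot>\<^bsub>U\<^esub> u, x)) r \<in> tensor_relators A U M" unfolding tensor_relators_def using *(3) by blast
  next
    fix u x y assume "r = frag_of (u, x \<oplus>\<^bsub>M\<^esub> y) - frag_of (u, x) - frag_of (u, y)"
      and *: "u \<in> carrier U" "x \<in> carrier M" "y \<in> carrier M"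
    then have "tensor_push (\<lambda>(u, x). (b \<odot>\<^bsub>U\<^esub> u, x)) r =
        frag_of (b \<odot>\<^bsub>U\<^esub> u, x \<oplus>\<^bsub>M\<^esub> y) - frag_of (b \<odot>\<^bsub>U\<^esub> u, x) - frag_of (b \<odot>\<^bsub>U\<^esub> u, y)"
      by (simp add: tensor_push_def frag_extend_diff)
    moreover have "b \<odot>\<^bsub>U\<^esub> u \<in> carrier U" using * b smult_closed by auto
    ultimately show "tensor_push (\<lambda>(u, x). (b \<odot>\<^bsub>U\<^esub> u, x)) r \<in> tensor_relators A U M" unfolding tensor_relators_def using *(2,3) by blast
  next
    fix u a x assume "r = frag_of (rsmult U u a, x) - frag_of (u, a \<odot>\<^bsub>M\<^esub> x)"
      and *: "u \<in> carrier U" "a \<in> carrier A" "x \<in> carrier M"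
    then have "tensor_push (\<lambda>(u, x). (b \<odot>\<^bsub>U\<^esub> u, x)) r =
        frag_of (rsmult U (b \<odot>\<^bsub>U\<^esub> u) a, x) - frag_of (b \<odot>\<^bsub>U\<^esub> u, a \<odot>\<^bsub>M\<^esub> x)"
      by (simp add: tensor_push_def frag_extend_diff smult_rsmult[OF b])
    moreover have "b \<odot>\<^bsub>U\<^esub> u \<in> carrier U" using * b smult_closed by auto
    ultimately show "tensor_push (\<lambda>(u, x). (b \<odot>\<^bsub>U\<^esub> u, x)) r \<in> tensor_relators A U M" unfolding tensor_relators_def using *(2,3) by blast
  qed
qed

lemma tensor_cosetE:
  assumes "t \<in> carrier (tensor_module A U M)"
  obtains c where "c \<in> carrier (free_Abelian_group (carrier U \<times> carrier M))"
    "t = tensor_rels A U M #>\<^bsub>free_Abelian_group (carrier U \<times> carrier M)\<^esub> c"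
  using assms by (auto simp: tensor_module_def tensor_group_def carrier_FactGroup simp del: carrier_free_Abelian_group_iff)

lemma tensor_push_add: "tensor_push h (c + d) = tensor_push h c + tensor_push h d"
  by (simp add: tensor_push_def frag_extend_add)

lemma tensor_smult:
  assumes M: "lmodule A M" and b: "b \<in> carrier B"
  shows "t \<in> carrier (tensor_module A U M) \<Longrightarrow> b \<odot>\<^bsub>tensor_module A U M\<^esub> t \<in> carrier (tensor_module A U M)"
    and "\<lbrakk>s \<in> carrier (tensor_module A U M); t \<in> carrier (tensor_module A U M)\<rbrakk> \<Longrightarrow>
      b \<odot>\<^bsub>tensor_module A U M\<^esub> (s \<oplus>\<^bsub>tensor_module A U M\<^esub> t) =
      b \<odot>\<^bsub>tensor_module A U M\<^esub> s \<oplus>\<^bsub>tensor_module A U M\<^esub> b \<odot>\<^bsub>tensor_module A U M\<^esub> t"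
    and "\<lbrakk>u \<in> carrier U; x \<in> carrier M\<rbrakk> \<Longrightarrow>
      b \<odot>\<^bsub>tensor_module A U M\<^esub> pure_tensor A U M u x = pure_tensor A U M (b \<odot>\<^bsub>U\<^esub> u) x"
proof -
  let ?T = "tensor_module A U M" and ?F = "free_Abelian_group (carrier U \<times> carrier M)"
  let ?p = "tensor_push (\<lambda>(u, x). (b \<odot>\<^bsub>U\<^esub> u, x))"
  have p: "?p c \<in> carrier ?F" if "c \<in> carrier ?F" for c
    using smult_closed b by (intro tensor_push_mem[OF that]) auto
  show "b \<odot>\<^bsub>?T\<^esub> t \<in> carrier ?T" if t: "t \<in> carrier ?T" for t
  proof -
    obtain c where c: "c \<in> carrier ?F" "t = tensor_rels A U M #>\<^bsub>?F\<^esub> c" using t by (rule tensor_cosetE)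
    show ?thesis unfolding c(2) tensor_smult_coset[OF M b c(1)] by (rule coset_closed[OF M p[OF c(1)]])
  qed
  show "b \<odot>\<^bsub>?T\<^esub> (s \<oplus>\<^bsub>?T\<^esub> t) = b \<odot>\<^bsub>?T\<^esub> s \<oplus>\<^bsub>?T\<^esub> b \<odot>\<^bsub>?T\<^esub> t"
    if s: "s \<in> carrier ?T" and t: "t \<in> carrier ?T" for s t
  proof -
    obtain c where c: "c \<in> carrier ?F" "t = tensor_rels A U M #>\<^bsub>?F\<^esub> c" using t by (rule tensor_cosetE)
    obtain d where d: "d \<in> carrier ?F" "s = tensor_rels A U M #>\<^bsub>?F\<^esub> d" using s by (rule tensor_cosetE)
    show ?thesis
      unfolding c(2) d(2) coset_add[OF M d(1) c(1), symmetric] tensor_smult_coset[OF M b c(1)]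
        tensor_smult_coset[OF M b d(1)] tensor_smult_coset[OF M b frag_add_mem[OF M d(1) c(1)]]
      by (simp only: coset_add[OF M p[OF d(1)] p[OF c(1)], symmetric] tensor_push_add)
  qed
  assume *: "u \<in> carrier U" "x \<in> carrier M"
  show "b \<odot>\<^bsub>?T\<^esub> pure_tensor A U M u x = pure_tensor A U M (b \<odot>\<^bsub>U\<^esub> u) x"
    using tensor_smult_coset[OF M b frag_of_mem[OF M *]] by (simp add: pure_tensor_def tensor_push_def)
qed

lemma tensor_map:
  assumes M: "lmodule A M" and N: "lmodule A N" and f: "f \<in> Hom A M N"
  shows "t \<in> carrier (tensor_module A U M) \<Longrightarrow> tensor_map A U N f t \<in> carrier (tensor_module A U N)"
    and "\<lbrakk>s \<in> carrier (tensor_module A U M); t \<in> carrier (tensor_module A U M)\<rbrakk> \<Longrightarrow>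
      tensor_map A U N f (s \<oplus>\<^bsub>tensor_module A U M\<^esub> t) =
      tensor_map A U N f s \<oplus>\<^bsub>tensor_module A U N\<^esub> tensor_map A U N f t"
    and "\<lbrakk>u \<in> carrier U; x \<in> carrier M\<rbrakk> \<Longrightarrow> tensor_map A U N f (pure_tensor A U M u x) = pure_tensor A U N u (f x)"
    and "tensor_map A U N f \<zero>\<^bsub>tensor_module A U M\<^esub> = \<zero>\<^bsub>tensor_module A U N\<^esub>"
proof -
  let ?T = "tensor_module A U M" and ?F = "free_Abelian_group (carrier U \<times> carrier M)"
    and ?T' = "tensor_module A U N" and ?F' = "free_Abelian_group (carrier U \<times> carrier N)"
  let ?p = "tensor_push (\<lambda>(u, x). (u, f x))"
  have p: "?p c \<in> carrier ?F'" if "c \<in> carrier ?F" for c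
    using HomE(2)[OF f] by (intro tensor_push_mem[OF that]) auto
  show "tensor_map A U N f t \<in> carrier ?T'" if t: "t \<in> carrier ?T" for t
  proof -
    obtain c where c: "c \<in> carrier ?F" "t = tensor_rels A U M #>\<^bsub>?F\<^esub> c" using t by (rule tensor_cosetE)
    show ?thesis unfolding c(2) tensor_map_coset[OF M N f c(1)] by (rule coset_closed[OF N p[OF c(1)]])
  qed
  show "tensor_map A U N f (s \<oplus>\<^bsub>?T\<^esub> t) = tensor_map A U N f s \<oplus>\<^bsub>?T'\<^esub> tensor_map A U N f t"
    if s: "s \<in> carrier ?T" and t: "t \<in> carrier ?T" for s t
  proof -
    obtain c where c: "c \<in> carrier ?F" "t = tensor_rels A U M #>\<^bsub>?F\<^esub> c" using t by (rule tensor_cosetE)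
    obtain d where d: "d \<in> carrier ?F" "s = tensor_rels A U M #>\<^bsub>?F\<^esub> d" using s by (rule tensor_cosetE)
    show ?thesis
      unfolding c(2) d(2) coset_add[OF M d(1) c(1), symmetric] tensor_map_coset[OF M N f c(1)]
        tensor_map_coset[OF M N f d(1)] tensor_map_coset[OF M N f frag_add_mem[OF M d(1) c(1)]]
      by (simp only: coset_add[OF N p[OF d(1)] p[OF c(1)], symmetric] tensor_push_add)
  qed
  show "tensor_map A U N f (pure_tensor A U M u x) = pure_tensor A U N u (f x)"
    if *: "u \<in> carrier U" "x \<in> carrier M" for u x
    using tensor_map_coset[OF M N f frag_of_mem[OF M *]] by (simp add: pure_tensor_def tensor_push_def)
  show "tensor_map A U N f \<zero>\<^bsub>?T\<^esub> = \<zero>\<^bsub>?T'\<^esub>"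
    using tensor_map_coset[OF M N f, of 0] coset_zero[OF M] coset_zero[OF N] by (simp add: tensor_push_def)
qed

lemma lmodule_tensor:
  assumes M: "lmodule A M"
  shows "lmodule B (tensor_module A U M)"
proof -
  let ?T = "tensor_module A U M"
  interpret T: abelian_group ?T by (rule abelian_group_tensor[OF M])
  note s = tensor_smult[OF M] and p = pure_closed[OF M]
  have z: "b \<odot>\<^bsub>?T\<^esub> \<zero>\<^bsub>?T\<^esub> = \<zero>\<^bsub>?T\<^esub>" if "b \<in> carrier B" for b
    using s(1)[OF that T.zero_closed] s(2)[OF that T.zero_closed T.zero_closed] by (metis T.add.r_cancel_one' T.r_zero T.zero_closed)
  show ?thesis
  proof (rule lmodule.intro[OF R.ring_axioms T.abelian_group_axioms], rule lmodule_axioms.intro)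
    fix a b t assume ab: "a \<in> carrier B" "b \<in> carrier B" and t: "t \<in> carrier ?T"
    then have c: "a \<oplus>\<^bsub>B\<^esub> b \<in> carrier B" "a \<otimes>\<^bsub>B\<^esub> b \<in> carrier B" by simp_all
    show "(a \<oplus>\<^bsub>B\<^esub> b) \<odot>\<^bsub>?T\<^esub> t = a \<odot>\<^bsub>?T\<^esub> t \<oplus>\<^bsub>?T\<^esub> b \<odot>\<^bsub>?T\<^esub> t"
      using t by (rule tensor_induct[OF M])
        (simp_all add: z ab c s smult_l_distr smult_closed pure_add_left[OF M] T.a_ac)
    show "(a \<otimes>\<^bsub>B\<^esub> b) \<odot>\<^bsub>?T\<^esub> t = a \<odot>\<^bsub>?T\<^esub> (b \<odot>\<^bsub>?T\<^esub> t)"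
      using t by (rule tensor_induct[OF M]) (simp_all add: z ab c s smult_assoc1 smult_closed)
  next
    fix t assume t: "t \<in> carrier ?T"
    show "\<one>\<^bsub>B\<^esub> \<odot>\<^bsub>?T\<^esub> t = t"
      using t by (rule tensor_induct[OF M]) (simp_all add: z s smult_one)
  qed (simp_all add: s)
qed

lemma tensor_universal_Hom:
  assumes M: "lmodule A M" and N: "lmodule B N" and \<beta>: "balanced A U M (add_monoid N) \<beta>"
    and B: "\<And>b u x. \<lbrakk>b \<in> carrier B; u \<in> carrier U; x \<in> carrier M\<rbrakk> \<Longrightarrow> \<beta> (b \<odot>\<^bsub>U\<^esub> u) x = b \<odot>\<^bsub>N\<^esub> \<beta> u x"
  obtains h where "h \<in> Hom B (tensor_module A U M) N"
    "\<And>u x. \<lbrakk>u \<in> carrier U; x \<in> carrier M\<rbrakk> \<Longrightarrow> h (pure_tensor A U M u x) = \<beta> u x"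
proof -
  let ?T = "tensor_module A U M"
  interpret N: lmodule B N by fact
  interpret T: lmodule B ?T by (rule lmodule_tensor[OF M])
  obtain h where h: "\<And>t. t \<in> carrier ?T \<Longrightarrow> h t \<in> carrier N"
    "\<And>s t. \<lbrakk>s \<in> carrier ?T; t \<in> carrier ?T\<rbrakk> \<Longrightarrow> h (s \<oplus>\<^bsub>?T\<^esub> t) = h s \<oplus>\<^bsub>N\<^esub> h t"
    "\<And>u x. \<lbrakk>u \<in> carrier U; x \<in> carrier M\<rbrakk> \<Longrightarrow> h (pure_tensor A U M u x) = \<beta> u x"
    by (rule tensor_universal[OF M N.M.a_comm_group \<beta>], rule that) simp_all
  have z: "h \<zero>\<^bsub>?T\<^esub> = \<zero>\<^bsub>N\<^esub>"
    using h(1,2)[OF T.M.zero_closed] T.M.zero_closed by (metis N.M.add.r_cancel_one' T.M.r_zero)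
  have "restrict h (carrier ?T) \<in> Hom B ?T N"
  proof (rule HomI[OF lmodule_tensor[OF M] h(1,2)])
    fix b t assume b: "b \<in> carrier B" and t: "t \<in> carrier ?T"
    show "h (b \<odot>\<^bsub>?T\<^esub> t) = b \<odot>\<^bsub>N\<^esub> h t"
      using t by (rule tensor_induct[OF M])
        (simp_all add: z b T.smult_zero_right N.smult_zero_right tensor_smult[OF M b] h smult_closed B
          T.smult_closed N.smult_r_distr)
  qed
  then show thesis using that h(3) pure_closed[OF M] by (metis (no_types, lifting) restrict_apply')
qed

lemma tensor_map_Hom:
  assumes M: "lmodule A M" and N: "lmodule A N" and f: "f \<in> Hom A M N"
  shows "restrict (tensor_map A U N f) (carrier (tensor_module A U M)) \<in> Hom B (tensor_module A U M) (tensor_module A U N)"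
proof (rule HomI[OF lmodule_tensor[OF M]])
  note m = tensor_map[OF M N f]
  interpret T: lmodule B "tensor_module A U M" by (rule lmodule_tensor[OF M])
  interpret T': lmodule B "tensor_module A U N" by (rule lmodule_tensor[OF N])
  fix b t assume b: "b \<in> carrier B" and t: "t \<in> carrier (tensor_module A U M)"
  show "tensor_map A U N f (b \<odot>\<^bsub>tensor_module A U M\<^esub> t) = b \<odot>\<^bsub>tensor_module A U N\<^esub> tensor_map A U N f t"
    using t by (rule tensor_induct[OF M])
      (simp_all add: b m T.smult_zero_right T'.smult_zero_right tensor_smult[OF M b] tensor_smult[OF N b] HomE(2)[OF f] smult_closed)
qed (use tensor_map[OF M N f] in auto)

text \<open>The composite enters as any h that agrees with g after f on the carrier, so that
  identities, projections and zero maps can take its place directly.\<close>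

lemma tensor_map_compose:
  assumes L: "lmodule A L" and M: "lmodule A M" and N: "lmodule A N"
    and f: "f \<in> Hom A L M" and g: "g \<in> Hom A M N" and h: "h \<in> Hom A L N"
    and e: "\<And>x. x \<in> carrier L \<Longrightarrow> h x = g (f x)" and t: "t \<in> carrier (tensor_module A U L)"
  shows "tensor_map A U N h t = tensor_map A U N g (tensor_map A U M f t)"
  using t by (rule tensor_induct[OF L])
    (simp_all add: tensor_map[OF L M f] tensor_map[OF M N g] tensor_map[OF L N h] e HomE(2)[OF f])

lemma tensor_map_id:
  assumes M: "lmodule A M" and f: "f \<in> Hom A M M" and e: "\<And>x. x \<in> carrier M \<Longrightarrow> f x = x"
    and t: "t \<in> carrier (tensor_module A U M)"
  shows "tensor_map A U M f t = t"
  using t by (rule tensor_induct[OF M]) (simp_all add: tensor_map[OF M M f] e)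

lemma tensor_map_zero:
  assumes M: "lmodule A M" and N: "lmodule A N" and f: "f \<in> Hom A M N" and e: "\<And>x. x \<in> carrier M \<Longrightarrow> f x = \<zero>\<^bsub>N\<^esub>"
    and t: "t \<in> carrier (tensor_module A U M)"
  shows "tensor_map A U N f t = \<zero>\<^bsub>tensor_module A U N\<^esub>"
proof -
  interpret N: lmodule A N by fact
  interpret T: lmodule B "tensor_module A U N" by (rule lmodule_tensor[OF N])
  have z: "pure_tensor A U N u \<zero>\<^bsub>N\<^esub> = \<zero>\<^bsub>tensor_module A U N\<^esub>" if "u \<in> carrier U" for u
    using pure_add_right[OF N that N.M.zero_closed N.M.zero_closed] pure_closed[OF N that N.M.zero_closed]
    by (metis N.M.l_zero N.M.zero_closed T.M.add.r_cancel_one')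
  show ?thesis using t by (rule tensor_induct[OF M]) (simp_all add: tensor_map[OF M N f] e z)
qed

lemma tensor_map_surj:
  assumes M: "lmodule A M" and N: "lmodule A N" and f: "f \<in> Hom A M N"
    and sur: "f ` carrier M = carrier N" and t: "t \<in> carrier (tensor_module A U N)"
  shows "\<exists>s\<in>carrier (tensor_module A U M). t = tensor_map A U N f s"
  using t
proof (rule tensor_induct[OF N])
  let ?T = "tensor_module A U M"
  interpret T: lmodule B ?T by (rule lmodule_tensor[OF M])
  note m = tensor_map[OF M N f]
  show "\<exists>s\<in>carrier ?T. \<zero>\<^bsub>tensor_module A U N\<^esub> = tensor_map A U N f s" using m(4) T.M.zero_closed by metis
  fix u x assume "u \<in> carrier U" "x \<in> carrier N"
  then show "\<exists>s\<in>carrier ?T. pure_tensor A U N u x = tensor_map A U N f s"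
    using sur m(3) pure_closed[OF M] by (metis imageE)
next
  let ?T = "tensor_module A U M"
  interpret T: lmodule B ?T by (rule lmodule_tensor[OF M])
  fix s t assume "\<exists>r\<in>carrier ?T. s = tensor_map A U N f r" "\<exists>r\<in>carrier ?T. t = tensor_map A U N f r"
  then show "\<exists>r\<in>carrier ?T. s \<oplus>\<^bsub>tensor_module A U N\<^esub> t = tensor_map A U N f r"
    using tensor_map(2)[OF M N f] T.M.a_closed by metis
qed

text \<open>The map \<open>U \<otimes> L \<rightarrow> (U \<otimes> N) / (U \<otimes> M)\<close> that splits off the cokernel shows right exactness.\<close>

lemma tensor_right_exact:
  assumes M: "lmodule A M" and N: "lmodule A N" and L: "lmodule A L" and f: "f \<in> Hom A M N" and g: "g \<in> Hom A N L"
    and sur: "g ` carrier N = carrier L" and ker: "\<And>y. y \<in> carrier N \<Longrightarrow> g y = \<zero>\<^bsub>L\<^esub> \<Longrightarrow> \<exists>x\<in>carrier M. y = f x"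
    and t: "t \<in> carrier (tensor_module A U N)" "tensor_map A U L g t = \<zero>\<^bsub>tensor_module A U L\<^esub>"
  shows "\<exists>s\<in>carrier (tensor_module A U M). t = tensor_map A U N f s"
proof -
  let ?TM = "tensor_module A U M" and ?TN = "tensor_module A U N" and ?TL = "tensor_module A U L"
  let ?G = "tensor_group A U N"
  interpret N: lmodule A N by fact
  interpret L: lmodule A L by fact
  interpret TN: lmodule B ?TN by (rule lmodule_tensor[OF N])
  interpret G: comm_group ?G by (rule comm_group_tensor[OF N])
  note Gs = tensor_module_simps[OF N]
  define I where "I = tensor_map A U N f ` carrier ?TM"
  have Isub: "submod B ?TN I"
    using submod_image[OF lmodule_tensor[OF M] lmodule_tensor[OF N] tensor_map_Hom[OF M N f]]
    by (simp add: I_def cong: image_cong)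
  have uminus: "inv\<^bsub>?G\<^esub> x = \<ominus>\<^bsub>?TN\<^esub> x" if "x \<in> carrier ?G" for x
    by (rule G.inv_equality) (use that TN.M.l_neg[of x] TN.M.a_inv_closed[of x] in \<open>simp_all add: Gs\<close>)
  have I: "subgroup I ?G"
  proof (rule subgroup.intro)
    show "I \<subseteq> carrier ?G" using Isub by (simp add: submod_def Gs)
    then show "inv\<^bsub>?G\<^esub> x \<in> I" if "x \<in> I" for x
      using that Isub uminus[of x] by (auto simp: submod_def)
  qed (use Isub in \<open>auto simp: submod_def Gs\<close>)
  have nI: "I \<lhd> ?G" using G.normal_iff_subgroup I by blast
  interpret Q: comm_group "?G Mod I" by (rule G.abelian_FactGroup[OF I])
  let ?q = "\<lambda>t. I #>\<^bsub>?G\<^esub> t"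
  have qc: "?q s \<in> carrier (?G Mod I)" if "s \<in> carrier ?TN" for s
    using that by (auto simp: carrier_FactGroup Gs)
  have qa: "?q (s \<oplus>\<^bsub>?TN\<^esub> t) = ?q s \<otimes>\<^bsub>?G Mod I\<^esub> ?q t" if "s \<in> carrier ?TN" "t \<in> carrier ?TN" for s t
    using normal.rcos_sum[OF nI] that by (simp add: Gs)
  define \<beta> where "\<beta> u z = ?q (pure_tensor A U N u (inv_into (carrier N) g z))" for u z
  \<comment> \<open>Independence of the chosen preimage: two preimages differ by some f x, and the
    tensor of u with f x lies in I.\<close>
  have \<beta>: "\<beta> u (g y) = ?q (pure_tensor A U N u y)" if u: "u \<in> carrier U" and y: "y \<in> carrier N" for u y
  proof -
    let ?y = "inv_into (carrier N) g (g y)"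
    have y': "?y \<in> carrier N" "g ?y = g y" using y by (auto intro: inv_into_into f_inv_into_f)
    then have "g (?y \<ominus>\<^bsub>N\<^esub> y) = \<zero>\<^bsub>L\<^esub>"
      using y HomE(2)[OF g y] by (simp add: Hom_minus[OF N L g] L.M.minus_self)
    then obtain x where x: "x \<in> carrier M" "?y \<ominus>\<^bsub>N\<^esub> y = f x" using ker y y' by blast
    then have "?y = f x \<oplus>\<^bsub>N\<^esub> y" using y y' N.M.minus_add_cancel(1) by metis
    then have e: "pure_tensor A U N u ?y = pure_tensor A U N u (f x) \<oplus>\<^bsub>?TN\<^esub> pure_tensor A U N u y"
      using pure_add_right[OF N u HomE(2)[OF f x(1)] y] by simp
    have "pure_tensor A U N u (f x) \<in> I"
      unfolding I_def using tensor_map(3)[OF M N f u x(1)] pure_closed[OF M u x(1)] by (metis image_eqI)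
    then have "?q (pure_tensor A U N u (f x)) = \<one>\<^bsub>?G Mod I\<^esub>"
      using G.coset_join2[OF _ I] subgroup.mem_carrier[OF I] by simp
    then show ?thesis
      unfolding \<beta>_def e qa[OF pure_closed[OF N u HomE(2)[OF f x(1)]] pure_closed[OF N u y]]
      using Q.l_one[OF qc[OF pure_closed[OF N u y]]] by metis
  qed
  have "balanced A U L (?G Mod I) \<beta>"
    unfolding balanced_def
  proof (intro conjI ballI)
    fix u z assume u: "u \<in> carrier U" and "z \<in> carrier L"
    then obtain y where y: "y \<in> carrier N" "z = g y" using sur by blast
    show "\<beta> u z \<in> carrier (?G Mod I)" using qc pure_closed[OF N u y(1)] \<beta>[OF u y(1)] y(2) by simp
    show "\<beta> (rsmult U u a) z = \<beta> u (a \<odot>\<^bsub>L\<^esub> z)" if a: "a \<in> carrier A" for a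
      unfolding y(2) HomE(4)[OF g a y(1), symmetric] \<beta>[OF u N.smult_closed[OF a y(1)]] \<beta>[OF rsmult_closed[OF u a] y(1)]
      by (simp add: pure_balanced[OF N u a y(1)])
    show "\<beta> (u \<oplus>\<^bsub>U\<^esub> v) z = \<beta> u z \<otimes>\<^bsub>?G Mod I\<^esub> \<beta> v z" if v: "v \<in> carrier U" for v
      unfolding y(2) \<beta>[OF u y(1)] \<beta>[OF v y(1)] \<beta>[OF M.a_closed[OF u v] y(1)] pure_add_left[OF N u v y(1)]
      by (rule qa[OF pure_closed[OF N u y(1)] pure_closed[OF N v y(1)]])
    fix z' assume "z' \<in> carrier L"
    then obtain y' where y': "y' \<in> carrier N" "z' = g y'" using sur by blast
    show "\<beta> u (z \<oplus>\<^bsub>L\<^esub> z') = \<beta> u z \<otimes>\<^bsub>?G Mod I\<^esub> \<beta> u z'"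
      unfolding y(2) y'(2) HomE(3)[OF g y(1) y'(1), symmetric] \<beta>[OF u y(1)] \<beta>[OF u y'(1)] \<beta>[OF u N.M.a_closed[OF y(1) y'(1)]]
        pure_add_right[OF N u y(1) y'(1)]
      by (rule qa[OF pure_closed[OF N u y(1)] pure_closed[OF N u y'(1)]])
  qed
  then obtain h where h: "\<And>t. t \<in> carrier ?TL \<Longrightarrow> h t \<in> carrier (?G Mod I)"
    "\<And>s t. \<lbrakk>s \<in> carrier ?TL; t \<in> carrier ?TL\<rbrakk> \<Longrightarrow> h (s \<oplus>\<^bsub>?TL\<^esub> t) = h s \<otimes>\<^bsub>?G Mod I\<^esub> h t"
    "\<And>u x. \<lbrakk>u \<in> carrier U; x \<in> carrier L\<rbrakk> \<Longrightarrow> h (pure_tensor A U L u x) = \<beta> u x"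
    using tensor_universal[OF L Q.comm_group_axioms] by metis
  interpret TL: lmodule B ?TL by (rule lmodule_tensor[OF L])
  note mg = tensor_map[OF N L g]
  have z: "h \<zero>\<^bsub>?TL\<^esub> = \<one>\<^bsub>?G Mod I\<^esub>"
    using h(1,2)[OF TL.M.zero_closed] TL.M.zero_closed by (metis Q.r_cancel_one' TL.M.r_zero)
  \<comment> \<open>h is a left inverse of the map that g induces on the quotient by I; so an
    element killed by g has trivial class there.\<close>
  have "h (tensor_map A U L g t) = ?q t"
    using t(1)
  proof (rule tensor_induct[OF N])
    show "h (tensor_map A U L g \<zero>\<^bsub>?TN\<^esub>) = ?q \<zero>\<^bsub>?TN\<^esub>"
      using G.coset_join2[OF _ I] subgroup.one_closed[OF I] mg(4) z by (simp add: Gs)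
    show "h (tensor_map A U L g (pure_tensor A U N u x)) = ?q (pure_tensor A U N u x)" if "u \<in> carrier U" "x \<in> carrier N" for u x
      using mg(3)[OF that] h(3)[OF that(1) HomE(2)[OF g that(2)]] \<beta>[OF that] by simp
    show "h (tensor_map A U L g (s \<oplus>\<^bsub>?TN\<^esub> t)) = ?q (s \<oplus>\<^bsub>?TN\<^esub> t)"
      if "s \<in> carrier ?TN" "t \<in> carrier ?TN" "h (tensor_map A U L g s) = ?q s" "h (tensor_map A U L g t) = ?q t" for s t
      using mg(2)[OF that(1,2)] h(2)[OF mg(1)[OF that(1)] mg(1)[OF that(2)]] qa[OF that(1,2)] that(3,4) by simp
  qed
  then have "?q t = I" using t(2) z by simp
  moreover have "t \<in> carrier ?G" using t(1) by (simp add: Gs)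
  ultimately have "t \<in> I" using G.coset_join1[OF _ _ I] subgroup.subset[OF I] by metis
  then show ?thesis unfolding I_def by blast
qed

end

context triangular
begin

text \<open>Every element is a finite sum of pure tensors, so lists of pairs map onto the tensor
  product.\<close>

lemma small_tensor:
  assumes M: "M \<in> RMod A \<U>"
  shows "small \<U> (carrier (tensor_module A U M))"
proof -
  have l: "lmodule A M" "small \<U> (carrier M)" using M by (auto simp: RMod_small)
  let ?T = "tensor_module A U M"
  let ?s = "\<lambda>xs. foldr (\<lambda>(u, x) t. pure_tensor A U M u x \<oplus>\<^bsub>?T\<^esub> t) xs \<zero>\<^bsub>?T\<^esub>"
  interpret T: lmodule B ?T by (rule lmodule_tensor[OF l(1)])
  have cl: "?s xs \<in> carrier ?T" if "xs \<in> lists (carrier U \<times> carrier M)" for xs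
    using that by induction (auto simp: pure_closed[OF l(1)])
  have ap: "?s (xs @ ys) = ?s xs \<oplus>\<^bsub>?T\<^esub> ?s ys" if "xs \<in> lists (carrier U \<times> carrier M)" "ys \<in> lists (carrier U \<times> carrier M)" for xs ys
    using that
  proof (induction rule: lists.induct)
    case Nil
    then show ?case using T.M.l_zero[OF cl] by simp
  next
    case (Cons q xs)
    then obtain u x where q: "q = (u, x)" "u \<in> carrier U" "x \<in> carrier M" by auto
    then show ?case
      using Cons T.M.a_assoc[OF pure_closed[OF l(1) q(2,3)] cl[of xs] cl[of ys]] by simp
  qed
  have "t \<in> ?s ` lists (carrier U \<times> carrier M)" if "t \<in> carrier ?T" for t
    using that
  proof (rule tensor_induct[OF l(1)])
    show "\<zero>\<^bsub>?T\<^esub> \<in> ?s ` lists (carrier U \<times> carrier M)" by (rule image_eqI[of _ _ "[]"]) simp_all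
    show "pure_tensor A U M u x \<in> ?s ` lists (carrier U \<times> carrier M)" if "u \<in> carrier U" "x \<in> carrier M" for u x
      using that by (intro image_eqI[of _ _ "[(u, x)]"]) (simp_all add: pure_closed[OF l(1)])
    show "s \<oplus>\<^bsub>?T\<^esub> t \<in> ?s ` lists (carrier U \<times> carrier M)"
      if s: "s \<in> ?s ` lists (carrier U \<times> carrier M)" and t: "t \<in> ?s ` lists (carrier U \<times> carrier M)" for s t
    proof -
      obtain xs ys where *: "xs \<in> lists (carrier U \<times> carrier M)" "ys \<in> lists (carrier U \<times> carrier M)" "s = ?s xs" "t = ?s ys"
        using s t by blast
      then show ?thesis using ap by (intro image_eqI[of _ _ "xs @ ys"]) simp_all
    qed
  qed
  then show ?thesis
    by (intro small_subset[OF small_image[OF small_lists[OF small_Times[OF small_index[OF powers_U] l(2)]], of ?s]] subsetI)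
qed

end

section \<open>Vanishing of Tor\<close>

context triangular
begin

lemma tensor_map_injI:
  assumes "lmodule A M" "lmodule A N" "f \<in> Hom A M N"
    "\<And>t. t \<in> carrier (tensor_module A U M) \<Longrightarrow> tensor_map A U N f t = \<zero>\<^bsub>tensor_module A U N\<^esub> \<Longrightarrow> t = \<zero>\<^bsub>tensor_module A U M\<^esub>"
  shows "inj_on (tensor_map A U N f) (carrier (tensor_module A U M))"
proof -
  have "inj_on (restrict (tensor_map A U N f) (carrier (tensor_module A U M))) (carrier (tensor_module A U M))"
    by (rule Hom_inj_onI[OF lmodule_tensor lmodule_tensor tensor_map_Hom]) (use assms in simp_all)
  then show ?thesis by (simp add: inj_on_def)
qed

lemma tensor_map_injD:
  assumes "lmodule A M" "lmodule A N" "f \<in> Hom A M N" "inj_on (tensor_map A U N f) (carrier (tensor_module A U M))"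
    "t \<in> carrier (tensor_module A U M)" "tensor_map A U N f t = \<zero>\<^bsub>tensor_module A U N\<^esub>"
  shows "t = \<zero>\<^bsub>tensor_module A U M\<^esub>"
proof -
  interpret T: lmodule B "tensor_module A U M" by (rule lmodule_tensor[OF assms(1)])
  show ?thesis using assms(4-6) tensor_map(4)[OF assms(1-3)] T.M.zero_closed by (metis inj_onD)
qed

text \<open>
  \<open>flat_end C\<close> expresses \<open>Tor\<^sub>1(U, C) = 0\<close>, and \<open>tor_vanish m C\<close> expresses \<open>Tor\<^sub>j(U, C) = 0\<close> for
  \<open>1 \<le> j \<le> m\<close>, without resolutions. Quantifying over all extensions makes the dimension shift along
  arbitrary exact sequences available by definition; the work is in the proof that
  the vanishing of the groups \<open>Tor\<close> implies it.
\<close>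

definition flat_end :: "('a, 'm) module \<Rightarrow> bool"
  where "flat_end C \<longleftrightarrow> (\<forall>K\<in>RMod A \<U>. \<forall>M\<in>RMod A \<U>. \<forall>f g. short_exact A K f M g C \<longrightarrow>
    inj_on (tensor_map A U M f) (carrier (tensor_module A U K)))"

primrec tor_vanish :: "nat \<Rightarrow> ('a, 'm) module \<Rightarrow> bool"
  where "tor_vanish 0 C = True"
  | "tor_vanish (Suc m) C \<longleftrightarrow> flat_end C \<and> (\<forall>K\<in>RMod A \<U>. \<forall>M\<in>RMod A \<U>. \<forall>f g. short_exact A K f M g C \<longrightarrow>
      tor_vanish m M \<longrightarrow> tor_vanish m K)"

text \<open>The pullback of q and p splits over P along the lift s, hence it is K \<oplus> P; its
  projection to G has kernel L. As in Schanuel's lemma, this relates two sequences that end at the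
  same C. The equations for v and w identify the induced maps on K and into P.\<close>

lemma pullback_sequence:
  assumes l: "lmodule A K" "lmodule A G" "lmodule A C" "lmodule A L" "lmodule A P"
    and KGC: "short_exact A K j G q C" and LPC: "short_exact A L i P p C"
    and s: "s \<in> Hom A P G" "\<And>x. x \<in> carrier P \<Longrightarrow> q (s x) = p x"
  obtains v w where "short_exact A L v (dirsum K P) w G" "\<And>x. x \<in> carrier L \<Longrightarrow> snd (v x) = i x"
    "\<And>x. x \<in> carrier K \<Longrightarrow> w (x, \<zero>\<^bsub>P\<^esub>) = j x"
proof -
  interpret K: lmodule A K by fact
  interpret G: lmodule A G by fact
  interpret P: lmodule A P by fact
  interpret C: lmodule A C by fact
  note kg = short_exactD[OF KGC] and lp = short_exactD[OF LPC]
  note si = Hom_compose[OF l(4) lp(1) s(1)]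
  \<comment> \<open>In these coordinates x from L is the point (0, i x) of the pullback, so its
    K-coordinate solves j (k x) + s (i x) = 0.\<close>
  let ?h = "\<lambda>x\<in>carrier L. \<ominus>\<^bsub>G\<^esub> compose (carrier L) s i x"
  have h: "?h \<in> Hom A L G" by (rule Hom_neg[OF l(4,2) si])
  have hx: "?h x = \<ominus>\<^bsub>G\<^esub> s (i x)" "s (i x) \<in> carrier G" "i x \<in> carrier P" if "x \<in> carrier L" for x
    using that HomE(2)[OF s(1) HomE(2)[OF lp(1) that]] HomE(2)[OF lp(1) that] by (simp_all add: compose_eq)
  obtain k where k: "k \<in> Hom A L K" "\<And>x. x \<in> carrier L \<Longrightarrow> j (k x) = ?h x"
  proof (rule factor_through_kernel[OF l(4,1,2) kg(1,3) h])
    show "?h ` carrier L \<subseteq> j ` carrier K"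
    proof (rule image_subsetI)
      fix x assume x: "x \<in> carrier L"
      have "q (?h x) = \<zero>\<^bsub>C\<^esub>"
        using hx[OF x] s(2) lp(4)[OF x] by (simp add: Hom_uminus[OF l(2,3) kg(2)])
      then show "?h x \<in> j ` carrier K" using kg(5)[OF HomE(2)[OF h x]] by blast
    qed
  qed blast
  let ?w = "\<lambda>z\<in>carrier (dirsum K P). j (fst z) \<oplus>\<^bsub>G\<^esub> s (snd z)" and ?v = "\<lambda>x\<in>carrier L. (k x, i x)"
  have "short_exact A L ?v (dirsum K P) ?w G"
  proof (rule short_exactI)
    show "?v \<in> Hom A L (dirsum K P)" by (rule Hom_pair[OF l(4) k(1) lp(1)])
    show "?w \<in> Hom A (dirsum K P) G" by (rule Hom_copair[OF l(1,5,2) kg(1) s(1)])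
    show "inj_on ?v (carrier L)" using lp(3) by (auto simp: inj_on_def)
    show "?w (?v x) = \<zero>\<^bsub>G\<^esub>" if x: "x \<in> carrier L" for x
      using x HomE(2)[OF k(1) x] hx[OF x] k(2)[OF x] by (simp add: G.M.l_neg)
  next
    fix z assume z: "z \<in> carrier (dirsum K P)" "?w z = \<zero>\<^bsub>G\<^esub>"
    then obtain a x where ax: "z = (a, x)" "a \<in> carrier K" "x \<in> carrier P" "j a \<oplus>\<^bsub>G\<^esub> s x = \<zero>\<^bsub>G\<^esub>" by auto
    have c: "j a \<in> carrier G" "s x \<in> carrier G" using HomE(2)[OF kg(1) ax(2)] HomE(2)[OF s(1) ax(3)] .
    have ja: "j a = \<ominus>\<^bsub>G\<^esub> s x" using G.M.add_eq_zeroD[OF c ax(4)] .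
    have "\<zero>\<^bsub>C\<^esub> = \<ominus>\<^bsub>C\<^esub> p x" using kg(4)[OF ax(2)] s(2)[OF ax(3)] c unfolding ja by (simp add: Hom_uminus[OF l(2,3) kg(2)])
    then have "p x = \<zero>\<^bsub>C\<^esub>" using HomE(2)[OF lp(2) ax(3)] by (metis C.M.minus_minus C.M.minus_equality C.M.l_zero C.M.zero_closed)
    then obtain y where y: "y \<in> carrier L" "x = i y" using lp(5)[OF ax(3)] by blast
    have "j a = j (k y)" using ja y hx[OF y(1)] k(2)[OF y(1)] by simp
    then have "a = k y" using kg(3) ax(2) HomE(2)[OF k(1) y(1)] by (auto dest: inj_onD)
    then show "\<exists>x\<in>carrier L. z = ?v x" using y ax(1) by auto
  next
    fix y assume y: "y \<in> carrier G"
    obtain x where x: "x \<in> carrier P" "q y = p x" using lp(6)[OF HomE(2)[OF kg(2) y]] by blast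
    have sx: "s x \<in> carrier G" using HomE(2)[OF s(1) x(1)] .
    have "q (y \<ominus>\<^bsub>G\<^esub> s x) = \<zero>\<^bsub>C\<^esub>"
      using y sx s(2)[OF x(1)] x(2) HomE(2)[OF kg(2) y] by (simp add: Hom_minus[OF l(2,3) kg(2)] C.M.minus_self)
    then obtain a where a: "a \<in> carrier K" "y \<ominus>\<^bsub>G\<^esub> s x = j a" using kg(5)[OF G.M.minus_closed[OF y sx]] by blast
    then have "y = j a \<oplus>\<^bsub>G\<^esub> s x" using G.M.minus_add_cancel(1)[OF y sx] by simp
    then show "\<exists>z\<in>carrier (dirsum K P). y = ?w z" using a x(1) by (intro bexI[of _ "(a, x)"]) auto
  qed
  moreover have "?w (x, \<zero>\<^bsub>P\<^esub>) = j x" if "x \<in> carrier K" for x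
    using that HomE(2)[OF kg(1) that] Hom_zero[OF l(5,2) s(1)] by simp
  ultimately show thesis by (intro that[of ?v ?w]) auto
qed

lemma short_exact_lift:
  assumes P: "projective A \<U> P" and G: "G \<in> RMod A \<U>" and C: "C \<in> RMod A \<U>" and "short_exact A K j G q C" "p \<in> Hom A P C"
  obtains s where "s \<in> Hom A P G" "\<And>x. x \<in> carrier P \<Longrightarrow> q (s x) = p x"
  using projective_lift[OF P C G assms(5) short_exactD(2)[OF assms(4)]] short_exactD(6)[OF assms(4)] HomE(2)[OF assms(5)] by metis

text \<open>One projective presentation decides. If t from U \<otimes> K dies in U \<otimes> M, its
  image in U \<otimes> (K \<oplus> P) comes from some y in U \<otimes> L by right exactness of the
  pullback sequence. The P-coordinate of that image is zero, so y = 0 by the injectivity for i, and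
  the K-coordinate, which is t, is zero as well.\<close>

lemma flat_end_presentation:
  assumes L: "L \<in> RMod A \<U>" and P: "projective A \<U> P" and C: "C \<in> RMod A \<U>" and LPC: "short_exact A L i P p C"
    and inj: "inj_on (tensor_map A U P i) (carrier (tensor_module A U L))"
  shows "flat_end C"
  unfolding flat_end_def
proof (intro ballI allI impI)
  fix K M j q assume K: "K \<in> RMod A \<U>" and M: "M \<in> RMod A \<U>" and KMC: "short_exact A K j M q C"
  note lp = short_exactD[OF LPC] and km = short_exactD[OF KMC]
  have l: "lmodule A K" "lmodule A M" "lmodule A C" "lmodule A L" "lmodule A P"
    using K M C L projectiveD(2)[OF P] by (auto simp: RMod_def)
  obtain s where s: "s \<in> Hom A P M" "\<And>x. x \<in> carrier P \<Longrightarrow> q (s x) = p x"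
    using short_exact_lift[OF P M C KMC lp(2)] by metis
  obtain v w where vw: "short_exact A L v (dirsum K P) w M" "\<And>x. x \<in> carrier L \<Longrightarrow> snd (v x) = i x"
    "\<And>x. x \<in> carrier K \<Longrightarrow> w (x, \<zero>\<^bsub>P\<^esub>) = j x"
    using pullback_sequence[OF l KMC LPC s] by metis
  note d = dirsum_Hom[OF l(1,5)] and lD = lmodule_dirsum[OF l(1,5)] and e = short_exactD[OF vw(1)]
  have esur: "w ` carrier (dirsum K P) = carrier M" using vw(1) by (simp add: short_exact_def)
  interpret K: lmodule A K by (rule l)
  interpret P: lmodule A P by (rule l)
  show "inj_on (tensor_map A U M j) (carrier (tensor_module A U K))"
  proof (rule tensor_map_injI[OF l(1,2) km(1)])
    fix t assume t: "t \<in> carrier (tensor_module A U K)" "tensor_map A U M j t = \<zero>\<^bsub>tensor_module A U M\<^esub>"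
    let ?i1 = "\<lambda>x\<in>carrier K. (x, \<zero>\<^bsub>P\<^esub>)"
    let ?t = "tensor_map A U (dirsum K P) ?i1 t"
    have tc: "?t \<in> carrier (tensor_module A U (dirsum K P))" by (rule tensor_map(1)[OF l(1) lD d(3) t(1)])
    have "tensor_map A U M w ?t = \<zero>\<^bsub>tensor_module A U M\<^esub>"
      using tensor_map_compose[OF l(1) lD l(2) d(3) e(2) km(1) _ t(1)] vw(3) t(2) by simp
    then obtain y where y: "y \<in> carrier (tensor_module A U L)" "?t = tensor_map A U (dirsum K P) v y"
      using tensor_right_exact[OF l(4) lD l(2) e(1,2) esur e(5) tc] by blast
    have z: "(\<lambda>x\<in>carrier K. \<zero>\<^bsub>P\<^esub>) \<in> Hom A K P" by (rule Hom_const_zero[OF l(1,5)])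
    \<comment> \<open>The P-coordinate in two ways: through L it is the image of y, through K it is
      zero.\<close>
    have "tensor_map A U P i y = tensor_map A U P (\<lambda>z\<in>carrier (dirsum K P). snd z) ?t"
      unfolding y(2) using vw(2) HomE(2)[OF e(1)] by (intro tensor_map_compose[OF l(4) lD l(5) e(1) d(2) lp(1) _ y(1)]) simp
    also have "\<dots> = tensor_map A U P (\<lambda>x\<in>carrier K. \<zero>\<^bsub>P\<^esub>) t"
      by (rule tensor_map_compose[OF l(1) lD l(5) d(3) d(2) z _ t(1), symmetric]) simp
    also have "\<dots> = \<zero>\<^bsub>tensor_module A U P\<^esub>" by (rule tensor_map_zero[OF l(1,5) z _ t(1)]) simp
    finally have "y = \<zero>\<^bsub>tensor_module A U L\<^esub>" using tensor_map_injD[OF l(4,5) lp(1) inj y(1)] by blast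
    then have t0: "?t = \<zero>\<^bsub>tensor_module A U (dirsum K P)\<^esub>" using y(2) tensor_map(4)[OF l(4) lD e(1)] by simp
    have "t = tensor_map A U K (\<lambda>x\<in>carrier K. x) t" by (rule tensor_map_id[OF l(1) Hom_id[OF l(1)] _ t(1), symmetric]) simp
    also have "\<dots> = tensor_map A U K (\<lambda>z\<in>carrier (dirsum K P). fst z) ?t"
      by (rule tensor_map_compose[OF l(1) lD l(1) d(3) d(1) Hom_id[OF l(1)] _ t(1)]) simp
    also have "\<dots> = \<zero>\<^bsub>tensor_module A U K\<^esub>" unfolding t0 by (rule tensor_map(4)[OF lD l(1) d(1)])
    finally show "t = \<zero>\<^bsub>tensor_module A U K\<^esub>" .
  qed
qed

text \<open>Every module is presented by itself with zero kernel. For projective P this brings P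
  under the results on presentations and on lifts.\<close>

lemma trivial_presentation:
  assumes "lmodule A P"
  shows "submod A P {\<zero>\<^bsub>P\<^esub>}"
    and "short_exact A (P\<lparr>carrier := {\<zero>\<^bsub>P\<^esub>}\<rparr>) (\<lambda>x\<in>{\<zero>\<^bsub>P\<^esub>}. x) P (\<lambda>x\<in>carrier P. x) P"
proof -
  interpret P: lmodule A P by fact
  have "\<ominus>\<^bsub>P\<^esub> \<zero>\<^bsub>P\<^esub> = \<zero>\<^bsub>P\<^esub>" using P.M.minus_equality[of "\<zero>\<^bsub>P\<^esub>" "\<zero>\<^bsub>P\<^esub>"] by simp
  then show s: "submod A P {\<zero>\<^bsub>P\<^esub>}" by (auto simp: submod_def P.smult_zero_right)
  show "short_exact A (P\<lparr>carrier := {\<zero>\<^bsub>P\<^esub>}\<rparr>) (\<lambda>x\<in>{\<zero>\<^bsub>P\<^esub>}. x) P (\<lambda>x\<in>carrier P. x) P"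
    using Hom_submod_inclusion[OF assms s] Hom_id[OF assms] by (intro short_exactI) auto
qed

text \<open>The presentation of P by itself has zero kernel Z, and U \<otimes> Z is zero because the
  identity of Z is also its zero map.\<close>

lemma flat_end_projective:
  assumes P: "projective A \<U> P"
  shows "flat_end P"
proof -
  note l = projectiveD[OF P] and s = trivial_presentation[OF projectiveD(2)[OF P]]
  note lz = lmodule_submod[OF l(2) s(1)] and i = short_exactD(1)[OF s(2)]
  show ?thesis
  proof (rule flat_end_presentation[OF RMod_submod[OF l(1) s(1)] P l(1) s(2) tensor_map_injI[OF lz l(2) i]])
    let ?Z = "P\<lparr>carrier := {\<zero>\<^bsub>P\<^esub>}\<rparr>"
    fix t assume t: "t \<in> carrier (tensor_module A U ?Z)"
    have id: "(\<lambda>x\<in>{\<zero>\<^bsub>P\<^esub>}. x) \<in> Hom A ?Z ?Z" using Hom_id[OF lz] by simp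
    have "t = tensor_map A U ?Z (\<lambda>x\<in>{\<zero>\<^bsub>P\<^esub>}. x) t" by (rule tensor_map_id[OF lz id _ t, symmetric]) simp
    also have "\<dots> = \<zero>\<^bsub>tensor_module A U ?Z\<^esub>" by (rule tensor_map_zero[OF lz lz id _ t]) simp
    finally show "t = \<zero>\<^bsub>tensor_module A U ?Z\<^esub>" .
  qed
qed

text \<open>The pullback sequence for the presentation of P by itself has a zero term on the left,
  so the map from K \<oplus> P to G is bijective.\<close>

lemma split_projective:
  assumes P: "projective A \<U> P" and K: "K \<in> RMod A \<U>" and G: "G \<in> RMod A \<U>" and KGP: "short_exact A K j G q P"
  obtains f g where "isos A G (dirsum K P) f g"
proof -
  note p = projectiveD[OF P] and s0 = trivial_presentation[OF projectiveD(2)[OF P]]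
  have l: "lmodule A K" "lmodule A G" using K G by (auto simp: RMod_def)
  obtain s where s: "s \<in> Hom A P G" "\<And>x. x \<in> carrier P \<Longrightarrow> q (s x) = (\<lambda>x\<in>carrier P. x) x"
    using short_exact_lift[OF P G p(1) KGP Hom_id[OF p(2)]] by metis
  obtain v w where vw: "short_exact A (P\<lparr>carrier := {\<zero>\<^bsub>P\<^esub>}\<rparr>) v (dirsum K P) w G"
    using pullback_sequence[OF l p(2) lmodule_submod[OF p(2) s0(1)] p(2) KGP s0(2) s] by metis
  note e = short_exactD[OF vw] and lD = lmodule_dirsum[OF l(1) p(2)] and lz = lmodule_submod[OF p(2) s0(1)]
  have "inj_on w (carrier (dirsum K P))"
  proof (rule Hom_inj_onI[OF lD l(2) e(2)])
    fix z assume "z \<in> carrier (dirsum K P)" "w z = \<zero>\<^bsub>G\<^esub>"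
    then obtain x where "x = \<zero>\<^bsub>P\<^esub>" "z = v x" using e(5) by auto
    then show "z = \<zero>\<^bsub>dirsum K P\<^esub>" using Hom_zero[OF lz lD e(1)] by simp
  qed
  moreover have "w ` carrier (dirsum K P) = carrier G" using vw by (simp add: short_exact_def)
  ultimately show thesis
    using that isos_sym[OF bij_Hom_isos[OF lD l(2) e(2)]] by (metis bij_betw_def)
qed

text \<open>N' is the preimage of L in N. A sequence that ends at M is thereby cut into one that
  ends at G and one that ends at L, through which properties of G and L reach M.\<close>

lemma nine_sequence:
  assumes R: "L \<in> RMod A \<U>" "M \<in> RMod A \<U>" "G \<in> RMod A \<U>" "H \<in> RMod A \<U>" "N \<in> RMod A \<U>"
    and LMG: "short_exact A L i M p G" and HNM: "short_exact A H f N g M"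
  obtains N' k f' g' r where "N' \<in> RMod A \<U>" "short_exact A N' k N r G" "short_exact A H f' N' g' L"
    "\<And>x. x \<in> carrier H \<Longrightarrow> k (f' x) = f x"
proof -
  have l: "lmodule A L" "lmodule A M" "lmodule A G" "lmodule A H" "lmodule A N" using R by (auto simp: RMod_def)
  note lm = short_exactD[OF LMG] and hn = short_exactD[OF HNM]
  let ?r = "compose (carrier N) p g"
  note r = Hom_compose[OF l(5) hn(2) lm(2)]
  have rs: "?r ` carrier N = carrier G"
    using LMG HNM HomE(2)[OF hn(2)] by (simp add: short_exact_def compose_eq flip: image_comp cong: image_cong) (metis image_image)
  let ?S = "a_kernel N G ?r"
  note s = submod_kernel[OF l(5,3) r]
  let ?N = "N\<lparr>carrier := ?S\<rparr>"
  note lN = lmodule_submod[OF l(5) s]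
  have S: "x \<in> ?S \<longleftrightarrow> x \<in> carrier N \<and> p (g x) = \<zero>\<^bsub>G\<^esub>" for x by (auto simp: a_kernel_iff compose_eq)
  have gS: "restrict g ?S \<in> Hom A ?N M" by (rule Hom_submod_restrict[OF l(5) s hn(2)])
  obtain g' where g': "g' \<in> Hom A ?N L" "\<And>x. x \<in> carrier ?N \<Longrightarrow> i (g' x) = restrict g ?S x"
  proof (rule factor_through_kernel[OF lN l(1,2) lm(1,3) gS])
    show "restrict g ?S ` carrier ?N \<subseteq> i ` carrier L"
      using S lm(5)[OF HomE(2)[OF hn(2)]] by auto
  qed blast
  have fS: "f ` carrier H \<subseteq> ?S"
    using hn(4) HomE(2)[OF hn(1)] Hom_zero[OF l(2,3) lm(2)] by (auto simp: S)
  have "short_exact A H f ?N g' L"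
  proof (rule short_exactI)
    show "f \<in> Hom A H ?N" by (rule Hom_submod_codomain[OF hn(1) fS])
    show "g' \<in> Hom A ?N L" "inj_on f (carrier H)" by fact+
    have iz: "i y = \<zero>\<^bsub>M\<^esub> \<longleftrightarrow> y = \<zero>\<^bsub>L\<^esub>" if "y \<in> carrier L" for y
      using Hom_inj_onD[OF l(1,2) lm(1,3) that] Hom_zero[OF l(1,2) lm(1)] by blast
    show "g' (f x) = \<zero>\<^bsub>L\<^esub>" if x: "x \<in> carrier H" for x
    proof -
      have fx: "f x \<in> ?S" using fS x by blast
      then have "i (g' (f x)) = \<zero>\<^bsub>M\<^esub>" using g'(2)[of "f x"] hn(4)[OF x] by simp
      then show ?thesis using iz HomE(2)[OF g'(1), of "f x"] fx by simp
    qed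
    show "\<exists>x\<in>carrier H. y = f x" if y: "y \<in> carrier ?N" "g' y = \<zero>\<^bsub>L\<^esub>" for y
      using y g'(2)[OF y(1)] Hom_zero[OF l(1,2) lm(1)] S by (intro hn(5)) auto
    show "\<exists>y\<in>carrier ?N. z = g' y" if z: "z \<in> carrier L" for z
    proof -
      obtain y where y: "y \<in> carrier N" "i z = g y" using hn(6)[OF HomE(2)[OF lm(1) z]] by blast
      then have yS: "y \<in> ?S" using lm(4)[OF z] S by metis
      then have "i (g' y) = i z" using g'(2)[of y] y(2) by simp
      then show ?thesis using lm(3) z yS HomE(2)[OF g'(1), of y] by (intro bexI[of _ y]) (auto dest: inj_onD)
    qed
  qed
  then show thesis
    using fS short_exact_kernel[OF l(5,3) r rs] RMod_submod[OF R(5) s]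
    by (intro that[of ?N "\<lambda>x\<in>?S. x" ?r f g']) auto
qed

lemma flat_endD:
  "\<lbrakk>flat_end C; K \<in> RMod A \<U>; M \<in> RMod A \<U>; short_exact A K f M g C\<rbrakk> \<Longrightarrow>
    inj_on (tensor_map A U M f) (carrier (tensor_module A U K))"
  unfolding flat_end_def by blast

lemma tor_vanish_SucD:
  "\<lbrakk>tor_vanish (Suc m) C; K \<in> RMod A \<U>; M \<in> RMod A \<U>; short_exact A K f M g C; tor_vanish m M\<rbrakk> \<Longrightarrow> tor_vanish m K"
  by simp blast

text \<open>After cutting the sequence with \<open>nine_sequence\<close>, injectivity holds for both
  factors of f; and vanishing passes from N to N' by the condition on G, then from N' to H by the
  condition on L.\<close>

lemma tor_vanish_extension:
  assumes R: "L \<in> RMod A \<U>" "M \<in> RMod A \<U>" "G \<in> RMod A \<U>"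
    and LMG: "short_exact A L i M p G" and t: "tor_vanish m L" "tor_vanish m G"
  shows "tor_vanish m M"
proof (cases m)
  case (Suc m')
  have "flat_end M"
    unfolding flat_end_def
  proof (intro ballI allI impI)
    fix H N f g assume HN: "H \<in> RMod A \<U>" "N \<in> RMod A \<U>" and HNM: "short_exact A H f N g M"
    obtain N' k f' g' r where N': "N' \<in> RMod A \<U>" "short_exact A N' k N r G" "short_exact A H f' N' g' L"
      "\<And>x. x \<in> carrier H \<Longrightarrow> k (f' x) = f x"
      using nine_sequence[OF R HN LMG HNM] by metis
    have l: "lmodule A H" "lmodule A N" "lmodule A N'" using HN N' by (auto simp: RMod_def)
    note k = short_exactD(1)[OF N'(2)] and f' = short_exactD(1)[OF N'(3)] and f = short_exactD(1)[OF HNM]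
    have ik: "inj_on (tensor_map A U N k) (carrier (tensor_module A U N'))"
      using t(2) N' HN Suc by (intro flat_endD[of G]) auto
    have if': "inj_on (tensor_map A U N' f') (carrier (tensor_module A U H))"
      using t(1) N' HN Suc by (intro flat_endD[of L]) auto
    show "inj_on (tensor_map A U N f) (carrier (tensor_module A U H))"
    proof (rule tensor_map_injI[OF l(1,2) f])
      fix z assume z: "z \<in> carrier (tensor_module A U H)" "tensor_map A U N f z = \<zero>\<^bsub>tensor_module A U N\<^esub>"
      have "tensor_map A U N f z = tensor_map A U N k (tensor_map A U N' f' z)"
        using N'(4) by (intro tensor_map_compose[OF l(1,3,2) f' k f _ z(1)]) simp
      then have "tensor_map A U N' f' z = \<zero>\<^bsub>tensor_module A U N'\<^esub>"
        using tensor_map_injD[OF l(3,2) k ik] tensor_map(1)[OF l(1,3) f' z(1)] z(2) by simp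
      then show "z = \<zero>\<^bsub>tensor_module A U H\<^esub>" using tensor_map_injD[OF l(1,3) f' if' z(1)] by blast
    qed
  qed
  moreover have "tor_vanish m' H"
    if HN: "H \<in> RMod A \<U>" "N \<in> RMod A \<U>" and HNM: "short_exact A H f N g M" and tN: "tor_vanish m' N" for H N f g
  proof -
    obtain N' k f' g' r where N': "N' \<in> RMod A \<U>" "short_exact A N' k N r G" "short_exact A H f' N' g' L"
      using nine_sequence[OF R HN LMG HNM] by metis
    have "tor_vanish m' N'" using tor_vanish_SucD[of m' G] t(2) Suc N' HN tN by blast
    then show ?thesis using tor_vanish_SucD[of m' L] t(1) Suc N' HN by blast
  qed
  ultimately show ?thesis using Suc by auto
qed simp

text \<open>Adding P to the middle and to the right term turns a sequence that ends at K into one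
  that ends at W. The new middle term is an extension of P by M, so
  \<open>tor_vanish_extension\<close> applies to it.\<close>

lemma dirsum_sequence:
  assumes R: "H \<in> RMod A \<U>" "M \<in> RMod A \<U>" "K \<in> RMod A \<U>" "P \<in> RMod A \<U>" "W \<in> RMod A \<U>"
    and W: "isos A W (dirsum K P) a b" and HMK: "short_exact A H f M g K"
  obtains M' f' g' c where "M' \<in> RMod A \<U>" "short_exact A H f' M' g' W"
    "c \<in> Hom A M M'" "\<And>x. x \<in> carrier H \<Longrightarrow> f' x = c (f x)" "\<exists>d. short_exact A M c M' d P"
proof -
  have l: "lmodule A H" "lmodule A M" "lmodule A K" "lmodule A P" "lmodule A W" using R by (auto simp: RMod_def)
  interpret M: lmodule A M by (rule l)
  interpret P: lmodule A P by (rule l)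
  note lD = lmodule_dirsum[OF l(2,4)] lmodule_dirsum[OF l(3,4)] and e = short_exactD[OF HMK]
  note d = dirsum_Hom[OF l(2,4)]
  obtain M' \<phi> \<psi> where M': "M' \<in> RMod A \<U>" "isos A M' (dirsum M P) \<phi> \<psi>" using RMod_dirsum[OF R(2,4)] by metis
  have lM': "lmodule A M'" using M'(1) by (simp add: RMod_def)
  let ?f = "compose (carrier H) (\<lambda>x\<in>carrier M. (x, \<zero>\<^bsub>P\<^esub>)) f"
  let ?g = "\<lambda>z\<in>carrier (dirsum M P). (g (fst z), snd z)"
  have g: "?g \<in> Hom A (dirsum M P) (dirsum K P)"
    using e(2) by (intro HomI[OF lD(1)]) (auto simp: HomE)
  have fx: "?f x = (f x, \<zero>\<^bsub>P\<^esub>)" "f x \<in> carrier M" if "x \<in> carrier H" for x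
    using that HomE(2)[OF e(1) that] by (simp_all add: compose_eq)
  have ex: "short_exact A H ?f (dirsum M P) ?g (dirsum K P)"
  proof (rule short_exactI[OF Hom_compose[OF l(1) e(1) d(3)] g])
    show "inj_on ?f (carrier H)" using e(3) fx by (auto simp: inj_on_def)
    show "?g (?f x) = \<zero>\<^bsub>dirsum K P\<^esub>" if "x \<in> carrier H" for x using fx[OF that] e(4)[OF that] by simp
    show "\<exists>x\<in>carrier H. y = ?f x" if "y \<in> carrier (dirsum M P)" "?g y = \<zero>\<^bsub>dirsum K P\<^esub>" for y
      using that e(5)[of "fst y"] fx by (cases y) auto
    show "\<exists>y\<in>carrier (dirsum M P). z = ?g y" if "z \<in> carrier (dirsum K P)" for z
      using that e(6)[of "fst z"] by (cases z) auto
  qed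
  note ex' = short_exact_isos_middle[OF l(1) lM' ex M'(2)]
  note ex'' = short_exact_isos_right[OF lM' lD(2) l(5) ex' isos_sym[OF W]]
  let ?c = "compose (carrier M) \<psi> (\<lambda>x\<in>carrier M. (x, \<zero>\<^bsub>P\<^esub>))"
  have "short_exact A M (\<lambda>x\<in>carrier M. (x, \<zero>\<^bsub>P\<^esub>)) (dirsum M P) (\<lambda>z\<in>carrier (dirsum M P). snd z) P"
    by (rule short_exactI[OF d(3,2)]) (auto simp: inj_on_def)
  note s = short_exact_isos_middle[OF l(2) lM' this M'(2)]
  show thesis
  proof (rule that[OF M'(1) ex'' short_exactD(1)[OF s]])
    show "compose (carrier H) \<psi> ?f x = ?c (f x)" if "x \<in> carrier H" for x
      using fx[OF that] that by (simp add: compose_eq)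
    show "\<exists>d. short_exact A M ?c M' d P" using s by blast
  qed
qed

text \<open>The two claims carry each other through the induction. Cancelling P in degree m + 1 uses
  \<open>tor_vanish m P\<close>, by which M \<oplus> P inherits the condition from M. A projective P
  in degree m + 1 uses cancellation in degree m, since every sequence that ends at P splits.\<close>

lemma tor_vanish_projective_aux:
  "(\<forall>W\<in>RMod A \<U>. \<forall>K\<in>RMod A \<U>. \<forall>P a b. isos A W (dirsum K P) a b \<longrightarrow> projective A \<U> P \<longrightarrow> tor_vanish m W \<longrightarrow> tor_vanish m K) \<and>
   (\<forall>P. projective A \<U> P \<longrightarrow> tor_vanish m P)"
proof (induction m)
  case (Suc m)
  have "tor_vanish (Suc m) K"
    if W: "W \<in> RMod A \<U>" and K: "K \<in> RMod A \<U>" and i: "isos A W (dirsum K P) a b" and P: "projective A \<U> P"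
      and t: "tor_vanish (Suc m) W" for W K P a b
  proof -
    note seq = dirsum_sequence[OF _ _ K projectiveD(1)[OF P] W i]
    have "flat_end K"
      unfolding flat_end_def
    proof (intro ballI allI impI)
      fix H M f g assume HM: "H \<in> RMod A \<U>" "M \<in> RMod A \<U>" and HMK: "short_exact A H f M g K"
      obtain M' f' g' c where M': "M' \<in> RMod A \<U>" "short_exact A H f' M' g' W"
        "c \<in> Hom A M M'" "\<And>x. x \<in> carrier H \<Longrightarrow> f' x = c (f x)" using seq[OF HM HMK] by metis
      have l: "lmodule A H" "lmodule A M" "lmodule A M'" using HM M' by (auto simp: RMod_def)
      note f' = short_exactD(1)[OF M'(2)] and f = short_exactD(1)[OF HMK]
      have if': "inj_on (tensor_map A U M' f') (carrier (tensor_module A U H))"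
        using t M' HM by (intro flat_endD[of W]) auto
      show "inj_on (tensor_map A U M f) (carrier (tensor_module A U H))"
      proof (rule tensor_map_injI[OF l(1,2) f])
        fix z assume z: "z \<in> carrier (tensor_module A U H)" "tensor_map A U M f z = \<zero>\<^bsub>tensor_module A U M\<^esub>"
        have "tensor_map A U M' f' z = tensor_map A U M' c (tensor_map A U M f z)"
          by (rule tensor_map_compose[OF l f M'(3) f' M'(4) z(1)])
        then have "tensor_map A U M' f' z = \<zero>\<^bsub>tensor_module A U M'\<^esub>"
          using z(2) tensor_map(4)[OF l(2,3) M'(3)] by simp
        then show "z = \<zero>\<^bsub>tensor_module A U H\<^esub>" using tensor_map_injD[OF l(1,3) f' if' z(1)] by blast
      qed
    qed
    moreover have "tor_vanish m H"
      if HM: "H \<in> RMod A \<U>" "M \<in> RMod A \<U>" and HMK: "short_exact A H f M g K" and tM: "tor_vanish m M" for H M f g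
    proof -
      obtain M' f' g' c d where M': "M' \<in> RMod A \<U>" "short_exact A H f' M' g' W" "short_exact A M c M' d P"
        using seq[OF HM HMK] by metis
      have "tor_vanish m P" using Suc.IH P by blast
      then have "tor_vanish m M'" by (rule tor_vanish_extension[OF HM(2) M'(1) projectiveD(1)[OF P] M'(3) tM])
      then show ?thesis using tor_vanish_SucD[OF t HM(1) M'(1,2)] by blast
    qed
    ultimately show ?thesis by auto
  qed
  moreover have "tor_vanish (Suc m) P" if P: "projective A \<U> P" for P
  proof -
    have "tor_vanish m K" if KG: "K \<in> RMod A \<U>" "G \<in> RMod A \<U>" "short_exact A K f G g P" "tor_vanish m G" for K G f g
      using split_projective[OF P KG(1-3)] Suc.IH KG P by metis
    then show ?thesis using flat_end_projective[OF P] by auto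
  qed
  ultimately show ?case by blast
qed simp

lemma tor_vanish_projective: "projective A \<U> P \<Longrightarrow> tor_vanish m P"
  using tor_vanish_projective_aux by blast

text \<open>Given another sequence K, G, C, the pullback sequence makes K \<oplus> P an extension of
  G by L. So it satisfies \<open>tor_vanish m\<close>, and P can be cancelled.\<close>

lemma tor_vanish_presentation:
  assumes L: "L \<in> RMod A \<U>" and P: "projective A \<U> P" and C: "C \<in> RMod A \<U>" and LPC: "short_exact A L i P p C"
    and inj: "inj_on (tensor_map A U P i) (carrier (tensor_module A U L))" and t: "tor_vanish m L"
  shows "tor_vanish (Suc m) C"
proof -
  have "tor_vanish m K"
    if KG: "K \<in> RMod A \<U>" "G \<in> RMod A \<U>" and KGC: "short_exact A K f G g C" and tG: "tor_vanish m G" for K G f g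
  proof -
    have l: "lmodule A K" "lmodule A G" "lmodule A C" "lmodule A L" "lmodule A P"
      using KG C L projectiveD(2)[OF P] by (auto simp: RMod_def)
    obtain s where s: "s \<in> Hom A P G" "\<And>x. x \<in> carrier P \<Longrightarrow> g (s x) = p x"
      using short_exact_lift[OF P KG(2) C KGC short_exactD(2)[OF LPC]] by metis
    obtain v w where vw: "short_exact A L v (dirsum K P) w G" using pullback_sequence[OF l KGC LPC s] by metis
    obtain W a b where W: "W \<in> RMod A \<U>" "isos A W (dirsum K P) a b" using RMod_dirsum[OF KG(1) projectiveD(1)[OF P]] by metis
    then have lW: "lmodule A W" by (simp add: RMod_def)
    have "tor_vanish m W"
      using tor_vanish_extension[OF L W(1) KG(2) short_exact_isos_middle[OF l(4) lW vw W(2)] t tG] .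
    then show ?thesis using tor_vanish_projective_aux W KG(1) P by blast
  qed
  then show ?thesis using flat_end_presentation[OF L P C LPC inj] by auto
qed

text \<open>Makes the resolution hidden in \<open>Tor\<close> available, with triviality of a group
  read as exactness of the tensored complex. This resolution is used once, to establish
  \<open>tor_vanish\<close>, which no longer refers to a choice.\<close>

lemma Tor_trivial_exact:
  assumes C: "C \<in> RMod A \<U>"
  obtains P d e where "proj_resolution A \<U> P d e C"
    "\<And>j t. \<lbrakk>trivial_group (Tor A \<U> (Suc j) U C); t \<in> carrier (tensor_module A U (P (Suc j)));
      tensor_map A U (P j) (d j) t = \<zero>\<^bsub>tensor_module A U (P j)\<^esub>\<rbrakk> \<Longrightarrow>
      \<exists>s\<in>carrier (tensor_module A U (P (Suc (Suc j)))). t = tensor_map A U (P (Suc j)) (d (Suc j)) s"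
proof -
  define T where "T = (SOME (P, d, e). proj_resolution A \<U> P d e C)"
  obtain P d e where T: "T = (P, d, e)" by (cases T)
  obtain P' d' e' where "proj_resolution A \<U> P' d' e' C"
    using projective_resolution_exists[OF _ _ small_rings(1)] C by (metis RMod_small)
  then have "case T of (P, d, e) \<Rightarrow> proj_resolution A \<U> P d e C"
    unfolding T_def by (intro someI_ex[of "\<lambda>(P, d, e). proj_resolution A \<U> P d e C"]) auto
  then have P: "proj_resolution A \<U> P d e C" by (simp add: T)
  have l: "lmodule A (P i)" for i using P projectiveD(2)[of A \<U> "P i"] by (simp add: proj_resolution_def)
  note p = resolutionD[OF P[unfolded proj_resolution_def, THEN conjunct1]]
  have "\<exists>s\<in>carrier (tensor_module A U (P (Suc (Suc j)))). t = tensor_map A U (P (Suc j)) (d (Suc j)) s"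
    if tr: "trivial_group (Tor A \<U> (Suc j) U C)" and t: "t \<in> carrier (tensor_module A U (P (Suc j)))"
      "tensor_map A U (P j) (d j) t = \<zero>\<^bsub>tensor_module A U (P j)\<^esub>" for j t
  proof -
    let ?G = "\<lambda>i. tensor_group A U (P i)" and ?\<delta> = "\<lambda>i. tensor_map A U (P i) (d i)"
    have tor: "Tor A \<U> (Suc j) U C =
        (?G (Suc j))\<lparr>carrier := kernel (?G (Suc j)) (?G j) (?\<delta> j)\<rparr> Mod (?\<delta> (Suc j) ` carrier (?G (Suc (Suc j))))"
      unfolding Tor_def T_def[symmetric] T by (simp add: Let_def)
    interpret G: comm_group "?G (Suc j)" by (rule comm_group_tensor[OF l])
    note s = tensor_module_simps[OF l]
    interpret T2: lmodule B "tensor_module A U (P (Suc (Suc j)))" by (rule lmodule_tensor[OF l])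
    have "\<one>\<^bsub>?G (Suc j)\<^esub> \<in> ?\<delta> (Suc j) ` carrier (?G (Suc (Suc j)))"
      using tensor_map(4)[OF l l p(2)[of "Suc j"]] T2.M.zero_closed unfolding s by (metis image_eqI)
    then have "kernel (?G (Suc j)) (?G j) (?\<delta> j) \<subseteq> ?\<delta> (Suc j) ` carrier (?G (Suc (Suc j)))"
      using G.trivial_group_ModD[OF tr[unfolded tor]] by (simp add: kernel_def)
    moreover have "t \<in> kernel (?G (Suc j)) (?G j) (?\<delta> j)" using t by (simp add: kernel_def s)
    ultimately show ?thesis unfolding s by blast
  qed
  then show thesis using that P by blast
qed

text \<open>Dimension shift along the syzygies K i, the images of the differentials. Each
  presentation K (i + 1), P (i + 1), K i feeds \<open>tor_vanish_presentation\<close>, and K 0, P 0,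
  C gives the claim.\<close>

lemma Tor_trivial_imp_tor_vanish:
  assumes C: "C \<in> RMod A \<U>" and tor: "\<And>j. 1 \<le> j \<Longrightarrow> j \<le> N \<Longrightarrow> trivial_group (Tor A \<U> j U C)" and m: "m \<le> N"
  shows "tor_vanish m C"
proof -
  obtain P d e where P: "proj_resolution A \<U> P d e C" and ex:
    "\<And>j t. \<lbrakk>trivial_group (Tor A \<U> (Suc j) U C); t \<in> carrier (tensor_module A U (P (Suc j)));
      tensor_map A U (P j) (d j) t = \<zero>\<^bsub>tensor_module A U (P j)\<^esub>\<rbrakk> \<Longrightarrow>
      \<exists>s\<in>carrier (tensor_module A U (P (Suc (Suc j)))). t = tensor_map A U (P (Suc j)) (d (Suc j)) s"
    using Tor_trivial_exact[OF C] by metis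
  have pr: "projective A \<U> (P i)" for i using P by (simp add: proj_resolution_def)
  note lP = projectiveD[OF pr] and p = resolutionD[OF P[unfolded proj_resolution_def, THEN conjunct1]]
  have lC: "lmodule A C" using C by (simp add: RMod_def)
  define S where "S i = d i ` carrier (P (Suc i))" for i
  define K where "K i = (P i)\<lparr>carrier := S i\<rparr>" for i
  have s: "submod A (P i) (S i)" for i unfolding S_def by (rule submod_image[OF lP(2) lP(2) p(2)])
  have K: "K i \<in> RMod A \<U>" "lmodule A (K i)" for i
    unfolding K_def by (rule RMod_submod[OF lP(1) s], rule lmodule_submod[OF lP(2) s])
  let ?i = "\<lambda>i. \<lambda>x\<in>S i. x"
  have inc: "?i i \<in> Hom A (K i) (P i)" for i unfolding K_def by (rule Hom_submod_inclusion[OF lP(2) s])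
  have dK: "d i \<in> Hom A (P (Suc i)) (K i)" for i unfolding K_def S_def by (rule Hom_submod_codomain[OF p(2)]) simp
  have cK: "carrier (K i) = S i" "\<zero>\<^bsub>K i\<^esub> = \<zero>\<^bsub>P i\<^esub>" for i by (simp_all add: K_def)
  have e0: "short_exact A (K 0) (?i 0) (P 0) e C"
  proof (rule short_exactI[OF inc p(1)])
    show "\<exists>x\<in>carrier (K 0). y = ?i 0 x" if "y \<in> carrier (P 0)" "e y = \<zero>\<^bsub>C\<^esub>" for y
      using p(5)[OF that] by (auto simp: cK S_def)
  qed (use p(3,4) in \<open>auto simp: cK S_def inj_on_def\<close>)
  have eS: "short_exact A (K (Suc i)) (?i (Suc i)) (P (Suc i)) (d i) (K i)" for i
  proof (rule short_exactI[OF inc dK])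
    show "\<exists>x\<in>carrier (K (Suc i)). y = ?i (Suc i) x" if "y \<in> carrier (P (Suc i))" "d i y = \<zero>\<^bsub>K i\<^esub>" for y
      using p(7)[of y i] that by (auto simp: cK S_def)
  qed (use p(6) in \<open>auto simp: cK S_def inj_on_def\<close>)
  \<comment> \<open>Triviality of Tor in degree i + 1 is exactness of the tensored complex at P (i +
    1). An element killed in U \<otimes> P i lifts to U \<otimes> P (i + 1), where it is a boundary,
    and boundaries become zero in U \<otimes> K i.\<close>
  have inj: "inj_on (tensor_map A U (P i) (?i i)) (carrier (tensor_module A U (K i)))" if N: "Suc i \<le> N" for i
  proof (rule tensor_map_injI[OF K(2) lP(2) inc])
    fix t assume t: "t \<in> carrier (tensor_module A U (K i))" "tensor_map A U (P i) (?i i) t = \<zero>\<^bsub>tensor_module A U (P i)\<^esub>"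
    obtain w where w: "w \<in> carrier (tensor_module A U (P (Suc i)))" "t = tensor_map A U (K i) (d i) w"
      using tensor_map_surj[OF lP(2) K(2) dK _ t(1)] by (auto simp: cK S_def)
    have "tensor_map A U (P i) (d i) w = tensor_map A U (P i) (?i i) (tensor_map A U (K i) (d i) w)"
      by (rule tensor_map_compose[OF lP(2) K(2) lP(2) dK inc p(2) _ w(1)]) (simp add: S_def)
    then obtain y where y: "y \<in> carrier (tensor_module A U (P (Suc (Suc i))))" "w = tensor_map A U (P (Suc i)) (d (Suc i)) y"
      using ex[OF tor w(1)] N t(2) w(2) by auto
    have z: "(\<lambda>x\<in>carrier (P (Suc (Suc i))). \<zero>\<^bsub>K i\<^esub>) \<in> Hom A (P (Suc (Suc i))) (K i)" by (rule Hom_const_zero[OF lP(2) K(2)])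
    have "t = tensor_map A U (K i) (\<lambda>x\<in>carrier (P (Suc (Suc i))). \<zero>\<^bsub>K i\<^esub>) y"
      unfolding w(2) y(2) by (rule tensor_map_compose[OF lP(2) lP(2) K(2) p(2) dK z _ y(1), symmetric]) (simp add: cK p(6))
    also have "\<dots> = \<zero>\<^bsub>tensor_module A U (K i)\<^esub>" by (rule tensor_map_zero[OF lP(2) K(2) z _ y(1)]) simp
    finally show "t = \<zero>\<^bsub>tensor_module A U (K i)\<^esub>" .
  qed
  \<comment> \<open>K i is the syzygy number i + 1, so \<open>tor_vanish m (K i)\<close> draws on
    Tor of C up to degree i + 1 + m.\<close>
  have "\<forall>i. Suc i + m \<le> N \<longrightarrow> tor_vanish m (K i)" for m
  proof (induction m)
    case (Suc m)
    show ?case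
    proof (intro allI impI)
      fix i assume "Suc i + Suc m \<le> N"
      then show "tor_vanish (Suc m) (K i)"
        using Suc by (intro tor_vanish_presentation[OF K(1) pr K(1) eS inj]) auto
    qed
  qed simp
  note * = this
  show ?thesis
  proof (cases m)
    case (Suc m')
    then have "tor_vanish m' (K 0)" and N: "Suc 0 \<le> N" using * m by auto
    then show ?thesis unfolding Suc by (intro tor_vanish_presentation[OF K(1) pr C e0 inj[OF N]])
  qed simp
qed

text \<open>The tensored sequence is exact once every cosyzygy J i is a \<open>flat_end\<close>.
  This is known at the zero tail and moves to the left at the price of one degree per step. The
  condition on C i is asked for each m up to k, since monotonicity of \<open>tor_vanish\<close> in m
  is not derived.\<close>

lemma tensor_coresolution:
  assumes c: "coresolution A X e C d" and X: "X \<in> RMod A \<U>" and C: "\<And>i. C i \<in> RMod A \<U>"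
    and van: "\<forall>i\<le>k. \<forall>m\<le>k. tor_vanish m (C i)" and zero: "\<forall>i>k. carrier (C i) = {\<zero>\<^bsub>C i\<^esub>}"
  shows "inj_on (tensor_map A U (C 0) e) (carrier (tensor_module A U X))"
    and "\<lbrakk>t \<in> carrier (tensor_module A U (C 0)); tensor_map A U (C (Suc 0)) (d 0) t = \<zero>\<^bsub>tensor_module A U (C (Suc 0))\<^esub>\<rbrakk> \<Longrightarrow>
      \<exists>s\<in>carrier (tensor_module A U X). t = tensor_map A U (C 0) e s"
    and "\<lbrakk>z \<in> carrier (tensor_module A U (C (Suc i)));
      tensor_map A U (C (Suc (Suc i))) (d (Suc i)) z = \<zero>\<^bsub>tensor_module A U (C (Suc (Suc i)))\<^esub>\<rbrakk> \<Longrightarrow>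
      \<exists>s\<in>carrier (tensor_module A U (C i)). z = tensor_map A U (C (Suc i)) (d i) s"
proof -
  note van = van[rule_format] and zero = zero[rule_format]
  note p = coresolutionD[OF c]
  have l: "lmodule A X" "lmodule A (C i)" for i using X C by (auto simp: RMod_def)
  define S where "S i = d i ` carrier (C i)" for i
  define J where "J i = (C (Suc i))\<lparr>carrier := S i\<rparr>" for i
  have s: "submod A (C (Suc i)) (S i)" for i unfolding S_def by (rule submod_image[OF l(2) l(2) p(2)])
  have J: "J i \<in> RMod A \<U>" "lmodule A (J i)" for i
    unfolding J_def by (rule RMod_submod[OF C s], rule lmodule_submod[OF l(2) s])
  let ?i = "\<lambda>i. \<lambda>x\<in>S i. x"
  have inc: "?i i \<in> Hom A (J i) (C (Suc i))" for i unfolding J_def by (rule Hom_submod_inclusion[OF l(2) s])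
  have dJ: "d i \<in> Hom A (C i) (J i)" for i unfolding J_def S_def by (rule Hom_submod_codomain[OF p(2)]) simp
  have cJ: "carrier (J i) = S i" "\<zero>\<^bsub>J i\<^esub> = \<zero>\<^bsub>C (Suc i)\<^esub>" for i by (simp_all add: J_def)
  have e0: "short_exact A X e (C 0) (d 0) (J 0)"
    using p(3,4,5) by (intro short_exactI[OF p(1) dJ]) (auto simp: cJ S_def)
  have eS: "short_exact A (J i) (?i i) (C (Suc i)) (d (Suc i)) (J (Suc i))" for i
  proof (rule short_exactI[OF inc dJ])
    show "\<exists>x\<in>carrier (J i). y = ?i i x" if "y \<in> carrier (C (Suc i))" "d (Suc i) y = \<zero>\<^bsub>J (Suc i)\<^esub>" for y
      using p(7)[of y i] that by (auto simp: cJ S_def)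
  qed (use p(6) in \<open>auto simp: cJ S_def inj_on_def\<close>)
  \<comment> \<open>From index k on the cosyzygies are zero, hence projective, and satisfy the
    condition in every degree.\<close>
  have Jz: "tor_vanish m (J i)" if "k \<le> i" for i m
  proof (rule tor_vanish_projective, rule projective_trivial[OF J(1)])
    have "S i \<subseteq> {\<zero>\<^bsub>C (Suc i)\<^esub>}" "\<zero>\<^bsub>C (Suc i)\<^esub> \<in> S i" using s[of i] zero[of "Suc i"] that by (auto simp: submod_def)
    then show "carrier (J i) = {\<zero>\<^bsub>J i\<^esub>}" unfolding cJ by blast
  qed
  \<comment> \<open>With i = k - r, degree m + 1 for J i and degree m for C i give degree m for J (i
    - 1). So m + r stays bounded by k + 1, which leaves degree 1 for every J i.\<close>
  have "\<forall>m. m + r \<le> Suc k \<longrightarrow> tor_vanish m (J (k - r))" if "r \<le> k" for r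
    using that
  proof (induction r)
    case 0 then show ?case using Jz by simp
  next
    case (Suc r)
    have eq: "Suc (k - Suc r) = k - r" using Suc.prems by simp
    show ?case
    proof (intro allI impI)
      fix m assume m: "m + Suc r \<le> Suc k"
      have "\<forall>m. m + r \<le> Suc k \<longrightarrow> tor_vanish m (J (k - r))" using Suc by simp
      then have "tor_vanish (Suc m) (J (k - r))" using m by (elim allE[of _ "Suc m"]) simp
      moreover have "tor_vanish m (C (k - r))" using m by (intro van) auto
      ultimately show "tor_vanish m (J (k - Suc r))"
        using tor_vanish_SucD[OF _ J(1) C eS[of "k - Suc r"]] unfolding eq by blast
    qed
  qed
  note * = this
  have "tor_vanish 1 (J i)" for i
  proof (cases "k \<le> i")
    case False
    then show ?thesis using *[of "k - i"] by (simp del: tor_vanish.simps)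
  qed (rule Jz)
  then have fJ: "flat_end (J i)" for i by simp
  show "inj_on (tensor_map A U (C 0) e) (carrier (tensor_module A U X))" by (rule flat_endD[OF fJ X C e0])
  have dz: "tensor_map A U (J i) (d i) t = \<zero>\<^bsub>tensor_module A U (J i)\<^esub>"
    if t: "t \<in> carrier (tensor_module A U (C i))" "tensor_map A U (C (Suc i)) (d i) t = \<zero>\<^bsub>tensor_module A U (C (Suc i))\<^esub>" for i t
  proof -
    have "tensor_map A U (C (Suc i)) (d i) t = tensor_map A U (C (Suc i)) (?i i) (tensor_map A U (J i) (d i) t)"
      by (rule tensor_map_compose[OF l(2) J(2) l(2) dJ inc p(2) _ t(1)]) (simp add: S_def)
    then show ?thesis
      using tensor_map_injD[OF J(2) l(2) inc flat_endD[OF fJ J(1) C eS]] tensor_map(1)[OF l(2) J(2) dJ t(1)] t(2) by simp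
  qed
  have sur: "d i ` carrier (C i) = carrier (J i)" for i by (simp add: cJ S_def)
  show "\<exists>s\<in>carrier (tensor_module A U X). t = tensor_map A U (C 0) e s"
    if "t \<in> carrier (tensor_module A U (C 0))" "tensor_map A U (C (Suc 0)) (d 0) t = \<zero>\<^bsub>tensor_module A U (C (Suc 0))\<^esub>"
    using tensor_right_exact[OF l(1) l(2) J(2) p(1) dJ sur _ that(1) dz[OF that]] p(5) by (simp add: cJ)
  show "\<exists>s\<in>carrier (tensor_module A U (C i)). z = tensor_map A U (C (Suc i)) (d i) s"
    if "z \<in> carrier (tensor_module A U (C (Suc i)))"
      "tensor_map A U (C (Suc (Suc i))) (d (Suc i)) z = \<zero>\<^bsub>tensor_module A U (C (Suc (Suc i)))\<^esub>"
    using tensor_right_exact[OF l(2) l(2) J(2) p(2) dJ sur _ that(1) dz[OF that]] p(7) by (simp add: cJ)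
qed

end

section \<open>Modules over the triangular matrix ring as triples\<close>

text \<open>The module axioms pass along a surjection that respects the operations, which spares
  their verification on cosets.\<close>

lemma lmodule_surj_image:
  assumes M: "lmodule R M" and q: "q ` carrier M = carrier Q"
    and a: "\<And>x y. \<lbrakk>x \<in> carrier M; y \<in> carrier M\<rbrakk> \<Longrightarrow> q (x \<oplus>\<^bsub>M\<^esub> y) = q x \<oplus>\<^bsub>Q\<^esub> q y"
    and s: "\<And>r x. \<lbrakk>r \<in> carrier R; x \<in> carrier M\<rbrakk> \<Longrightarrow> q (r \<odot>\<^bsub>M\<^esub> x) = r \<odot>\<^bsub>Q\<^esub> q x"
    and z: "\<zero>\<^bsub>Q\<^esub> = q \<zero>\<^bsub>M\<^esub>"
  shows "lmodule R Q"
proof -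
  interpret M: lmodule R M by fact
  have q': "\<exists>y\<in>carrier M. x = q y" if "x \<in> carrier Q" for x using that q by blast
  have qc: "q x \<in> carrier Q" if "x \<in> carrier M" for x using that q by blast
  show ?thesis
  proof (rule lmoduleI[OF M.R.ring_axioms])
    show "\<zero>\<^bsub>Q\<^esub> \<in> carrier Q" using z qc by simp
    fix x assume "x \<in> carrier Q"
    then obtain x' where x: "x' \<in> carrier M" "x = q x'" using q' by blast
    show "\<zero>\<^bsub>Q\<^esub> \<oplus>\<^bsub>Q\<^esub> x = x" unfolding x(2) z using a[of "\<zero>\<^bsub>M\<^esub>" x'] x(1) by simp
    show "\<exists>y\<in>carrier Q. y \<oplus>\<^bsub>Q\<^esub> x = \<zero>\<^bsub>Q\<^esub>"
      unfolding x(2) z using x(1) qc a[of "\<ominus>\<^bsub>M\<^esub> x'" x'] by (intro bexI[of _ "q (\<ominus>\<^bsub>M\<^esub> x')"]) (simp_all add: M.M.l_neg)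
    show "\<one>\<^bsub>R\<^esub> \<odot>\<^bsub>Q\<^esub> x = x" unfolding x(2) using s[of "\<one>\<^bsub>R\<^esub>" x'] x(1) by (simp add: M.smult_one)
    show "r \<odot>\<^bsub>Q\<^esub> x \<in> carrier Q" if r: "r \<in> carrier R" for r
      unfolding x(2) using qc[OF M.smult_closed[OF r x(1)]] s[OF r x(1)] by simp
    show "(r \<oplus>\<^bsub>R\<^esub> r') \<odot>\<^bsub>Q\<^esub> x = r \<odot>\<^bsub>Q\<^esub> x \<oplus>\<^bsub>Q\<^esub> r' \<odot>\<^bsub>Q\<^esub> x"
      "(r \<otimes>\<^bsub>R\<^esub> r') \<odot>\<^bsub>Q\<^esub> x = r \<odot>\<^bsub>Q\<^esub> (r' \<odot>\<^bsub>Q\<^esub> x)" if r: "r \<in> carrier R" and r': "r' \<in> carrier R" for r r'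
      unfolding x(2) using r r' x(1)
      by (simp_all add: s[symmetric] a[symmetric] M.smult_closed M.smult_l_distr M.smult_assoc1)
    fix y assume "y \<in> carrier Q"
    then obtain y' where y: "y' \<in> carrier M" "y = q y'" using q' by blast
    show "x \<oplus>\<^bsub>Q\<^esub> y \<in> carrier Q" unfolding x(2) y(2) using a[OF x(1) y(1)] qc[OF M.M.a_closed[OF x(1) y(1)]] by simp
    show "x \<oplus>\<^bsub>Q\<^esub> y = y \<oplus>\<^bsub>Q\<^esub> x"
      unfolding x(2) y(2) a[OF x(1) y(1), symmetric] a[OF y(1) x(1), symmetric] M.M.a_comm[OF x(1) y(1)] ..
    show "r \<odot>\<^bsub>Q\<^esub> (x \<oplus>\<^bsub>Q\<^esub> y) = r \<odot>\<^bsub>Q\<^esub> x \<oplus>\<^bsub>Q\<^esub> r \<odot>\<^bsub>Q\<^esub> y" if r: "r \<in> carrier R" for r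
      unfolding x(2) y(2) using r x(1) y(1) by (simp add: s[symmetric] a[symmetric] M.smult_closed M.smult_r_distr)
    fix w assume "w \<in> carrier Q"
    then obtain w' where w: "w' \<in> carrier M" "w = q w'" using q' by blast
    show "(x \<oplus>\<^bsub>Q\<^esub> y) \<oplus>\<^bsub>Q\<^esub> w = x \<oplus>\<^bsub>Q\<^esub> (y \<oplus>\<^bsub>Q\<^esub> w)"
      unfolding x(2) y(2) w(2) using x(1) y(1) w(1) by (simp add: a[symmetric] M.M.a_assoc)
  qed
qed

lemma quot_module:
  assumes M: "lmodule R M" and I: "submod R M I"
  shows "lmodule R (quot_module M I)"
    and "(\<lambda>x\<in>carrier M. I +>\<^bsub>M\<^esub> x) \<in> Hom R M (quot_module M I)"
    and "X \<in> carrier (quot_module M I) \<Longrightarrow> \<exists>x\<in>carrier M. X = I +>\<^bsub>M\<^esub> x"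
    and "x \<in> carrier M \<Longrightarrow> I +>\<^bsub>M\<^esub> x = \<zero>\<^bsub>quot_module M I\<^esub> \<longleftrightarrow> x \<in> I"
proof -
  interpret M: lmodule R M by fact
  note i = I[unfolded submod_def]
  have sg: "subgroup I (add_monoid M)"
    using i by (intro subgroup.intro) (auto simp: a_inv_def[symmetric])
  interpret I: abelian_subgroup I M
    by (intro abelian_subgroupI3 additive_subgroup.intro M.M.abelian_group_axioms sg)
  have coset: "I +>\<^bsub>M\<^esub> x = {k \<oplus>\<^bsub>M\<^esub> x | k. k \<in> I}" for x by (auto simp: a_r_coset_def')
  have c: "carrier (quot_module M I) = (\<lambda>x. I +>\<^bsub>M\<^esub> x) ` carrier M" by (auto simp: quot_module_def A_RCOSETS_def')
  have z: "\<zero>\<^bsub>quot_module M I\<^esub> = I +>\<^bsub>M\<^esub> \<zero>\<^bsub>M\<^esub>"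
    using i M.M.a_coset_join2[OF M.M.zero_closed sg] by (simp add: quot_module_def)
  have a: "I +>\<^bsub>M\<^esub> (x \<oplus>\<^bsub>M\<^esub> y) = (I +>\<^bsub>M\<^esub> x) \<oplus>\<^bsub>quot_module M I\<^esub> (I +>\<^bsub>M\<^esub> y)" if "x \<in> carrier M" "y \<in> carrier M" for x y
    using that I.a_rcos_sum by (simp add: quot_module_def)
  have s: "I +>\<^bsub>M\<^esub> (r \<odot>\<^bsub>M\<^esub> x) = r \<odot>\<^bsub>quot_module M I\<^esub> (I +>\<^bsub>M\<^esub> x)" if r: "r \<in> carrier R" and x: "x \<in> carrier M" for r x
  proof -
    have "y \<in> I <+>\<^bsub>M\<^esub> (\<lambda>x. r \<odot>\<^bsub>M\<^esub> x) ` (I +>\<^bsub>M\<^esub> x) \<longleftrightarrow> y \<in> I +>\<^bsub>M\<^esub> (r \<odot>\<^bsub>M\<^esub> x)" for y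
    proof
      assume "y \<in> I <+>\<^bsub>M\<^esub> (\<lambda>x. r \<odot>\<^bsub>M\<^esub> x) ` (I +>\<^bsub>M\<^esub> x)"
      then obtain k l where kl: "k \<in> I" "l \<in> I" "y = k \<oplus>\<^bsub>M\<^esub> r \<odot>\<^bsub>M\<^esub> (l \<oplus>\<^bsub>M\<^esub> x)" by (auto simp: set_add_def' coset)
      have "l \<in> carrier M" "k \<in> carrier M" using kl i by auto
      then have "y = (k \<oplus>\<^bsub>M\<^esub> r \<odot>\<^bsub>M\<^esub> l) \<oplus>\<^bsub>M\<^esub> r \<odot>\<^bsub>M\<^esub> x"
        using r x kl(3) by (simp add: M.smult_r_distr M.smult_closed M.M.a_assoc)
      moreover have "k \<oplus>\<^bsub>M\<^esub> r \<odot>\<^bsub>M\<^esub> l \<in> I" using kl i r by blast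
      ultimately show "y \<in> I +>\<^bsub>M\<^esub> (r \<odot>\<^bsub>M\<^esub> x)" unfolding coset by blast
    next
      assume "y \<in> I +>\<^bsub>M\<^esub> (r \<odot>\<^bsub>M\<^esub> x)"
      then obtain k where k: "k \<in> I" "y = k \<oplus>\<^bsub>M\<^esub> r \<odot>\<^bsub>M\<^esub> (\<zero>\<^bsub>M\<^esub> \<oplus>\<^bsub>M\<^esub> x)" unfolding coset using x by auto
      moreover have "\<zero>\<^bsub>M\<^esub> \<oplus>\<^bsub>M\<^esub> x \<in> I +>\<^bsub>M\<^esub> x" unfolding coset using i by blast
      ultimately show "y \<in> I <+>\<^bsub>M\<^esub> (\<lambda>x. r \<odot>\<^bsub>M\<^esub> x) ` (I +>\<^bsub>M\<^esub> x)" unfolding set_add_def' by blast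
    qed
    then show ?thesis by (auto simp: quot_module_def)
  qed
  show "lmodule R (quot_module M I)" by (rule lmodule_surj_image[OF M _ a s z]) (simp_all add: c)
  show "(\<lambda>x\<in>carrier M. I +>\<^bsub>M\<^esub> x) \<in> Hom R M (quot_module M I)" by (rule HomI[OF M _ a s]) (simp_all add: c)
  show "\<exists>x\<in>carrier M. X = I +>\<^bsub>M\<^esub> x" if "X \<in> carrier (quot_module M I)" using that c by blast
  show "I +>\<^bsub>M\<^esub> x = \<zero>\<^bsub>quot_module M I\<^esub> \<longleftrightarrow> x \<in> I" if "x \<in> carrier M"
  proof
    assume e: "I +>\<^bsub>M\<^esub> x = \<zero>\<^bsub>quot_module M I\<^esub>"
    have "\<zero>\<^bsub>M\<^esub> \<oplus>\<^bsub>M\<^esub> x \<in> I +>\<^bsub>M\<^esub> x" unfolding coset using i by blast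
    then show "x \<in> I" unfolding e using that by (simp add: quot_module_def)
  next
    assume "x \<in> I"
    then show "I +>\<^bsub>M\<^esub> x = \<zero>\<^bsub>quot_module M I\<^esub>"
      using M.M.a_coset_join2[OF that sg] by (simp add: quot_module_def)
  qed
qed

context triangular
begin

abbreviation act where "act L u x \<equiv> (\<zero>\<^bsub>A\<^esub>, u, \<zero>\<^bsub>B\<^esub>) \<odot>\<^bsub>L\<^esub> x"

lemma act:
  assumes L: "lmodule \<Lambda> L"
  shows "\<lbrakk>u \<in> carrier U; x \<in> carrier L\<rbrakk> \<Longrightarrow> act L u x \<in> carrier (comp\<^sub>2 L)"
    and "\<lbrakk>u \<in> carrier U; v \<in> carrier U; x \<in> carrier L\<rbrakk> \<Longrightarrow> act L (u \<oplus>\<^bsub>U\<^esub> v) x = act L u x \<oplus>\<^bsub>L\<^esub> act L v x"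
    and "\<lbrakk>u \<in> carrier U; x \<in> carrier L; y \<in> carrier L\<rbrakk> \<Longrightarrow> act L u (x \<oplus>\<^bsub>L\<^esub> y) = act L u x \<oplus>\<^bsub>L\<^esub> act L u y"
    and "\<lbrakk>u \<in> carrier U; a \<in> carrier A; x \<in> carrier L\<rbrakk> \<Longrightarrow> act L (rsmult U u a) x = act L u (inc_A U B a \<odot>\<^bsub>L\<^esub> x)"
    and "\<lbrakk>u \<in> carrier U; b \<in> carrier B; x \<in> carrier L\<rbrakk> \<Longrightarrow> act L (b \<odot>\<^bsub>U\<^esub> u) x = inc_B A U b \<odot>\<^bsub>L\<^esub> act L u x"
    and "u \<in> carrier U \<Longrightarrow> act L u \<zero>\<^bsub>L\<^esub> = \<zero>\<^bsub>L\<^esub>"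
proof -
  interpret L: lmodule \<Lambda> L by fact
  have m: "(\<zero>\<^bsub>A\<^esub>, u, \<zero>\<^bsub>B\<^esub>) \<in> carrier \<Lambda>" if "u \<in> carrier U" for u using that by simp
  have i: "inc_A U B a \<in> carrier \<Lambda>" "inc_B A U b \<in> carrier \<Lambda>" if "a \<in> carrier A" "b \<in> carrier B" for a b
    using that by (simp_all add: inc_A_def inc_B_def)
  show b: "act L (b \<odot>\<^bsub>U\<^esub> u) x = inc_B A U b \<odot>\<^bsub>L\<^esub> act L u x" if "u \<in> carrier U" "b \<in> carrier B" "x \<in> carrier L" for u b x
    using that L.smult_assoc1[OF i(2)[OF A.zero_closed that(2)] m[OF that(1)] that(3)]
    by (simp add: inc_B_def rsmult_zero_left smult_closed)
  show "act L u x \<in> carrier (comp\<^sub>2 L)" if "u \<in> carrier U" "x \<in> carrier L"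
    using b[OF that(1) R.one_closed that(2)] that m[OF that(1)] by (simp add: smult_one L.smult_closed)
  show "act L (u \<oplus>\<^bsub>U\<^esub> v) x = act L u x \<oplus>\<^bsub>L\<^esub> act L v x" if "u \<in> carrier U" "v \<in> carrier U" "x \<in> carrier L"
    using L.smult_l_distr[OF m[OF that(1)] m[OF that(2)] that(3)] by simp
  show "act L u (x \<oplus>\<^bsub>L\<^esub> y) = act L u x \<oplus>\<^bsub>L\<^esub> act L u y" if "u \<in> carrier U" "x \<in> carrier L" "y \<in> carrier L"
    using L.smult_r_distr[OF m[OF that(1)] that(2,3)] .
  show "act L (rsmult U u a) x = act L u (inc_A U B a \<odot>\<^bsub>L\<^esub> x)" if "u \<in> carrier U" "a \<in> carrier A" "x \<in> carrier L"
    using that L.smult_assoc1[OF m[OF that(1)] i(1)[OF that(2) R.zero_closed] that(3)]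
    by (simp add: inc_A_def smult_zero_right rsmult_closed)
  show "act L u \<zero>\<^bsub>L\<^esub> = \<zero>\<^bsub>L\<^esub>" if "u \<in> carrier U" using L.smult_zero_right[OF m[OF that]] .
qed

text \<open>The map \<open>U \<otimes>\<^sub>A L\<^sub>1 \<rightarrow> L\<^sub>2\<close> of the triple that belongs to \<open>L\<close>.\<close>

definition phi :: "('a \<times> 'u \<times> 'b, 'm) module \<Rightarrow> ('u \<times> 'm \<Rightarrow>\<^sub>0 int) set \<Rightarrow> 'm"
  where "phi L = (SOME h. h \<in> Hom B (tensor_module A U (comp\<^sub>1 L)) (comp\<^sub>2 L) \<and>
    (\<forall>u\<in>carrier U. \<forall>x\<in>carrier (comp\<^sub>1 L). h (pure_tensor A U (comp\<^sub>1 L) u x) = act L u x))"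

lemma phi:
  assumes L: "lmodule \<Lambda> L"
  shows "phi L \<in> Hom B (tensor_module A U (comp\<^sub>1 L)) (comp\<^sub>2 L)"
    and "\<lbrakk>u \<in> carrier U; x \<in> carrier (comp\<^sub>1 L)\<rbrakk> \<Longrightarrow> phi L (pure_tensor A U (comp\<^sub>1 L) u x) = act L u x"
proof -
  note a = act[OF L] and l1 = lmodule_cor[OF nuhom_tri(1) L] and l2 = lmodule_cor[OF nuhom_tri(2) L]
  obtain h where "h \<in> Hom B (tensor_module A U (comp\<^sub>1 L)) (comp\<^sub>2 L)"
    "\<And>u x. \<lbrakk>u \<in> carrier U; x \<in> carrier (comp\<^sub>1 L)\<rbrakk> \<Longrightarrow> h (pure_tensor A U (comp\<^sub>1 L) u x) = act L u x"
  proof (rule tensor_universal_Hom[OF l1 l2, of "act L"])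
    show "balanced A U (comp\<^sub>1 L) (add_monoid (comp\<^sub>2 L)) (act L)"
      unfolding balanced_def using a(1) by (simp add: a(2,3,4))
    show "act L (b \<odot>\<^bsub>U\<^esub> u) x = b \<odot>\<^bsub>comp\<^sub>2 L\<^esub> act L u x" if "b \<in> carrier B" "u \<in> carrier U" "x \<in> carrier (comp\<^sub>1 L)" for b u x
      using that by (simp add: a(5))
  qed blast
  then have "\<exists>h. h \<in> Hom B (tensor_module A U (comp\<^sub>1 L)) (comp\<^sub>2 L) \<and>
    (\<forall>u\<in>carrier U. \<forall>x\<in>carrier (comp\<^sub>1 L). h (pure_tensor A U (comp\<^sub>1 L) u x) = act L u x)" by blast
  from someI_ex[OF this] show "phi L \<in> Hom B (tensor_module A U (comp\<^sub>1 L)) (comp\<^sub>2 L)"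
    "\<lbrakk>u \<in> carrier U; x \<in> carrier (comp\<^sub>1 L)\<rbrakk> \<Longrightarrow> phi L (pure_tensor A U (comp\<^sub>1 L) u x) = act L u x"
    unfolding phi_def[symmetric] by blast+
qed

lemma Hom_tensor_eq:
  assumes M: "lmodule A M" and N: "lmodule B N" and f: "f \<in> Hom B (tensor_module A U M) N" and g: "g \<in> Hom B (tensor_module A U M) N"
    and e: "\<And>u x. \<lbrakk>u \<in> carrier U; x \<in> carrier M\<rbrakk> \<Longrightarrow> f (pure_tensor A U M u x) = g (pure_tensor A U M u x)"
    and t: "t \<in> carrier (tensor_module A U M)"
  shows "f t = g t"
  using t
proof (rule tensor_induct[OF M, where P = "\<lambda>t. f t = g t"])
  show "f \<zero>\<^bsub>tensor_module A U M\<^esub> = g \<zero>\<^bsub>tensor_module A U M\<^esub>"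
    using Hom_zero[OF lmodule_tensor[OF M] N] f g by metis
qed (use e HomE(3)[OF f] HomE(3)[OF g] in simp_all)

text \<open>A \<Lambda>-linear map commutes with the action of the entries from U, and on pure
  tensors \<open>phi\<close> is that action.\<close>

lemma phi_natural:
  assumes L: "lmodule \<Lambda> L" and M: "lmodule \<Lambda> M" and f: "f \<in> Hom \<Lambda> L M" and t: "t \<in> carrier (tensor_module A U (comp\<^sub>1 L))"
  shows "phi M (tensor_map A U (comp\<^sub>1 M) (restrict f (carrier (comp\<^sub>1 L))) t) = f (phi L t)"
proof -
  let ?f1 = "restrict f (carrier (comp\<^sub>1 L))" and ?f2 = "restrict f (carrier (comp\<^sub>2 L))"
  let ?T = "tensor_module A U (comp\<^sub>1 L)"
  note l = lmodule_cor[OF nuhom_tri(1) L] lmodule_cor[OF nuhom_tri(1) M] lmodule_cor[OF nuhom_tri(2) M]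
  note f1 = cor_Hom[OF nuhom_tri(1) L f] and f2 = cor_Hom[OF nuhom_tri(2) L f]
  note h1 = Hom_compose[OF lmodule_tensor[OF l(1)] tensor_map_Hom[OF l(1,2) f1] phi(1)[OF M]]
  note h2 = Hom_compose[OF lmodule_tensor[OF l(1)] phi(1)[OF L] f2]
  have "compose (carrier ?T) (phi M) (restrict (tensor_map A U (comp\<^sub>1 M) ?f1) (carrier ?T)) t = compose (carrier ?T) ?f2 (phi L) t"
  proof (rule Hom_tensor_eq[OF l(1,3) h1 h2 _ t])
    fix u x assume u: "u \<in> carrier U" and x: "x \<in> carrier (comp\<^sub>1 L)"
    have xL: "x \<in> carrier L" using x by simp
    have ax: "act L u x \<in> carrier (comp\<^sub>2 L)" by (rule act(1)[OF L u xL])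
    have "phi M (tensor_map A U (comp\<^sub>1 M) ?f1 (pure_tensor A U (comp\<^sub>1 L) u x)) = act M u (f x)"
      using tensor_map(3)[OF l(1,2) f1 u x] phi(2)[OF M u HomE(2)[OF f1 x]] x by simp
    also have "\<dots> = ?f2 (phi L (pure_tensor A U (comp\<^sub>1 L) u x))"
      using phi(2)[OF L u x] ax HomE(4)[OF f _ xL, of "(\<zero>\<^bsub>A\<^esub>, u, \<zero>\<^bsub>B\<^esub>)"] u by simp
    finally show "compose (carrier ?T) (phi M) (restrict (tensor_map A U (comp\<^sub>1 M) ?f1) (carrier ?T)) (pure_tensor A U (comp\<^sub>1 L) u x) =
        compose (carrier ?T) ?f2 (phi L) (pure_tensor A U (comp\<^sub>1 L) u x)"
      using pure_closed[OF l(1) u x] by (simp add: compose_eq)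
  qed
  then show ?thesis using t HomE(2)[OF phi(1)[OF L] t] by (simp add: compose_eq)
qed

lemma tri_module_simps [simp]:
  "carrier (tri_module A U M N \<phi>) = carrier M \<times> carrier N"
  "\<zero>\<^bsub>tri_module A U M N \<phi>\<^esub> = (\<zero>\<^bsub>M\<^esub>, \<zero>\<^bsub>N\<^esub>)"
  "(x, y) \<oplus>\<^bsub>tri_module A U M N \<phi>\<^esub> (x', y') = (x \<oplus>\<^bsub>M\<^esub> x', y \<oplus>\<^bsub>N\<^esub> y')"
  "(a, u, b) \<odot>\<^bsub>tri_module A U M N \<phi>\<^esub> (x, y) = (a \<odot>\<^bsub>M\<^esub> x, \<phi> (pure_tensor A U M u x) \<oplus>\<^bsub>N\<^esub> b \<odot>\<^bsub>N\<^esub> y)"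
  by (simp_all add: tri_module_def)

text \<open>The right action on U becomes a left action: a (b f) sends u to f (u a b).\<close>

lemma lmodule_hom_module:
  assumes F: "lmodule B F"
  shows "lmodule A (hom_module B U F)"
proof -
  interpret F: lmodule B F by fact
  have U': "lmodule B U" by (rule lmodule_axioms)
  interpret G: comm_group "hom_group B U F" by (rule comm_group_hom_group[OF U' F])
  let ?H = "hom_module B U F"
  have s: "carrier ?H = Hom B U F" "\<zero>\<^bsub>?H\<^esub> = \<one>\<^bsub>hom_group B U F\<^esub>" "f \<oplus>\<^bsub>?H\<^esub> g = f \<otimes>\<^bsub>hom_group B U F\<^esub> g"
    "carrier (hom_group B U F) = Hom B U F" "a \<odot>\<^bsub>?H\<^esub> f = (\<lambda>u\<in>carrier U. f (rsmult U u a))" for f g a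
    by (simp_all add: hom_module_def hom_group_def)
  have sm: "a \<odot>\<^bsub>?H\<^esub> f \<in> Hom B U F" if "a \<in> carrier A" "f \<in> Hom B U F" for a f
    unfolding s using that(1) HomE(2)[OF that(2)] HomE(3,4)[OF that(2), symmetric]
    by (intro HomI[OF U']) (auto simp: rsmult_closed rsmult_l_distr smult_rsmult[symmetric])
  have pt: "(f \<otimes>\<^bsub>hom_group B U F\<^esub> g) u = f u \<oplus>\<^bsub>F\<^esub> g u" if "u \<in> carrier U" for f g u
    using that by (simp add: hom_group_def)
  have ag: "abelian_group ?H"
    by (rule abelian_groupI) (auto simp: s(1,2,3) s(4)[symmetric] G.m_ac intro: G.l_inv_ex)
  have eq: "f = g" if "f \<in> Hom B U F" "g \<in> Hom B U F" "\<And>u. u \<in> carrier U \<Longrightarrow> f u = g u" for f g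
    using Hom_eqI[OF that(1,2) refl that(3)] .
  have mc: "f \<otimes>\<^bsub>hom_group B U F\<^esub> g \<in> Hom B U F" if "f \<in> Hom B U F" "g \<in> Hom B U F" for f g
    using that G.m_closed unfolding s by blast
  show ?thesis
  proof (rule lmodule.intro[OF A.ring_axioms ag], rule lmodule_axioms.intro; unfold s(1,3))
    fix a f assume a: "a \<in> carrier A" and f: "f \<in> Hom B U F"
    show "a \<odot>\<^bsub>?H\<^esub> f \<in> Hom B U F" by (rule sm[OF a f])
    fix g assume g: "g \<in> Hom B U F"
    show "a \<odot>\<^bsub>?H\<^esub> (f \<otimes>\<^bsub>hom_group B U F\<^esub> g) = (a \<odot>\<^bsub>?H\<^esub> f) \<otimes>\<^bsub>hom_group B U F\<^esub> (a \<odot>\<^bsub>?H\<^esub> g)"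
      using sm[OF a f] sm[OF a g] sm[OF a mc[OF f g]] a by (intro eq mc) (auto simp: pt s(5) rsmult_closed)
  next
    fix a b f assume ab: "a \<in> carrier A" "b \<in> carrier A" and f: "f \<in> Hom B U F"
    show "(a \<oplus>\<^bsub>A\<^esub> b) \<odot>\<^bsub>?H\<^esub> f = (a \<odot>\<^bsub>?H\<^esub> f) \<otimes>\<^bsub>hom_group B U F\<^esub> (b \<odot>\<^bsub>?H\<^esub> f)"
      using sm[OF ab(1) f] sm[OF ab(2) f] sm[OF A.a_closed[OF ab] f] ab
      by (intro eq mc) (auto simp: pt s(5) rsmult_closed rsmult_r_distr HomE(3)[OF f])
    show "(a \<otimes>\<^bsub>A\<^esub> b) \<odot>\<^bsub>?H\<^esub> f = a \<odot>\<^bsub>?H\<^esub> (b \<odot>\<^bsub>?H\<^esub> f)"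
      using sm[OF ab(1) sm[OF ab(2) f]] sm[OF A.m_closed[OF ab] f] ab
      by (intro eq) (auto simp: s(5) rsmult_closed rsmult_assoc)
  next
    fix f assume f: "f \<in> Hom B U F"
    show "\<one>\<^bsub>A\<^esub> \<odot>\<^bsub>?H\<^esub> f = f" using sm[OF A.one_closed f] f by (intro eq) (auto simp: s(5) rsmult_one)
  qed
qed

lemma hom_module_simps:
  "carrier (hom_module B U F) = Hom B U F"
  "f \<oplus>\<^bsub>hom_module B U F\<^esub> g = (\<lambda>u\<in>carrier U. f u \<oplus>\<^bsub>F\<^esub> g u)"
  "\<zero>\<^bsub>hom_module B U F\<^esub> = (\<lambda>u\<in>carrier U. \<zero>\<^bsub>F\<^esub>)"
  "a \<odot>\<^bsub>hom_module B U F\<^esub> f = (\<lambda>u\<in>carrier U. f (rsmult U u a))"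
  by (simp_all add: hom_module_def hom_group_def)

lemma U_zero: "\<zero>\<^bsub>U\<^esub> \<in> carrier U" "\<zero>\<^bsub>U\<^esub> \<oplus>\<^bsub>U\<^esub> \<zero>\<^bsub>U\<^esub> = \<zero>\<^bsub>U\<^esub>"
  by simp_all

section \<open>Triples as modules over the triangular matrix ring\<close>

context
  fixes M :: "('a, 'n) module" and N :: "('b, 'k) module" and \<phi>
  assumes M: "lmodule A M" and N: "lmodule B N" and \<phi>: "\<phi> \<in> Hom B (tensor_module A U M) N"
begin

interpretation M: lmodule A M by (rule M)
interpretation N: lmodule B N by (rule N)

private abbreviation (input) T where "T \<equiv> tri_module A U M N \<phi>"
private abbreviation (input) \<psi> where "\<psi> u x \<equiv> \<phi> (pure_tensor A U M u x)"

lemma tri_pairing: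
  shows "\<lbrakk>u \<in> carrier U; x \<in> carrier M\<rbrakk> \<Longrightarrow> \<psi> u x \<in> carrier N"
    and "\<lbrakk>u \<in> carrier U; v \<in> carrier U; x \<in> carrier M\<rbrakk> \<Longrightarrow> \<psi> (u \<oplus>\<^bsub>U\<^esub> v) x = \<psi> u x \<oplus>\<^bsub>N\<^esub> \<psi> v x"
    and "\<lbrakk>u \<in> carrier U; x \<in> carrier M; y \<in> carrier M\<rbrakk> \<Longrightarrow> \<psi> u (x \<oplus>\<^bsub>M\<^esub> y) = \<psi> u x \<oplus>\<^bsub>N\<^esub> \<psi> u y"
    and "\<lbrakk>u \<in> carrier U; a \<in> carrier A; x \<in> carrier M\<rbrakk> \<Longrightarrow> \<psi> (rsmult U u a) x = \<psi> u (a \<odot>\<^bsub>M\<^esub> x)"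
    and "\<lbrakk>u \<in> carrier U; b \<in> carrier B; x \<in> carrier M\<rbrakk> \<Longrightarrow> \<psi> (b \<odot>\<^bsub>U\<^esub> u) x = b \<odot>\<^bsub>N\<^esub> \<psi> u x"
    and "x \<in> carrier M \<Longrightarrow> \<psi> \<zero>\<^bsub>U\<^esub> x = \<zero>\<^bsub>N\<^esub>" and "u \<in> carrier U \<Longrightarrow> \<psi> u \<zero>\<^bsub>M\<^esub> = \<zero>\<^bsub>N\<^esub>"
proof -
  note p = pure_closed[OF M] and h = HomE[OF \<phi>]
  show 1: "\<psi> u x \<in> carrier N" if "u \<in> carrier U" "x \<in> carrier M" for u x using h(2)[OF p[OF that]] .
  show 2: "\<psi> (u \<oplus>\<^bsub>U\<^esub> v) x = \<psi> u x \<oplus>\<^bsub>N\<^esub> \<psi> v x" if "u \<in> carrier U" "v \<in> carrier U" "x \<in> carrier M" for u v x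
    using that by (simp add: pure_add_left[OF M] h(3) p)
  show 3: "\<psi> u (x \<oplus>\<^bsub>M\<^esub> y) = \<psi> u x \<oplus>\<^bsub>N\<^esub> \<psi> u y" if "u \<in> carrier U" "x \<in> carrier M" "y \<in> carrier M" for u x y
    using that by (simp add: pure_add_right[OF M] h(3) p)
  show "\<psi> (rsmult U u a) x = \<psi> u (a \<odot>\<^bsub>M\<^esub> x)" if "u \<in> carrier U" "a \<in> carrier A" "x \<in> carrier M"
    using that by (simp add: pure_balanced[OF M])
  show "\<psi> (b \<odot>\<^bsub>U\<^esub> u) x = b \<odot>\<^bsub>N\<^esub> \<psi> u x" if "u \<in> carrier U" "b \<in> carrier B" "x \<in> carrier M"
    using that h(4)[OF that(2) p[OF that(1,3)]] by (simp add: tensor_smult(3)[OF M])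
  show "\<psi> \<zero>\<^bsub>U\<^esub> x = \<zero>\<^bsub>N\<^esub>" if "x \<in> carrier M"
    using 1[OF U_zero(1) that] 2[OF U_zero(1) U_zero(1) that] by (metis U_zero(2) N.M.add.r_cancel_one')
  show "\<psi> u \<zero>\<^bsub>M\<^esub> = \<zero>\<^bsub>N\<^esub>" if "u \<in> carrier U"
    using 1[OF that M.M.zero_closed] 3[OF that M.M.zero_closed M.M.zero_closed] by (metis M.M.l_zero M.M.zero_closed N.M.add.r_cancel_one')
qed

lemma lmodule_tri: "lmodule \<Lambda> T"
proof -
  note t = tri_pairing
  have inv: "\<exists>x'\<in>carrier M. \<exists>y'\<in>carrier N. x' \<oplus>\<^bsub>M\<^esub> x = \<zero>\<^bsub>M\<^esub> \<and> y' \<oplus>\<^bsub>N\<^esub> y = \<zero>\<^bsub>N\<^esub>" if "x \<in> carrier M" "y \<in> carrier N" for x y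
    using that M.M.l_neg N.M.l_neg by blast
  show ?thesis
    by (rule lmoduleI[OF ring_tri_ring])
      (auto simp: inv t smult_closed rsmult_closed M.smult_closed N.smult_closed M.smult_l_distr N.smult_l_distr M.smult_r_distr
        N.smult_r_distr M.smult_assoc1 N.smult_assoc1 M.smult_one N.smult_one M.M.a_ac N.M.a_ac)
qed

text \<open>In the module of a triple the two idempotents cut out M \<times> 0 and 0 \<times> N, so
  L determines M, N and \<phi> up to isomorphism. Conditions on a triple thereby become conditions
  on L itself.\<close>

lemma tri_isos_components:
  assumes L: "lmodule \<Lambda> L" and i: "isos \<Lambda> L T f g"
  shows "isos A (comp\<^sub>1 L) M (\<lambda>x\<in>carrier (comp\<^sub>1 L). fst (f x)) (\<lambda>x\<in>carrier M. g (x, \<zero>\<^bsub>N\<^esub>))"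
    and "isos B (comp\<^sub>2 L) N (\<lambda>x\<in>carrier (comp\<^sub>2 L). snd (f x)) (\<lambda>y\<in>carrier N. g (\<zero>\<^bsub>M\<^esub>, y))"
    and "\<lbrakk>u \<in> carrier U; x \<in> carrier (comp\<^sub>1 L)\<rbrakk> \<Longrightarrow> snd (f (act L u x)) = \<psi> u (fst (f x))"
proof -
  note t = tri_pairing and lT = lmodule_tri
  interpret T: lmodule \<Lambda> T by (rule lT)
  have c1: "p \<in> carrier (comp\<^sub>1 T) \<longleftrightarrow> (\<exists>x\<in>carrier M. p = (x, \<zero>\<^bsub>N\<^esub>))" for p
    by (auto simp: inc_A_def t M.smult_one N.smult_zero_left)
  have c2: "p \<in> carrier (comp\<^sub>2 T) \<longleftrightarrow> (\<exists>y\<in>carrier N. p = (\<zero>\<^bsub>M\<^esub>, y))" for p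
    by (auto simp: inc_B_def t N.smult_one M.smult_zero_left)
  have e1: "isos A (comp\<^sub>1 T) M (\<lambda>p\<in>carrier (comp\<^sub>1 T). fst p) (\<lambda>x\<in>carrier M. (x, \<zero>\<^bsub>N\<^esub>))"
    unfolding isos_def
  proof (intro conjI ballI)
    show "(\<lambda>p\<in>carrier (comp\<^sub>1 T). fst p) \<in> Hom A (comp\<^sub>1 T) M"
      by (rule HomI[OF lmodule_cor[OF nuhom_tri(1) lT]]) (auto simp: c1 inc_A_def simp del: cor_simps(1))
    show "(\<lambda>x\<in>carrier M. (x, \<zero>\<^bsub>N\<^esub>)) \<in> Hom A M (comp\<^sub>1 T)"
      by (rule HomI[OF M]) (auto simp: c1 inc_A_def t N.smult_zero_left M.smult_closed simp del: cor_simps(1))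
  qed (auto simp: c1 simp del: cor_simps(1))
  have e2: "isos B (comp\<^sub>2 T) N (\<lambda>p\<in>carrier (comp\<^sub>2 T). snd p) (\<lambda>y\<in>carrier N. (\<zero>\<^bsub>M\<^esub>, y))"
    unfolding isos_def
  proof (intro conjI ballI)
    show "(\<lambda>p\<in>carrier (comp\<^sub>2 T). snd p) \<in> Hom B (comp\<^sub>2 T) N"
      by (rule HomI[OF lmodule_cor[OF nuhom_tri(2) lT]]) (auto simp: c2 inc_B_def t N.smult_closed simp del: cor_simps(1))
    show "(\<lambda>y\<in>carrier N. (\<zero>\<^bsub>M\<^esub>, y)) \<in> Hom B N (comp\<^sub>2 T)"
      by (rule HomI[OF N]) (auto simp: c2 inc_B_def t M.smult_zero_left N.smult_closed simp del: cor_simps(1))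
  qed (auto simp: c2 simp del: cor_simps(1))
  note i1 = cor_isos[OF nuhom_tri(1) L lT i] and i2 = cor_isos[OF nuhom_tri(2) L lT i]
  have m1: "(x, \<zero>\<^bsub>N\<^esub>) \<in> carrier (comp\<^sub>1 T)" if "x \<in> carrier M" for x using that c1 by blast
  have m2: "(\<zero>\<^bsub>M\<^esub>, x) \<in> carrier (comp\<^sub>2 T)" if "x \<in> carrier N" for x using that c2 by blast
  show "isos A (comp\<^sub>1 L) M (\<lambda>x\<in>carrier (comp\<^sub>1 L). fst (f x)) (\<lambda>x\<in>carrier M. g (x, \<zero>\<^bsub>N\<^esub>))"
    using isos_trans[OF lmodule_cor[OF nuhom_tri(1) L] M i1 e1] HomE(2)[OF isosD(1)[OF i1]] m1
    by (simp add: compose_def cong: restrict_cong del: cor_simps(1))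
  show "isos B (comp\<^sub>2 L) N (\<lambda>x\<in>carrier (comp\<^sub>2 L). snd (f x)) (\<lambda>y\<in>carrier N. g (\<zero>\<^bsub>M\<^esub>, y))"
    using isos_trans[OF lmodule_cor[OF nuhom_tri(2) L] N i2 e2] HomE(2)[OF isosD(1)[OF i2]] m2
    by (simp add: compose_def cong: restrict_cong del: cor_simps(1))
  show "snd (f (act L u x)) = \<psi> u (fst (f x))" if u: "u \<in> carrier U" and x: "x \<in> carrier (comp\<^sub>1 L)"
  proof -
    have xL: "x \<in> carrier L" using x by simp
    obtain y where y: "y \<in> carrier M" "f x = (y, \<zero>\<^bsub>N\<^esub>)" using HomE(2)[OF isosD(1)[OF i1] x] x c1 by auto
    show ?thesis
      using HomE(4)[OF isosD(1)[OF i] _ xL, of "(\<zero>\<^bsub>A\<^esub>, u, \<zero>\<^bsub>B\<^esub>)"] u y t(1)[OF u y(1)]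
      by (simp add: N.smult_zero_left)
  qed
qed

end

section \<open>The three classes in terms of components and action\<close>

lemma class_AD:
  assumes X: "module_class A \<U> \<X>" and Y: "module_class B \<U> \<Y>" and L: "L \<in> class_A A U B \<U> \<X> \<Y>"
  shows "L \<in> RMod \<Lambda> \<U>" "lmodule \<Lambda> L" "comp\<^sub>1 L \<in> \<X>" "comp\<^sub>2 L \<in> \<Y>"
proof -
  obtain M N \<phi> where *: "L \<in> RMod \<Lambda> \<U>" "\<phi> \<in> Hom B (tensor_module A U M) N" "mod_iso \<Lambda> L (tri_module A U M N \<phi>)" "M \<in> \<X>" "N \<in> \<Y>"
    using L unfolding class_A_def by blast
  then show L': "L \<in> RMod \<Lambda> \<U>" "lmodule \<Lambda> L" by (auto simp: RMod_def)
  note l = module_classD(2)[OF X *(4)] module_classD(2)[OF Y *(5)]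
  obtain f g where i: "isos \<Lambda> L (tri_module A U M N \<phi>) f g"
    using mod_iso_imp_isos[OF L'(2) lmodule_tri[OF l *(2)] *(3)] by metis
  note c = tri_isos_components[OF l *(2) L'(2) i]
  show "comp\<^sub>1 L \<in> \<X>"
    using module_classD(3)[OF X *(4) RMod_cor[OF nuhom_tri(1) L'(1)] isos_imp_mod_iso[OF isos_sym[OF c(1)]]] .
  show "comp\<^sub>2 L \<in> \<Y>"
    using module_classD(3)[OF Y *(5) RMod_cor[OF nuhom_tri(2) L'(1)] isos_imp_mod_iso[OF isos_sym[OF c(2)]]] .
qed

text \<open>The quotient module of the definition gives way to a short exact sequence that begins
  with \<open>phi L\<close>, the form needed for diagram chases. The isomorphism of first components
  is followed through the tensor product to compare \<open>phi L\<close> with \<phi>.\<close>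

lemma class_PD:
  assumes X: "module_class A \<U> \<X>" and Y: "module_class B \<U> \<Y>" and L: "L \<in> class_P A U B \<U> \<X> \<Y>"
  shows "L \<in> RMod \<Lambda> \<U>" "lmodule \<Lambda> L" "comp\<^sub>1 L \<in> \<X>"
    "\<exists>E\<in>\<Y>. \<exists>p. short_exact B (tensor_module A U (comp\<^sub>1 L)) (phi L) (comp\<^sub>2 L) p E"
proof -
  obtain M N \<phi> where *: "L \<in> RMod \<Lambda> \<U>" "N \<in> RMod B \<U>" "\<phi> \<in> Hom B (tensor_module A U M) N"
    "mod_iso \<Lambda> L (tri_module A U M N \<phi>)" "M \<in> \<X>"
    "in_class B \<Y> (quot_module N (\<phi> ` carrier (tensor_module A U M)))" "inj_on \<phi> (carrier (tensor_module A U M))"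
    using L unfolding class_P_def by blast
  then show L': "L \<in> RMod \<Lambda> \<U>" "lmodule \<Lambda> L" by (auto simp: RMod_def)
  have l: "lmodule A M" "lmodule B N" using module_classD(2)[OF X *(5)] *(2) by (auto simp: RMod_def)
  obtain f g where i: "isos \<Lambda> L (tri_module A U M N \<phi>) f g"
    using mod_iso_imp_isos[OF L'(2) lmodule_tri[OF l *(3)] *(4)] by metis
  note c = tri_isos_components[OF l *(3) L'(2) i]
  show "comp\<^sub>1 L \<in> \<X>"
    using module_classD(3)[OF X *(5) RMod_cor[OF nuhom_tri(1) L'(1)] isos_imp_mod_iso[OF isos_sym[OF c(1)]]] .
  let ?\<alpha> = "\<lambda>x\<in>carrier (comp\<^sub>1 L). fst (f x)" and ?\<beta> = "\<lambda>x\<in>carrier (comp\<^sub>2 L). snd (f x)"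
  let ?\<alpha>' = "\<lambda>x\<in>carrier M. g (x, \<zero>\<^bsub>N\<^esub>)"
  let ?T = "tensor_module A U (comp\<^sub>1 L)" and ?TM = "tensor_module A U M"
  note l1 = lmodule_cor[OF nuhom_tri(1) L'(2)] and l2 = lmodule_cor[OF nuhom_tri(2) L'(2)]
  note \<alpha> = isosD[OF c(1)] and \<beta> = isosD[OF c(2)] and p = phi[OF L'(2)]
  note lT = lmodule_tensor[OF l1] and lTM = lmodule_tensor[OF l(1)]
  note t\<alpha> = tensor_map[OF l1 l(1) \<alpha>(1)] and t\<alpha>' = tensor_map[OF l(1) l1 \<alpha>(2)]
  note h1 = Hom_compose[OF lT p(1) \<beta>(1)] and h2 = Hom_compose[OF lT tensor_map_Hom[OF l1 l(1) \<alpha>(1)] *(3)]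
  have "compose (carrier ?T) ?\<beta> (phi L) t = compose (carrier ?T) \<phi> (restrict (tensor_map A U M ?\<alpha>) (carrier ?T)) t"
    if t: "t \<in> carrier ?T" for t
  proof (rule Hom_tensor_eq[OF l1 l(2) h1 h2 _ t])
    fix u x assume u: "u \<in> carrier U" and x: "x \<in> carrier (comp\<^sub>1 L)"
    have "act L u x \<in> carrier (comp\<^sub>2 L)" using act(1)[OF L'(2) u] x by simp
    then show "compose (carrier ?T) ?\<beta> (phi L) (pure_tensor A U (comp\<^sub>1 L) u x) =
        compose (carrier ?T) \<phi> (restrict (tensor_map A U M ?\<alpha>) (carrier ?T)) (pure_tensor A U (comp\<^sub>1 L) u x)"
      using pure_closed[OF l1 u x] p(2)[OF u x] c(3)[OF u x] t\<alpha>(3)[OF u x] x by (simp add: compose_eq del: cor_simps(1))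
  qed
  then have comm: "?\<beta> (phi L t) = \<phi> (tensor_map A U M ?\<alpha> t)" if "t \<in> carrier ?T" for t
    using that by (simp add: compose_eq del: cor_simps(1))
  have ta: "tensor_map A U (comp\<^sub>1 L) ?\<alpha>' (tensor_map A U M ?\<alpha> t) = t" if t: "t \<in> carrier ?T" for t
    using tensor_map_compose[OF l1 l(1) l1 \<alpha>(1,2) Hom_id[OF l1] _ t] tensor_map_id[OF l1 Hom_id[OF l1] _ t] \<alpha>(3)
    by (simp del: cor_simps(1))
  have ta': "tensor_map A U M ?\<alpha> (tensor_map A U (comp\<^sub>1 L) ?\<alpha>' t) = t" if t: "t \<in> carrier ?TM" for t
    using tensor_map_compose[OF l(1) l1 l(1) \<alpha>(2,1) Hom_id[OF l(1)] _ t] tensor_map_id[OF l(1) Hom_id[OF l(1)] _ t] \<alpha>(4)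
    by simp
  let ?I = "\<phi> ` carrier ?TM" and ?Q = "quot_module N (\<phi> ` carrier ?TM)"
  note q = quot_module[OF l(2) submod_image[OF lTM l(2) *(3)]]
  obtain E where E: "E \<in> \<Y>" "mod_iso B E ?Q" using *(6) unfolding in_class_def by blast
  have lE: "lmodule B E" using module_classD(2)[OF Y E(1)] .
  obtain k k' where k: "isos B E ?Q k k'" using mod_iso_imp_isos[OF lE q(1) E(2)] by metis
  have ex: "short_exact B ?T (phi L) (comp\<^sub>2 L) (compose (carrier (comp\<^sub>2 L)) (\<lambda>x\<in>carrier N. ?I +>\<^bsub>N\<^esub> x) ?\<beta>) ?Q"
  proof (rule short_exactI[OF p(1) Hom_compose[OF l2 \<beta>(1) q(2)]])
    show "inj_on (phi L) (carrier ?T)"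
    proof (rule inj_onI)
      fix s t assume st: "s \<in> carrier ?T" "t \<in> carrier ?T" "phi L s = phi L t"
      then have "\<phi> (tensor_map A U M ?\<alpha> s) = \<phi> (tensor_map A U M ?\<alpha> t)" using comm by metis
      then have "tensor_map A U M ?\<alpha> s = tensor_map A U M ?\<alpha> t" using *(7) t\<alpha>(1) st by (meson inj_onD)
      then show "s = t" using ta st by metis
    qed
    fix t assume t: "t \<in> carrier ?T"
    have "?\<beta> (phi L t) \<in> ?I" unfolding comm[OF t] using t\<alpha>(1)[OF t] by blast
    then have "?I +>\<^bsub>N\<^esub> ?\<beta> (phi L t) = \<zero>\<^bsub>?Q\<^esub>"
      using q(4)[OF HomE(2)[OF \<beta>(1) HomE(2)[OF p(1) t]]] by blast
    then show "compose (carrier (comp\<^sub>2 L)) (\<lambda>x\<in>carrier N. ?I +>\<^bsub>N\<^esub> x) ?\<beta> (phi L t) = \<zero>\<^bsub>?Q\<^esub>"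
      using HomE(2)[OF p(1) t] HomE(2)[OF \<beta>(1) HomE(2)[OF p(1) t]] by (simp add: compose_eq del: cor_simps(1))
  next
    fix y assume y: "y \<in> carrier (comp\<^sub>2 L)" "compose (carrier (comp\<^sub>2 L)) (\<lambda>x\<in>carrier N. ?I +>\<^bsub>N\<^esub> x) ?\<beta> y = \<zero>\<^bsub>?Q\<^esub>"
    note by' = HomE(2)[OF \<beta>(1) y(1)]
    have "?I +>\<^bsub>N\<^esub> ?\<beta> y = \<zero>\<^bsub>?Q\<^esub>" using y by' by (simp add: compose_eq del: cor_simps(1))
    then obtain s where s: "s \<in> carrier ?TM" "?\<beta> y = \<phi> s" using q(4)[OF by'] by blast
    let ?t = "tensor_map A U (comp\<^sub>1 L) ?\<alpha>' s"
    have "?\<beta> (phi L ?t) = ?\<beta> y" using comm[OF t\<alpha>'(1)[OF s(1)]] ta'[OF s(1)] s(2) by simp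
    then have "phi L ?t = y" using \<beta>(3)[OF y(1)] \<beta>(3)[OF HomE(2)[OF p(1) t\<alpha>'(1)[OF s(1)]]] by metis
    then show "\<exists>t\<in>carrier ?T. y = phi L t" using t\<alpha>'(1)[OF s(1)] by blast
  next
    fix X assume "X \<in> carrier ?Q"
    then obtain x where x: "x \<in> carrier N" "X = ?I +>\<^bsub>N\<^esub> x" using q(3) by blast
    then show "\<exists>y\<in>carrier (comp\<^sub>2 L). X = compose (carrier (comp\<^sub>2 L)) (\<lambda>x\<in>carrier N. ?I +>\<^bsub>N\<^esub> x) ?\<beta> y"
      using HomE(2)[OF \<beta>(2) x(1)] \<beta>(4)[OF x(1)]
      by (intro bexI[of _ "(\<lambda>y\<in>carrier N. g (\<zero>\<^bsub>M\<^esub>, y)) x"]) (simp_all add: compose_eq del: cor_simps(1))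
  qed
  show "\<exists>E\<in>\<Y>. \<exists>p. short_exact B ?T (phi L) (comp\<^sub>2 L) p E"
    using short_exact_isos_right[OF l2 q(1) lE ex isos_sym[OF k]] E(1) by blast
qed

text \<open>The isomorphism with a triple matches the adjoint of \<phi> with the action of U on L,
  so kernel and surjectivity of the adjoint can be expressed in L without any triple.\<close>

lemma class_ID:
  assumes X: "module_class A \<U> \<X>" and Y: "module_class B \<U> \<Y>" and L: "L \<in> class_I A U B \<U> \<X> \<Y>"
  shows "L \<in> RMod \<Lambda> \<U>" "lmodule \<Lambda> L" "comp\<^sub>2 L \<in> \<Y>"
    "(comp\<^sub>1 L)\<lparr>carrier := {x \<in> carrier (comp\<^sub>1 L). \<forall>u\<in>carrier U. act L u x = \<zero>\<^bsub>L\<^esub>}\<rparr> \<in> \<X>"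
    "h \<in> Hom B U (comp\<^sub>2 L) \<Longrightarrow> \<exists>x\<in>carrier (comp\<^sub>1 L). \<forall>u\<in>carrier U. h u = act L u x"
proof -
  obtain M N \<phi> where *: "L \<in> RMod \<Lambda> \<U>" "M \<in> RMod A \<U>" "\<phi> \<in> Hom B (tensor_module A U M) N"
    "mod_iso \<Lambda> L (tri_module A U M N \<phi>)" "N \<in> \<Y>"
    "M\<lparr>carrier := a_kernel M (hom_module B U N) (tri_adjoint A U M \<phi>)\<rparr> \<in> \<X>"
    "tri_adjoint A U M \<phi> ` carrier M = carrier (hom_module B U N)"
    using L unfolding class_I_def by blast
  then show L': "L \<in> RMod \<Lambda> \<U>" "lmodule \<Lambda> L" by (auto simp: RMod_def)
  have l: "lmodule A M" "lmodule B N" using module_classD(2)[OF Y *(5)] *(2) by (auto simp: RMod_def)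
  obtain f g where i: "isos \<Lambda> L (tri_module A U M N \<phi>) f g"
    using mod_iso_imp_isos[OF L'(2) lmodule_tri[OF l *(3)] *(4)] by metis
  note c = tri_isos_components[OF l *(3) L'(2) i]
  show "comp\<^sub>2 L \<in> \<Y>"
    using module_classD(3)[OF Y *(5) RMod_cor[OF nuhom_tri(2) L'(1)] isos_imp_mod_iso[OF isos_sym[OF c(2)]]] .
  let ?\<alpha> = "\<lambda>x\<in>carrier (comp\<^sub>1 L). fst (f x)" and ?\<beta> = "\<lambda>x\<in>carrier (comp\<^sub>2 L). snd (f x)"
  let ?\<alpha>' = "\<lambda>x\<in>carrier M. g (x, \<zero>\<^bsub>N\<^esub>)"
  note l1 = lmodule_cor[OF nuhom_tri(1) L'(2)] and l2 = lmodule_cor[OF nuhom_tri(2) L'(2)]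
  interpret L: lmodule \<Lambda> L by (rule L')
  note \<alpha> = isosD[OF c(1)] and \<beta> = isosD[OF c(2)]
  have ac: "act L u x \<in> carrier (comp\<^sub>2 L)" if "u \<in> carrier U" "x \<in> carrier (comp\<^sub>1 L)" for u x
    using act(1)[OF L'(2)] that by simp
  have comm: "?\<beta> (act L u x) = tri_adjoint A U M \<phi> (?\<alpha> x) u" if "u \<in> carrier U" "x \<in> carrier (comp\<^sub>1 L)" for u x
    using c(3)[OF that] ac[OF that] HomE(2)[OF \<alpha>(1) that(2)] that by (simp add: tri_adjoint_def del: cor_simps(1))
  have zero: "act L u x = \<zero>\<^bsub>L\<^esub> \<longleftrightarrow> tri_adjoint A U M \<phi> (?\<alpha> x) u = \<zero>\<^bsub>N\<^esub>" if "u \<in> carrier U" "x \<in> carrier (comp\<^sub>1 L)" for u x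
    using isos_eq_zero_iff[OF l2 l(2) c(2) ac[OF that]] comm[OF that] by simp
  let ?K = "a_kernel M (hom_module B U N) (tri_adjoint A U M \<phi>)"
  let ?S = "{x \<in> carrier (comp\<^sub>1 L). \<forall>u\<in>carrier U. act L u x = \<zero>\<^bsub>L\<^esub>}"
  have K: "m \<in> ?K \<longleftrightarrow> m \<in> carrier M \<and> (\<forall>u\<in>carrier U. tri_adjoint A U M \<phi> m u = \<zero>\<^bsub>N\<^esub>)" for m
    by (auto simp: a_kernel_iff tri_adjoint_def hom_module_simps fun_eq_iff)
  have S: "x \<in> ?S \<longleftrightarrow> x \<in> carrier (comp\<^sub>1 L) \<and> ?\<alpha> x \<in> ?K" for x
    unfolding K using zero HomE(2)[OF \<alpha>(1)] by blast
  have SK: "?\<alpha>' m \<in> ?S" if "m \<in> ?K" for m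
    unfolding S using that HomE(2)[OF \<alpha>(2)] \<alpha>(4) K by metis
  have sS: "submod A (comp\<^sub>1 L) ?S"
    unfolding submod_def
  proof (intro conjI ballI)
    interpret c1: lmodule A "comp\<^sub>1 L" by (rule l1)
    show "?S \<subseteq> carrier (comp\<^sub>1 L)" by blast
    show "\<zero>\<^bsub>comp\<^sub>1 L\<^esub> \<in> ?S" using c1.M.zero_closed act(6)[OF L'(2)] by simp
    fix x assume x: "x \<in> ?S"
    show "x \<oplus>\<^bsub>comp\<^sub>1 L\<^esub> y \<in> ?S" if y: "y \<in> ?S" for y
      using x y c1.M.a_closed[of x y] act(3)[OF L'(2), of _ x y] by simp
    show "\<ominus>\<^bsub>comp\<^sub>1 L\<^esub> x \<in> ?S"
    proof -
      have m: "\<ominus>\<^bsub>comp\<^sub>1 L\<^esub> x \<in> carrier (comp\<^sub>1 L)" using x c1.M.a_inv_closed by blast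
      have "act L u (\<ominus>\<^bsub>comp\<^sub>1 L\<^esub> x) = \<zero>\<^bsub>L\<^esub>" if u: "u \<in> carrier U" for u
      proof -
        have "act L u (\<ominus>\<^bsub>comp\<^sub>1 L\<^esub> x) \<oplus>\<^bsub>L\<^esub> act L u x = act L u \<zero>\<^bsub>L\<^esub>"
          using x m u c1.M.l_neg[of x] act(3)[OF L'(2) u, of "\<ominus>\<^bsub>comp\<^sub>1 L\<^esub> x" x] by simp
        then show ?thesis using ac[OF u m] x u act(6)[OF L'(2) u] by simp
      qed
      then show ?thesis using m by blast
    qed
    show "a \<odot>\<^bsub>comp\<^sub>1 L\<^esub> x \<in> ?S" if a: "a \<in> carrier A" for a
      using x a c1.smult_closed[of a x] act(4)[OF L'(2) _ a, of _ x, symmetric] rsmult_closed by simp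
  qed
  have isK: "mod_iso A (M\<lparr>carrier := ?K\<rparr>) ((comp\<^sub>1 L)\<lparr>carrier := ?S\<rparr>)"
    unfolding mod_iso_def
  proof (intro bexI)
    have lK: "lmodule A (M\<lparr>carrier := ?K\<rparr>)" using module_classD(2)[OF X *(6)] .
    have KM: "x \<in> ?K \<Longrightarrow> x \<in> carrier M" for x by (simp add: K)
    have "restrict ?\<alpha>' (carrier (M\<lparr>carrier := ?K\<rparr>)) \<in> Hom A (M\<lparr>carrier := ?K\<rparr>) ((comp\<^sub>1 L)\<lparr>carrier := ?S\<rparr>)"
    proof (rule HomI[OF lK])
      show "?\<alpha>' x \<in> carrier ((comp\<^sub>1 L)\<lparr>carrier := ?S\<rparr>)" if "x \<in> carrier (M\<lparr>carrier := ?K\<rparr>)" for x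
        using SK[of x] that by (simp del: cor_simps(1) restrict_apply)
    qed (use HomE(3,4)[OF \<alpha>(2)] KM in \<open>simp_all del: cor_simps(1) restrict_apply\<close>)
    then show "restrict ?\<alpha>' ?K \<in> Hom A (M\<lparr>carrier := ?K\<rparr>) ((comp\<^sub>1 L)\<lparr>carrier := ?S\<rparr>)" by simp
    have "bij_betw (restrict ?\<alpha>' ?K) ?K ?S"
    proof (rule bij_betw_byWitness[where f' = ?\<alpha>])
      show "\<forall>x\<in>?K. ?\<alpha> (restrict ?\<alpha>' ?K x) = x"
      proof
        fix x assume x: "x \<in> ?K"
        show "?\<alpha> (restrict ?\<alpha>' ?K x) = x" unfolding restrict_apply'[OF x] by (rule \<alpha>(4)[OF KM[OF x]])
      qed
      show "\<forall>x\<in>?S. restrict ?\<alpha>' ?K (?\<alpha> x) = x"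
      proof
        fix x assume "x \<in> ?S"
        then have x: "x \<in> carrier (comp\<^sub>1 L)" "?\<alpha> x \<in> ?K" using S by blast+
        show "restrict ?\<alpha>' ?K (?\<alpha> x) = x" unfolding restrict_apply'[OF x(2)] by (rule \<alpha>(3)[OF x(1)])
      qed
      show "restrict ?\<alpha>' ?K ` ?K \<subseteq> ?S" using SK by (intro image_subsetI) (simp only: restrict_apply')
      show "?\<alpha> ` ?S \<subseteq> ?K" using S by blast
    qed
    then show "bij_betw (restrict ?\<alpha>' ?K) (carrier (M\<lparr>carrier := ?K\<rparr>)) (carrier ((comp\<^sub>1 L)\<lparr>carrier := ?S\<rparr>))" by simp
  qed
  show "(comp\<^sub>1 L)\<lparr>carrier := ?S\<rparr> \<in> \<X>"
    by (rule module_classD(3)[OF X *(6) RMod_submod[OF RMod_cor[OF nuhom_tri(1) L'(1)] sS] isK])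
  assume h: "h \<in> Hom B U (comp\<^sub>2 L)"
  have "compose (carrier U) ?\<beta> h \<in> tri_adjoint A U M \<phi> ` carrier M"
    using Hom_compose[OF lmodule_axioms h \<beta>(1)] *(7) by (simp add: hom_module_simps)
  then obtain m where m: "m \<in> carrier M" "compose (carrier U) ?\<beta> h = tri_adjoint A U M \<phi> m" by blast
  let ?x = "?\<alpha>' m"
  have x: "?x \<in> carrier (comp\<^sub>1 L)" using HomE(2)[OF \<alpha>(2) m(1)] .
  have "h u = act L u ?x" if u: "u \<in> carrier U" for u
  proof -
    have "?\<beta> (h u) = ?\<beta> (act L u ?x)"
      using fun_cong[OF m(2), of u] comm[OF u x] \<alpha>(4)[OF m(1)] u by (simp add: compose_eq del: restrict_apply)
    then show ?thesis using \<beta>(3)[OF HomE(2)[OF h u]] \<beta>(3)[OF ac[OF u x]] by metis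
  qed
  then show "\<exists>x\<in>carrier (comp\<^sub>1 L). \<forall>u\<in>carrier U. h u = act L u x" using x by blast
qed

end

section \<open>The classes of triples\<close>

context triangular
begin

lemma comp\<^sub>1_emb\<^sub>1:
  assumes "lmodule A M"
  shows "isos A (comp\<^sub>1 (emb\<^sub>1 M)) M (\<lambda>x\<in>carrier M. x) (\<lambda>x\<in>carrier M. x)"
  using cor_id_isos[OF assms] cor_cor[OF nuhom_tri(3,1) assms] by (simp add: inc_A_def)

lemma comp\<^sub>2_emb\<^sub>2:
  assumes "lmodule B M"
  shows "isos B (comp\<^sub>2 (emb\<^sub>2 M)) M (\<lambda>x\<in>carrier M. x) (\<lambda>x\<in>carrier M. x)"
  using cor_id_isos[OF assms] cor_cor[OF nuhom_tri(4,2) assms] by (simp add: inc_B_def)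

lemma emb_carrier:
  shows "lmodule A M \<Longrightarrow> carrier (emb\<^sub>1 M) = carrier M" and "lmodule B N \<Longrightarrow> carrier (emb\<^sub>2 N) = carrier N"
  by (auto simp: lmodule.smult_one)

text \<open>The free module on the empty set. Approximations are taken of given modules, so one
  module is needed to start from before the classes are known to be nonempty.\<close>

lemma RMod_exists:
  assumes "ring R" "small \<U> (carrier R)"
  obtains M where "M \<in> RMod R \<U>"
proof -
  have "small \<U> ({} :: 'm set)" by (rule small_subset[OF small_rings(1)[THEN small_image[where f = undefined]]]) simp
  then show thesis
    using RMod_transport[OF ring.lmodule_free[OF assms(1)] small_free_module[OF _ assms(2)]] that by metis
qed

text \<open>A triple with zero map is the direct sum of its components, each placed in its corner.
  Both orders are provided, as closure under summands speaks of the first summand.\<close>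

lemma class_A_exists:
  assumes M: "M \<in> \<X>" "M \<in> RMod A \<U>" and N: "N \<in> \<Y>" "N \<in> RMod B \<U>"
  obtains L where "L \<in> class_A A U B \<U> \<X> \<Y>"
    "mod_iso \<Lambda> L (dirsum (emb\<^sub>1 M) (emb\<^sub>2 N))" "mod_iso \<Lambda> L (dirsum (emb\<^sub>2 N) (emb\<^sub>1 M))"
proof -
  have l: "lmodule A M" "lmodule B N" using M N by (auto simp: RMod_def)
  interpret N: lmodule B N by (rule l)
  have e: "emb\<^sub>1 M \<in> RMod \<Lambda> \<U>" "emb\<^sub>2 N \<in> RMod \<Lambda> \<U>" using RMod_cor[OF nuhom_tri(3) M(2)] RMod_cor[OF nuhom_tri(4) N(2)] .
  then have le: "lmodule \<Lambda> (emb\<^sub>1 M)" "lmodule \<Lambda> (emb\<^sub>2 N)" by (auto simp: RMod_def)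
  note lD = lmodule_dirsum[OF le] and lD' = lmodule_dirsum[OF le(2,1)]
  obtain L f g where L: "L \<in> RMod \<Lambda> \<U>" "isos \<Lambda> L (dirsum (emb\<^sub>1 M) (emb\<^sub>2 N)) f g" using RMod_dirsum[OF e] by metis
  then have lL: "lmodule \<Lambda> L" by (simp add: RMod_def)
  let ?\<phi> = "\<lambda>t\<in>carrier (tensor_module A U M). \<zero>\<^bsub>N\<^esub>"
  let ?T = "tri_module A U M N ?\<phi>"
  have \<phi>: "?\<phi> \<in> Hom B (tensor_module A U M) N" by (rule Hom_const_zero[OF lmodule_tensor[OF l(1)] l(2)])
  note lT = lmodule_tri[OF l \<phi>]
  let ?D = "dirsum (emb\<^sub>1 M) (emb\<^sub>2 N)"
  have cD: "carrier ?D = carrier M \<times> carrier N" by (simp only: dirsum_simps emb_carrier(1)[OF l(1)] emb_carrier(2)[OF l(2)])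
  \<comment> \<open>With the zero map as \<phi>, the triple and the direct sum have the same carrier
    and the same operations on it.\<close>
  have "restrict (\<lambda>z. z) (carrier ?D) \<in> Hom \<Lambda> ?D ?T"
    by (rule HomI[OF lD]) (auto simp: pure_closed[OF l(1)] N.smult_closed)
  then have "mod_iso \<Lambda> ?D ?T" unfolding mod_iso_def by (intro bexI) (auto simp: cD bij_betw_def inj_on_def simp del: dirsum_simps)
  then obtain h k where hk: "isos \<Lambda> ?D ?T h k" using mod_iso_imp_isos[OF lD lT] by metis
  have "L \<in> class_A A U B \<U> \<X> \<Y>"
    unfolding class_A_def using L(1) M N \<phi> isos_imp_mod_iso[OF isos_trans[OF lL lT L(2) hk]] by blast
  moreover
  have sw: "restrict prod.swap (carrier ?D) \<in> Hom \<Lambda> ?D (dirsum (emb\<^sub>2 N) (emb\<^sub>1 M))" by (rule HomI[OF lD]) auto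
  have "mod_iso \<Lambda> ?D (dirsum (emb\<^sub>2 N) (emb\<^sub>1 M))"
    unfolding mod_iso_def by (rule bexI[OF _ sw]) (auto simp: bij_betw_def inj_on_def image_iff simp del: cor_simps)
  then obtain h' k' where "isos \<Lambda> ?D (dirsum (emb\<^sub>2 N) (emb\<^sub>1 M)) h' k'" using mod_iso_imp_isos[OF lD lD'] by metis
  note isos_imp_mod_iso[OF isos_trans[OF lL lD' L(2) this]]
  ultimately show thesis using that isos_imp_mod_iso[OF L(2)] by blast
qed

text \<open>Modules concentrated in one component split off from triples with zero map, whose other
  component is any member of its class; nonemptiness supplies one. A decomposition of M or N is then
  tested on the embedded modules.\<close>

lemma class_A_summands:
  assumes X: "module_class A \<U> \<X>" and Y: "module_class B \<U> \<Y>" and ne: "class_A A U B \<U> \<X> \<Y> \<noteq> {}"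
    and cl: "closed_under_summands \<Lambda> \<U> (class_A A U B \<U> \<X> \<Y>)"
  shows "M \<in> \<X> \<Longrightarrow> emb\<^sub>1 M \<in> class_A A U B \<U> \<X> \<Y>" and "N \<in> \<Y> \<Longrightarrow> emb\<^sub>2 N \<in> class_A A U B \<U> \<X> \<Y>"
    and "closed_under_summands A \<U> \<X>" and "closed_under_summands B \<U> \<Y>"
proof -
  let ?A = "class_A A U B \<U> \<X> \<Y>"
  note xd = module_classD[OF X] and yd = module_classD[OF Y]
  have sum: "K \<in> ?A" if "L \<in> ?A" "K \<in> RMod \<Lambda> \<U>" "K' \<in> RMod \<Lambda> \<U>" "mod_iso \<Lambda> L (dirsum K K')" for L K K'
    using cl that unfolding closed_under_summands_def by blast
  obtain M0 N0 where 0: "M0 \<in> \<X>" "N0 \<in> \<Y>" using ne class_AD[OF X Y] by blast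
  show e1: "emb\<^sub>1 M \<in> ?A" if M: "M \<in> \<X>" for M
    using class_A_exists[OF M xd(1)[OF M] 0(2) yd(1)[OF 0(2)]] RMod_cor[OF nuhom_tri(3) xd(1)[OF M]]
      RMod_cor[OF nuhom_tri(4) yd(1)[OF 0(2)]] sum by metis
  show e2: "emb\<^sub>2 N \<in> ?A" if N: "N \<in> \<Y>" for N
    using class_A_exists[OF 0(1) xd(1)[OF 0(1)] N yd(1)[OF N]] RMod_cor[OF nuhom_tri(3) xd(1)[OF 0(1)]]
      RMod_cor[OF nuhom_tri(4) yd(1)[OF N]] sum by metis
  show "closed_under_summands A \<U> \<X>"
    unfolding closed_under_summands_def
  proof (intro ballI impI)
    fix M K K' assume *: "M \<in> \<X>" "K \<in> RMod A \<U>" "K' \<in> RMod A \<U>" "mod_iso A M (dirsum K K')"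
    have l: "lmodule A K" "lmodule A K'" using * by (auto simp: RMod_def)
    have "mod_iso \<Lambda> (emb\<^sub>1 M) (dirsum (emb\<^sub>1 K) (emb\<^sub>1 K'))"
      using cor_mod_iso[OF nuhom_tri(3) xd(2)[OF *(1)] lmodule_dirsum[OF l] *(4)] by (simp add: cor_dirsum)
    then have "emb\<^sub>1 K \<in> ?A" using sum[OF e1[OF *(1)]] RMod_cor[OF nuhom_tri(3)] *(2,3) by blast
    then show "K \<in> \<X>" using xd(3)[OF class_AD(3)[OF X Y] *(2) isos_imp_mod_iso[OF comp\<^sub>1_emb\<^sub>1[OF l(1)]]] by blast
  qed
  show "closed_under_summands B \<U> \<Y>"
    unfolding closed_under_summands_def
  proof (intro ballI impI)
    fix M K K' assume *: "M \<in> \<Y>" "K \<in> RMod B \<U>" "K' \<in> RMod B \<U>" "mod_iso B M (dirsum K K')"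
    have l: "lmodule B K" "lmodule B K'" using * by (auto simp: RMod_def)
    have "mod_iso \<Lambda> (emb\<^sub>2 M) (dirsum (emb\<^sub>2 K) (emb\<^sub>2 K'))"
      using cor_mod_iso[OF nuhom_tri(4) yd(2)[OF *(1)] lmodule_dirsum[OF l] *(4)] by (simp add: cor_dirsum)
    then have "emb\<^sub>2 K \<in> ?A" using sum[OF e2[OF *(1)]] RMod_cor[OF nuhom_tri(4)] *(2,3) by blast
    then show "K \<in> \<Y>" using yd(3)[OF class_AD(4)[OF X Y] *(2) isos_imp_mod_iso[OF comp\<^sub>2_emb\<^sub>2[OF l(1)]]] by blast
  qed
qed

text \<open>Zero need not belong to \<open>\<Y>\<close>, so the triple \<open>(C, U \<otimes> C \<oplus> E)\<close> takes the place of \<open>(C, U \<otimes> C)\<close> and of \<open>(0, E)\<close>.\<close>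

lemma class_P_exists:
  assumes C: "C \<in> \<X>" "C \<in> RMod A \<U>" and E: "E \<in> \<Y>" "E \<in> RMod B \<U>"
  obtains L where "L \<in> class_P A U B \<U> \<X> \<Y>" "retract A C (comp\<^sub>1 L)" "retract \<Lambda> (emb\<^sub>2 E) L"
proof -
  let ?TC = "tensor_module A U C"
  have l: "lmodule A C" "lmodule B E" using C E by (auto simp: RMod_def)
  note lTC = lmodule_tensor[OF l(1)] and lD = lmodule_dirsum[OF lmodule_tensor[OF l(1)] l(2)] and d = dirsum_Hom[OF lmodule_tensor[OF l(1)] l(2)]
  interpret C: lmodule A C by (rule l)
  interpret E: lmodule B E by (rule l)
  interpret TC: lmodule B ?TC by (rule lTC)
  have "small \<U> (carrier (dirsum ?TC E))" using small_tensor[OF C(2)] E(2) by (simp add: RMod_small small_Times)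
  then obtain M \<tau> \<sigma> where M: "M \<in> RMod B \<U>" "isos B M (dirsum ?TC E) \<tau> \<sigma>" using RMod_transport[OF lD] by metis
  then have lM: "lmodule B M" by (simp add: RMod_def)
  interpret M: lmodule B M by (rule lM)
  note i = isosD[OF M(2)]
  \<comment> \<open>The inclusion of the first summand: injective, with cokernel E.\<close>
  let ?\<phi> = "compose (carrier ?TC) \<sigma> (\<lambda>t\<in>carrier ?TC. (t, \<zero>\<^bsub>E\<^esub>))"
  note \<phi> = Hom_compose[OF lTC d(3) i(2)]
  have \<phi>t: "?\<phi> t = \<sigma> (t, \<zero>\<^bsub>E\<^esub>)" "\<tau> (?\<phi> t) = (t, \<zero>\<^bsub>E\<^esub>)" if "t \<in> carrier ?TC" for t
    using that i(4)[of "(t, \<zero>\<^bsub>E\<^esub>)"] by (simp_all add: compose_eq)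
  let ?T = "tri_module A U C M ?\<phi>"
  note lT = lmodule_tri[OF l(1) lM \<phi>]
  interpret T: lmodule \<Lambda> ?T by (rule lT)
  have "small \<U> (carrier ?T)" using C(2) M(1) by (simp add: RMod_small small_Times)
  then obtain L f g where L: "L \<in> RMod \<Lambda> \<U>" "isos \<Lambda> L ?T f g" using RMod_transport[OF lT] by metis
  then have lL: "lmodule \<Lambda> L" by (simp add: RMod_def)
  let ?I = "?\<phi> ` carrier ?TC"
  note q = quot_module[OF lM submod_image[OF lTC lM \<phi>]]
  let ?Q = "quot_module M ?I"
  let ?s = "compose (carrier E) \<sigma> (\<lambda>y\<in>carrier E. (\<zero>\<^bsub>?TC\<^esub>, y))"
  note s = Hom_compose[OF l(2) d(4) i(2)]
  have st: "?s y = \<sigma> (\<zero>\<^bsub>?TC\<^esub>, y)" "\<tau> (?s y) = (\<zero>\<^bsub>?TC\<^esub>, y)" if "y \<in> carrier E" for y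
    using that i(4)[of "(\<zero>\<^bsub>?TC\<^esub>, y)"] by (simp_all add: compose_eq)
  let ?k = "compose (carrier E) (\<lambda>x\<in>carrier M. ?I +>\<^bsub>M\<^esub> x) ?s"
  note k = Hom_compose[OF l(2) s q(2)]
  have kx: "?k y = ?I +>\<^bsub>M\<^esub> ?s y" "?s y \<in> carrier M" if "y \<in> carrier E" for y
    using that HomE(2)[OF s that] by (simp_all add: compose_eq[of y "carrier E" "\<lambda>x\<in>carrier M. ?I +>\<^bsub>M\<^esub> x" ?s])
  have "inj_on ?k (carrier E)"
  proof (rule Hom_inj_onI[OF l(2) q(1) k])
    fix y assume y: "y \<in> carrier E" "?k y = \<zero>\<^bsub>?Q\<^esub>"
    then have "?s y \<in> ?I" using kx[OF y(1)] q(4)[OF kx(2)[OF y(1)]] by simp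
    then obtain t where t: "t \<in> carrier ?TC" "?s y = ?\<phi> t" by blast
    then have "(\<zero>\<^bsub>?TC\<^esub>, y) = (t, \<zero>\<^bsub>E\<^esub>)" using st(2)[OF y(1)] \<phi>t(2)[OF t(1)] by metis
    then show "y = \<zero>\<^bsub>E\<^esub>" by simp
  qed
  \<comment> \<open>Modulo the image of \<phi> the first coordinate disappears, so the class of x is
    that of its E-coordinate.\<close>
  moreover have "X \<in> ?k ` carrier E" if X: "X \<in> carrier ?Q" for X
  proof -
    obtain x where x: "x \<in> carrier M" "X = ?I +>\<^bsub>M\<^esub> x" using q(3)[OF X] by blast
    obtain t y where ty: "\<tau> x = (t, y)" "t \<in> carrier ?TC" "y \<in> carrier E" using HomE(2)[OF i(1) x(1)] by auto
    have "x = \<sigma> ((t, \<zero>\<^bsub>E\<^esub>) \<oplus>\<^bsub>dirsum ?TC E\<^esub> (\<zero>\<^bsub>?TC\<^esub>, y))" using i(3)[OF x(1)] ty by simp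
    also have "\<dots> = ?\<phi> t \<oplus>\<^bsub>M\<^esub> ?s y" using ty HomE(3)[OF i(2), of "(t, \<zero>\<^bsub>E\<^esub>)" "(\<zero>\<^bsub>?TC\<^esub>, y)"] by (simp add: \<phi>t(1) st(1))
    finally have xe: "x = ?\<phi> t \<oplus>\<^bsub>M\<^esub> ?s y" .
    have pm: "?\<phi> t \<in> carrier M" using HomE(2)[OF \<phi> ty(2)] .
    have "X = (?I +>\<^bsub>M\<^esub> ?\<phi> t) \<oplus>\<^bsub>?Q\<^esub> (?I +>\<^bsub>M\<^esub> ?s y)"
      using HomE(3)[OF q(2) pm kx(2)[OF ty(3)]] pm kx(2)[OF ty(3)] unfolding x(2) xe by simp
    also have "?I +>\<^bsub>M\<^esub> ?\<phi> t = \<zero>\<^bsub>?Q\<^esub>" using q(4)[OF pm] ty(2) by blast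
    also have "\<zero>\<^bsub>?Q\<^esub> \<oplus>\<^bsub>?Q\<^esub> (?I +>\<^bsub>M\<^esub> ?s y) = ?k y"
      using HomE(2)[OF k ty(3)] kx(1)[OF ty(3)] lmodule_imp_abelian_group[OF q(1)]
      by (simp add: abelian_monoid.l_zero abelian_group.axioms)
    finally show ?thesis using ty(3) by blast
  qed
  ultimately have "bij_betw ?k (carrier E) (carrier ?Q)"
    unfolding bij_betw_def using HomE(2)[OF k] by blast
  then have "in_class B \<Y> ?Q" unfolding in_class_def mod_iso_def using k E(1) by blast
  moreover have "inj_on ?\<phi> (carrier ?TC)" by (rule inj_onI) (metis \<phi>t(2) Pair_inject)
  ultimately have LP: "L \<in> class_P A U B \<U> \<X> \<Y>"
    unfolding class_P_def using L(1) C M(1) \<phi> isos_imp_mod_iso[OF L(2)] by blast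
  have r1: "retract A C (comp\<^sub>1 L)"
    by (rule isos_retract[OF isos_sym[OF tri_isos_components(1)[OF l(1) lM \<phi> lL L(2)]]])
  have le: "lmodule \<Lambda> (emb\<^sub>2 E)" by (rule lmodule_cor[OF nuhom_tri(4) l(2)])
  have ce: "carrier (emb\<^sub>2 E) = carrier E" by (rule emb_carrier(2)[OF l(2)])
  have "retract \<Lambda> (emb\<^sub>2 E) ?T"
    unfolding retract_def
  proof (intro bexI ballI)
    show i2: "restrict (\<lambda>y. (\<zero>\<^bsub>C\<^esub>, ?s y)) (carrier (emb\<^sub>2 E)) \<in> Hom \<Lambda> (emb\<^sub>2 E) ?T"
    proof (rule HomI[OF le]; unfold ce)
      fix x assume x: "x \<in> carrier E"
      show "(\<zero>\<^bsub>C\<^esub>, ?s x) \<in> carrier ?T" using kx(2)[OF x] by simp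
      show "(\<zero>\<^bsub>C\<^esub>, ?s (x \<oplus>\<^bsub>emb\<^sub>2 E\<^esub> y)) = (\<zero>\<^bsub>C\<^esub>, ?s x) \<oplus>\<^bsub>?T\<^esub> (\<zero>\<^bsub>C\<^esub>, ?s y)" if "y \<in> carrier E" for y
        using HomE(3)[OF s x that] by simp
      fix r assume "r \<in> carrier \<Lambda>"
      then obtain a u b where r: "r = (a, u, b)" "a \<in> carrier A" "u \<in> carrier U" "b \<in> carrier B" by auto
      show "(\<zero>\<^bsub>C\<^esub>, ?s (r \<odot>\<^bsub>emb\<^sub>2 E\<^esub> x)) = r \<odot>\<^bsub>?T\<^esub> (\<zero>\<^bsub>C\<^esub>, ?s x)"
        using r HomE(4)[OF s r(4) x] tri_pairing(7)[OF l(1) lM \<phi> r(3)] kx(2)[OF x]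
        by (simp add: C.smult_zero_right M.smult_closed)
    qed
    \<comment> \<open>The entries from U act through \<phi>, whose image is the other summand; so
      the projection to E does not see them and is linear over \<Lambda>.\<close>
    show "restrict (\<lambda>p. snd (\<tau> (snd p))) (carrier ?T) \<in> Hom \<Lambda> ?T (emb\<^sub>2 E)"
    proof (rule HomI[OF lT]; (unfold ce)?)
      fix p assume "p \<in> carrier ?T"
      then obtain x m where p: "p = (x, m)" "x \<in> carrier C" "m \<in> carrier M" by auto
      note tm = HomE(2)[OF i(1) p(3)]
      show "snd (\<tau> (snd p)) \<in> carrier E" using tm p by auto
      show "snd (\<tau> (snd (p \<oplus>\<^bsub>?T\<^esub> p'))) = snd (\<tau> (snd p)) \<oplus>\<^bsub>emb\<^sub>2 E\<^esub> snd (\<tau> (snd p'))" if p': "p' \<in> carrier ?T" for p'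
      proof -
        obtain x' m' where p': "p' = (x', m')" "m' \<in> carrier M" using p' by auto
        show ?thesis using p p' HomE(3)[OF i(1) p(3) p'(2)] by (cases "\<tau> m"; cases "\<tau> m'") simp
      qed
      fix r assume "r \<in> carrier \<Lambda>"
      then obtain a u b where r: "r = (a, u, b)" "a \<in> carrier A" "u \<in> carrier U" "b \<in> carrier B" by auto
      note pc = pure_closed[OF l(1) r(3) p(2)]
      have m': "?\<phi> (pure_tensor A U C u x) \<in> carrier M" "b \<odot>\<^bsub>M\<^esub> m \<in> carrier M" using HomE(2)[OF \<phi> pc] M.smult_closed[OF r(4) p(3)] .
      obtain t y where ty: "\<tau> m = (t, y)" "t \<in> carrier ?TC" "y \<in> carrier E" using tm by auto
      have "\<tau> (?\<phi> (pure_tensor A U C u x) \<oplus>\<^bsub>M\<^esub> b \<odot>\<^bsub>M\<^esub> m) = (pure_tensor A U C u x, \<zero>\<^bsub>E\<^esub>) \<oplus>\<^bsub>dirsum ?TC E\<^esub> b \<odot>\<^bsub>dirsum ?TC E\<^esub> (t, y)"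
        using HomE(3)[OF i(1) m'] HomE(4)[OF i(1) r(4) p(3)] \<phi>t(2)[OF pc] ty by simp
      then show "snd (\<tau> (snd (r \<odot>\<^bsub>?T\<^esub> p))) = r \<odot>\<^bsub>emb\<^sub>2 E\<^esub> snd (\<tau> (snd p))"
        using p r ty by (simp add: E.smult_closed)
    qed
    show "restrict (\<lambda>p. snd (\<tau> (snd p))) (carrier ?T) (restrict (\<lambda>y. (\<zero>\<^bsub>C\<^esub>, ?s y)) (carrier (emb\<^sub>2 E)) y) = y"
      if "y \<in> carrier (emb\<^sub>2 E)" for y
      using that st(2)[of y] kx(2)[of y] unfolding ce by simp
  qed
  then have "retract \<Lambda> (emb\<^sub>2 E) L" by (rule retract_trans[OF le lL _ isos_retract[OF isos_sym[OF L(2)]]])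
  then show thesis using that LP r1 by blast
qed

text \<open>The dual construction: first component D \<oplus> Hom(U, F), second component F, and
  evaluation as the structure map. Its adjoint is the second projection, which is onto with kernel
  D. As zero may be missing from the classes, this triple stands in for (D, 0) and for (Hom(U, F),
  F).\<close>

lemma class_I_exists:
  assumes D: "D \<in> \<X>" and X: "module_class A \<U> \<X>" and F: "F \<in> \<Y>" "F \<in> RMod B \<U>"
  obtains L where "L \<in> class_I A U B \<U> \<X> \<Y>" "retract \<Lambda> (emb\<^sub>1 D) L" "retract B F (comp\<^sub>2 L)"
proof -
  let ?H = "hom_module B U F"
  have DR: "D \<in> RMod A \<U>" using module_classD(1)[OF X D] .
  have l: "lmodule A D" "lmodule B F" using DR F by (auto simp: RMod_def)
  note lH = lmodule_hom_module[OF l(2)]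
  note lDH = lmodule_dirsum[OF l(1) lH] and d = dirsum_Hom[OF l(1) lH]
  interpret D: lmodule A D by (rule l)
  interpret F: lmodule B F by (rule l)
  interpret H: lmodule A ?H by (rule lH)
  have "small \<U> (carrier ?H)"
    using F(2) by (intro small_subset[OF small_exponent[OF powers_U]]) (auto simp: RMod_small hom_module_simps Hom_def)
  then have "small \<U> (carrier (dirsum D ?H))" using DR by (simp add: RMod_small small_Times)
  then obtain M \<tau> \<sigma> where M: "M \<in> RMod A \<U>" "isos A M (dirsum D ?H) \<tau> \<sigma>" using RMod_transport[OF lDH] by metis
  then have lM: "lmodule A M" by (simp add: RMod_def)
  interpret M: lmodule A M by (rule lM)
  note i = isosD[OF M(2)]
  have sm: "fst (\<tau> m) \<in> carrier D" "snd (\<tau> m) \<in> Hom B U F" if "m \<in> carrier M" for m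
    using HomE(2)[OF i(1) that] by (auto simp: hom_module_simps)
  obtain \<phi> where \<phi>: "\<phi> \<in> Hom B (tensor_module A U M) F"
    "\<And>u m. \<lbrakk>u \<in> carrier U; m \<in> carrier M\<rbrakk> \<Longrightarrow> \<phi> (pure_tensor A U M u m) = snd (\<tau> m) u"
  proof (rule tensor_universal_Hom[OF lM l(2), of "\<lambda>u m. snd (\<tau> m) u"])
    show "balanced A U M (add_monoid F) (\<lambda>u m. snd (\<tau> m) u)"
      unfolding balanced_def
    proof (intro conjI ballI)
      fix u m assume u: "u \<in> carrier U" and m: "m \<in> carrier M"
      show "snd (\<tau> m) u \<in> carrier (add_monoid F)" using HomE(2)[OF sm(2)[OF m] u] by simp
      show "snd (\<tau> m) (u \<oplus>\<^bsub>U\<^esub> v) = snd (\<tau> m) u \<otimes>\<^bsub>add_monoid F\<^esub> snd (\<tau> m) v" if "v \<in> carrier U" for v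
        using HomE(3)[OF sm(2)[OF m] u that] by simp
      show "snd (\<tau> (m \<oplus>\<^bsub>M\<^esub> m')) u = snd (\<tau> m) u \<otimes>\<^bsub>add_monoid F\<^esub> snd (\<tau> m') u" if "m' \<in> carrier M" for m'
        using HomE(3)[OF i(1) m that] u by (cases "\<tau> m"; cases "\<tau> m'") (simp add: hom_module_simps)
      show "snd (\<tau> m) (rsmult U u a) = snd (\<tau> (a \<odot>\<^bsub>M\<^esub> m)) u" if "a \<in> carrier A" for a
        using HomE(4)[OF i(1) that m] u by (cases "\<tau> m") (simp add: hom_module_simps)
    qed
    show "snd (\<tau> m) (b \<odot>\<^bsub>U\<^esub> u) = b \<odot>\<^bsub>F\<^esub> snd (\<tau> m) u" if "b \<in> carrier B" "u \<in> carrier U" "m \<in> carrier M" for b u m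
      using HomE(4)[OF sm(2)[OF that(3)] that(1,2)] .
  qed blast
  let ?T = "tri_module A U M F \<phi>"
  note lT = lmodule_tri[OF lM l(2) \<phi>(1)]
  have "small \<U> (carrier ?T)" using F(2) M(1) by (simp add: RMod_small small_Times)
  then obtain L f g where L: "L \<in> RMod \<Lambda> \<U>" "isos \<Lambda> L ?T f g" using RMod_transport[OF lT] by metis
  then have lL: "lmodule \<Lambda> L" by (simp add: RMod_def)
  have adj: "tri_adjoint A U M \<phi> m = snd (\<tau> m)" if "m \<in> carrier M" for m
    using HomE(1)[OF sm(2)[OF that]] that \<phi>(2) by (auto simp: tri_adjoint_def fun_eq_iff PiE_iff extensional_def)
  let ?s = "compose (carrier D) \<sigma> (\<lambda>x\<in>carrier D. (x, \<zero>\<^bsub>?H\<^esub>))"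
  note s = Hom_compose[OF l(1) d(3) i(2)]
  have st: "\<tau> (?s x) = (x, \<zero>\<^bsub>?H\<^esub>)" "?s x \<in> carrier M" if "x \<in> carrier D" for x
    using that i(4)[of "(x, \<zero>\<^bsub>?H\<^esub>)"] HomE(2)[OF s that] by (simp_all add: compose_eq)
  let ?K = "a_kernel M ?H (tri_adjoint A U M \<phi>)"
  have K: "m \<in> ?K \<longleftrightarrow> m \<in> carrier M \<and> snd (\<tau> m) = \<zero>\<^bsub>?H\<^esub>" for m by (auto simp: a_kernel_iff adj)
  have adjH: "tri_adjoint A U M \<phi> \<in> Hom A M ?H"
  proof -
    have "restrict (tri_adjoint A U M \<phi>) (carrier M) = compose (carrier M) (\<lambda>p\<in>carrier (dirsum D ?H). snd p) \<tau>"
      using HomE(2)[OF i(1)] adj by (auto simp: compose_def intro!: restrict_ext)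
    moreover have "restrict (tri_adjoint A U M \<phi>) (carrier M) = tri_adjoint A U M \<phi>" by (simp add: tri_adjoint_def)
    ultimately show ?thesis using Hom_compose[OF lM i(1) d(2)] by simp
  qed
  note sK = submod_kernel[OF lM lH adjH]
  have "mod_iso A D (M\<lparr>carrier := ?K\<rparr>)"
    unfolding mod_iso_def
  proof (intro bexI)
    have "?s ` carrier D \<subseteq> ?K" using st by (auto simp: K)
    then show sH: "?s \<in> Hom A D (M\<lparr>carrier := ?K\<rparr>)" by (rule Hom_submod_codomain[OF s])
    have "inj_on ?s (carrier D)" by (rule inj_onI) (metis st(1) Pair_inject)
    moreover have "m \<in> ?s ` carrier D" if m: "m \<in> ?K" for m
    proof -
      have m: "m \<in> carrier M" "snd (\<tau> m) = \<zero>\<^bsub>?H\<^esub>" using m K by auto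
      then have "?s (fst (\<tau> m)) = \<sigma> (\<tau> m)" using sm(1)[OF m(1)] by (cases "\<tau> m") (simp add: compose_eq)
      then show ?thesis using i(3)[OF m(1)] sm(1)[OF m(1)] by (metis image_eqI)
    qed
    ultimately show "bij_betw ?s (carrier D) (carrier (M\<lparr>carrier := ?K\<rparr>))"
      unfolding bij_betw_def using HomE(2)[OF sH] by auto
  qed
  then have KX: "M\<lparr>carrier := ?K\<rparr> \<in> \<X>" using module_classD(3)[OF X D RMod_submod[OF M(1) sK]] by blast
  have sur: "tri_adjoint A U M \<phi> ` carrier M = carrier ?H"
  proof
    show "tri_adjoint A U M \<phi> ` carrier M \<subseteq> carrier ?H" using HomE(2)[OF adjH] by blast
    show "carrier ?H \<subseteq> tri_adjoint A U M \<phi> ` carrier M"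
    proof
      fix h assume h: "h \<in> carrier ?H"
      have m: "\<sigma> (\<zero>\<^bsub>D\<^esub>, h) \<in> carrier M" using HomE(2)[OF i(2), of "(\<zero>\<^bsub>D\<^esub>, h)"] h by simp
      moreover have "h = tri_adjoint A U M \<phi> (\<sigma> (\<zero>\<^bsub>D\<^esub>, h))" using adj[OF m] i(4)[of "(\<zero>\<^bsub>D\<^esub>, h)"] h by simp
      ultimately show "h \<in> tri_adjoint A U M \<phi> ` carrier M" by blast
    qed
  qed
  have LI: "L \<in> class_I A U B \<U> \<X> \<Y>"
    unfolding class_I_def using L(1) M(1) F \<phi>(1) isos_imp_mod_iso[OF L(2)] KX sur by blast
  have r2: "retract B F (comp\<^sub>2 L)"
    by (rule isos_retract[OF isos_sym[OF tri_isos_components(2)[OF lM l(2) \<phi>(1) lL L(2)]]])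
  have le: "lmodule \<Lambda> (emb\<^sub>1 D)" by (rule lmodule_cor[OF nuhom_tri(3) l(1)])
  have ce: "carrier (emb\<^sub>1 D) = carrier D" by (rule emb_carrier(1)[OF l(1)])
  have "retract \<Lambda> (emb\<^sub>1 D) ?T"
    unfolding retract_def
  proof (intro bexI ballI)
    \<comment> \<open>An element of D has zero Hom-part, so the entries from U annihilate it; hence
      the inclusion is linear over \<Lambda>.\<close>
    show "restrict (\<lambda>x. (?s x, \<zero>\<^bsub>F\<^esub>)) (carrier (emb\<^sub>1 D)) \<in> Hom \<Lambda> (emb\<^sub>1 D) ?T"
    proof (rule HomI[OF le]; unfold ce)
      fix x assume x: "x \<in> carrier D"
      show "(?s x, \<zero>\<^bsub>F\<^esub>) \<in> carrier ?T" using st(2)[OF x] by simp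
      show "(?s (x \<oplus>\<^bsub>emb\<^sub>1 D\<^esub> y), \<zero>\<^bsub>F\<^esub>) = (?s x, \<zero>\<^bsub>F\<^esub>) \<oplus>\<^bsub>?T\<^esub> (?s y, \<zero>\<^bsub>F\<^esub>)" if "y \<in> carrier D" for y
        using HomE(3)[OF s x that] by simp
      fix r assume "r \<in> carrier \<Lambda>"
      then obtain a u b where r: "r = (a, u, b)" "a \<in> carrier A" "u \<in> carrier U" "b \<in> carrier B" by auto
      show "(?s (r \<odot>\<^bsub>emb\<^sub>1 D\<^esub> x), \<zero>\<^bsub>F\<^esub>) = r \<odot>\<^bsub>?T\<^esub> (?s x, \<zero>\<^bsub>F\<^esub>)"
        using r HomE(4)[OF s r(2) x] \<phi>(2)[OF r(3) st(2)[OF x]] st(1)[OF x]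
        by (simp add: hom_module_simps F.smult_zero_right)
    qed
    show "restrict (\<lambda>p. fst (\<tau> (fst p))) (carrier ?T) \<in> Hom \<Lambda> ?T (emb\<^sub>1 D)"
    proof (rule HomI[OF lT]; (unfold ce)?)
      fix p assume "p \<in> carrier ?T"
      then obtain m y where p: "p = (m, y)" "m \<in> carrier M" "y \<in> carrier F" by auto
      show "fst (\<tau> (fst p)) \<in> carrier D" using sm(1)[OF p(2)] p(1) by simp
      show "fst (\<tau> (fst (p \<oplus>\<^bsub>?T\<^esub> p'))) = fst (\<tau> (fst p)) \<oplus>\<^bsub>emb\<^sub>1 D\<^esub> fst (\<tau> (fst p'))" if p': "p' \<in> carrier ?T" for p'
      proof -
        obtain m' y' where p': "p' = (m', y')" "m' \<in> carrier M" using p' by auto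
        show ?thesis using p p' HomE(3)[OF i(1) p(2) p'(2)] by (cases "\<tau> m"; cases "\<tau> m'") simp
      qed
      fix r assume "r \<in> carrier \<Lambda>"
      then obtain a u b where r: "r = (a, u, b)" "a \<in> carrier A" by auto
      show "fst (\<tau> (fst (r \<odot>\<^bsub>?T\<^esub> p))) = r \<odot>\<^bsub>emb\<^sub>1 D\<^esub> fst (\<tau> (fst p))"
        using p r HomE(4)[OF i(1) r(2) p(2)] by (cases "\<tau> m") simp
    qed
    show "restrict (\<lambda>p. fst (\<tau> (fst p))) (carrier ?T) (restrict (\<lambda>x. (?s x, \<zero>\<^bsub>F\<^esub>)) (carrier (emb\<^sub>1 D)) x) = x"
      if "x \<in> carrier (emb\<^sub>1 D)" for x
      using that st[of x] unfolding ce by simp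
  qed
  then have "retract \<Lambda> (emb\<^sub>1 D) L" by (rule retract_trans[OF le lL _ isos_retract[OF isos_sym[OF L(2)]]])
  then show thesis using that LI r2 by blast
qed

end

section \<open>Cotorsion pairs over triangular matrix rings\<close>

context triangular
begin

section \<open>Cokernels of the structure maps along a coresolution\<close>

lemma trivial_tensor:
  assumes M: "lmodule A M" and z: "carrier M = {\<zero>\<^bsub>M\<^esub>}" and t: "t \<in> carrier (tensor_module A U M)"
  shows "t = \<zero>\<^bsub>tensor_module A U M\<^esub>"
  using tensor_map_id[OF M Hom_id[OF M] _ t] tensor_map_zero[OF M M Hom_id[OF M] _ t] z by simp

text \<open>The maps \<open>phi (L i)\<close> compare two exact rows, the tensored first components
  and the second components, with the E i as column cokernels; a diagram chase makes the cokernel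
  row exact. The exactness of the upper row enters in the form that
  \<open>tensor_coresolution\<close> delivers.\<close>

lemma cokernel_coresolution:
  assumes c: "coresolution \<Lambda> X e L d" and X: "X \<in> RMod \<Lambda> \<U>" and L: "\<And>i. L i \<in> RMod \<Lambda> \<U>" and E: "\<And>i. E i \<in> RMod B \<U>"
    and p: "\<And>i. short_exact B (tensor_module A U (comp\<^sub>1 (L i))) (phi (L i)) (comp\<^sub>2 (L i)) (p i) (E i)"
    and ex: "inj_on (tensor_map A U (comp\<^sub>1 (L 0)) (restrict e (carrier (comp\<^sub>1 X)))) (carrier (tensor_module A U (comp\<^sub>1 X)))"
      "\<And>t. \<lbrakk>t \<in> carrier (tensor_module A U (comp\<^sub>1 (L 0)));
        tensor_map A U (comp\<^sub>1 (L (Suc 0))) (restrict (d 0) (carrier (comp\<^sub>1 (L 0)))) t = \<zero>\<^bsub>tensor_module A U (comp\<^sub>1 (L (Suc 0)))\<^esub>\<rbrakk> \<Longrightarrow>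
        \<exists>s\<in>carrier (tensor_module A U (comp\<^sub>1 X)). t = tensor_map A U (comp\<^sub>1 (L 0)) (restrict e (carrier (comp\<^sub>1 X))) s"
      "\<And>i t. \<lbrakk>t \<in> carrier (tensor_module A U (comp\<^sub>1 (L (Suc i))));
        tensor_map A U (comp\<^sub>1 (L (Suc (Suc i)))) (restrict (d (Suc i)) (carrier (comp\<^sub>1 (L (Suc i))))) t =
          \<zero>\<^bsub>tensor_module A U (comp\<^sub>1 (L (Suc (Suc i))))\<^esub>\<rbrakk> \<Longrightarrow>
        \<exists>s\<in>carrier (tensor_module A U (comp\<^sub>1 (L i))). t = tensor_map A U (comp\<^sub>1 (L (Suc i))) (restrict (d i) (carrier (comp\<^sub>1 (L i)))) s"
  obtains Q q k \<delta> where "Q \<in> RMod B \<U>" "short_exact B (tensor_module A U (comp\<^sub>1 X)) (phi X) (comp\<^sub>2 X) q Q"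
    "coresolution B Q k E \<delta>"
proof -
  have l: "lmodule \<Lambda> X" "lmodule \<Lambda> (L i)" "lmodule B (E i)" for i using X L E by (auto simp: RMod_def)
  note l1 = lmodule_cor[OF nuhom_tri(1) l(1)] lmodule_cor[OF nuhom_tri(1) l(2)]
    and l2 = lmodule_cor[OF nuhom_tri(2) l(1)] lmodule_cor[OF nuhom_tri(2) l(2)]
  note lT = lmodule_tensor[OF l1(1)] lmodule_tensor[OF l1(2)]
  note cr = coresolutionD[OF c]
  let ?e1 = "restrict e (carrier (comp\<^sub>1 X))" and ?d1 = "\<lambda>i. restrict (d i) (carrier (comp\<^sub>1 (L i)))"
  define e2 where "e2 = restrict e (carrier (comp\<^sub>2 X))"
  define d2 where "d2 i = restrict (d i) (carrier (comp\<^sub>2 (L i)))" for i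
  have c2: "coresolution B (comp\<^sub>2 X) e2 (\<lambda>i. comp\<^sub>2 (L i)) d2"
    unfolding e2_def d2_def by (rule cor_coresolution[OF nuhom_tri(2) l(2,1) c])
  note h1 = cor_Hom[OF nuhom_tri(1) l(1) cr(1)] cor_Hom[OF nuhom_tri(1) l(2) cr(2)]
  note r = coresolutionD[OF c2]
  note ph = phi(1)[OF l(1)] phi(1)[OF l(2)]
  note pe = short_exactD[OF p]
  let ?TX = "tensor_module A U (comp\<^sub>1 X)" and ?T = "\<lambda>i. tensor_module A U (comp\<^sub>1 (L i))"
  have nat_e: "phi (L 0) (tensor_map A U (comp\<^sub>1 (L 0)) ?e1 t) = e2 (phi X t)" if "t \<in> carrier ?TX" for t
    using phi_natural[OF l(1,2) cr(1) that] HomE(2)[OF ph(1) that] by (simp add: e2_def)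
  have nat_d: "phi (L (Suc i)) (tensor_map A U (comp\<^sub>1 (L (Suc i))) (?d1 i) t) = d2 i (phi (L i) t)" if "t \<in> carrier (?T i)" for i t
    using phi_natural[OF l(2,2) cr(2) that] HomE(2)[OF ph(2) that] by (simp add: d2_def)
  have phi_inj: "t = \<zero>\<^bsub>?T i\<^esub>" if "t \<in> carrier (?T i)" "phi (L i) t = \<zero>\<^bsub>comp\<^sub>2 (L i)\<^esub>" for i t
    using Hom_inj_onD[OF lT(2) l2(2) ph(2) pe(3)] that by blast
  note te = tensor_map[OF l1(1) l1(2) h1(1)] and td = tensor_map[OF l1(2) l1(2) h1(2)]
  \<comment> \<open>The cokernel of \<open>phi X\<close> is realised as an image inside E 0, so that
    its inclusion can start the new coresolution. That the kernel of q is the image of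
    \<open>phi X\<close> needs exactness of the tensored row at index 0.\<close>
  define q where "q = compose (carrier (comp\<^sub>2 X)) (p 0) e2"
  have q: "q \<in> Hom B (comp\<^sub>2 X) (E 0)" unfolding q_def by (rule Hom_compose[OF l2(1) r(1) pe(2)])
  have qx: "q y = p 0 (e2 y)" if "y \<in> carrier (comp\<^sub>2 X)" for y using that by (simp add: q_def compose_eq del: cor_simps(1))
  let ?S = "q ` carrier (comp\<^sub>2 X)"
  define Q where "Q = (E 0)\<lparr>carrier := ?S\<rparr>"
  note sS = submod_image[OF l2(1) l(3) q]
  have Q: "Q \<in> RMod B \<U>" "lmodule B Q" unfolding Q_def by (rule RMod_submod[OF E sS], rule lmodule_submod[OF l(3) sS])
  have cQ: "carrier Q = ?S" "\<zero>\<^bsub>Q\<^esub> = \<zero>\<^bsub>E 0\<^esub>" by (simp_all add: Q_def)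
  have ses: "short_exact B ?TX (phi X) (comp\<^sub>2 X) q Q"
  proof (rule short_exactI[OF ph(1)])
    show "q \<in> Hom B (comp\<^sub>2 X) Q" unfolding Q_def by (rule Hom_submod_codomain[OF q]) simp
    show "inj_on (phi X) (carrier ?TX)"
    proof (rule Hom_inj_onI[OF lT(1) l2(1) ph(1)])
      fix t assume t: "t \<in> carrier ?TX" "phi X t = \<zero>\<^bsub>comp\<^sub>2 X\<^esub>"
      have "phi (L 0) (tensor_map A U (comp\<^sub>1 (L 0)) ?e1 t) = \<zero>\<^bsub>comp\<^sub>2 (L 0)\<^esub>"
        using nat_e[OF t(1)] t(2) Hom_zero[OF l2(1) l2(2) r(1)] by simp
      then have "tensor_map A U (comp\<^sub>1 (L 0)) ?e1 t = \<zero>\<^bsub>?T 0\<^esub>" using phi_inj te(1)[OF t(1)] by blast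
      then show "t = \<zero>\<^bsub>?TX\<^esub>" using tensor_map_injD[OF l1(1) l1(2) h1(1) ex(1) t(1)] by blast
    qed
    show "q (phi X t) = \<zero>\<^bsub>Q\<^esub>" if t: "t \<in> carrier ?TX" for t
      using qx[OF HomE(2)[OF ph(1) t]] nat_e[OF t] pe(4)[OF te(1)[OF t]] cQ(2) by simp
    show "\<exists>t\<in>carrier ?TX. y = phi X t" if y: "y \<in> carrier (comp\<^sub>2 X)" "q y = \<zero>\<^bsub>Q\<^esub>" for y
    proof -
      obtain t where t: "t \<in> carrier (?T 0)" "e2 y = phi (L 0) t"
        using pe(5)[OF HomE(2)[OF r(1) y(1)]] qx[OF y(1)] y(2) cQ(2) by auto
      have "phi (L (Suc 0)) (tensor_map A U (comp\<^sub>1 (L (Suc 0))) (?d1 0) t) = \<zero>\<^bsub>comp\<^sub>2 (L (Suc 0))\<^esub>"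
        using nat_d[OF t(1)] t(2) r(4)[OF y(1)] by simp
      then have "tensor_map A U (comp\<^sub>1 (L (Suc 0))) (?d1 0) t = \<zero>\<^bsub>?T (Suc 0)\<^esub>" using phi_inj td(1)[OF t(1)] by blast
      then obtain s where s: "s \<in> carrier ?TX" "t = tensor_map A U (comp\<^sub>1 (L 0)) ?e1 s" using ex(2)[OF t(1)] by blast
      then have "e2 y = e2 (phi X s)" using nat_e t(2) by simp
      then have "y = phi X s" using r(3) y(1) HomE(2)[OF ph(1) s(1)] by (meson inj_onD)
      then show ?thesis using s(1) by blast
    qed
  qed (auto simp: cQ)
  have "\<exists>\<delta>. \<delta> \<in> Hom B (E i) (E (Suc i)) \<and> (\<forall>y\<in>carrier (comp\<^sub>2 (L i)). \<delta> (p i y) = p (Suc i) (d2 i y))" for i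
  proof -
    note h = Hom_compose[OF l2(2) r(2) pe(2)]
    have im: "p i ` carrier (comp\<^sub>2 (L i)) = carrier (E i)" using p[of i] by (simp add: short_exact_def)
    obtain \<delta> where "\<delta> \<in> Hom B (E i) (E (Suc i))"
      "\<And>y. y \<in> carrier (comp\<^sub>2 (L i)) \<Longrightarrow> \<delta> (p i y) = compose (carrier (comp\<^sub>2 (L i))) (p (Suc i)) (d2 i) y"
    proof (rule factor_through_cokernel[OF l2(2) l(3) l(3) pe(2) im h])
      fix y assume y: "y \<in> carrier (comp\<^sub>2 (L i))" "p i y = \<zero>\<^bsub>E i\<^esub>"
      then obtain t where t: "t \<in> carrier (?T i)" "y = phi (L i) t" using pe(5) by blast
      then have "p (Suc i) (d2 i y) = \<zero>\<^bsub>E (Suc i)\<^esub>" using nat_d[OF t(1)] pe(4)[OF td(1)[OF t(1)]] by metis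
      then show "compose (carrier (comp\<^sub>2 (L i))) (p (Suc i)) (d2 i) y = \<zero>\<^bsub>E (Suc i)\<^esub>" using y(1) by (simp add: compose_eq del: cor_simps(1))
    qed blast
    then show ?thesis by (intro exI[of _ \<delta>]) (simp add: compose_eq del: cor_simps(1))
  qed
  then obtain \<delta> where \<delta>: "\<And>i. \<delta> i \<in> Hom B (E i) (E (Suc i))"
    "\<And>i y. y \<in> carrier (comp\<^sub>2 (L i)) \<Longrightarrow> \<delta> i (p i y) = p (Suc i) (d2 i y)" by metis
  \<comment> \<open>The correction behind the chase: if d2 y dies in E (i + 1), it comes from a
    cycle of the tensored row, hence from a boundary there. Subtracting the image of a preimage of
    that boundary from y gives a cycle with the same class in E i.\<close>
  have corr: "\<exists>s\<in>carrier (?T i). d2 i (y \<ominus>\<^bsub>comp\<^sub>2 (L i)\<^esub> phi (L i) s) = \<zero>\<^bsub>comp\<^sub>2 (L (Suc i))\<^esub>"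
    if y: "y \<in> carrier (comp\<^sub>2 (L i))" "p (Suc i) (d2 i y) = \<zero>\<^bsub>E (Suc i)\<^esub>" for i y
  proof -
    obtain t where t: "t \<in> carrier (?T (Suc i))" "d2 i y = phi (L (Suc i)) t"
      using pe(5)[OF HomE(2)[OF r(2) y(1)] y(2)] by blast
    have "phi (L (Suc (Suc i))) (tensor_map A U (comp\<^sub>1 (L (Suc (Suc i)))) (?d1 (Suc i)) t) = \<zero>\<^bsub>comp\<^sub>2 (L (Suc (Suc i)))\<^esub>"
      using nat_d[OF t(1)] t(2) r(6)[OF y(1)] by simp
    then have "tensor_map A U (comp\<^sub>1 (L (Suc (Suc i)))) (?d1 (Suc i)) t = \<zero>\<^bsub>?T (Suc (Suc i))\<^esub>" using phi_inj td(1)[OF t(1)] by blast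
    then obtain s where s: "s \<in> carrier (?T i)" "t = tensor_map A U (comp\<^sub>1 (L (Suc i))) (?d1 i) s" using ex(3)[OF t(1)] by blast
    then have "d2 i y = d2 i (phi (L i) s)" using nat_d t(2) by simp
    then show ?thesis
      using s(1) y(1) HomE(2)[OF ph(2) s(1)] HomE(2)[OF r(2) y(1)] abelian_group.minus_self[OF lmodule_imp_abelian_group[OF l2(2)]]
      by (intro bexI[of _ s]) (simp_all only: Hom_minus[OF l2(2) l2(2) r(2)])
  qed
  have pz: "p i (y \<ominus>\<^bsub>comp\<^sub>2 (L i)\<^esub> phi (L i) s) = p i y" if "y \<in> carrier (comp\<^sub>2 (L i))" "s \<in> carrier (?T i)" for i y s
    using that HomE(2)[OF ph(2) that(2)] pe(4)[OF that(2)] HomE(2)[OF pe(2) that(1)]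
      abelian_group.zero_minus[OF lmodule_imp_abelian_group[OF l(3)]]
    by (simp only: Hom_minus[OF l2(2) l(3) pe(2)])
  have mc: "y \<ominus>\<^bsub>comp\<^sub>2 (L i)\<^esub> phi (L i) s \<in> carrier (comp\<^sub>2 (L i))" if "y \<in> carrier (comp\<^sub>2 (L i))" "s \<in> carrier (?T i)" for i y s
    using abelian_group.minus_closed[OF lmodule_imp_abelian_group[OF l2(2)] that(1) HomE(2)[OF ph(2) that(2)]] .
  have "coresolution B Q (\<lambda>x\<in>?S. x) E \<delta>"
  proof (rule coresolutionI)
    show "\<delta> i \<in> Hom B (E i) (E (Suc i))" for i by (rule \<delta>(1))
    show "(\<lambda>x\<in>?S. x) \<in> Hom B Q (E 0)" unfolding Q_def by (rule Hom_submod_inclusion[OF l(3) sS])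
    show "inj_on (\<lambda>x\<in>?S. x) (carrier Q)" by (auto simp: cQ inj_on_def)
    show "\<delta> 0 ((\<lambda>x\<in>?S. x) x) = \<zero>\<^bsub>E (Suc 0)\<^esub>" if x: "x \<in> carrier Q" for x
    proof -
      obtain y where y: "y \<in> carrier (comp\<^sub>2 X)" "x = q y" using x unfolding cQ(1) by blast
      then have "\<delta> 0 x = p (Suc 0) (d2 0 (e2 y))" using \<delta>(2)[OF HomE(2)[OF r(1) y(1)]] qx by simp
      also have "\<dots> = \<zero>\<^bsub>E (Suc 0)\<^esub>" using r(4)[OF y(1)] Hom_zero[OF l2(2) l(3) pe(2)] by simp
      finally show ?thesis using y by simp
    qed
    show "\<exists>x\<in>carrier Q. z = (\<lambda>x\<in>?S. x) x" if z: "z \<in> carrier (E 0)" "\<delta> 0 z = \<zero>\<^bsub>E (Suc 0)\<^esub>" for z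
    proof -
      obtain y where y: "y \<in> carrier (comp\<^sub>2 (L 0))" "z = p 0 y" using pe(6)[OF z(1)] by blast
      obtain s where s: "s \<in> carrier (?T 0)" "d2 0 (y \<ominus>\<^bsub>comp\<^sub>2 (L 0)\<^esub> phi (L 0) s) = \<zero>\<^bsub>comp\<^sub>2 (L (Suc 0))\<^esub>"
        using corr[OF y(1)] \<delta>(2)[OF y(1)] z(2) y(2) by metis
      obtain x where x: "x \<in> carrier (comp\<^sub>2 X)" "y \<ominus>\<^bsub>comp\<^sub>2 (L 0)\<^esub> phi (L 0) s = e2 x" using r(5)[OF mc[OF y(1) s(1)] s(2)] by blast
      have "z = q x" using pz[OF y(1) s(1)] y(2) x qx by simp
      then show ?thesis using x(1) by (auto simp: cQ simp del: cor_simps(1))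
    qed
    show "\<delta> (Suc i) (\<delta> i z) = \<zero>\<^bsub>E (Suc (Suc i))\<^esub>" if z: "z \<in> carrier (E i)" for i z
    proof -
      obtain y where y: "y \<in> carrier (comp\<^sub>2 (L i))" "z = p i y" using pe(6)[OF z] by blast
      then show ?thesis
        using \<delta>(2)[OF y(1)] \<delta>(2)[OF HomE(2)[OF r(2) y(1)]] r(6)[OF y(1)] Hom_zero[OF l2(2) l(3) pe(2)] by simp
    qed
    show "\<exists>z\<in>carrier (E i). w = \<delta> i z" if w: "w \<in> carrier (E (Suc i))" "\<delta> (Suc i) w = \<zero>\<^bsub>E (Suc (Suc i))\<^esub>" for i w
    proof -
      obtain y where y: "y \<in> carrier (comp\<^sub>2 (L (Suc i)))" "w = p (Suc i) y" using pe(6)[OF w(1)] by blast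
      obtain s where s: "s \<in> carrier (?T (Suc i))" "d2 (Suc i) (y \<ominus>\<^bsub>comp\<^sub>2 (L (Suc i))\<^esub> phi (L (Suc i)) s) = \<zero>\<^bsub>comp\<^sub>2 (L (Suc (Suc i)))\<^esub>"
        using corr[OF y(1)] \<delta>(2)[OF y(1)] w(2) y(2) by metis
      obtain x where x: "x \<in> carrier (comp\<^sub>2 (L i))" "y \<ominus>\<^bsub>comp\<^sub>2 (L (Suc i))\<^esub> phi (L (Suc i)) s = d2 i x" using r(7)[OF mc[OF y(1) s(1)] s(2)] by blast
      have "w = \<delta> i (p i x)" using pz[OF y(1) s(1)] y(2) x \<delta>(2)[OF x(1)] by simp
      then show ?thesis using HomE(2)[OF pe(2) x(1)] by blast
    qed
  qed
  then show thesis using that Q(1) ses by blast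
qed

text \<open>Triviality of Tor provides the exact upper row and membership in the class provides the
  column cokernels. Both rows have the same length k, so the bound n - 1 passes to the coresolution
  of Q.\<close>

lemma class_P_coresolution:
  assumes C: "module_class A \<U> \<C>" and E: "module_class B \<U> \<E>" and X: "X \<in> cores_class \<Lambda> \<U> (n - 1) (class_P A U B \<U> \<C> \<E>)"
    and tor: "\<And>C j. C \<in> \<C> \<Longrightarrow> 1 \<le> j \<Longrightarrow> j \<le> n + 1 \<Longrightarrow> trivial_group (Tor A \<U> j U C)"
  obtains Q q where "Q \<in> cores_class B \<U> (n - 1) \<E>" "short_exact B (tensor_module A U (comp\<^sub>1 X)) (phi X) (comp\<^sub>2 X) q Q"
proof -
  obtain k L d e where L: "X \<in> RMod \<Lambda> \<U>" "k \<le> n - 1" "coresolution \<Lambda> X e L d" "\<And>i. i \<le> k \<Longrightarrow> L i \<in> class_P A U B \<U> \<C> \<E>"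
    "\<And>i. i > k \<Longrightarrow> L i \<in> RMod \<Lambda> \<U> \<and> carrier (L i) = {\<zero>\<^bsub>L i\<^esub>}"
    using X unfolding cores_class_def by blast
  note PD = class_PD[OF C E L(4)]
  have LR: "L i \<in> RMod \<Lambda> \<U>" for i using PD(1) L(5) by (cases "i \<le> k") auto
  have l: "lmodule \<Lambda> (L i)" "lmodule \<Lambda> X" for i using LR L(1) by (auto simp: RMod_def)
  note l1 = lmodule_cor[OF nuhom_tri(1) l(1)] and l2 = lmodule_cor[OF nuhom_tri(2) l(1)]
  have "\<exists>E p. E \<in> RMod B \<U> \<and> (i \<le> k \<longrightarrow> E \<in> \<E>) \<and> (i > k \<longrightarrow> carrier E = {\<zero>\<^bsub>E\<^esub>}) \<and>
    short_exact B (tensor_module A U (comp\<^sub>1 (L i))) (phi (L i)) (comp\<^sub>2 (L i)) p E" for i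
  proof (cases "i \<le> k")
    case True
    then show ?thesis using PD(4)[OF True] module_classD(1)[OF E] by auto
  next
    case False
    then have z: "carrier (L i) = {\<zero>\<^bsub>L i\<^esub>}" using L(5) by auto
    note z1 = cor_zero[OF nuhom_tri(1) l(1) z] and z2 = cor_zero[OF nuhom_tri(2) l(1) z]
    \<comment> \<open>Beyond k everything is zero, so the second component itself serves as the
      cokernel.\<close>
    have "short_exact B (tensor_module A U (comp\<^sub>1 (L i))) (phi (L i)) (comp\<^sub>2 (L i)) (\<lambda>x\<in>carrier (comp\<^sub>2 (L i)). x) (comp\<^sub>2 (L i))"
    proof (rule short_exactI[OF phi(1)[OF l(1)] Hom_id[OF l2]])
      interpret T: lmodule B "tensor_module A U (comp\<^sub>1 (L i))" by (rule lmodule_tensor[OF l1])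
      show "inj_on (phi (L i)) (carrier (tensor_module A U (comp\<^sub>1 (L i))))"
        using trivial_tensor[OF l1 z1] by (metis inj_onI)
      show "(\<lambda>x\<in>carrier (comp\<^sub>2 (L i)). x) (phi (L i) t) = \<zero>\<^bsub>comp\<^sub>2 (L i)\<^esub>" if "t \<in> carrier (tensor_module A U (comp\<^sub>1 (L i)))" for t
        using HomE(2)[OF phi(1)[OF l(1)] that] z2 by (simp del: cor_simps)
      show "\<exists>t\<in>carrier (tensor_module A U (comp\<^sub>1 (L i))). y = phi (L i) t" if "y \<in> carrier (comp\<^sub>2 (L i))" for y
        using that z2 Hom_zero[OF T.lmodule_axioms l2 phi(1)[OF l(1)]] T.M.zero_closed by (metis singletonD)
    qed (simp del: cor_simps)
    then show ?thesis using z2 False RMod_cor[OF nuhom_tri(2) LR] by blast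
  qed
  then obtain E' p where Ep: "\<And>i. E' i \<in> RMod B \<U>" "\<And>i. i \<le> k \<Longrightarrow> E' i \<in> \<E>" "\<And>i. i > k \<Longrightarrow> carrier (E' i) = {\<zero>\<^bsub>E' i\<^esub>}"
    "\<And>i. short_exact B (tensor_module A U (comp\<^sub>1 (L i))) (phi (L i)) (comp\<^sub>2 (L i)) (p i) (E' i)" by metis
  have "tor_vanish m (comp\<^sub>1 (L i))" if "i \<le> k" "m \<le> k" for i m
  proof (rule Tor_trivial_imp_tor_vanish[OF RMod_cor[OF nuhom_tri(1) LR]])
    show "trivial_group (Tor A \<U> j U (comp\<^sub>1 (L i)))" if "1 \<le> j" "j \<le> n + 1" for j
      using tor[OF PD(3)[OF \<open>i \<le> k\<close>] that] .
    show "m \<le> n + 1" using that L(2) by simp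
  qed
  then have tv: "\<forall>i\<le>k. \<forall>m\<le>k. tor_vanish m (comp\<^sub>1 (L i))" by blast
  have z: "\<forall>i>k. carrier (comp\<^sub>1 (L i)) = {\<zero>\<^bsub>comp\<^sub>1 (L i)\<^esub>}"
    using cor_zero[OF nuhom_tri(1) l(1)] L(5) by blast
  note tc = tensor_coresolution[OF cor_coresolution[OF nuhom_tri(1) l L(3)] RMod_cor[OF nuhom_tri(1) L(1)] RMod_cor[OF nuhom_tri(1) LR] tv z]
  obtain Q q h \<delta> where Q: "Q \<in> RMod B \<U>" "short_exact B (tensor_module A U (comp\<^sub>1 X)) (phi X) (comp\<^sub>2 X) q Q"
    "coresolution B Q h E' \<delta>"
    using cokernel_coresolution[OF L(3,1) LR Ep(1,4) tc] by metis
  have "Q \<in> cores_class B \<U> (n - 1) \<E>"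
    unfolding cores_class_def mem_Collect_eq
    by (intro conjI exI[of _ k] exI allI impI, rule Q(1), rule L(2), rule Q(3)) (use Ep in auto)
  then show thesis using that Q(2) by blast
qed

section \<open>Isomorphisms induced by tensoring and by zero end terms\<close>

lemma tensor_isos:
  assumes M: "lmodule A M" and N: "lmodule A N" and i: "isos A M N f g"
  shows "mod_iso B (tensor_module A U M) (tensor_module A U N)"
proof -
  note i = isosD[OF i]
  have a: "tensor_map A U M g (tensor_map A U N f t) = t" if "t \<in> carrier (tensor_module A U M)" for t
    using tensor_map_compose[OF M N M i(1,2) Hom_id[OF M] _ that] tensor_map_id[OF M Hom_id[OF M] _ that] i(3) by simp
  have b: "tensor_map A U N f (tensor_map A U M g t) = t" if "t \<in> carrier (tensor_module A U N)" for t
    using tensor_map_compose[OF N M N i(2,1) Hom_id[OF N] _ that] tensor_map_id[OF N Hom_id[OF N] _ that] i(4) by simp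
  have "isos B (tensor_module A U M) (tensor_module A U N) (restrict (tensor_map A U N f) (carrier (tensor_module A U M)))
    (restrict (tensor_map A U M g) (carrier (tensor_module A U N)))"
    using tensor_map_Hom[OF M N i(1)] tensor_map_Hom[OF N M i(2)] a b tensor_map(1)[OF M N i(1)] tensor_map(1)[OF N M i(2)]
    by (simp add: isos_def)
  then show ?thesis by (rule isos_imp_mod_iso)
qed

lemma short_exact_zero_left:
  assumes "lmodule R L" "lmodule R M" "lmodule R N" "short_exact R L f M g N" "carrier L = {\<zero>\<^bsub>L\<^esub>}"
  obtains h k where "isos R M N h k"
proof -
  note e = short_exactD[OF assms(4)]
  have "inj_on g (carrier M)"
    using e(5) assms(5) Hom_zero[OF assms(1,2) e(1)] by (intro Hom_inj_onI[OF assms(2,3) e(2)]) auto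
  then have "bij_betw g (carrier M) (carrier N)" using assms(4) by (simp add: bij_betw_def short_exact_def)
  then show thesis using bij_Hom_isos[OF assms(2,3) e(2)] that by blast
qed

lemma short_exact_zero_right:
  assumes "lmodule R L" "lmodule R M" "short_exact R L f M g N" "carrier N = {\<zero>\<^bsub>N\<^esub>}"
  obtains h k where "isos R L M h k"
proof -
  note e = short_exactD[OF assms(3)]
  have "y \<in> f ` carrier L" if "y \<in> carrier M" for y
    using e(5)[OF that] HomE(2)[OF e(2) that] assms(4) by auto
  then have "bij_betw f (carrier L) (carrier M)" using e(3) HomE(2)[OF e(1)] by (auto simp: bij_betw_def)
  then show thesis using bij_Hom_isos[OF assms(1,2) e(1)] that by blast
qed

lemma comp_emb_zero:
  shows "lmodule B N \<Longrightarrow> carrier (comp\<^sub>1 (emb\<^sub>2 N)) = {\<zero>\<^bsub>comp\<^sub>1 (emb\<^sub>2 N)\<^esub>}"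
    and "lmodule A M \<Longrightarrow> carrier (comp\<^sub>2 (emb\<^sub>1 M)) = {\<zero>\<^bsub>comp\<^sub>2 (emb\<^sub>1 M)\<^esub>}"
proof -
  assume N: "lmodule B N"
  interpret N: lmodule B N by fact
  have "x \<in> carrier (comp\<^sub>1 (emb\<^sub>2 N)) \<longleftrightarrow> x = \<zero>\<^bsub>N\<^esub>" for x
    by (auto simp: inc_A_def N.smult_zero_left N.smult_one)
  then show "carrier (comp\<^sub>1 (emb\<^sub>2 N)) = {\<zero>\<^bsub>comp\<^sub>1 (emb\<^sub>2 N)\<^esub>}" unfolding cor_simps(2) set_eq_iff singleton_iff by blast
next
  assume M: "lmodule A M"
  interpret M: lmodule A M by fact
  have "x \<in> carrier (comp\<^sub>2 (emb\<^sub>1 M)) \<longleftrightarrow> x = \<zero>\<^bsub>M\<^esub>" for x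
    by (auto simp: inc_B_def M.smult_zero_left M.smult_one)
  then show "carrier (comp\<^sub>2 (emb\<^sub>1 M)) = {\<zero>\<^bsub>comp\<^sub>2 (emb\<^sub>1 M)\<^esub>}" unfolding cor_simps(2) set_eq_iff singleton_iff by blast
qed

text \<open>A cochain is lifted along g, its defect on boundaries is pulled back to K, solved there
  and subtracted. These are two pieces of the long exact sequence of Ext(U, -), written on cochains
  over a fixed resolution; \<open>ext_vanish\<close> in degree j stands for Ext in degree j +
  1.\<close>

lemma ext_vanish_lift:
  assumes P: "proj_resolution B \<U> P d \<epsilon> U" and R: "K \<in> RMod B \<U>" "F \<in> RMod B \<U>" "N \<in> RMod B \<U>"
    and ses: "short_exact B K f F g N"
  shows "ext_vanish B P d K 0 \<Longrightarrow> h \<in> Hom B U N \<Longrightarrow> \<exists>h'\<in>Hom B U F. \<forall>u\<in>carrier U. h u = g (h' u)"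
    and "ext_vanish B P d F j \<Longrightarrow> ext_vanish B P d K (Suc j) \<Longrightarrow> ext_vanish B P d N j"
proof -
  have pr: "projective B \<U> (P i)" for i using P by (simp add: proj_resolution_def)
  note lP = projectiveD[OF pr] and p = resolutionD[OF P[unfolded proj_resolution_def, THEN conjunct1]]
  have l: "lmodule B K" "lmodule B F" "lmodule B N" "lmodule B U" using R lmodule_axioms by (auto simp: RMod_def)
  note e = short_exactD[OF ses]
  have lift: "\<exists>v'\<in>Hom B (P i) F. \<forall>x\<in>carrier (P i). v x = g (v' x)" if v: "v \<in> Hom B (P i) N" for i v
    using projective_lift[OF pr R(3,2) v e(2)] e(6)[OF HomE(2)[OF v]] by metis
  have pull: "\<exists>w\<in>Hom B (P i) K. \<forall>x\<in>carrier (P i). v x = f (w x)"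
    if v: "v \<in> Hom B (P i) F" "\<And>x. x \<in> carrier (P i) \<Longrightarrow> g (v x) = \<zero>\<^bsub>N\<^esub>" for i v
  proof -
    have "v ` carrier (P i) \<subseteq> f ` carrier K" using e(5)[OF HomE(2)[OF v(1)] v(2)] by blast
    then show ?thesis using factor_through_kernel[OF lP(2) l(1,2) e(1,3) v(1)] by metis
  qed
  have fz: "x = \<zero>\<^bsub>K\<^esub>" if "x \<in> carrier K" "f x = \<zero>\<^bsub>F\<^esub>" for x using Hom_inj_onD[OF l(1,2) e(1,3) that] .
  interpret F: lmodule B F by (rule l)
  show "\<exists>h'\<in>Hom B U F. \<forall>u\<in>carrier U. h u = g (h' u)" if van: "ext_vanish B P d K 0" and h: "h \<in> Hom B U N"
  proof -
    note h\<epsilon> = Hom_compose[OF lP(2) p(1) h]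
    obtain v where v: "v \<in> Hom B (P 0) F" "\<And>x. x \<in> carrier (P 0) \<Longrightarrow> h (\<epsilon> x) = g (v x)"
      using lift[OF h\<epsilon>] by (metis compose_eq)
    note vd = Hom_compose[OF lP(2) p(2) v(1)]
    have "g (compose (carrier (P (Suc 0))) v (d 0) x) = \<zero>\<^bsub>N\<^esub>" if x: "x \<in> carrier (P (Suc 0))" for x
      using v(2)[OF HomE(2)[OF p(2) x]] p(4)[OF x] Hom_zero[OF l(4,3) h] x by (simp add: compose_eq)
    then obtain w where w: "w \<in> Hom B (P (Suc 0)) K" "\<And>x. x \<in> carrier (P (Suc 0)) \<Longrightarrow> v (d 0 x) = f (w x)"
      using pull[OF vd] by (metis compose_eq)
    have "w (d (Suc 0) x) = \<zero>\<^bsub>K\<^esub>" if x: "x \<in> carrier (P (Suc (Suc 0)))" for x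
      using w(2)[OF HomE(2)[OF p(2) x]] p(6)[OF x] Hom_zero[OF lP(2) l(2) v(1)] by (intro fz HomE(2)[OF w(1)] HomE(2)[OF p(2) x]) simp
    then obtain y where y: "y \<in> Hom B (P 0) K" "\<And>x. x \<in> carrier (P (Suc 0)) \<Longrightarrow> w x = y (d 0 x)"
      using ext_vanishD[OF van w(1)] by metis
    note fy = Hom_compose[OF lP(2) y(1) e(1)]
    \<comment> \<open>On boundaries v takes the values of f y, so the difference vanishes on the
      kernel of \<epsilon> and descends to U; applying g does not notice the correction, as g f =
      0.\<close>
    let ?v = "\<lambda>x\<in>carrier (P 0). v x \<ominus>\<^bsub>F\<^esub> compose (carrier (P 0)) f y x"
    note v' = Hom_diff[OF lP(2) l(2) v(1) fy]
    have sur: "\<epsilon> ` carrier (P 0) = carrier U" using P by (simp add: proj_resolution_def resolution_def)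
    obtain h' where h': "h' \<in> Hom B U F" "\<And>x. x \<in> carrier (P 0) \<Longrightarrow> h' (\<epsilon> x) = ?v x"
    proof (rule factor_through_cokernel[OF lP(2) l(4,2) p(1) sur v'])
      fix x assume "x \<in> carrier (P 0)" "\<epsilon> x = \<zero>\<^bsub>U\<^esub>"
      then obtain x' where x': "x' \<in> carrier (P (Suc 0))" "x = d 0 x'" using p(5) by blast
      then show "?v x = \<zero>\<^bsub>F\<^esub>"
        using w(2)[OF x'(1)] y(2)[OF x'(1)] HomE(2)[OF p(2) x'(1)] HomE(2)[OF v(1) HomE(2)[OF p(2) x'(1)]]
        by (simp add: compose_eq F.M.minus_self)
    qed blast
    have "h u = g (h' u)" if u: "u \<in> carrier U" for u
    proof -
      obtain x where x: "x \<in> carrier (P 0)" "u = \<epsilon> x" using p(3)[OF u] by blast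
      have c: "v x \<in> carrier F" "f (y x) \<in> carrier F" "y x \<in> carrier K"
        using HomE(2)[OF v(1) x(1)] HomE(2)[OF e(1) HomE(2)[OF y(1) x(1)]] HomE(2)[OF y(1) x(1)] .
      have "g (h' u) = g (v x) \<ominus>\<^bsub>N\<^esub> g (f (y x))"
        using h'(2)[OF x(1)] x c by (simp add: compose_eq Hom_minus[OF l(2,3) e(2)])
      then show ?thesis
        using e(4)[OF c(3)] v(2)[OF x(1)] x(2) HomE(2)[OF e(2) c(1)] abelian_group.zero_minus[OF lmodule_imp_abelian_group[OF l(3)]] by simp
    qed
    then show ?thesis using h'(1) by blast
  qed
  show "ext_vanish B P d N j" if vF: "ext_vanish B P d F j" and vK: "ext_vanish B P d K (Suc j)"
    unfolding ext_vanish_def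
  proof (intro ballI impI)
    fix c assume c: "c \<in> Hom B (P (Suc j)) N" and z: "\<forall>x\<in>carrier (P (Suc (Suc j))). c (d (Suc j) x) = \<zero>\<^bsub>N\<^esub>"
    obtain v where v: "v \<in> Hom B (P (Suc j)) F" "\<And>x. x \<in> carrier (P (Suc j)) \<Longrightarrow> c x = g (v x)" using lift[OF c] by metis
    note vd = Hom_compose[OF lP(2) p(2) v(1)]
    have "g (compose (carrier (P (Suc (Suc j)))) v (d (Suc j)) x) = \<zero>\<^bsub>N\<^esub>" if x: "x \<in> carrier (P (Suc (Suc j)))" for x
      using v(2)[OF HomE(2)[OF p(2) x]] z x by (simp add: compose_eq)
    then obtain w where w: "w \<in> Hom B (P (Suc (Suc j))) K" "\<And>x. x \<in> carrier (P (Suc (Suc j))) \<Longrightarrow> v (d (Suc j) x) = f (w x)"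
      using pull[OF vd] by (metis compose_eq)
    have "w (d (Suc (Suc j)) x) = \<zero>\<^bsub>K\<^esub>" if x: "x \<in> carrier (P (Suc (Suc (Suc j))))" for x
      using w(2)[OF HomE(2)[OF p(2) x]] p(6)[OF x] Hom_zero[OF lP(2) l(2) v(1)] by (intro fz HomE(2)[OF w(1)] HomE(2)[OF p(2) x]) simp
    then obtain y where y: "y \<in> Hom B (P (Suc j)) K" "\<And>x. x \<in> carrier (P (Suc (Suc j))) \<Longrightarrow> w x = y (d (Suc j) x)"
      using ext_vanishD[OF vK w(1)] by metis
    note fy = Hom_compose[OF lP(2) y(1) e(1)]
    \<comment> \<open>The same correction one degree further: the difference is a cocycle in F that
      still lifts c.\<close>
    let ?v = "\<lambda>x\<in>carrier (P (Suc j)). v x \<ominus>\<^bsub>F\<^esub> compose (carrier (P (Suc j))) f y x"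
    note v' = Hom_diff[OF lP(2) l(2) v(1) fy]
    have vz: "?v (d (Suc j) x) = \<zero>\<^bsub>F\<^esub>" if x: "x \<in> carrier (P (Suc (Suc j)))" for x
      using w(2)[OF x] y(2)[OF x] HomE(2)[OF p(2) x] HomE(2)[OF v(1) HomE(2)[OF p(2) x]] by (simp add: compose_eq F.M.minus_self)
    obtain b where b: "b \<in> Hom B (P j) F" "\<And>x. x \<in> carrier (P (Suc j)) \<Longrightarrow> ?v x = b (d j x)"
      by (rule ext_vanishD[OF vF v' vz]) (assumption, (rule that; assumption))
    have "c x = compose (carrier (P j)) g b (d j x)" if x: "x \<in> carrier (P (Suc j))" for x
    proof -
      have m: "v x \<in> carrier F" "f (y x) \<in> carrier F" "y x \<in> carrier K"
        using HomE(2)[OF v(1) x] HomE(2)[OF e(1) HomE(2)[OF y(1) x]] HomE(2)[OF y(1) x] .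
      have "g (b (d j x)) = g (v x) \<ominus>\<^bsub>N\<^esub> g (f (y x))"
        using b(2)[OF x] x m by (simp add: compose_eq Hom_minus[OF l(2,3) e(2)] flip: b(2)[OF x])
      then show ?thesis
        using e(4)[OF m(3)] v(2)[OF x] HomE(2)[OF p(2) x] HomE(2)[OF e(2) m(1)]
          abelian_group.zero_minus[OF lmodule_imp_abelian_group[OF l(3)]] by (simp add: compose_eq)
    qed
    then show "\<exists>g\<in>Hom B (P j) N. \<forall>x\<in>carrier (P (Suc j)). c x = g (d j x)" using Hom_compose[OF lP(2) b(1) e(2)] by blast
  qed
qed

lemma ext_vanish_trivial:
  assumes P: "\<And>i. lmodule B (P i)" and K: "lmodule B K" "carrier K = {\<zero>\<^bsub>K\<^esub>}" and d: "\<And>i. d i \<in> Hom B (P (Suc i)) (P i)"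
  shows "ext_vanish B P d K j"
  unfolding ext_vanish_def
proof (intro ballI impI)
  fix f assume f: "f \<in> Hom B (P (Suc j)) K"
  show "\<exists>g\<in>Hom B (P j) K. \<forall>x\<in>carrier (P (Suc j)). f x = g (d j x)"
    using Hom_const_zero[OF P K(1)] HomE(2)[OF f] K(2) HomE(2)[OF d] by (intro bexI[of _ "\<lambda>x\<in>carrier (P j). \<zero>\<^bsub>K\<^esub>"]) auto
qed

text \<open>Counterpart of \<open>tensor_coresolution\<close>: Hom(U, -) keeps the resolution exact
  because Ext of degree 1 vanishes on every image K i. That vanishing is again propagated from the
  zero tail.\<close>

lemma hom_resolution:
  assumes c: "resolution B F d e N" and N: "N \<in> RMod B \<U>" and F: "\<And>i. F i \<in> RMod B \<U>"
    and van: "\<forall>i\<le>k. \<forall>j\<le>k. trivial_group (Ext B \<U> (Suc j) U (F i))" and zero: "\<forall>i>k. carrier (F i) = {\<zero>\<^bsub>F i\<^esub>}"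
  shows "h \<in> Hom B U N \<Longrightarrow> \<exists>h'\<in>Hom B U (F 0). \<forall>u\<in>carrier U. h u = e (h' u)"
    and "\<lbrakk>h \<in> Hom B U (F 0); \<And>u. u \<in> carrier U \<Longrightarrow> e (h u) = \<zero>\<^bsub>N\<^esub>\<rbrakk> \<Longrightarrow>
      \<exists>h'\<in>Hom B U (F (Suc 0)). \<forall>u\<in>carrier U. h u = d 0 (h' u)"
    and "\<lbrakk>h \<in> Hom B U (F (Suc i)); \<And>u. u \<in> carrier U \<Longrightarrow> d i (h u) = \<zero>\<^bsub>F i\<^esub>\<rbrakk> \<Longrightarrow>
      \<exists>h'\<in>Hom B U (F (Suc (Suc i))). \<forall>u\<in>carrier U. h u = d (Suc i) (h' u)"
proof -
  note van = van[rule_format] and zero = zero[rule_format] and p = resolutionD[OF c]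
  have l: "lmodule B N" "lmodule B (F i)" for i using N F by (auto simp: RMod_def)
  \<comment> \<open>U has its own element type, so the resolution inside \<open>Ext\<close> is kept;
    it is the same for all second arguments, which the dimension shift relies on.\<close>
  obtain P dP \<epsilon> where P: "proj_resolution B \<U> P dP \<epsilon> U"
    "\<And>(Y :: ('b, 'm) module) j. lmodule B Y \<Longrightarrow> trivial_group (Ext B \<U> (Suc j) U Y) \<longleftrightarrow> ext_vanish B P dP Y j"
    using Ext_trivial_iff_SOME[of B \<U> U] projective_resolution_exists[OF lmodule_axioms small_index[OF powers_U] small_rings(2)] by metis
  have lP: "lmodule B (P i)" for i using P(1) projectiveD(2)[of B \<U> "P i"] by (simp add: proj_resolution_def)
  note rP = resolutionD[OF P(1)[unfolded proj_resolution_def, THEN conjunct1]]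
  define S where "S i = d i ` carrier (F (Suc i))" for i
  define K where "K i = (F i)\<lparr>carrier := S i\<rparr>" for i
  have s: "submod B (F i) (S i)" for i unfolding S_def by (rule submod_image[OF l(2) l(2) p(2)])
  have K: "K i \<in> RMod B \<U>" "lmodule B (K i)" for i
    unfolding K_def by (rule RMod_submod[OF F s], rule lmodule_submod[OF l(2) s])
  let ?i = "\<lambda>i. \<lambda>x\<in>S i. x"
  have inc: "?i i \<in> Hom B (K i) (F i)" for i unfolding K_def by (rule Hom_submod_inclusion[OF l(2) s])
  have dK: "d i \<in> Hom B (F (Suc i)) (K i)" for i unfolding K_def S_def by (rule Hom_submod_codomain[OF p(2)]) simp
  have cK: "carrier (K i) = S i" "\<zero>\<^bsub>K i\<^esub> = \<zero>\<^bsub>F i\<^esub>" for i by (simp_all add: K_def)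
  have S0: "x \<in> S 0" if "x \<in> carrier (F 0)" "e x = \<zero>\<^bsub>N\<^esub>" for x using p(5)[OF that] unfolding S_def by blast
  have SS: "x \<in> S (Suc i)" if "x \<in> carrier (F (Suc i))" "d i x = \<zero>\<^bsub>F i\<^esub>" for i x using p(7)[OF that] unfolding S_def by blast
  have e0: "short_exact B (K 0) (?i 0) (F 0) e N"
  proof (rule short_exactI[OF inc p(1)])
    show "\<exists>x\<in>carrier (K 0). y = ?i 0 x" if "y \<in> carrier (F 0)" "e y = \<zero>\<^bsub>N\<^esub>" for y
      using S0[OF that] by (auto simp: cK)
  qed (use p(3,4) in \<open>auto simp: cK S_def inj_on_def\<close>)
  have eS: "short_exact B (K (Suc i)) (?i (Suc i)) (F (Suc i)) (d i) (K i)" for i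
  proof (rule short_exactI[OF inc dK])
    show "\<exists>x\<in>carrier (K (Suc i)). y = ?i (Suc i) x" if "y \<in> carrier (F (Suc i))" "d i y = \<zero>\<^bsub>K i\<^esub>" for y
      using SS[of y i] that by (auto simp: cK)
  qed (use p(6) in \<open>auto simp: cK S_def inj_on_def\<close>)
  have Kz: "ext_vanish B P dP (K i) j" if "k \<le> i" for i j
  proof (rule ext_vanish_trivial)
    show "lmodule B (P i)" "lmodule B (K j)" "dP i \<in> Hom B (P (Suc i)) (P i)" for i j by (rule lP, rule K(2), rule rP(2))
    have "S i = {d i \<zero>\<^bsub>F (Suc i)\<^esub>}" using zero[of "Suc i"] that by (simp add: S_def)
    then show "carrier (K i) = {\<zero>\<^bsub>K i\<^esub>}" unfolding cK using Hom_zero[OF l(2) l(2) p(2)] by simp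
  qed
  \<comment> \<open>In the sequence K (i + 1), F (i + 1), K i a vanishing degree j + 1 on the left
    and j in the middle give degree j on the right. Starting from the zero tail with all degrees,
    degree 0 is left for every K i.\<close>
  have claim: "\<forall>j. j + r \<le> Suc k \<longrightarrow> ext_vanish B P dP (K (k - r)) j" if "r \<le> k" for r
    using that
  proof (induction r)
    case 0 then show ?case using Kz by simp
  next
    case (Suc r)
    have eq: "Suc (k - Suc r) = k - r" using Suc.prems by simp
    show ?case
    proof (intro allI impI)
      fix j assume j: "j + Suc r \<le> Suc k"
      have "\<forall>j. j + r \<le> Suc k \<longrightarrow> ext_vanish B P dP (K (k - r)) j" using Suc by simp
      then have "ext_vanish B P dP (K (k - r)) (Suc j)" using j by (elim allE[of _ "Suc j"]) simp
      moreover have "ext_vanish B P dP (F (k - r)) j" using P(2)[OF l(2)] van[of "k - r" j] j by simp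
      ultimately show "ext_vanish B P dP (K (k - Suc r)) j"
        using ext_vanish_lift(2)[OF P(1) K(1) F K(1) eS[of "k - Suc r"]] unfolding eq by blast
    qed
  qed
  have v0: "ext_vanish B P dP (K i) 0" for i
  proof (cases "k \<le> i")
    case False
    then show ?thesis using claim[of "k - i"] by simp
  qed (rule Kz)
  show "\<exists>h'\<in>Hom B U (F 0). \<forall>u\<in>carrier U. h u = e (h' u)" if "h \<in> Hom B U N"
    by (rule ext_vanish_lift(1)[OF P(1) K(1) F N e0 v0 that])
  have step: "\<exists>h'\<in>Hom B U (F (Suc i)). \<forall>u\<in>carrier U. h u = d i (h' u)"
    if "h \<in> Hom B U (F i)" "\<And>u. u \<in> carrier U \<Longrightarrow> h u \<in> S i" for h i
    using ext_vanish_lift(1)[OF P(1) K(1) F K(1) eS v0, of h] Hom_submod_codomain[OF that(1), of "S i"] that(2) unfolding K_def by blast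
  show "\<exists>h'\<in>Hom B U (F (Suc 0)). \<forall>u\<in>carrier U. h u = d 0 (h' u)"
    if "h \<in> Hom B U (F 0)" "\<And>u. u \<in> carrier U \<Longrightarrow> e (h u) = \<zero>\<^bsub>N\<^esub>"
    using step[OF that(1)] S0[OF HomE(2)[OF that(1)] that(2)] by blast
  show "\<exists>h'\<in>Hom B U (F (Suc (Suc i))). \<forall>u\<in>carrier U. h u = d (Suc i) (h' u)"
    if "h \<in> Hom B U (F (Suc i))" "\<And>u. u \<in> carrier U \<Longrightarrow> d i (h u) = \<zero>\<^bsub>F i\<^esub>"
    using step[OF that(1)] SS[OF HomE(2)[OF that(1)] that(2)] by blast
qed

section \<open>The adjoint map of a module over \<Lambda> and its kernel along a resolution\<close>

definition adj :: "('a \<times> 'u \<times> 'b, 'm) module \<Rightarrow> 'm \<Rightarrow> 'u \<Rightarrow> 'm"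
  where "adj L = (\<lambda>x\<in>carrier (comp\<^sub>1 L). \<lambda>u\<in>carrier U. act L u x)"

text \<open>The kernel of \<open>adj L\<close>, see \<open>adj_Hom\<close>, spelled out so that it
  matches the conclusion of \<open>class_ID\<close> literally.\<close>

definition adj_kernel :: "('a \<times> 'u \<times> 'b, 'm) module \<Rightarrow> 'm set"
  where "adj_kernel L = {x \<in> carrier (comp\<^sub>1 L). \<forall>u\<in>carrier U. act L u x = \<zero>\<^bsub>L\<^esub>}"

lemma adj_Hom:
  assumes L: "lmodule \<Lambda> L"
  shows "adj L \<in> Hom A (comp\<^sub>1 L) (hom_module B U (comp\<^sub>2 L))"
    and "x \<in> carrier (comp\<^sub>1 L) \<Longrightarrow> adj L x \<in> Hom B U (comp\<^sub>2 L)"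
    and "a_kernel (comp\<^sub>1 L) (hom_module B U (comp\<^sub>2 L)) (adj L) = adj_kernel L"
    and "submod A (comp\<^sub>1 L) (adj_kernel L)"
proof -
  note a = act[OF L] and l1 = lmodule_cor[OF nuhom_tri(1) L] and l2 = lmodule_cor[OF nuhom_tri(2) L]
  interpret c1: lmodule A "comp\<^sub>1 L" by (rule l1)
  show m: "adj L x \<in> Hom B U (comp\<^sub>2 L)" if x: "x \<in> carrier (comp\<^sub>1 L)" for x
  proof -
    have "restrict (\<lambda>u. act L u x) (carrier U) \<in> Hom B U (comp\<^sub>2 L)"
      using x a(1,2,5) by (intro HomI[OF lmodule_axioms]) auto
    then show ?thesis using x by (simp add: adj_def)
  qed
  have "restrict (\<lambda>x. \<lambda>u\<in>carrier U. act L u x) (carrier (comp\<^sub>1 L)) \<in> Hom A (comp\<^sub>1 L) (hom_module B U (comp\<^sub>2 L))"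
  proof (rule HomI[OF l1])
    fix x assume x: "x \<in> carrier (comp\<^sub>1 L)"
    show "(\<lambda>u\<in>carrier U. act L u x) \<in> carrier (hom_module B U (comp\<^sub>2 L))" using m[OF x] x by (simp add: adj_def hom_module_simps)
    show "(\<lambda>u\<in>carrier U. act L u (a \<odot>\<^bsub>comp\<^sub>1 L\<^esub> x)) = a \<odot>\<^bsub>hom_module B U (comp\<^sub>2 L)\<^esub> (\<lambda>u\<in>carrier U. act L u x)" if "a \<in> carrier A" for a
      using that x a(4)[of _ a x] rsmult_closed by (auto simp: hom_module_simps intro!: restrict_ext)
    fix y assume "y \<in> carrier (comp\<^sub>1 L)"
    then show "(\<lambda>u\<in>carrier U. act L u (x \<oplus>\<^bsub>comp\<^sub>1 L\<^esub> y)) =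
        (\<lambda>u\<in>carrier U. act L u x) \<oplus>\<^bsub>hom_module B U (comp\<^sub>2 L)\<^esub> (\<lambda>u\<in>carrier U. act L u y)"
      using x a(3)[of _ x y] by (auto simp: hom_module_simps intro!: restrict_ext)
  qed
  then show H: "adj L \<in> Hom A (comp\<^sub>1 L) (hom_module B U (comp\<^sub>2 L))" by (simp add: adj_def)
  show K: "a_kernel (comp\<^sub>1 L) (hom_module B U (comp\<^sub>2 L)) (adj L) = adj_kernel L"
  proof -
    have "adj L x = \<zero>\<^bsub>hom_module B U (comp\<^sub>2 L)\<^esub> \<longleftrightarrow> (\<forall>u\<in>carrier U. act L u x = \<zero>\<^bsub>L\<^esub>)" if x: "x \<in> carrier (comp\<^sub>1 L)" for x
      using x unfolding adj_def hom_module_simps restrict_apply'[OF x] by (auto intro!: restrict_ext dest: fun_cong simp: restrict_def) (metis)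
    then show ?thesis unfolding set_eq_iff a_kernel_iff adj_kernel_def mem_Collect_eq by blast
  qed
  show "submod A (comp\<^sub>1 L) (adj_kernel L)"
    using submod_kernel[OF l1 lmodule_hom_module[OF l2] H] by (simp add: K)
qed

text \<open>The adjoint maps compare the row of first components with the row of Hom(U, -) of the
  second components, which \<open>hom_resolution\<close> keeps exact. A preimage of a kernel element
  is corrected by a boundary until it lies in a kernel itself. For Y the adjoint is onto because a
  map into its second component lifts to L 0 and is realised there.\<close>

lemma adj_kernel_resolution:
  assumes c: "resolution \<Lambda> L d e Y" and Y: "Y \<in> RMod \<Lambda> \<U>" and L: "\<And>i. L i \<in> RMod \<Lambda> \<U>"
    and adj: "\<forall>i. \<forall>h\<in>Hom B U (comp\<^sub>2 (L i)). \<exists>x\<in>carrier (comp\<^sub>1 (L i)). \<forall>u\<in>carrier U. h u = act (L i) u x"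
    and van: "\<forall>i\<le>k. \<forall>j\<le>k. trivial_group (Ext B \<U> (Suc j) U (comp\<^sub>2 (L i)))"
    and zero: "\<forall>i>k. carrier (L i) = {\<zero>\<^bsub>L i\<^esub>}"
  shows "adj Y ` carrier (comp\<^sub>1 Y) = carrier (hom_module B U (comp\<^sub>2 Y))"
    and "resolution A (\<lambda>i. (comp\<^sub>1 (L i))\<lparr>carrier := adj_kernel (L i)\<rparr>) (\<lambda>i. restrict (d i) (adj_kernel (L (Suc i))))
      (restrict e (adj_kernel (L 0))) ((comp\<^sub>1 Y)\<lparr>carrier := adj_kernel Y\<rparr>)"
proof -
  have l: "lmodule \<Lambda> Y" "lmodule \<Lambda> (L i)" for i using Y L by (auto simp: RMod_def)
  note l1 = lmodule_cor[OF nuhom_tri(1) l(1)] lmodule_cor[OF nuhom_tri(1) l(2)]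
    and l2 = lmodule_cor[OF nuhom_tri(2) l(1)] lmodule_cor[OF nuhom_tri(2) l(2)]
  note adj = adj[rule_format]
  note cr = resolutionD[OF c]
  define e1 where "e1 = restrict e (carrier (comp\<^sub>1 (L 0)))"
  define d1 where "d1 i = restrict (d i) (carrier (comp\<^sub>1 (L (Suc i))))" for i
  have c1: "resolution A (\<lambda>i. comp\<^sub>1 (L i)) d1 e1 (comp\<^sub>1 Y)"
    unfolding e1_def d1_def by (rule cor_resolution[OF nuhom_tri(1) l(2) c])
  note r = resolutionD[OF c1]
  have zero2: "\<forall>i>k. carrier (comp\<^sub>2 (L i)) = {\<zero>\<^bsub>comp\<^sub>2 (L i)\<^esub>}"
    using cor_zero[OF nuhom_tri(2) l(2)] zero by blast
  note hr = hom_resolution[OF cor_resolution[OF nuhom_tri(2) l(2) c] RMod_cor[OF nuhom_tri(2) Y] RMod_cor[OF nuhom_tri(2) L] van zero2]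
  have um: "(\<zero>\<^bsub>A\<^esub>, u, \<zero>\<^bsub>B\<^esub>) \<in> carrier \<Lambda>" if "u \<in> carrier U" for u using that by simp
  have ac: "act (L i) u x \<in> carrier (comp\<^sub>2 (L i))" if "u \<in> carrier U" "x \<in> carrier (comp\<^sub>1 (L i))" for i u x
    using act(1)[OF l(2), of u x i] that by simp
  have act_e: "act Y u (e1 x) = e (act (L 0) u x)" if "u \<in> carrier U" "x \<in> carrier (comp\<^sub>1 (L 0))" for u x
    using HomE(4)[OF cr(1) um[OF that(1)], of x] that by (simp add: e1_def)
  have act_d: "act (L i) u (d1 i x) = d i (act (L (Suc i)) u x)" if "u \<in> carrier U" "x \<in> carrier (comp\<^sub>1 (L (Suc i)))" for i u x
    using HomE(4)[OF cr(2) um[OF that(1)], of x i] that by (simp add: d1_def)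
  have KI: "x \<in> adj_kernel M \<longleftrightarrow> x \<in> carrier (comp\<^sub>1 M) \<and> (\<forall>u\<in>carrier U. act M u x = \<zero>\<^bsub>M\<^esub>)" for x M
    by (auto simp: adj_kernel_def)
  \<comment> \<open>If the adjoint of x is the boundary of the adjoint of w, then subtracting the
    boundary of w moves x into the kernel, and the next map, which kills boundaries, sees no
    difference.\<close>
  have diff: "x \<ominus>\<^bsub>comp\<^sub>1 (L i)\<^esub> d1 i w \<in> adj_kernel (L i)"
    if x: "x \<in> carrier (comp\<^sub>1 (L i))" and w: "w \<in> carrier (comp\<^sub>1 (L (Suc i)))"
      and e: "\<And>u. u \<in> carrier U \<Longrightarrow> act (L i) u x = d i (act (L (Suc i)) u w)" for i x w
  proof -
    interpret c1: lmodule A "comp\<^sub>1 (L i)" by (rule l1)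
    interpret c2: lmodule B "comp\<^sub>2 (L i)" by (rule l2)
    interpret Li: lmodule \<Lambda> "L i" by (rule l)
    let ?y = "x \<ominus>\<^bsub>comp\<^sub>1 (L i)\<^esub> d1 i w"
    have dw: "d1 i w \<in> carrier (comp\<^sub>1 (L i))" using HomE(2)[OF r(2) w] .
    have y: "?y \<in> carrier (comp\<^sub>1 (L i))" using c1.M.minus_closed[OF x dw] .
    have "act (L i) u ?y = \<zero>\<^bsub>L i\<^esub>" if u: "u \<in> carrier U" for u
    proof -
      have "act (L i) u ?y \<oplus>\<^bsub>L i\<^esub> act (L i) u (d1 i w) = act (L i) u x"
        using act(3)[OF l(2) u, of ?y i "d1 i w"] y dw c1.M.minus_add_cancel(1)[OF x dw] by simp
      moreover have "act (L i) u (d1 i w) = act (L i) u x" using act_d[OF u w] e[OF u] by simp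
      moreover have "act (L i) u ?y \<in> carrier (L i)" "act (L i) u x \<in> carrier (L i)"
        using act(1)[OF l(2) u, of ?y i] act(1)[OF l(2) u, of x i] x y by simp_all
      ultimately show ?thesis by simp
    qed
    then show ?thesis using y unfolding KI by blast
  qed
  \<comment> \<open>The adjoint of x is a cycle of the Hom row, so it is the boundary of some h; and
    h is the adjoint of some w, since the adjoint maps of the L i are onto.\<close>
  have corr0: "\<exists>w\<in>carrier (comp\<^sub>1 (L (Suc 0))). x \<ominus>\<^bsub>comp\<^sub>1 (L 0)\<^esub> d1 0 w \<in> adj_kernel (L 0)"
    if x: "x \<in> carrier (comp\<^sub>1 (L 0))" and z: "\<And>u. u \<in> carrier U \<Longrightarrow> e (act (L 0) u x) = \<zero>\<^bsub>Y\<^esub>" for x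
  proof -
    have "adj (L 0) x \<in> Hom B U (comp\<^sub>2 (L 0))" by (rule adj_Hom(2)[OF l(2) x])
    moreover have "restrict e (carrier (comp\<^sub>2 (L 0))) (adj (L 0) x u) = \<zero>\<^bsub>comp\<^sub>2 Y\<^esub>" if "u \<in> carrier U" for u
      using z[OF that] x that ac(1)[OF that x] by (simp add: adj_def del: cor_simps(1))
    ultimately obtain h where h: "h \<in> Hom B U (comp\<^sub>2 (L (Suc 0)))" "\<forall>u\<in>carrier U. adj (L 0) x u = restrict (d 0) (carrier (comp\<^sub>2 (L (Suc 0)))) (h u)"
      using hr(2)[where h = "adj (L 0) x"] by blast
    have hu: "act (L 0) u x = d 0 (h u)" if "u \<in> carrier U" for u
      using h(2) that x HomE(2)[OF h(1) that] by (simp add: adj_def del: cor_simps(1))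
    obtain w where w: "w \<in> carrier (comp\<^sub>1 (L (Suc 0)))" "\<forall>u\<in>carrier U. h u = act (L (Suc 0)) u w" using adj[OF h(1)] by blast
    then show ?thesis using diff[OF x w(1)] hu w(2) by metis
  qed
  have corrS: "\<exists>w\<in>carrier (comp\<^sub>1 (L (Suc (Suc i)))). x \<ominus>\<^bsub>comp\<^sub>1 (L (Suc i))\<^esub> d1 (Suc i) w \<in> adj_kernel (L (Suc i))"
    if x: "x \<in> carrier (comp\<^sub>1 (L (Suc i)))" and z: "\<And>u. u \<in> carrier U \<Longrightarrow> d i (act (L (Suc i)) u x) = \<zero>\<^bsub>L i\<^esub>" for x i
  proof -
    have "adj (L (Suc i)) x \<in> Hom B U (comp\<^sub>2 (L (Suc i)))" by (rule adj_Hom(2)[OF l(2) x])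
    moreover have "restrict (d i) (carrier (comp\<^sub>2 (L (Suc i)))) (adj (L (Suc i)) x u) = \<zero>\<^bsub>comp\<^sub>2 (L i)\<^esub>" if "u \<in> carrier U" for u
      using z[OF that] x that ac(1)[OF that x] by (simp add: adj_def del: cor_simps(1))
    ultimately obtain h where h: "h \<in> Hom B U (comp\<^sub>2 (L (Suc (Suc i))))"
      "\<forall>u\<in>carrier U. adj (L (Suc i)) x u = restrict (d (Suc i)) (carrier (comp\<^sub>2 (L (Suc (Suc i))))) (h u)"
      using hr(3)[where h = "adj (L (Suc i)) x" and i = i] by blast
    have hu: "act (L (Suc i)) u x = d (Suc i) (h u)" if "u \<in> carrier U" for u
      using h(2) that x HomE(2)[OF h(1) that] by (simp add: adj_def del: cor_simps(1))
    obtain w where w: "w \<in> carrier (comp\<^sub>1 (L (Suc (Suc i))))" "\<forall>u\<in>carrier U. h u = act (L (Suc (Suc i))) u w" using adj[OF h(1)] by blast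
    then show ?thesis using diff[OF x w(1)] hu w(2) by metis
  qed
  show "adj Y ` carrier (comp\<^sub>1 Y) = carrier (hom_module B U (comp\<^sub>2 Y))"
  proof
    show "adj Y ` carrier (comp\<^sub>1 Y) \<subseteq> carrier (hom_module B U (comp\<^sub>2 Y))" using HomE(2)[OF adj_Hom(1)[OF l(1)]] by blast
    show "carrier (hom_module B U (comp\<^sub>2 Y)) \<subseteq> adj Y ` carrier (comp\<^sub>1 Y)"
    proof
      fix h assume "h \<in> carrier (hom_module B U (comp\<^sub>2 Y))"
      then have h: "h \<in> Hom B U (comp\<^sub>2 Y)" by (simp add: hom_module_simps)
      obtain h' where h': "h' \<in> Hom B U (comp\<^sub>2 (L 0))" "\<forall>u\<in>carrier U. h u = restrict e (carrier (comp\<^sub>2 (L 0))) (h' u)"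
        using hr(1)[OF h] by blast
      obtain x where x: "x \<in> carrier (comp\<^sub>1 (L 0))" "\<forall>u\<in>carrier U. h' u = act (L 0) u x" using adj[OF h'(1)] by blast
      have ex: "e1 x \<in> carrier (comp\<^sub>1 Y)" using HomE(2)[OF r(1) x(1)] .
      have "h = adj Y (e1 x)"
      proof (rule Hom_eqI[OF h adj_Hom(2)[OF l(1) ex] refl])
        fix u assume u: "u \<in> carrier U"
        have "h u = e (h' u)" using h'(2) u HomE(2)[OF h'(1) u] by (simp del: cor_simps(1))
        then show "h u = adj Y (e1 x) u" using act_e[OF u x(1)] x(2) u ex by (simp add: adj_def del: cor_simps(1))
      qed
      then show "h \<in> adj Y ` carrier (comp\<^sub>1 Y)" using ex by blast
    qed
  qed
  let ?K = "\<lambda>i. (comp\<^sub>1 (L i))\<lparr>carrier := adj_kernel (L i)\<rparr>" and ?KY = "(comp\<^sub>1 Y)\<lparr>carrier := adj_kernel Y\<rparr>"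
  let ?d = "\<lambda>i. restrict (d i) (adj_kernel (L (Suc i)))" and ?e = "restrict e (adj_kernel (L 0))"
  have Kc: "x \<in> carrier (comp\<^sub>1 M)" if "x \<in> adj_kernel M" for x M using that KI by blast
  have e1x: "?e x = e1 x" if "x \<in> adj_kernel (L 0)" for x using that Kc by (simp add: e1_def del: cor_simps(1))
  have d1x: "?d i x = d1 i x" if "x \<in> adj_kernel (L (Suc i))" for i x using that Kc by (simp add: d1_def del: cor_simps(1))
  have eK: "e1 x \<in> adj_kernel Y" if x: "x \<in> adj_kernel (L 0)" for x
    using x act_e[OF _ Kc[OF x]] HomE(2)[OF r(1) Kc[OF x]] Hom_zero[OF l(2,1) cr(1)] unfolding KI by (simp del: cor_simps(1))
  have dK: "d1 i x \<in> adj_kernel (L i)" if x: "x \<in> adj_kernel (L (Suc i))" for i x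
    using x act_d[OF _ Kc[OF x]] HomE(2)[OF r(2) Kc[OF x]] Hom_zero[OF l(2) l(2) cr(2)] unfolding KI by (simp del: cor_simps(1))
  note sm = adj_Hom(4)[OF l(1)] adj_Hom(4)[OF l(2)]
  have eH: "?e \<in> Hom A (?K 0) ?KY"
  proof (rule Hom_submod_codomain)
    have "?e = restrict e1 (adj_kernel (L 0))" using e1x by (auto simp: fun_eq_iff restrict_def)
    then show "?e \<in> Hom A (?K 0) (comp\<^sub>1 Y)" using Hom_submod_restrict[OF l1(2) sm(2) r(1)] by simp
    show "?e ` carrier (?K 0) \<subseteq> adj_kernel Y" using eK e1x by (simp del: restrict_apply) blast
  qed
  have dH: "?d i \<in> Hom A (?K (Suc i)) (?K i)" for i
  proof (rule Hom_submod_codomain)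
    have "?d i = restrict (d1 i) (adj_kernel (L (Suc i)))" using d1x by (auto simp: fun_eq_iff restrict_def)
    then show "?d i \<in> Hom A (?K (Suc i)) (comp\<^sub>1 (L i))" using Hom_submod_restrict[OF l1(2) sm(2) r(2)] by simp
    show "?d i ` carrier (?K (Suc i)) \<subseteq> adj_kernel (L i)" using dK d1x by (simp del: restrict_apply) blast
  qed
  have cz: "carrier (?K i) = adj_kernel (L i)" "carrier ?KY = adj_kernel Y" "\<zero>\<^bsub>?K i\<^esub> = \<zero>\<^bsub>comp\<^sub>1 (L i)\<^esub>" "\<zero>\<^bsub>?KY\<^esub> = \<zero>\<^bsub>comp\<^sub>1 Y\<^esub>" for i
    by simp_all
  have em: "e1 (x \<ominus>\<^bsub>comp\<^sub>1 (L 0)\<^esub> d1 0 w) = e1 x" if "x \<in> carrier (comp\<^sub>1 (L 0))" "w \<in> carrier (comp\<^sub>1 (L (Suc 0)))" for x w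
    using Hom_minus[OF l1(2) l1(1) r(1) that(1) HomE(2)[OF r(2) that(2)]] r(4)[OF that(2)] HomE(2)[OF r(1) that(1)]
      abelian_group.zero_minus[OF lmodule_imp_abelian_group[OF l1(1)]] by (simp only:)
  have dm: "d1 i (x \<ominus>\<^bsub>comp\<^sub>1 (L (Suc i))\<^esub> d1 (Suc i) w) = d1 i x"
    if "x \<in> carrier (comp\<^sub>1 (L (Suc i)))" "w \<in> carrier (comp\<^sub>1 (L (Suc (Suc i))))" for i x w
    using Hom_minus[OF l1(2) l1(2) r(2) that(1) HomE(2)[OF r(2) that(2)]] r(6)[OF that(2)] HomE(2)[OF r(2) that(1)]
      abelian_group.zero_minus[OF lmodule_imp_abelian_group[OF l1(2)]] by (simp only:)
  show "resolution A ?K ?d ?e ?KY"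
  proof (rule resolutionI; (unfold cz)?)
    show "?e \<in> Hom A (?K 0) ?KY" by (rule eH)
    show "?d i \<in> Hom A (?K (Suc i)) (?K i)" for i by (rule dH)
  next
    fix y assume y: "y \<in> adj_kernel Y"
    obtain x where x: "x \<in> carrier (comp\<^sub>1 (L 0))" "y = e1 x" using r(3)[OF Kc[OF y]] by blast
    have "e (act (L 0) u x) = \<zero>\<^bsub>Y\<^esub>" if "u \<in> carrier U" for u using act_e[OF that x(1)] y x(2) that unfolding KI by simp
    then obtain w where w: "w \<in> carrier (comp\<^sub>1 (L (Suc 0)))" "x \<ominus>\<^bsub>comp\<^sub>1 (L 0)\<^esub> d1 0 w \<in> adj_kernel (L 0)" using corr0[OF x(1)] by blast
    then show "\<exists>x\<in>adj_kernel (L 0). y = ?e x" using em[OF x(1) w(1)] e1x[OF w(2)] x(2) by (intro bexI[OF _ w(2)]) metis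
  next
    show "?e (?d 0 x) = \<zero>\<^bsub>comp\<^sub>1 Y\<^esub>" if x: "x \<in> adj_kernel (L (Suc 0))" for x
      using d1x[OF x] e1x[OF dK[OF x]] r(4)[OF Kc[OF x]] by metis
    show "?d i (?d (Suc i) x) = \<zero>\<^bsub>comp\<^sub>1 (L i)\<^esub>" if x: "x \<in> adj_kernel (L (Suc (Suc i)))" for i x
      using d1x[OF x] d1x[OF dK[OF x]] r(6)[OF Kc[OF x]] by metis
  next
    fix x assume x: "x \<in> adj_kernel (L 0)" "?e x = \<zero>\<^bsub>comp\<^sub>1 Y\<^esub>"
    obtain w where w: "w \<in> carrier (comp\<^sub>1 (L (Suc 0)))" "x = d1 0 w" using r(5)[OF Kc[OF x(1)]] x(2) e1x[OF x(1)] by metis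
    have "d 0 (act (L (Suc 0)) u w) = \<zero>\<^bsub>L 0\<^esub>" if "u \<in> carrier U" for u using act_d[OF that w(1)] x(1) w(2) that unfolding KI by simp
    then obtain v where v: "v \<in> carrier (comp\<^sub>1 (L (Suc (Suc 0))))" "w \<ominus>\<^bsub>comp\<^sub>1 (L (Suc 0))\<^esub> d1 (Suc 0) v \<in> adj_kernel (L (Suc 0))"
      using corrS[OF w(1)] by blast
    then show "\<exists>w\<in>adj_kernel (L (Suc 0)). x = ?d 0 w" using dm[OF w(1) v(1)] d1x[OF v(2)] w(2) by (intro bexI[OF _ v(2)]) metis
  next
    fix i x assume x: "x \<in> adj_kernel (L (Suc i))" "?d i x = \<zero>\<^bsub>comp\<^sub>1 (L i)\<^esub>"
    obtain w where w: "w \<in> carrier (comp\<^sub>1 (L (Suc (Suc i))))" "x = d1 (Suc i) w" using r(7)[OF Kc[OF x(1)]] x(2) d1x[OF x(1)] by metis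
    have "d (Suc i) (act (L (Suc (Suc i))) u w) = \<zero>\<^bsub>L (Suc i)\<^esub>" if "u \<in> carrier U" for u
      using act_d[OF that w(1)] x(1) w(2) that unfolding KI by simp
    then obtain v where v: "v \<in> carrier (comp\<^sub>1 (L (Suc (Suc (Suc i)))))"
      "w \<ominus>\<^bsub>comp\<^sub>1 (L (Suc (Suc i)))\<^esub> d1 (Suc (Suc i)) v \<in> adj_kernel (L (Suc (Suc i)))"
      using corrS[OF w(1)] by blast
    then show "\<exists>w\<in>adj_kernel (L (Suc (Suc i))). x = ?d (Suc i) w" using dm[OF w(1) v(1)] d1x[OF v(2)] w(2) by (intro bexI[OF _ v(2)]) metis
  qed
qed

text \<open>Membership in the class makes the adjoint maps onto with kernels in \<D>, and the
  vanishing of Ext keeps the Hom row exact. The resulting sequence exhibits the first component of Y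
  as an extension, to which closure under extensions can be applied.\<close>

lemma class_I_resolution:
  assumes D: "module_class A \<U> \<D>" and F: "module_class B \<U> \<F>" and Y: "Y \<in> res_class \<Lambda> \<U> (n - 1) (class_I A U B \<U> \<D> \<F>)"
    and ext: "\<And>F j. F \<in> \<F> \<Longrightarrow> 1 \<le> j \<Longrightarrow> j \<le> n + 1 \<Longrightarrow> trivial_group (Ext B \<U> j U F)"
  obtains K k where "K \<in> res_class A \<U> (n - 1) \<D>" "short_exact A K k (comp\<^sub>1 Y) (adj Y) (hom_module B U (comp\<^sub>2 Y))"
proof -
  obtain k L d e where L: "Y \<in> RMod \<Lambda> \<U>" "k \<le> n - 1" "resolution \<Lambda> L d e Y" "\<And>i. i \<le> k \<Longrightarrow> L i \<in> class_I A U B \<U> \<D> \<F>"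
    "\<And>i. i > k \<Longrightarrow> L i \<in> RMod \<Lambda> \<U> \<and> carrier (L i) = {\<zero>\<^bsub>L i\<^esub>}"
    using Y unfolding res_class_def by blast
  note ID = class_ID[OF D F L(4)]
  have LR: "L i \<in> RMod \<Lambda> \<U>" for i using ID(1) L(5) by (cases "i \<le> k") auto
  have l: "lmodule \<Lambda> (L i)" "lmodule \<Lambda> Y" for i using LR L(1) by (auto simp: RMod_def)
  note l1 = lmodule_cor[OF nuhom_tri(1) l(1)] lmodule_cor[OF nuhom_tri(1) l(2)]
    and l2 = lmodule_cor[OF nuhom_tri(2) l(1)] lmodule_cor[OF nuhom_tri(2) l(2)]
  have zero: "\<forall>i>k. carrier (L i) = {\<zero>\<^bsub>L i\<^esub>}" using L(5) by blast
  have adjs: "\<exists>x\<in>carrier (comp\<^sub>1 (L i)). \<forall>u\<in>carrier U. h u = act (L i) u x" if h: "h \<in> Hom B U (comp\<^sub>2 (L i))" for i h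
  proof (cases "i \<le> k")
    case True
    then show ?thesis using ID(5) h by blast
  next
    case False
    interpret c1: lmodule A "comp\<^sub>1 (L i)" by (rule l1)
    \<comment> \<open>Beyond k the second component is zero, so h is zero and is represented by the
      zero element.\<close>
    have z: "carrier (comp\<^sub>2 (L i)) = {\<zero>\<^bsub>L i\<^esub>}" using cor_zero[OF nuhom_tri(2) l(1)] zero False by simp
    show ?thesis
      using HomE(2)[OF h] c1.M.zero_closed act(6)[OF l(1)] unfolding z by (intro bexI[of _ "\<zero>\<^bsub>comp\<^sub>1 (L i)\<^esub>"]) simp_all
  qed
  have van: "\<forall>i\<le>k. \<forall>j\<le>k. trivial_group (Ext B \<U> (Suc j) U (comp\<^sub>2 (L i)))"
    using ext[OF ID(3)] L(2) by simp
  have adjs': "\<forall>i. \<forall>h\<in>Hom B U (comp\<^sub>2 (L i)). \<exists>x\<in>carrier (comp\<^sub>1 (L i)). \<forall>u\<in>carrier U. h u = act (L i) u x"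
    using adjs by blast
  note r = adj_kernel_resolution[OF L(3,1) LR adjs' van zero]
  let ?K = "(comp\<^sub>1 Y)\<lparr>carrier := adj_kernel Y\<rparr>"
  have "?K \<in> res_class A \<U> (n - 1) \<D>"
    unfolding res_class_def mem_Collect_eq
  proof (intro conjI exI[of _ k] exI allI impI)
    show "?K \<in> RMod A \<U>" by (rule RMod_submod[OF RMod_cor[OF nuhom_tri(1) L(1)] adj_Hom(4)[OF l(2)]])
    show "k \<le> n - 1" by fact
    show "resolution A (\<lambda>i. (comp\<^sub>1 (L i))\<lparr>carrier := adj_kernel (L i)\<rparr>) (\<lambda>i. restrict (d i) (adj_kernel (L (Suc i))))
      (restrict e (adj_kernel (L 0))) ?K" by (rule r(2))
    show "(comp\<^sub>1 (L i))\<lparr>carrier := adj_kernel (L i)\<rparr> \<in> \<D>" if "i \<le> k" for i using ID(4)[OF that] by (simp add: adj_kernel_def)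
    fix i assume i: "k < i"
    show "(comp\<^sub>1 (L i))\<lparr>carrier := adj_kernel (L i)\<rparr> \<in> RMod A \<U>"
      by (rule RMod_submod[OF RMod_cor[OF nuhom_tri(1) LR] adj_Hom(4)[OF l(1)]])
    have "adj_kernel (L i) \<subseteq> {\<zero>\<^bsub>comp\<^sub>1 (L i)\<^esub>}" "\<zero>\<^bsub>comp\<^sub>1 (L i)\<^esub> \<in> adj_kernel (L i)"
      using adj_Hom(4)[OF l(1)] cor_zero[OF nuhom_tri(1) l(1) zero[rule_format, OF i]] unfolding submod_def by blast+
    then show "carrier ((comp\<^sub>1 (L i))\<lparr>carrier := adj_kernel (L i)\<rparr>) = {\<zero>\<^bsub>(comp\<^sub>1 (L i))\<lparr>carrier := adj_kernel (L i)\<rparr>\<^esub>}" by auto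
  qed
  moreover have "short_exact A ?K (\<lambda>x\<in>adj_kernel Y. x) (comp\<^sub>1 Y) (adj Y) (hom_module B U (comp\<^sub>2 Y))"
    using short_exact_kernel[OF l1(2) lmodule_hom_module[OF l2(2)] adj_Hom(1)[OF l(2)] r(1)] unfolding adj_Hom(3)[OF l(2)] .
  ultimately show thesis using that by blast
qed

lemma hom_module_isos:
  fixes M N :: "('b, 'm) module"
  assumes M: "lmodule B M" and N: "lmodule B N" and i: "isos B M N f g"
  shows "mod_iso A (hom_module B U M) (hom_module B U N)"
proof -
  have c: "compose (carrier U) q \<in> Hom B U M \<rightarrow> Hom B U N" if "q \<in> Hom B M N" for q and M N :: "('b, 'm) module"
    using Hom_compose[OF lmodule_axioms _ that] by blast
  have H: "restrict (compose (carrier U) q) (Hom B U M) \<in> Hom A (hom_module B U M) (hom_module B U N)"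
    if l: "lmodule B M" and q: "q \<in> Hom B M N" for q and M N :: "('b, 'm) module"
  proof -
    have "restrict (compose (carrier U) q) (carrier (hom_module B U M)) \<in> Hom A (hom_module B U M) (hom_module B U N)"
    proof (rule HomI[OF lmodule_hom_module[OF l]]; unfold hom_module_simps)
      fix h assume h: "h \<in> Hom B U M"
      show "compose (carrier U) q h \<in> Hom B U N" using c[OF q] h by blast
      show "compose (carrier U) q (\<lambda>u\<in>carrier U. h (rsmult U u a)) = (\<lambda>u\<in>carrier U. compose (carrier U) q h (rsmult U u a))" if "a \<in> carrier A" for a
        using that rsmult_closed by (auto simp: compose_def restrict_def fun_eq_iff)
      fix h' assume h': "h' \<in> Hom B U M"
      show "compose (carrier U) q (\<lambda>u\<in>carrier U. h u \<oplus>\<^bsub>M\<^esub> h' u) =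
          (\<lambda>u\<in>carrier U. compose (carrier U) q h u \<oplus>\<^bsub>N\<^esub> compose (carrier U) q h' u)"
        using HomE(3)[OF q HomE(2)[OF h] HomE(2)[OF h']] by (auto simp: compose_def restrict_def fun_eq_iff)
    qed
    then show ?thesis by (simp add: hom_module_simps)
  qed
  note i = isosD[OF i]
  have inv: "compose (carrier U) q' (compose (carrier U) q h) = h"
    if h: "h \<in> Hom B U M" and "\<And>x. x \<in> carrier M \<Longrightarrow> q' (q x) = x" for q q' h and M :: "('b, 'm) module"
    using that(2)[OF HomE(2)[OF h]] HomE(1)[OF h] by (auto simp: compose_def fun_eq_iff extensional_def PiE_def)
  have "isos A (hom_module B U M) (hom_module B U N) (restrict (compose (carrier U) f) (Hom B U M)) (restrict (compose (carrier U) g) (Hom B U N))"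
    unfolding isos_def hom_module_simps(1)
    using H[OF M i(1)] H[OF N i(2)] c[OF i(1)] c[OF i(2)] inv[of _ M g f, OF _ i(3)] inv[of _ N f g, OF _ i(4)] by (auto simp: Pi_def)
  then show ?thesis by (rule isos_imp_mod_iso)
qed

section \<open>The four implications\<close>

context
  fixes n :: nat and \<C> \<D> :: "('a, 'm) module set" and \<E> \<F> :: "('b, 'm) module set"
  assumes \<C>: "module_class A \<U> \<C>" and \<D>: "module_class A \<U> \<D>" and \<E>: "module_class B \<U> \<E>" and \<F>: "module_class B \<U> \<F>"
begin

text \<open>Approximating any one module exhibits members of the classes: a coresolution has a term
  in degree 0 even if its length k is 0.\<close>

lemma right_pair_nonempty:
  assumes r: "right_cotorsion_pair \<Lambda> \<U> n (class_P A U B \<U> \<C> \<E>) (class_A A U B \<U> \<D> \<F>)"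
  shows "\<C> \<noteq> {}" and "\<E> \<noteq> {}" and "class_A A U B \<U> \<D> \<F> \<noteq> {}"
proof -
  obtain M where "M \<in> RMod \<Lambda> \<U>" by (rule RMod_exists[OF ring_tri_ring small_rings(3)])
  then obtain X Y where XY: "Y \<in> class_A A U B \<U> \<D> \<F>" "X \<in> cores_class \<Lambda> \<U> (n - 1) (class_P A U B \<U> \<C> \<E>)"
    using r unfolding right_cotorsion_pair_def by blast
  then show "class_A A U B \<U> \<D> \<F> \<noteq> {}" by blast
  obtain L where "L \<in> class_P A U B \<U> \<C> \<E>" using XY(2) unfolding cores_class_def by blast
  then show "\<C> \<noteq> {}" "\<E> \<noteq> {}" using class_PD[OF \<C> \<E>] by blast+
qed

lemma left_pair_nonempty:
  assumes r: "left_cotorsion_pair \<Lambda> \<U> n (class_A A U B \<U> \<C> \<E>) (class_I A U B \<U> \<D> \<F>)"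
  shows "\<D> \<noteq> {}" and "\<F> \<noteq> {}" and "class_A A U B \<U> \<C> \<E> \<noteq> {}"
proof -
  obtain M where "M \<in> RMod \<Lambda> \<U>" by (rule RMod_exists[OF ring_tri_ring small_rings(3)])
  then obtain X Y where XY: "X \<in> class_A A U B \<U> \<C> \<E>" "Y \<in> res_class \<Lambda> \<U> (n - 1) (class_I A U B \<U> \<D> \<F>)"
    using r unfolding left_cotorsion_pair_def by blast
  then show "class_A A U B \<U> \<C> \<E> \<noteq> {}" by blast
  obtain L where "L \<in> class_I A U B \<U> \<D> \<F>" using XY(2) unfolding res_class_def by blast
  then show "\<D> \<noteq> {}" "\<F> \<noteq> {}" using class_ID(3,4)[OF \<D> \<F>] by blast+
qed

lemma right_pair_A:
  assumes r: "right_cotorsion_pair \<Lambda> \<U> n (class_P A U B \<U> \<C> \<E>) (class_A A U B \<U> \<D> \<F>)"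
  shows "right_cotorsion_pair A \<U> n \<C> \<D>"
  unfolding right_cotorsion_pair_def
proof (intro conjI ballI allI impI)
  note R = r[unfolded right_cotorsion_pair_def]
  note S = class_A_summands[OF \<D> \<F> right_pair_nonempty(3)[OF r] R[THEN conjunct1]]
  show "closed_under_summands A \<U> \<D>" by (rule S(3))
  show "trivial_group (Ext A \<U> i C D)" if C: "C \<in> \<C>" and D: "D \<in> \<D>" and i: "1 \<le> i \<and> i \<le> n" for C D i
  proof -
    \<comment> \<open>To place C in a triple of the class, some cokernel from \<E> is required; any
      member serves.\<close>
    obtain E where E: "E \<in> \<E>" using right_pair_nonempty(2)[OF r] by blast
    note CR = module_classD[OF \<C>] and DR = module_classD[OF \<D>]
    obtain L where L: "L \<in> class_P A U B \<U> \<C> \<E>" "retract A C (comp\<^sub>1 L)"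
      using class_P_exists[OF C CR(1)[OF C] E module_classD(1)[OF \<E> E]] by metis
    note LR = class_PD(1)[OF \<C> \<E> L(1)]
    obtain j where j: "i = Suc j" using i by (cases i) auto
    have "trivial_group (Ext \<Lambda> \<U> (Suc j) L (emb\<^sub>1 D))" using R L(1) S(1)[OF D] i unfolding j by blast
    then have "trivial_group (Ext A \<U> (Suc j) (comp\<^sub>1 L) D)" by (rule Ext_trivial_comp\<^sub>1[OF LR DR(1)[OF D]])
    then show ?thesis unfolding j
      by (rule Ext_trivial_retract[OF CR(1)[OF C] RMod_cor[OF nuhom_tri(1) LR] L(2) small_rings(1) DR(2)[OF D] DR(2)[OF D]
        isos_retract[OF isos_refl[OF DR(2)[OF D]]]])
  qed
  fix M assume M: "M \<in> RMod A \<U>"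
  then have l: "lmodule A M" by (simp add: RMod_def)
  obtain Y X f g where Y: "Y \<in> class_A A U B \<U> \<D> \<F>" and X: "X \<in> cores_class \<Lambda> \<U> (n - 1) (class_P A U B \<U> \<C> \<E>)"
    and s: "short_exact \<Lambda> (emb\<^sub>1 M) f Y g X"
    using R RMod_cor[OF nuhom_tri(3) M] by blast
  note YD = class_AD[OF \<D> \<F> Y]
  note ses = short_exact_isos_left[OF l
    cor_short_exact[OF nuhom_tri(1) lmodule_cor[OF nuhom_tri(3) l] YD(2) s] isos_sym[OF comp\<^sub>1_emb\<^sub>1[OF l]]]
  have "comp\<^sub>1 X \<in> cores_class A \<U> (n - 1) \<C>"
    by (rule cor_cores_class[OF nuhom_tri(1) _ X]) (use class_PD(1,3)[OF \<C> \<E>] in blast)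
  then show "\<exists>Y\<in>\<D>. \<exists>X\<in>cores_class A \<U> (n - 1) \<C>. \<exists>f g. short_exact A M f Y g X" using ses YD(3) by blast
qed

lemma right_pair_B:
  assumes r: "right_cotorsion_pair \<Lambda> \<U> n (class_P A U B \<U> \<C> \<E>) (class_A A U B \<U> \<D> \<F>)"
    and tor: "\<And>C j. C \<in> \<C> \<Longrightarrow> 1 \<le> j \<Longrightarrow> j \<le> n + 1 \<Longrightarrow> trivial_group (Tor A \<U> j U C)"
    and ext: "closed_under_extensions B \<U> (cores_class B \<U> (n - 1) \<E>)"
    and ten: "\<And>D. D \<in> \<D> \<Longrightarrow> in_class B (cores_class B \<U> (n - 1) \<E>) (tensor_module A U D)"
  shows "right_cotorsion_pair B \<U> n \<E> \<F>"
  unfolding right_cotorsion_pair_def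
proof (intro conjI ballI allI impI)
  note R = r[unfolded right_cotorsion_pair_def]
  note S = class_A_summands[OF \<D> \<F> right_pair_nonempty(3)[OF r] R[THEN conjunct1]]
  show "closed_under_summands B \<U> \<F>" by (rule S(4))
  show "trivial_group (Ext B \<U> i E F)" if E: "E \<in> \<E>" and F: "F \<in> \<F>" and i: "1 \<le> i \<and> i \<le> n" for E F i
  proof -
    obtain C where C: "C \<in> \<C>" using right_pair_nonempty(1)[OF r] by blast
    note ER = module_classD[OF \<E>] and FR = module_classD[OF \<F>]
    obtain L where L: "L \<in> class_P A U B \<U> \<C> \<E>" "retract \<Lambda> (emb\<^sub>2 E) L"
      using class_P_exists[OF C module_classD(1)[OF \<C> C] E ER(1)[OF E]] by metis
    note LR = class_PD(1)[OF \<C> \<E> L(1)]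
    note ER' = RMod_cor[OF nuhom_tri(4) ER(1)[OF E]] and FR' = RMod_cor[OF nuhom_tri(4) FR(1)[OF F]]
    note lF = lmodule_cor[OF nuhom_tri(4) FR(2)[OF F]]
    obtain j where j: "i = Suc j" using i by (cases i) auto
    have "trivial_group (Ext \<Lambda> \<U> (Suc j) L (emb\<^sub>2 F))" using R L(1) S(2)[OF F] i unfolding j by blast
    then have "trivial_group (Ext \<Lambda> \<U> (Suc j) (emb\<^sub>2 E) (emb\<^sub>2 F))"
      by (rule Ext_trivial_retract[OF ER' LR L(2) small_rings(3) lF lF isos_retract[OF isos_refl[OF lF]]])
    then have "trivial_group (Ext B \<U> (Suc j) E (comp\<^sub>2 (emb\<^sub>2 F)))" by (rule Ext_trivial_emb\<^sub>2[OF ER(1)[OF E] FR'])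
    then show ?thesis unfolding j
      by (rule Ext_trivial_retract[OF ER(1)[OF E] ER(1)[OF E] isos_retract[OF isos_refl[OF ER(2)[OF E]]] small_rings(2)
        FR(2)[OF F] lmodule_cor[OF nuhom_tri(2) lF] isos_retract[OF isos_sym[OF comp\<^sub>2_emb\<^sub>2[OF FR(2)[OF F]]]]])
  qed
  fix N assume N: "N \<in> RMod B \<U>"
  then have l: "lmodule B N" by (simp add: RMod_def)
  note lN = lmodule_cor[OF nuhom_tri(4) l]
  obtain Y X f g where Y: "Y \<in> class_A A U B \<U> \<D> \<F>" and X: "X \<in> cores_class \<Lambda> \<U> (n - 1) (class_P A U B \<U> \<C> \<E>)"
    and s: "short_exact \<Lambda> (emb\<^sub>2 N) f Y g X"
    using R RMod_cor[OF nuhom_tri(4) N] by blast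
  note YD = class_AD[OF \<D> \<F> Y]
  have XR: "X \<in> RMod \<Lambda> \<U>" "lmodule \<Lambda> X" using X by (auto simp: cores_class_def RMod_def)
  note l1 = lmodule_cor[OF nuhom_tri(1) YD(2)] lmodule_cor[OF nuhom_tri(1) XR(2)]
  note ses = short_exact_isos_left[OF l cor_short_exact[OF nuhom_tri(2) lN YD(2) s] isos_sym[OF comp\<^sub>2_emb\<^sub>2[OF l]]]
  obtain h k where hk: "isos A (comp\<^sub>1 Y) (comp\<^sub>1 X) h k"
    by (rule short_exact_zero_left[OF lmodule_cor[OF nuhom_tri(1) lN] l1 cor_short_exact[OF nuhom_tri(1) lN YD(2) s] comp_emb_zero(1)[OF l]])
  \<comment> \<open>T is a copy of the tensor product on the universe type. The extension is formed
    with T, because closure under extensions speaks of members of the class.\<close>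
  obtain T where T: "T \<in> cores_class B \<U> (n - 1) \<E>" "mod_iso B T (tensor_module A U (comp\<^sub>1 Y))"
    using ten[OF YD(3)] unfolding in_class_def by blast
  have lT: "lmodule B T" using T(1) by (auto simp: cores_class_def RMod_def)
  note lTY = lmodule_tensor[OF l1(1)] and lTX = lmodule_tensor[OF l1(2)]
  obtain a b where ab: "isos B T (tensor_module A U (comp\<^sub>1 Y)) a b" by (rule mod_iso_imp_isos[OF lT lTY T(2)])
  obtain a' b' where ab': "isos B (tensor_module A U (comp\<^sub>1 Y)) (tensor_module A U (comp\<^sub>1 X)) a' b'"
    by (rule mod_iso_imp_isos[OF lTY lTX tensor_isos[OF l1 hk]])
  obtain Q q where Q: "Q \<in> cores_class B \<U> (n - 1) \<E>" "short_exact B (tensor_module A U (comp\<^sub>1 X)) (phi X) (comp\<^sub>2 X) q Q"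
    using class_P_coresolution[OF \<C> \<E> X tor] by blast
  have "comp\<^sub>2 X \<in> cores_class B \<U> (n - 1) \<E>"
    using short_exact_isos_left[OF lT Q(2) isos_trans[OF lT lTX ab ab']] ext T(1) Q(1) RMod_cor[OF nuhom_tri(2) XR(1)]
    unfolding closed_under_extensions_def by blast
  then show "\<exists>Y\<in>\<F>. \<exists>X\<in>cores_class B \<U> (n - 1) \<E>. \<exists>f g. short_exact B N f Y g X" using ses YD(4) by blast
qed

lemma left_pair_B:
  assumes r: "left_cotorsion_pair \<Lambda> \<U> n (class_A A U B \<U> \<C> \<E>) (class_I A U B \<U> \<D> \<F>)"
  shows "left_cotorsion_pair B \<U> n \<E> \<F>"
  unfolding left_cotorsion_pair_def
proof (intro conjI ballI allI impI)
  note R = r[unfolded left_cotorsion_pair_def]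
  note S = class_A_summands[OF \<C> \<E> left_pair_nonempty(3)[OF r] R[THEN conjunct1]]
  show "closed_under_summands B \<U> \<E>" by (rule S(4))
  show "trivial_group (Ext B \<U> i E F)" if E: "E \<in> \<E>" and F: "F \<in> \<F>" and i: "1 \<le> i \<and> i \<le> n" for E F i
  proof -
    obtain D where D: "D \<in> \<D>" using left_pair_nonempty(1)[OF r] by blast
    note ER = module_classD[OF \<E>] and FR = module_classD[OF \<F>]
    obtain L where L: "L \<in> class_I A U B \<U> \<D> \<F>" "retract B F (comp\<^sub>2 L)"
      using class_I_exists[OF D \<D> F FR(1)[OF F]] by metis
    note LR = class_ID(1,2)[OF \<D> \<F> L(1)]
    obtain j where j: "i = Suc j" using i by (cases i) auto
    have "trivial_group (Ext \<Lambda> \<U> (Suc j) (emb\<^sub>2 E) L)" using R L(1) S(2)[OF E] i unfolding j by blast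
    then have "trivial_group (Ext B \<U> (Suc j) E (comp\<^sub>2 L))" by (rule Ext_trivial_emb\<^sub>2[OF ER(1)[OF E] LR(1)])
    then show ?thesis unfolding j
      by (rule Ext_trivial_retract[OF ER(1)[OF E] ER(1)[OF E] isos_retract[OF isos_refl[OF ER(2)[OF E]]] small_rings(2)
        FR(2)[OF F] lmodule_cor[OF nuhom_tri(2) LR(2)] L(2)])
  qed
  fix N assume N: "N \<in> RMod B \<U>"
  then have l: "lmodule B N" by (simp add: RMod_def)
  obtain X Y f g where X: "X \<in> class_A A U B \<U> \<C> \<E>" and Y: "Y \<in> res_class \<Lambda> \<U> (n - 1) (class_I A U B \<U> \<D> \<F>)"
    and s: "short_exact \<Lambda> Y f X g (emb\<^sub>2 N)"
    using R RMod_cor[OF nuhom_tri(4) N] by blast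
  note XD = class_AD[OF \<C> \<E> X]
  have lY: "lmodule \<Lambda> Y" using Y by (auto simp: res_class_def RMod_def)
  note ses = short_exact_isos_right[OF lmodule_cor[OF nuhom_tri(2) XD(2)] lmodule_cor[OF nuhom_tri(2) lmodule_cor[OF nuhom_tri(4) l]] l
    cor_short_exact[OF nuhom_tri(2) lY XD(2) s] comp\<^sub>2_emb\<^sub>2[OF l]]
  have "comp\<^sub>2 Y \<in> res_class B \<U> (n - 1) \<F>"
    by (rule cor_res_class[OF nuhom_tri(2) _ Y]) (use class_ID(1,3)[OF \<D> \<F>] in blast)
  then show "\<exists>X\<in>\<E>. \<exists>Y\<in>res_class B \<U> (n - 1) \<F>. \<exists>f g. short_exact B Y f X g N" using ses XD(4) by blast
qed

lemma left_pair_A: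
  assumes r: "left_cotorsion_pair \<Lambda> \<U> n (class_A A U B \<U> \<C> \<E>) (class_I A U B \<U> \<D> \<F>)"
    and van: "\<And>F j. F \<in> \<F> \<Longrightarrow> 1 \<le> j \<Longrightarrow> j \<le> n + 1 \<Longrightarrow> trivial_group (Ext B \<U> j U F)"
    and ext: "closed_under_extensions A \<U> (res_class A \<U> (n - 1) \<D>)"
    and hom: "\<And>E. E \<in> \<E> \<Longrightarrow> in_class A (res_class A \<U> (n - 1) \<D>) (hom_module B U E)"
  shows "left_cotorsion_pair A \<U> n \<C> \<D>"
  unfolding left_cotorsion_pair_def
proof (intro conjI ballI allI impI)
  note R = r[unfolded left_cotorsion_pair_def]
  note S = class_A_summands[OF \<C> \<E> left_pair_nonempty(3)[OF r] R[THEN conjunct1]]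
  show "closed_under_summands A \<U> \<C>" by (rule S(3))
  show "trivial_group (Ext A \<U> i C D)" if C: "C \<in> \<C>" and D: "D \<in> \<D>" and i: "1 \<le> i \<and> i \<le> n" for C D i
  proof -
    obtain F where F: "F \<in> \<F>" using left_pair_nonempty(2)[OF r] by blast
    note CR = module_classD[OF \<C>] and DR = module_classD[OF \<D>]
    obtain L where L: "L \<in> class_I A U B \<U> \<D> \<F>" "retract \<Lambda> (emb\<^sub>1 D) L"
      using class_I_exists[OF D \<D> F module_classD(1)[OF \<F> F]] by metis
    note LR = class_ID(1,2)[OF \<D> \<F> L(1)]
    note CR' = RMod_cor[OF nuhom_tri(3) CR(1)[OF C]] and lC = lmodule_cor[OF nuhom_tri(3) CR(2)[OF C]]
    obtain j where j: "i = Suc j" using i by (cases i) auto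
    have "trivial_group (Ext \<Lambda> \<U> (Suc j) (emb\<^sub>1 C) L)" using R L(1) S(1)[OF C] i unfolding j by blast
    then have "trivial_group (Ext \<Lambda> \<U> (Suc j) (emb\<^sub>1 C) (emb\<^sub>1 D))"
      by (rule Ext_trivial_retract[OF CR' CR' isos_retract[OF isos_refl[OF lC]] small_rings(3)
        lmodule_cor[OF nuhom_tri(3) DR(2)[OF D]] LR(2) L(2)])
    then have "trivial_group (Ext A \<U> (Suc j) (comp\<^sub>1 (emb\<^sub>1 C)) D)" by (rule Ext_trivial_comp\<^sub>1[OF CR' DR(1)[OF D]])
    then show ?thesis unfolding j
      by (rule Ext_trivial_retract[OF CR(1)[OF C] RMod_cor[OF nuhom_tri(1) CR'] isos_retract[OF isos_sym[OF comp\<^sub>1_emb\<^sub>1[OF CR(2)[OF C]]]]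
        small_rings(1) DR(2)[OF D] DR(2)[OF D] isos_retract[OF isos_refl[OF DR(2)[OF D]]]])
  qed
  fix M assume M: "M \<in> RMod A \<U>"
  then have l: "lmodule A M" by (simp add: RMod_def)
  note lM = lmodule_cor[OF nuhom_tri(3) l]
  obtain X Y f g where X: "X \<in> class_A A U B \<U> \<C> \<E>" and Y: "Y \<in> res_class \<Lambda> \<U> (n - 1) (class_I A U B \<U> \<D> \<F>)"
    and s: "short_exact \<Lambda> Y f X g (emb\<^sub>1 M)"
    using R RMod_cor[OF nuhom_tri(3) M] by blast
  note XD = class_AD[OF \<C> \<E> X]
  have YR: "Y \<in> RMod \<Lambda> \<U>" "lmodule \<Lambda> Y" using Y by (auto simp: res_class_def RMod_def)
  note l2 = lmodule_cor[OF nuhom_tri(2) XD(2)] lmodule_cor[OF nuhom_tri(2) YR(2)]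
  note ses = short_exact_isos_right[OF lmodule_cor[OF nuhom_tri(1) XD(2)] lmodule_cor[OF nuhom_tri(1) lM] l
    cor_short_exact[OF nuhom_tri(1) YR(2) XD(2) s] comp\<^sub>1_emb\<^sub>1[OF l]]
  obtain h k where hk: "isos B (comp\<^sub>2 Y) (comp\<^sub>2 X) h k"
    by (rule short_exact_zero_right[OF l2(2,1) cor_short_exact[OF nuhom_tri(2) YR(2) XD(2) s] comp_emb_zero(2)[OF l]])
  \<comment> \<open>As the Hom module consists of functions, a copy H on the universe type takes its
    place in the extension.\<close>
  obtain H where H: "H \<in> res_class A \<U> (n - 1) \<D>" "mod_iso A H (hom_module B U (comp\<^sub>2 X))"
    using hom[OF XD(4)] unfolding in_class_def by blast
  have lH: "lmodule A H" using H(1) by (auto simp: res_class_def RMod_def)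
  note lHX = lmodule_hom_module[OF l2(1)] and lHY = lmodule_hom_module[OF l2(2)]
  obtain a b where ab: "isos A H (hom_module B U (comp\<^sub>2 X)) a b" by (rule mod_iso_imp_isos[OF lH lHX H(2)])
  obtain a' b' where ab': "isos A (hom_module B U (comp\<^sub>2 Y)) (hom_module B U (comp\<^sub>2 X)) a' b'"
    by (rule mod_iso_imp_isos[OF lHY lHX hom_module_isos[OF l2(2,1) hk]])
  obtain K q where K: "K \<in> res_class A \<U> (n - 1) \<D>" "short_exact A K q (comp\<^sub>1 Y) (adj Y) (hom_module B U (comp\<^sub>2 Y))"
    using class_I_resolution[OF \<D> \<F> Y van] by blast
  have "comp\<^sub>1 Y \<in> res_class A \<U> (n - 1) \<D>"
    using short_exact_isos_right[OF lmodule_cor[OF nuhom_tri(1) YR(2)] lHY lH K(2) isos_trans[OF lHY lH ab' isos_sym[OF ab]]]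
      ext H(1) K(1) RMod_cor[OF nuhom_tri(1) YR(1)]
    unfolding closed_under_extensions_def by blast
  then show "\<exists>X\<in>\<C>. \<exists>Y\<in>res_class A \<U> (n - 1) \<D>. \<exists>f g. short_exact A Y f X g M" using ses XD(3) by blast
qed

end

end

theorem theorem3p8:
  fixes n :: nat
    and A :: "'a ring" and B :: "'b ring" and U :: "('b, 'u, 'a) bimodule"
    and \<U> :: "'m set set"
    and \<C> \<D> :: "('a, 'm) module set" and \<E> \<F> :: "('b, 'm) module set"
  assumes n: "n \<ge> 1"
    and A: "ring A" "\<one>\<^bsub>A\<^esub> \<noteq> \<zero>\<^bsub>A\<^esub>"
    and B: "ring B" "\<one>\<^bsub>B\<^esub> \<noteq> \<zero>\<^bsub>B\<^esub>"
    and U: "bimodule B A U"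
    and universe: "universe \<U>" "closed_under_powers \<U> (UNIV :: nat set)"
      "closed_under_powers \<U> (carrier A)" "closed_under_powers \<U> (carrier B)"
      "closed_under_powers \<U> (carrier U)"
    and classes: "module_class A \<U> \<C>" "module_class A \<U> \<D>"
      "module_class B \<U> \<E>" "module_class B \<U> \<F>"
  shows
    "(right_cotorsion_pair (tri_ring A U B) \<U> n (class_P A U B \<U> \<C> \<E>) (class_A A U B \<U> \<D> \<F>) \<longrightarrow>
        ((\<forall>C\<in>\<C>. \<forall>j. 1 \<le> j \<and> j \<le> n + 1 \<longrightarrow> trivial_group (Tor A \<U> j U C)) \<longrightarrow>
          right_cotorsion_pair A \<U> n \<C> \<D>) \<and>
        ((\<forall>C\<in>\<C>. \<forall>j. 1 \<le> j \<and> j \<le> n + 1 \<longrightarrow> trivial_group (Tor A \<U> j U C)) \<and>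
         closed_under_extensions B \<U> (cores_class B \<U> (n - 1) \<E>) \<and>
         (\<forall>D\<in>\<D>. in_class B (cores_class B \<U> (n - 1) \<E>) (tensor_module A U D)) \<longrightarrow>
          right_cotorsion_pair B \<U> n \<E> \<F>)) \<and>
     (left_cotorsion_pair (tri_ring A U B) \<U> n (class_A A U B \<U> \<C> \<E>) (class_I A U B \<U> \<D> \<F>) \<longrightarrow>
        ((\<forall>F\<in>\<F>. \<forall>j. 1 \<le> j \<and> j \<le> n + 1 \<longrightarrow> trivial_group (Ext B \<U> j U F)) \<longrightarrow>
          left_cotorsion_pair B \<U> n \<E> \<F>) \<and>
        ((\<forall>F\<in>\<F>. \<forall>j. 1 \<le> j \<and> j \<le> n + 1 \<longrightarrow> trivial_group (Ext B \<U> j U F)) \<and>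
         closed_under_extensions A \<U> (res_class A \<U> (n - 1) \<D>) \<and>
         (\<forall>E\<in>\<E>. in_class A (res_class A \<U> (n - 1) \<D>) (hom_module B U E)) \<longrightarrow>
          left_cotorsion_pair A \<U> n \<C> \<D>))"
proof -
  interpret triangular A B U \<U>
    by (intro triangular.intro small_universe.intro triangular_axioms.intro U universe)
  note pairs = right_pair_A[OF classes] right_pair_B[OF classes] left_pair_A[OF classes] left_pair_B[OF classes]
  show ?thesis
    by (intro conjI impI) (rule pairs; (elim conjE)?; blast)+
qed

end
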